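(* Let $(\mathscr{C},\mathbb{E},\mathfrak{s})$ be an extriangulated category satisfying Condition (WIC). For any Hovey twin cotorsion pair $\mathcal{P}=((\mathcal{S},\mathcal{T}),(\mathcal{U},\mathcal{V}))$ on $\mathscr{C}$, we have mutually inverse bijective correspondences \[ \mathbb{R}\colon\mathfrak{M}_{\mathcal{P}}\to\mathfrak{CP}(\widetilde{\mathscr{C}}),\qquad \mathbb{I}\colon\mathfrak{CP}(\widetilde{\mathscr{C}})\to\mathfrak{M}_{\mathcal{P}} \] given by \[ \mathbb{R}((\mathcal{A},\mathcal{B}))=(\ell(\mathcal{A}),\ell(\mathcal{B})),\qquad \mathbb{I}((\mathcal{L},\mathcal{R}))=(\mathcal{U}\cap\ell^{-1}(\mathcal{L}),\ \mathcal{T}\cap\ell^{-1}(\mathcal{R})). \]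
   Context: Extriangulated categories. Let $\mathscr{C}$ be an additive category and $\mathbb{E}\colon\mathscr{C}^{\mathrm{op}}\times\mathscr{C}\to\mathit{Ab}$ a functor. Elements $\delta\in\mathbb{E}(C,A)$ are called $\mathbb{E}$-extensions; for $a\colon A\to A'$ and $c\colon C'\to C$ put $a_*\delta=\mathbb{E}(C,a)(\delta)$ and $c^*\delta=\mathbb{E}(c,A)(\delta)$. A morphism $(a,c)\colon\delta\to\delta'$ from $\delta\in\mathbb{E}(C,A)$ to $\delta'\in\mathbb{E}(C',A')$ is a pair $a\colon A\to A'$, $c\colon C\to C'$ with $a_*\delta=c^*\delta'$. Sequences $A\xrightarrow{x}B\xrightarrow{y}C$ and $A\xrightarrow{x'}B'\xrightarrow{y'}C$ are equivalent if there is an isomorphism $b\colon B\to B'$ with $bx=x'$, $y'b=y$; the class is written $[A\xrightarrow{x}B\xrightarrow{y}C]$. A realization $\mathfrak{s}$ assigns to each $\delta\in\mathbb{E}(C,A)$ such a class $\mathfrak{s}(\delta)=[A\xrightarrow{x}B\xrightarrow{y}C]$ so that for every morphism $(a,c)\colon\delta\to\delta'$, with $\mathfrak{s}(\delta')=[A'\xrightarrow{x'}B'\xrightarrow{y'}C']$, there is $b\colon B\to B'$ with $bx=x'a$, $y'b=cy$ (then $(a,b,c)$ is said to realize $(a,c)$). It is additive if $\mathfrak{s}(0)=[A\to A\oplus C\to C]$ (canonical inclusion and projection) and $\mathfrak{s}(\delta\oplus\delta')=[A\oplus A'\xrightarrow{x\oplus x'}B\oplus B'\xrightarrow{y\oplus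 y'}C\oplus C']$, where $\delta\oplus\delta'\in\mathbb{E}(C\oplus C',A\oplus A')$ corresponds to $(\delta,0,0,\delta')$. If $\mathfrak{s}(\delta)=[A\xrightarrow{x}B\xrightarrow{y}C]$, the sequence is called a conflation, $x$ an inflation, $y$ a deflation, and one speaks of the $\mathbb{E}$-triangle $A\xrightarrow{x}B\xrightarrow{y}C\overset{\delta}{\dashrightarrow}$. The triple $(\mathscr{C},\mathbb{E},\mathfrak{s})$ is an extriangulated category if: (ET1) $\mathbb{E}$ is biadditive; (ET2) $\mathfrak{s}$ is an additive realization; (ET3) for $\mathbb{E}$-triangles $A\xrightarrow{x}B\xrightarrow{y}C\overset{\delta}{\dashrightarrow}$, $A'\xrightarrow{x'}B'\xrightarrow{y'}C'\overset{\delta'}{\dashrightarrow}$ and $a,b$ with $bx=x'a$ there is $c$ such that $(a,c)\colon\delta\to\delta'$ is a morphism realized by $(a,b,c)$; (ET3)$^{\mathrm{op}}$ for $b,c$ with $y'b=cy$ there is $a$ such that $(a,c)\colon\delta\to\delta'$ is a morphism realized by $(a,b,c)$; (ET4) for $\mathbb{E}$-triangles $A\xrightarrow{f}B\xrightarrow{f'}D\overset{\delta}{\dashrightarrow}$ and $B\xrightarrow{g}C\xrightarrow{g'}F\overset{\delta'}{\dashrightarrow}$ there are an $\mathbb{E}$-triangle $A\xrightarrow{h}C\xrightarrow{h'}E\overset{\delta''}{\dashrightarrow}$ with $h=gf$ and $d\colon D\to E$, $e\colon E\to F$ with $df'=h'g$, $eh'=g'$, such that $D\xrightarrow{d}E\xrightarrow{e}F$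 realizes $f'_*\delta'$, $d^*\delta''=\delta$ and $f_*\delta''=e^*\delta'$; (ET4)$^{\mathrm{op}}$ for $\mathbb{E}$-triangles $D\xrightarrow{f'}A\xrightarrow{f}B\overset{\delta}{\dashrightarrow}$ and $F\xrightarrow{g'}B\xrightarrow{g}C\overset{\delta'}{\dashrightarrow}$ there are an $\mathbb{E}$-triangle $E\xrightarrow{h'}A\xrightarrow{h}C\overset{\delta''}{\dashrightarrow}$ with $h=gf$ and $d\colon D\to E$, $e\colon E\to F$ with $h'd=f'$, $fh'=g'e$, such that $D\xrightarrow{d}E\xrightarrow{e}F$ realizes $g'^*\delta$, $\delta'=e_*\delta''$ and $d_*\delta=g^*\delta''$. Condition (WIC): for all composable $f\colon A\to B$, $g\colon B\to C$: if $gf$ is an inflation then so is $f$; if $gf$ is a deflation then so is $g$. Cotorsion pairs. A cotorsion pair on $\mathscr{C}$ is a pair $(\mathcal{U},\mathcal{V})$ of full additive subcategories closed under isomorphisms and direct summands such that $\mathbb{E}(U,V)=0$ for all $U\in\mathcal{U},V\in\mathcal{V}$, and every $C\in\mathscr{C}$ admits conflations $V^C\to U^C\to C$ and $C\to V_C\to U_C$ with $U^C,U_C\in\mathcal{U}$, $V^C,V_C\in\mathcal{V}$. A twin cotorsion pair is a pair $((\mathcal{S},\mathcal{T}),(\mathcal{U},\mathcal{V}))$ of cotorsion pairs with $\mathbb{E}(\mathcal{S},\mathcal{V})=0$. Let $\mathcal{N}^i$ (resp. $\mathcal{N}^f$) be the full subcategory of objects $X$ admitting a conflation $V\to S\to X$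 (resp. $X\to V\to S$) with $V\in\mathcal{V},S\in\mathcal{S}$. The twin cotorsion pair is Hovey if $\mathcal{N}^i=\mathcal{N}^f$. $\mathfrak{CP}(\mathscr{C})$ denotes the class of cotorsion pairs on $\mathscr{C}$. Localization. $w\mathit{Fib}$ is the class of deflations $f\colon A\to B$ admitting a conflation $V\to A\xrightarrow{f}B$ with $V\in\mathcal{V}$; $w\mathit{Cof}$ is the class of inflations $f\colon A\to B$ admitting a conflation $A\xrightarrow{f}B\to S$ with $S\in\mathcal{S}$; $\mathbb{W}=w\mathit{Fib}\circ w\mathit{Cof}$ is the class of composites $p\circ i$, $i\in w\mathit{Cof}$, $p\in w\mathit{Fib}$; $\ell\colon\mathscr{C}\to\widetilde{\mathscr{C}}=\mathscr{C}[\mathbb{W}^{-1}]$ is the localization functor (identity on objects). Triangulated structure of $\widetilde{\mathscr{C}}$. Fix for each $A\in\mathscr{C}$ an $\mathbb{E}$-triangle $A\xrightarrow{v_A}V_A\xrightarrow{u_A}U_A\overset{\rho_A}{\dashrightarrow}$ with $V_A\in\mathcal{V}$, $U_A\in\mathcal{U}$. Put $A[1]=U_A$; for $f\colon A\to B$ choose $u_f\colon U_A\to U_B$ such that $(f,u_f)\colon\rho_A\to\rho_B$ is a morphism of $\mathbb{E}$-extensions and put $f[1]=\ell(u_f)$. This is a well-defined functor $\mathscr{C}\to\widetilde{\mathscr{C}}$ that inverts $\mathbb{W}$, and so induces $[1]\colon\widetilde{\mathscr{C}}\to\widetilde{\mathscr{C}}$. For $\delta\in\mathbb{E}(C,A)$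 define $\widetilde{\ell}(\delta)=\ell(d)\circ\ell(w)^{-1}\in\widetilde{\mathscr{C}}(C,A[1])$, where $C\xleftarrow{w}D\xrightarrow{d}U_A$ is any span with $w\in w\mathit{Fib}$ and $w^*\delta=d^*\rho_A$ (such spans exist and the result is independent of the choice). Distinguished triangles are the triangles isomorphic to some $A\xrightarrow{\ell(x)}B\xrightarrow{\ell(y)}C\xrightarrow{\widetilde{\ell}(\delta)}A[1]$ for an $\mathbb{E}$-triangle $A\xrightarrow{x}B\xrightarrow{y}C\overset{\delta}{\dashrightarrow}$. These make $\widetilde{\mathscr{C}}$ a triangulated category. Write $\mathrm{Ext}^1_{\widetilde{\mathscr{C}}}(X,Y)=\widetilde{\mathscr{C}}(X,Y[1])$. $\mathfrak{CP}(\widetilde{\mathscr{C}})$ is the class of cotorsion pairs on the triangulated category $\widetilde{\mathscr{C}}$, i.e. pairs $(\mathcal{L},\mathcal{R})$ of full additive subcategories closed under isomorphisms and direct summands with $\mathrm{Ext}^1_{\widetilde{\mathscr{C}}}(\mathcal{L},\mathcal{R})=0$ such that every object $X$ fits into distinguished triangles $R\to L\to X\to R[1]$ and $X\to R'\to L'\to X[1]$ with $L,L'\in\mathcal{L}$, $R,R'\in\mathcal{R}$. Mutable cotorsion pairs. $\mathfrak{M}_{\mathcal{P}}$ is the class of $(\mathcal{A},\mathcal{B})\in\mathfrak{CP}(\mathscr{C})$ with $\mathcal{S}\subseteq\mathcal{A}\subseteq\mathcal{U}$, $\mathcal{V}\subseteq\mathcal{B}\subseteq\mathcal{T}$ and $\mathrm{Ext}^1_{\widetilde{\mathscr{C}}}(\ell(\mathcal{A}),\ell(\mathcal{B}))=0$,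 where $\ell(\mathcal{A}),\ell(\mathcal{B})\subseteq\widetilde{\mathscr{C}}$ denote essential images. For a full subcategory $\mathcal{L}\subseteq\widetilde{\mathscr{C}}$, $\ell^{-1}(\mathcal{L})$ is the full subcategory of $X\in\mathscr{C}$ with $\ell(X)\in\mathcal{L}$. *)

theory Defs
  imports "HOL-Algebra.Group"
begin

section \<open>Categories\<close>

record ('o, 'm) cat =
  Ob :: "'o set"
  Arr :: "'m set"
  Dom :: "'m \<Rightarrow> 'o"
  Cod :: "'m \<Rightarrow> 'o"
  Id :: "'o \<Rightarrow> 'm"
  Comp :: "'m \<Rightarrow> 'm \<Rightarrow> 'm"  (infixr "\<cdot>\<index>" 75)

definition Hom :: "('o, 'm, 'z) cat_scheme \<Rightarrow> 'o \<Rightarrow> 'o \<Rightarrow> 'm set" where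
  "Hom C A B = {f \<in> Arr C. Dom C f = A \<and> Cod C f = B}"

locale category =
  fixes C :: "('o, 'm, 'z) cat_scheme" (structure)
  assumes Dom_Ob: "f \<in> Arr C \<Longrightarrow> Dom C f \<in> Ob C"
    and Cod_Ob: "f \<in> Arr C \<Longrightarrow> Cod C f \<in> Ob C"
    and Id_Hom: "A \<in> Ob C \<Longrightarrow> Id C A \<in> Hom C A A"
    and Comp_Hom: "f \<in> Hom C A B \<Longrightarrow> g \<in> Hom C B D \<Longrightarrow> g \<cdot> f \<in> Hom C A D"
    and Comp_Id_right: "f \<in> Hom C A B \<Longrightarrow> f \<cdot> Id C A = f"
    and Comp_Id_left: "f \<in> Hom C A B \<Longrightarrow> Id C B \<cdot> f = f"
    and Comp_assoc: "f \<in> Hom C A B \<Longrightarrow> g \<in> Hom C B D \<Longrightarrow> h \<in> Hom C D F \<Longrightarrow>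
      h \<cdot> (g \<cdot> f) = (h \<cdot> g) \<cdot> f"

definition is_functor ::
  "('o, 'm, 'z) cat_scheme \<Rightarrow> ('p, 'n, 'y) cat_scheme \<Rightarrow> ('o \<Rightarrow> 'p) \<Rightarrow> ('m \<Rightarrow> 'n) \<Rightarrow> bool" where
  "is_functor C D Fo Fm \<longleftrightarrow>
     (\<forall>A \<in> Ob C. Fo A \<in> Ob D) \<and>
     (\<forall>f \<in> Arr C. Fm f \<in> Hom D (Fo (Dom C f)) (Fo (Cod C f))) \<and>
     (\<forall>A \<in> Ob C. Fm (Id C A) = Id D (Fo A)) \<and>
     (\<forall>f \<in> Arr C. \<forall>g \<in> Arr C. Cod C f = Dom C g \<longrightarrow>
        Fm (g \<cdot>\<^bsub>C\<^esub> f) = Fm g \<cdot>\<^bsub>D\<^esub> Fm f)"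

definition is_inverse :: "('o, 'm, 'z) cat_scheme \<Rightarrow> 'm \<Rightarrow> 'm \<Rightarrow> bool" where
  "is_inverse C f g \<longleftrightarrow>
     f \<in> Arr C \<and> g \<in> Hom C (Cod C f) (Dom C f) \<and>
     g \<cdot>\<^bsub>C\<^esub> f = Id C (Dom C f) \<and> f \<cdot>\<^bsub>C\<^esub> g = Id C (Cod C f)"

definition is_iso :: "('o, 'm, 'z) cat_scheme \<Rightarrow> 'm \<Rightarrow> bool" where
  "is_iso C f \<longleftrightarrow> (\<exists>g. is_inverse C f g)"

definition inv_arr :: "('o, 'm, 'z) cat_scheme \<Rightarrow> 'm \<Rightarrow> 'm" where
  "inv_arr C f = (THE g. is_inverse C f g)"

definition isomorphic :: "('o, 'm, 'z) cat_scheme \<Rightarrow> 'o \<Rightarrow> 'o \<Rightarrow> bool" where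
  "isomorphic C A B \<longleftrightarrow> (\<exists>f \<in> Hom C A B. is_iso C f)"

definition zero_object :: "('o, 'm, 'z) cat_scheme \<Rightarrow> 'o \<Rightarrow> bool" where
  "zero_object C Z \<longleftrightarrow>
     Z \<in> Ob C \<and> (\<forall>A \<in> Ob C. (\<exists>!f. f \<in> Hom C A Z) \<and> (\<exists>!f. f \<in> Hom C Z A))"

definition zero_arr :: "('o, 'm, 'z) cat_scheme \<Rightarrow> 'm \<Rightarrow> bool" where
  "zero_arr C f \<longleftrightarrow>
     (\<exists>Z. zero_object C Z \<and>
       (\<exists>g \<in> Hom C (Dom C f) Z. \<exists>h \<in> Hom C Z (Cod C f). f = h \<cdot>\<^bsub>C\<^esub> g))"

definition biproduct ::
  "('o, 'm, 'z) cat_scheme \<Rightarrow> 'o \<Rightarrow> 'o \<Rightarrow> 'o \<Rightarrow> 'm \<Rightarrow> 'm \<Rightarrow> 'm \<Rightarrow> 'm \<Rightarrow> bool" where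
  "biproduct C A B P iA iB pA pB \<longleftrightarrow>
     iA \<in> Hom C A P \<and> iB \<in> Hom C B P \<and> pA \<in> Hom C P A \<and> pB \<in> Hom C P B \<and>
     pA \<cdot>\<^bsub>C\<^esub> iA = Id C A \<and> pB \<cdot>\<^bsub>C\<^esub> iB = Id C B \<and>
     zero_arr C (pB \<cdot>\<^bsub>C\<^esub> iA) \<and> zero_arr C (pA \<cdot>\<^bsub>C\<^esub> iB) \<and>
     (\<forall>X. \<forall>f \<in> Hom C X A. \<forall>g \<in> Hom C X B.
        \<exists>!h. h \<in> Hom C X P \<and> pA \<cdot>\<^bsub>C\<^esub> h = f \<and> pB \<cdot>\<^bsub>C\<^esub> h = g) \<and>
     (\<forall>X. \<forall>f \<in> Hom C A X. \<forall>g \<in> Hom C B X.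
        \<exists>!h. h \<in> Hom C P X \<and> h \<cdot>\<^bsub>C\<^esub> iA = f \<and> h \<cdot>\<^bsub>C\<^esub> iB = g)"

text \<open>Full subcategories are represented by their sets of objects.\<close>

definition additive_subcat :: "('o, 'm, 'z) cat_scheme \<Rightarrow> 'o set \<Rightarrow> bool" where
  "additive_subcat C X \<longleftrightarrow>
     X \<subseteq> Ob C \<and> (\<exists>Z \<in> X. zero_object C Z) \<and>
     (\<forall>A \<in> X. \<forall>B \<in> X. \<exists>P \<in> X. \<exists>iA iB pA pB. biproduct C A B P iA iB pA pB)"

definition iso_closed :: "('o, 'm, 'z) cat_scheme \<Rightarrow> 'o set \<Rightarrow> bool" where
  "iso_closed C X \<longleftrightarrow> (\<forall>A \<in> X. \<forall>B \<in> Ob C. isomorphic C A B \<longrightarrow> B \<in> X)"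

definition summand_closed :: "('o, 'm, 'z) cat_scheme \<Rightarrow> 'o set \<Rightarrow> bool" where
  "summand_closed C X \<longleftrightarrow>
     (\<forall>A \<in> Ob C. \<forall>B \<in> Ob C. \<forall>P iA iB pA pB.
        biproduct C A B P iA iB pA pB \<and> P \<in> X \<longrightarrow> A \<in> X \<and> B \<in> X)"

definition ess_image :: "('o, 'm, 'z) cat_scheme \<Rightarrow> 'o set \<Rightarrow> 'o set" where
  "ess_image C X = {B \<in> Ob C. \<exists>A \<in> X. isomorphic C A B}"


section \<open>Additive categories\<close>

text \<open>Abelian groups are commutative groups of HOL-Algebra, hence written multiplicatively:
  \<open>\<otimes>\<close> is the addition and \<open>\<one>\<close> the zero of the morphism and extension groups.\<close>

record ('o, 'm) add_cat = "('o, 'm) cat" +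
  HomGrp :: "'o \<Rightarrow> 'o \<Rightarrow> 'm monoid"

locale additive_category = category C for C :: "('o, 'm, 'z) add_cat_scheme" (structure) +
  assumes HomGrp_group: "A \<in> Ob C \<Longrightarrow> B \<in> Ob C \<Longrightarrow> comm_group (HomGrp C A B)"
    and HomGrp_carrier: "A \<in> Ob C \<Longrightarrow> B \<in> Ob C \<Longrightarrow> carrier (HomGrp C A B) = Hom C A B"
    and Comp_additive_right: "A \<in> Ob C \<Longrightarrow> g \<in> Hom C B D \<Longrightarrow>
      (\<lambda>f. g \<cdot> f) \<in> hom (HomGrp C A B) (HomGrp C A D)"
    and Comp_additive_left: "D \<in> Ob C \<Longrightarrow> f \<in> Hom C A B \<Longrightarrow>
      (\<lambda>g. g \<cdot> f) \<in> hom (HomGrp C B D) (HomGrp C A D)"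
    and zero_object_ex: "\<exists>Z. zero_object C Z"
    and biproduct_ex: "A \<in> Ob C \<Longrightarrow> B \<in> Ob C \<Longrightarrow>
      \<exists>P iA iB pA pB. biproduct C A B P iA iB pA pB"


section \<open>Extriangulated categories\<close>

text \<open>\<open>Ext E X A\<close> is the group $\mathbb{E}(X,A)$, \<open>ExtMap E c a\<close> is $\mathbb{E}(c,a)$, and
  \<open>Real E X A \<delta>\<close> is the class $\mathfrak{s}(\delta)$ of $\delta \in \mathbb{E}(X,A)$. Elements of
  different extension groups may coincide, so operations on extensions carry the objects
  along where these are not determined by an arrow.\<close>

record ('o, 'm, 'e) extri = "('o, 'm) add_cat" +
  Ext :: "'o \<Rightarrow> 'o \<Rightarrow> 'e monoid"
  ExtMap :: "'m \<Rightarrow> 'm \<Rightarrow> 'e \<Rightarrow> 'e"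
  Real :: "'o \<Rightarrow> 'o \<Rightarrow> 'e \<Rightarrow> ('m \<times> 'm) set"

text \<open>For $\delta \in \mathbb{E}(X,A)$: \<open>push E X a \<delta>\<close> is $a_*\delta$ and \<open>pull E A c \<delta>\<close> is
  $c^*\delta$.\<close>

definition push :: "('o, 'm, 'e, 'z) extri_scheme \<Rightarrow> 'o \<Rightarrow> 'm \<Rightarrow> 'e \<Rightarrow> 'e" where
  "push E X a \<delta> = ExtMap E (Id E X) a \<delta>"

definition pull :: "('o, 'm, 'e, 'z) extri_scheme \<Rightarrow> 'o \<Rightarrow> 'm \<Rightarrow> 'e \<Rightarrow> 'e" where
  "pull E A c \<delta> = ExtMap E c (Id E A) \<delta>"

definition ext_morphism ::
  "('o, 'm, 'e, 'z) extri_scheme \<Rightarrow> 'o \<Rightarrow> 'o \<Rightarrow> 'e \<Rightarrow> 'o \<Rightarrow> 'o \<Rightarrow> 'e \<Rightarrow> 'm \<Rightarrow> 'm \<Rightarrow> bool" where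
  "ext_morphism E X A \<delta> X' A' \<delta>' a c \<longleftrightarrow>
     \<delta> \<in> carrier (Ext E X A) \<and> \<delta>' \<in> carrier (Ext E X' A') \<and>
     a \<in> Hom E A A' \<and> c \<in> Hom E X X' \<and> push E X a \<delta> = pull E A' c \<delta>'"

definition sequences :: "('o, 'm, 'z) cat_scheme \<Rightarrow> 'o \<Rightarrow> 'o \<Rightarrow> ('m \<times> 'm) set" where
  "sequences C A X = {(x, y). \<exists>B. x \<in> Hom C A B \<and> y \<in> Hom C B X}"

definition seq_equiv :: "('o, 'm, 'z) cat_scheme \<Rightarrow> 'o \<Rightarrow> 'o \<Rightarrow> (('m \<times> 'm) \<times> ('m \<times> 'm)) set" where
  "seq_equiv C A X =
     {((x, y), (x', y')). (x, y) \<in> sequences C A X \<and> (x', y') \<in> sequences C A X \<and>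
        (\<exists>b \<in> Hom C (Cod C x) (Cod C x'). is_iso C b \<and> b \<cdot>\<^bsub>C\<^esub> x = x' \<and> y' \<cdot>\<^bsub>C\<^esub> b = y)}"

definition seq_class :: "('o, 'm, 'z) cat_scheme \<Rightarrow> 'o \<Rightarrow> 'o \<Rightarrow> 'm \<Rightarrow> 'm \<Rightarrow> ('m \<times> 'm) set" where
  "seq_class C A X x y = seq_equiv C A X `` {(x, y)}"

text \<open>\<open>triangle E A x B y X \<delta>\<close>: the $\mathbb{E}$-triangle
  $A \xrightarrow{x} B \xrightarrow{y} X \overset{\delta}{\dashrightarrow}$.\<close>

definition triangle ::
  "('o, 'm, 'e, 'z) extri_scheme \<Rightarrow> 'o \<Rightarrow> 'm \<Rightarrow> 'o \<Rightarrow> 'm \<Rightarrow> 'o \<Rightarrow> 'e \<Rightarrow> bool" where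
  "triangle E A x B y X \<delta> \<longleftrightarrow>
     A \<in> Ob E \<and> B \<in> Ob E \<and> X \<in> Ob E \<and>
     \<delta> \<in> carrier (Ext E X A) \<and> x \<in> Hom E A B \<and> y \<in> Hom E B X \<and>
     Real E X A \<delta> = seq_class E A X x y"

definition conflation ::
  "('o, 'm, 'e, 'z) extri_scheme \<Rightarrow> 'o \<Rightarrow> 'm \<Rightarrow> 'o \<Rightarrow> 'm \<Rightarrow> 'o \<Rightarrow> bool" where
  "conflation E A x B y X \<longleftrightarrow> (\<exists>\<delta>. triangle E A x B y X \<delta>)"

definition inflation :: "('o, 'm, 'e, 'z) extri_scheme \<Rightarrow> 'm \<Rightarrow> bool" where
  "inflation E x \<longleftrightarrow> (\<exists>A B y X. conflation E A x B y X)"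

definition deflation :: "('o, 'm, 'e, 'z) extri_scheme \<Rightarrow> 'm \<Rightarrow> bool" where
  "deflation E y \<longleftrightarrow> (\<exists>A x B X. conflation E A x B y X)"

text \<open>The arrow $f \oplus f'$ between given direct sums, described by projections.\<close>

definition is_dsum_arr ::
  "('o, 'm, 'z) cat_scheme \<Rightarrow> 'o \<Rightarrow> 'm \<Rightarrow> 'm \<Rightarrow> 'o \<Rightarrow> 'm \<Rightarrow> 'm \<Rightarrow> 'm \<Rightarrow> 'm \<Rightarrow> 'm \<Rightarrow> bool" where
  "is_dsum_arr C P p p' Q q q' f f' h \<longleftrightarrow>
     h \<in> Hom C P Q \<and> q \<cdot>\<^bsub>C\<^esub> h = f \<cdot>\<^bsub>C\<^esub> p \<and> q' \<cdot>\<^bsub>C\<^esub> h = f' \<cdot>\<^bsub>C\<^esub> p'"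

locale ext_bifunctor = additive_category E
  for E :: "('o, 'm, 'e, 'z) extri_scheme" (structure) +
  assumes Ext_group: "X \<in> Ob E \<Longrightarrow> A \<in> Ob E \<Longrightarrow> comm_group (Ext E X A)"
    and ExtMap_hom: "c \<in> Hom E X' X \<Longrightarrow> a \<in> Hom E A A' \<Longrightarrow>
      ExtMap E c a \<in> hom (Ext E X A) (Ext E X' A')"
    and ExtMap_Id: "X \<in> Ob E \<Longrightarrow> A \<in> Ob E \<Longrightarrow> \<delta> \<in> carrier (Ext E X A) \<Longrightarrow>
      ExtMap E (Id E X) (Id E A) \<delta> = \<delta>"
    and ExtMap_Comp: "c \<in> Hom E X' X \<Longrightarrow> c' \<in> Hom E X'' X' \<Longrightarrow>
      a \<in> Hom E A A' \<Longrightarrow> a' \<in> Hom E A' A'' \<Longrightarrow> \<delta> \<in> carrier (Ext E X A) \<Longrightarrow>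
      ExtMap E (c \<cdot> c') (a' \<cdot> a) \<delta> = ExtMap E c' a' (ExtMap E c a \<delta>)"

locale ext_biadditive = ext_bifunctor E
  for E :: "('o, 'm, 'e, 'z) extri_scheme" (structure) +
  assumes push_add: "X \<in> Ob E \<Longrightarrow> a \<in> Hom E A A' \<Longrightarrow> a' \<in> Hom E A A' \<Longrightarrow>
      \<delta> \<in> carrier (Ext E X A) \<Longrightarrow>
      push E X (a \<otimes>\<^bsub>HomGrp E A A'\<^esub> a') \<delta> = push E X a \<delta> \<otimes>\<^bsub>Ext E X A'\<^esub> push E X a' \<delta>"
    and pull_add: "A \<in> Ob E \<Longrightarrow> c \<in> Hom E X' X \<Longrightarrow> c' \<in> Hom E X' X \<Longrightarrow>
      \<delta> \<in> carrier (Ext E X A) \<Longrightarrow>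
      pull E A (c \<otimes>\<^bsub>HomGrp E X' X\<^esub> c') \<delta> = pull E A c \<delta> \<otimes>\<^bsub>Ext E X' A\<^esub> pull E A c' \<delta>"

definition realization :: "('o, 'm, 'e, 'z) extri_scheme \<Rightarrow> bool" where
  "realization E \<longleftrightarrow>
     (\<forall>X \<in> Ob E. \<forall>A \<in> Ob E. \<forall>\<delta> \<in> carrier (Ext E X A).
        Real E X A \<delta> \<in> sequences E A X // seq_equiv E A X) \<and>
     (\<forall>A x B y X \<delta> A' x' B' y' X' \<delta>' a c.
        triangle E A x B y X \<delta> \<and> triangle E A' x' B' y' X' \<delta>' \<and>
        ext_morphism E X A \<delta> X' A' \<delta>' a c \<longrightarrow>
        (\<exists>b \<in> Hom E B B'. b \<cdot>\<^bsub>E\<^esub> x = x' \<cdot>\<^bsub>E\<^esub> a \<and> y' \<cdot>\<^bsub>E\<^esub> b = c \<cdot>\<^bsub>E\<^esub> y))"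

text \<open>In the second conjunct \<open>\<epsilon>\<close> is $\delta \oplus \delta'$, the element of
  $\mathbb{E}(X \oplus X', A \oplus A')$ with components $(\delta, 0, 0, \delta')$; the direct
  sums of objects are arbitrary biproducts.\<close>

definition additive_realization :: "('o, 'm, 'e, 'z) extri_scheme \<Rightarrow> bool" where
  "additive_realization E \<longleftrightarrow>
     realization E \<and>
     (\<forall>A \<in> Ob E. \<forall>X \<in> Ob E. \<forall>P iA iX pA pX.
        biproduct E A X P iA iX pA pX \<longrightarrow> Real E X A \<one>\<^bsub>Ext E X A\<^esub> = seq_class E A X iA pX) \<and>
     (\<forall>A x B y X \<delta> A' x' B' y' X' \<delta>' AA iA iA' pA pA' BB iB iB' pB pB' XX iX iX' pX pX' \<epsilon> xx yy.
        triangle E A x B y X \<delta> \<and> triangle E A' x' B' y' X' \<delta>' \<and>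
        biproduct E A A' AA iA iA' pA pA' \<and>
        biproduct E B B' BB iB iB' pB pB' \<and>
        biproduct E X X' XX iX iX' pX pX' \<and>
        \<epsilon> \<in> carrier (Ext E XX AA) \<and>
        ExtMap E iX pA \<epsilon> = \<delta> \<and> ExtMap E iX pA' \<epsilon> = \<one>\<^bsub>Ext E X A'\<^esub> \<and>
        ExtMap E iX' pA \<epsilon> = \<one>\<^bsub>Ext E X' A\<^esub> \<and> ExtMap E iX' pA' \<epsilon> = \<delta>' \<and>
        is_dsum_arr E AA pA pA' BB pB pB' x x' xx \<and>
        is_dsum_arr E BB pB pB' XX pX pX' y y' yy \<longrightarrow>
        Real E XX AA \<epsilon> = seq_class E AA XX xx yy)"

locale extriangulated_category = ext_biadditive E
  for E :: "('o, 'm, 'e, 'z) extri_scheme" (structure) +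
  assumes ET2: "additive_realization E"
    and ET3: "triangle E A x B y X \<delta> \<Longrightarrow> triangle E A' x' B' y' X' \<delta>' \<Longrightarrow>
      a \<in> Hom E A A' \<Longrightarrow> b \<in> Hom E B B' \<Longrightarrow> b \<cdot> x = x' \<cdot> a \<Longrightarrow>
      \<exists>c. ext_morphism E X A \<delta> X' A' \<delta>' a c \<and> y' \<cdot> b = c \<cdot> y"
    and ET3_op: "triangle E A x B y X \<delta> \<Longrightarrow> triangle E A' x' B' y' X' \<delta>' \<Longrightarrow>
      b \<in> Hom E B B' \<Longrightarrow> c \<in> Hom E X X' \<Longrightarrow> y' \<cdot> b = c \<cdot> y \<Longrightarrow>
      \<exists>a. ext_morphism E X A \<delta> X' A' \<delta>' a c \<and> b \<cdot> x = x' \<cdot> a"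
    and ET4: "triangle E A f B f' D \<delta> \<Longrightarrow> triangle E B g C g' F \<delta>' \<Longrightarrow>
      \<exists>G h h' \<delta>'' d e. triangle E A h C h' G \<delta>'' \<and> h = g \<cdot> f \<and>
        d \<in> Hom E D G \<and> e \<in> Hom E G F \<and> d \<cdot> f' = h' \<cdot> g \<and> e \<cdot> h' = g' \<and>
        triangle E D d G e F (push E F f' \<delta>') \<and>
        pull E A d \<delta>'' = \<delta> \<and> push E G f \<delta>'' = pull E B e \<delta>'"
    and ET4_op: "triangle E D f' A f B \<delta> \<Longrightarrow> triangle E F g' B g C \<delta>' \<Longrightarrow>
      \<exists>G h h' \<delta>'' d e. triangle E G h' A h C \<delta>'' \<and> h = g \<cdot> f \<and>
        d \<in> Hom E D G \<and> e \<in> Hom E G F \<and> h' \<cdot> d = f' \<and> f \<cdot> h' = g' \<cdot> e \<and>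
        triangle E D d G e F (pull E D g' \<delta>) \<and>
        \<delta>' = push E C e \<delta>'' \<and> push E B d \<delta> = pull E G g \<delta>''"

definition WIC :: "('o, 'm, 'e, 'z) extri_scheme \<Rightarrow> bool" where
  "WIC E \<longleftrightarrow>
     (\<forall>A B D. \<forall>f \<in> Hom E A B. \<forall>g \<in> Hom E B D.
        (inflation E (g \<cdot>\<^bsub>E\<^esub> f) \<longrightarrow> inflation E f) \<and>
        (deflation E (g \<cdot>\<^bsub>E\<^esub> f) \<longrightarrow> deflation E g))"


section \<open>Cotorsion pairs\<close>

definition Ext_vanish :: "('o, 'm, 'e, 'z) extri_scheme \<Rightarrow> 'o set \<Rightarrow> 'o set \<Rightarrow> bool" where
  "Ext_vanish E \<U> \<V> \<longleftrightarrow> (\<forall>X \<in> \<U>. \<forall>A \<in> \<V>. carrier (Ext E X A) = {\<one>\<^bsub>Ext E X A\<^esub>})"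

definition CP :: "('o, 'm, 'e, 'z) extri_scheme \<Rightarrow> ('o set \<times> 'o set) set" where
  "CP E = {(\<U>, \<V>).
     additive_subcat E \<U> \<and> iso_closed E \<U> \<and> summand_closed E \<U> \<and>
     additive_subcat E \<V> \<and> iso_closed E \<V> \<and> summand_closed E \<V> \<and>
     Ext_vanish E \<U> \<V> \<and>
     (\<forall>X \<in> Ob E. \<exists>V \<in> \<V>. \<exists>U \<in> \<U>. \<exists>x y. conflation E V x U y X) \<and>
     (\<forall>X \<in> Ob E. \<exists>V \<in> \<V>. \<exists>U \<in> \<U>. \<exists>x y. conflation E X x V y U)}"

definition twin_cotorsion_pair ::
  "('o, 'm, 'e, 'z) extri_scheme \<Rightarrow> 'o set \<Rightarrow> 'o set \<Rightarrow> 'o set \<Rightarrow> 'o set \<Rightarrow> bool" where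
  "twin_cotorsion_pair E \<S> \<T> \<U> \<V> \<longleftrightarrow>
     (\<S>, \<T>) \<in> CP E \<and> (\<U>, \<V>) \<in> CP E \<and> Ext_vanish E \<S> \<V>"

definition N_i :: "('o, 'm, 'e, 'z) extri_scheme \<Rightarrow> 'o set \<Rightarrow> 'o set \<Rightarrow> 'o set" where
  "N_i E \<S> \<V> = {X \<in> Ob E. \<exists>V \<in> \<V>. \<exists>S \<in> \<S>. \<exists>x y. conflation E V x S y X}"

definition N_f :: "('o, 'm, 'e, 'z) extri_scheme \<Rightarrow> 'o set \<Rightarrow> 'o set \<Rightarrow> 'o set" where
  "N_f E \<S> \<V> = {X \<in> Ob E. \<exists>V \<in> \<V>. \<exists>S \<in> \<S>. \<exists>x y. conflation E X x V y S}"

definition Hovey_twin_cotorsion_pair ::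
  "('o, 'm, 'e, 'z) extri_scheme \<Rightarrow> 'o set \<Rightarrow> 'o set \<Rightarrow> 'o set \<Rightarrow> 'o set \<Rightarrow> bool" where
  "Hovey_twin_cotorsion_pair E \<S> \<T> \<U> \<V> \<longleftrightarrow>
     twin_cotorsion_pair E \<S> \<T> \<U> \<V> \<and> N_i E \<S> \<V> = N_f E \<S> \<V>"


section \<open>Localization of a category\<close>

text \<open>The Gabriel--Zisman construction of $\mathscr{C}[W^{-1}]$: arrows are zigzags of arrows of
  $\mathscr{C}$ and formal inverses of arrows in $W$, written in order of traversal, modulo the
  congruence generated by the composition law and cancellation of formal inverses. A zigzag is
  stored with its source and target.\<close>

datatype 'm letter = Fwd 'm | Bwd 'm

type_synonym ('o, 'm) zigzag = "'o \<times> 'm letter list \<times> 'o"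

inductive_set zigzags :: "('o, 'm, 'z) cat_scheme \<Rightarrow> 'm set \<Rightarrow> ('o, 'm) zigzag set"
  for C W where
  "A \<in> Ob C \<Longrightarrow> (A, [], A) \<in> zigzags C W"
| "f \<in> Arr C \<Longrightarrow> (Cod C f, p, B) \<in> zigzags C W \<Longrightarrow> (Dom C f, Fwd f # p, B) \<in> zigzags C W"
| "w \<in> W \<inter> Arr C \<Longrightarrow> (Dom C w, p, B) \<in> zigzags C W \<Longrightarrow> (Cod C w, Bwd w # p, B) \<in> zigzags C W"

inductive zz_basic :: "('o, 'm, 'z) cat_scheme \<Rightarrow> 'm set \<Rightarrow> 'm letter list \<Rightarrow> 'm letter list \<Rightarrow> bool"
  for C W where
  "A \<in> Ob C \<Longrightarrow> zz_basic C W [Fwd (Id C A)] []"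
| "f \<in> Hom C A B \<Longrightarrow> g \<in> Hom C B D \<Longrightarrow> zz_basic C W [Fwd f, Fwd g] [Fwd (g \<cdot>\<^bsub>C\<^esub> f)]"
| "w \<in> W \<inter> Arr C \<Longrightarrow> zz_basic C W [Fwd w, Bwd w] []"
| "w \<in> W \<inter> Arr C \<Longrightarrow> zz_basic C W [Bwd w, Fwd w] []"

definition zz_step :: "('o, 'm, 'z) cat_scheme \<Rightarrow> 'm set \<Rightarrow> ('o, 'm) zigzag rel" where
  "zz_step C W = {((A, l @ s @ r, B), (A, l @ t @ r, B)) | A l s t r B.
     zz_basic C W s t \<and> (A, l @ s @ r, B) \<in> zigzags C W \<and> (A, l @ t @ r, B) \<in> zigzags C W}"

definition zz_rel :: "('o, 'm, 'z) cat_scheme \<Rightarrow> 'm set \<Rightarrow> ('o, 'm) zigzag rel" where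
  "zz_rel C W = (zz_step C W \<union> (zz_step C W)\<inverse>)\<^sup>* \<inter> zigzags C W \<times> zigzags C W"

definition localization ::
  "('o, 'm, 'z) cat_scheme \<Rightarrow> 'm set \<Rightarrow> ('o, ('o, 'm) zigzag set) cat" where
  "localization C W =
     \<lparr>Ob = Ob C,
      Arr = zigzags C W // zz_rel C W,
      Dom = (\<lambda>F. fst (SOME z. z \<in> F)),
      Cod = (\<lambda>F. snd (snd (SOME z. z \<in> F))),
      Id = (\<lambda>A. zz_rel C W `` {(A, [], A)}),
      Comp = (\<lambda>G F. zz_rel C W `` {(A, p @ q, D) | A p B q D. (A, p, B) \<in> F \<and> (B, q, D) \<in> G})\<rparr>"

definition loc_arr :: "('o, 'm, 'z) cat_scheme \<Rightarrow> 'm set \<Rightarrow> 'm \<Rightarrow> ('o, 'm) zigzag set" where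
  "loc_arr C W f = zz_rel C W `` {(Dom C f, [Fwd f], Cod C f)}"


section \<open>Cotorsion pairs on triangulated categories\<close>

record ('o, 'm) tri_cat = "('o, 'm) cat" +
  ShOb :: "'o \<Rightarrow> 'o"
  ShArr :: "'m \<Rightarrow> 'm"
  Dist :: "('m \<times> 'm \<times> 'm) set"

text \<open>\<open>is_distinguished T X f Y g Z h\<close>: $X \xrightarrow{f} Y \xrightarrow{g} Z \xrightarrow{h} X[1]$
  is a distinguished triangle.\<close>

definition is_distinguished ::
  "('o, 'm, 'z) tri_cat_scheme \<Rightarrow> 'o \<Rightarrow> 'm \<Rightarrow> 'o \<Rightarrow> 'm \<Rightarrow> 'o \<Rightarrow> 'm \<Rightarrow> bool" where
  "is_distinguished T X f Y g Z h \<longleftrightarrow>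
     f \<in> Hom T X Y \<and> g \<in> Hom T Y Z \<and> h \<in> Hom T Z (ShOb T X) \<and> (f, g, h) \<in> Dist T"

definition tri_Ext_vanish :: "('o, 'm, 'z) tri_cat_scheme \<Rightarrow> 'o set \<Rightarrow> 'o set \<Rightarrow> bool" where
  "tri_Ext_vanish T \<L> \<R> \<longleftrightarrow> (\<forall>X \<in> \<L>. \<forall>Y \<in> \<R>. \<forall>f \<in> Hom T X (ShOb T Y). zero_arr T f)"

definition tri_CP :: "('o, 'm, 'z) tri_cat_scheme \<Rightarrow> ('o set \<times> 'o set) set" where
  "tri_CP T = {(\<L>, \<R>).
     additive_subcat T \<L> \<and> iso_closed T \<L> \<and> summand_closed T \<L> \<and>
     additive_subcat T \<R> \<and> iso_closed T \<R> \<and> summand_closed T \<R> \<and>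
     tri_Ext_vanish T \<L> \<R> \<and>
     (\<forall>X \<in> Ob T. \<exists>R \<in> \<R>. \<exists>L \<in> \<L>. \<exists>f g h. is_distinguished T R f L g X h) \<and>
     (\<forall>X \<in> Ob T. \<exists>R \<in> \<R>. \<exists>L \<in> \<L>. \<exists>f g h. is_distinguished T X f R g L h)}"


section \<open>The triangulated category attached to a twin cotorsion pair\<close>

definition wFib :: "('o, 'm, 'e, 'z) extri_scheme \<Rightarrow> 'o set \<Rightarrow> 'm set" where
  "wFib E \<V> = {f. \<exists>V \<in> \<V>. \<exists>x A B. conflation E V x A f B}"

definition wCof :: "('o, 'm, 'e, 'z) extri_scheme \<Rightarrow> 'o set \<Rightarrow> 'm set" where
  "wCof E \<S> = {f. \<exists>S \<in> \<S>. \<exists>y A B. conflation E A f B y S}"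

definition WW :: "('o, 'm, 'e, 'z) extri_scheme \<Rightarrow> 'o set \<Rightarrow> 'o set \<Rightarrow> 'm set" where
  "WW E \<S> \<V> = {p \<cdot>\<^bsub>E\<^esub> i | p i. i \<in> wCof E \<S> \<and> p \<in> wFib E \<V> \<and> Cod E i = Dom E p}"

definition loc_cat ::
  "('o, 'm, 'e, 'z) extri_scheme \<Rightarrow> 'o set \<Rightarrow> 'o set \<Rightarrow> ('o, ('o, 'm) zigzag set) cat" where
  "loc_cat E \<S> \<V> = localization E (WW E \<S> \<V>)"

definition ell :: "('o, 'm, 'e, 'z) extri_scheme \<Rightarrow> 'o set \<Rightarrow> 'o set \<Rightarrow> 'm \<Rightarrow> ('o, 'm) zigzag set" where
  "ell E \<S> \<V> f = loc_arr E (WW E \<S> \<V>) f"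

definition shift_choice ::
  "('o, 'm, 'e, 'z) extri_scheme \<Rightarrow> 'o set \<Rightarrow> 'o set \<Rightarrow>
   ('o \<Rightarrow> 'm) \<Rightarrow> ('o \<Rightarrow> 'o) \<Rightarrow> ('o \<Rightarrow> 'm) \<Rightarrow> ('o \<Rightarrow> 'o) \<Rightarrow> ('o \<Rightarrow> 'e) \<Rightarrow> bool" where
  "shift_choice E \<U> \<V> v VA u UA \<rho> \<longleftrightarrow>
     (\<forall>A \<in> Ob E. VA A \<in> \<V> \<and> UA A \<in> \<U> \<and> triangle E A (v A) (VA A) (u A) (UA A) (\<rho> A))"

text \<open>The arrow part of the functor $[1]$ on $\widetilde{\mathscr{C}}$ induced by
  $f \mapsto \ell(u_f)$. By the universal property of the localization it is determined on all
  arrows by the condition below.\<close>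

definition shift_arr ::
  "('o, 'm, 'e, 'z) extri_scheme \<Rightarrow> 'o set \<Rightarrow> 'o set \<Rightarrow> ('o \<Rightarrow> 'o) \<Rightarrow> ('o \<Rightarrow> 'e) \<Rightarrow>
   ('o, 'm) zigzag set \<Rightarrow> ('o, 'm) zigzag set" where
  "shift_arr E \<S> \<V> UA \<rho> =
     (SOME F. is_functor (loc_cat E \<S> \<V>) (loc_cat E \<S> \<V>) UA F \<and>
        (\<forall>A \<in> Ob E. \<forall>B \<in> Ob E. \<forall>f uf.
           ext_morphism E (UA A) A (\<rho> A) (UA B) B (\<rho> B) f uf \<longrightarrow>
           F (ell E \<S> \<V> f) = ell E \<S> \<V> uf))"

text \<open>The arrow $\widetilde{\ell}(\delta) = \ell(d) \circ \ell(w)^{-1}\colon X \to A[1]$ for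
  $\delta \in \mathbb{E}(X,A)$; all spans give the same arrow.\<close>

definition ell_ext ::
  "('o, 'm, 'e, 'z) extri_scheme \<Rightarrow> 'o set \<Rightarrow> 'o set \<Rightarrow> ('o \<Rightarrow> 'o) \<Rightarrow> ('o \<Rightarrow> 'e) \<Rightarrow>
   'o \<Rightarrow> 'o \<Rightarrow> 'e \<Rightarrow> ('o, 'm) zigzag set" where
  "ell_ext E \<S> \<V> UA \<rho> X A \<delta> =
     (SOME g. \<exists>D. \<exists>w \<in> Hom E D X. \<exists>d \<in> Hom E D (UA A).
        w \<in> wFib E \<V> \<and> pull E A w \<delta> = pull E A d (\<rho> A) \<and>
        g = ell E \<S> \<V> d \<cdot>\<^bsub>loc_cat E \<S> \<V>\<^esub> inv_arr (loc_cat E \<S> \<V>) (ell E \<S> \<V> w))"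

definition loc_dist ::
  "('o, 'm, 'e, 'z) extri_scheme \<Rightarrow> 'o set \<Rightarrow> 'o set \<Rightarrow> ('o \<Rightarrow> 'o) \<Rightarrow> ('o \<Rightarrow> 'e) \<Rightarrow>
   (('o, 'm) zigzag set \<times> ('o, 'm) zigzag set \<times> ('o, 'm) zigzag set) set" where
  "loc_dist E \<S> \<V> UA \<rho> = {(f, g, h) | f g h.
     \<exists>X Y Z A x B y D \<delta> a b c.
       f \<in> Hom (loc_cat E \<S> \<V>) X Y \<and> g \<in> Hom (loc_cat E \<S> \<V>) Y Z \<and>
       h \<in> Hom (loc_cat E \<S> \<V>) Z (UA X) \<and>
       triangle E A x B y D \<delta> \<and>
       a \<in> Hom (loc_cat E \<S> \<V>) X A \<and> is_iso (loc_cat E \<S> \<V>) a \<and>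
       b \<in> Hom (loc_cat E \<S> \<V>) Y B \<and> is_iso (loc_cat E \<S> \<V>) b \<and>
       c \<in> Hom (loc_cat E \<S> \<V>) Z D \<and> is_iso (loc_cat E \<S> \<V>) c \<and>
       b \<cdot>\<^bsub>loc_cat E \<S> \<V>\<^esub> f = ell E \<S> \<V> x \<cdot>\<^bsub>loc_cat E \<S> \<V>\<^esub> a \<and>
       c \<cdot>\<^bsub>loc_cat E \<S> \<V>\<^esub> g = ell E \<S> \<V> y \<cdot>\<^bsub>loc_cat E \<S> \<V>\<^esub> b \<and>
       shift_arr E \<S> \<V> UA \<rho> a \<cdot>\<^bsub>loc_cat E \<S> \<V>\<^esub> h =
         ell_ext E \<S> \<V> UA \<rho> D A \<delta> \<cdot>\<^bsub>loc_cat E \<S> \<V>\<^esub> c}"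

definition loc_tri ::
  "('o, 'm, 'e, 'z) extri_scheme \<Rightarrow> 'o set \<Rightarrow> 'o set \<Rightarrow> ('o \<Rightarrow> 'o) \<Rightarrow> ('o \<Rightarrow> 'e) \<Rightarrow>
   ('o, ('o, 'm) zigzag set) tri_cat" where
  "loc_tri E \<S> \<V> UA \<rho> =
     cat.extend (loc_cat E \<S> \<V>)
       (tri_cat.fields UA (shift_arr E \<S> \<V> UA \<rho>) (loc_dist E \<S> \<V> UA \<rho>))"


section \<open>Mutable cotorsion pairs and the two correspondences\<close>

text \<open>Since $\ell$ is the identity on objects, $\ell(\mathcal{A})$ is the closure of
  $\mathcal{A}$ under isomorphisms of $\widetilde{\mathscr{C}}$, and $\ell^{-1}(\mathcal{L})$ has
  the same objects as $\mathcal{L}$.\<close>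

definition mutable_CP ::
  "('o, 'm, 'e, 'z) extri_scheme \<Rightarrow> 'o set \<Rightarrow> 'o set \<Rightarrow> 'o set \<Rightarrow> 'o set \<Rightarrow>
   ('o \<Rightarrow> 'o) \<Rightarrow> ('o \<Rightarrow> 'e) \<Rightarrow> ('o set \<times> 'o set) set" where
  "mutable_CP E \<S> \<T> \<U> \<V> UA \<rho> = {(\<A>, \<B>) \<in> CP E.
     \<S> \<subseteq> \<A> \<and> \<A> \<subseteq> \<U> \<and> \<V> \<subseteq> \<B> \<and> \<B> \<subseteq> \<T> \<and>
     tri_Ext_vanish (loc_tri E \<S> \<V> UA \<rho>)
       (ess_image (loc_tri E \<S> \<V> UA \<rho>) \<A>) (ess_image (loc_tri E \<S> \<V> UA \<rho>) \<B>)}"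

definition ell_preimage :: "('o, 'm, 'e, 'z) extri_scheme \<Rightarrow> 'o set \<Rightarrow> 'o set" where
  "ell_preimage E \<L> = {X \<in> Ob E. X \<in> \<L>}"

definition RR ::
  "('o, 'm, 'e, 'z) extri_scheme \<Rightarrow> 'o set \<Rightarrow> 'o set \<Rightarrow> ('o \<Rightarrow> 'o) \<Rightarrow> ('o \<Rightarrow> 'e) \<Rightarrow>
   'o set \<times> 'o set \<Rightarrow> 'o set \<times> 'o set" where
  "RR E \<S> \<V> UA \<rho> = (\<lambda>(\<A>, \<B>).
     (ess_image (loc_tri E \<S> \<V> UA \<rho>) \<A>, ess_image (loc_tri E \<S> \<V> UA \<rho>) \<B>))"

definition II ::
  "('o, 'm, 'e, 'z) extri_scheme \<Rightarrow> 'o set \<Rightarrow> 'o set \<Rightarrow> 'o set \<times> 'o set \<Rightarrow> 'o set \<times> 'o set" where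
  "II E \<T> \<U> = (\<lambda>(\<L>, \<R>). (\<U> \<inter> ell_preimage E \<L>, \<T> \<inter> ell_preimage E \<R>))"

end

theory Submission
  imports Defs
begin

text \<open>Arrows of the localization from an object of $\mathcal{U}$ to an object of $\mathcal{T}$ are arrows of
  $\mathscr{C}$ modulo those factoring through $\mathcal{S}$. An arrow $f\colon X \to U_Y$ with
  $X \in \mathcal{U}$ and $\ell(f) = 0$ even factors through an object of $\mathcal{S}$ itself, and
  $\mathbb{E}(\mathcal{S},\mathcal{T}) = 0$; hence $\mathbb{E}(X,Y) \to \mathrm{Ext}^1(X,Y)$ is injective for
  $X \in \mathcal{U}$ and $Y \in \mathcal{T}$. Orthogonality in the localization thus splits approximating
  conflations in $\mathscr{C}$, which gives closure of $\ell(\mathcal{A})$ and $\ell(\mathcal{B})$ under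
  summands as well as $\mathcal{U} \cap \ell^{-1}\ell(\mathcal{A}) = \mathcal{A}$ and
  $\mathcal{T} \cap \ell^{-1}\ell(\mathcal{B}) = \mathcal{B}$.

  Conversely, a distinguished triangle is isomorphic to the image of a conflation $A \to B \to D$. That
  $D$ is the end of a conflation with $A \in \ell^{-1}(\mathcal{R})$ and $B \in \ell^{-1}(\mathcal{L})$ is a
  property invariant under weak fibrations and weak cofibrations in both directions, hence under
  isomorphism in the localization, so approximating triangles lift to conflations. The axioms of a
  triangulated category are not needed.\<close>

text \<open>Arrows of the localization are zigzags and are handled without a calculus of fractions.
  Fullness is an induction along the zigzag. Faithfulness needs an invariant: for fixed X in \<U>,
  send Z to the arrows from X to a \<T>-replacement of Z, modulo arrows through \<S>. Weak
  cofibrations are inverted because two replacements of one object agree modulo \<S>, weak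
  fibrations because \<E>(\<U>, \<V>) = 0, once they have been moved past a replacement. That move
  is where the Hovey condition enters: a weak fibration followed by a weak cofibration must be
  rewritten in the opposite order, and the kernel that appears lies in the common class \<N> of
  \<open>N_i\<close> and \<open>N_f\<close>. Closure of \<N> under extensions, together with the
  inclusion of \<T> \<inter> \<N> in \<V>, turns this kernel into an object of \<V>. Inflations need
  not be monic and pullbacks need not exist, so squares of conflations are built from (ET4) and its
  dual with corrected splittings. Condition (WIC) makes a split monomorphism an inflation; through
  it the kernel of a fibration that becomes invertible is recognized as an object of \<S>.\<close>

lemma Hom_iff [simp]: "f \<in> Hom C A B \<longleftrightarrow> f \<in> Arr C \<and> Dom C f = A \<and> Cod C f = B"
  by (simp add: Hom_def)

section \<open>Isomorphisms, zero arrows and biproducts in a category without hom groups\<close>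

context category
begin

lemma Dom_in [simp]: "f \<in> Arr C \<Longrightarrow> Dom C f \<in> Ob C"
  by (rule Dom_Ob)

lemma Cod_in [simp]: "f \<in> Arr C \<Longrightarrow> Cod C f \<in> Ob C"
  by (rule Cod_Ob)

lemma Id_simps [simp]:
  assumes "A \<in> Ob C"
  shows "Id C A \<in> Arr C" "Dom C (Id C A) = A" "Cod C (Id C A) = A"
  using Id_Hom[OF assms] by auto

lemma Comp_simps [simp]:
  assumes "f \<in> Arr C" "g \<in> Arr C" "Dom C g = Cod C f"
  shows "g \<cdot> f \<in> Arr C" "Dom C (g \<cdot> f) = Dom C f" "Cod C (g \<cdot> f) = Cod C g"
  using Comp_Hom[of f "Dom C f" "Cod C f" g "Cod C g"] assms by auto

lemma Comp_Id [simp]: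
  "f \<in> Arr C \<Longrightarrow> Dom C f = A \<Longrightarrow> f \<cdot> Id C A = f"
  "f \<in> Arr C \<Longrightarrow> Cod C f = A \<Longrightarrow> Id C A \<cdot> f = f"
  using Comp_Id_right Comp_Id_left by auto

lemma Comp_assoc_simp [simp]:
  "f \<in> Arr C \<Longrightarrow> g \<in> Arr C \<Longrightarrow> h \<in> Arr C \<Longrightarrow> Dom C g = Cod C f \<Longrightarrow> Dom C h = Cod C g \<Longrightarrow>
    (h \<cdot> g) \<cdot> f = h \<cdot> (g \<cdot> f)"
  using Comp_assoc[of f "Dom C f" "Cod C f" g "Cod C g" h "Cod C h"] by auto

text \<open>\<open>Comp_assoc_simp\<close> moves all brackets to the right, where a known composite
  \<open>g \<cdot> f\<close> is no longer a subterm; instances of this rule make such an equation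
  applicable again.\<close>

lemma Comp_reassoc:
  assumes "g \<cdot> f = k" "f \<in> Arr C" "g \<in> Arr C" "Dom C g = Cod C f"
    "e \<in> Arr C" "Cod C e = Dom C f"
  shows "g \<cdot> (f \<cdot> e) = k \<cdot> e"
  using assms by (metis Comp_assoc_simp)

lemma is_inverse_iff:
  "is_inverse C f g \<longleftrightarrow> f \<in> Arr C \<and> g \<in> Arr C \<and> Dom C g = Cod C f \<and> Cod C g = Dom C f \<and>
     g \<cdot> f = Id C (Dom C f) \<and> f \<cdot> g = Id C (Cod C f)"
  by (auto simp: is_inverse_def)

lemma is_inverse_unique:
  assumes "is_inverse C f g" "is_inverse C f h"
  shows "g = h"
proof -
  note a = assms[unfolded is_inverse_iff]
  have "(h \<cdot> f) \<cdot> g = g" using a by simp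
  moreover have "(h \<cdot> f) \<cdot> g = h \<cdot> (f \<cdot> g)"
    by (rule Comp_assoc_simp) (use a in simp_all)
  ultimately show ?thesis using a by simp
qed

lemma inv_arr_inverse: "is_iso C f \<Longrightarrow> is_inverse C f (inv_arr C f)"
  unfolding inv_arr_def is_iso_def by (blast intro: theI is_inverse_unique)

lemma inv_arr_eq: "is_inverse C f g \<Longrightarrow> inv_arr C f = g"
  using inv_arr_inverse[of f] is_inverse_unique unfolding is_iso_def by blast

lemma iso_Arr: "is_iso C f \<Longrightarrow> f \<in> Arr C"
  by (auto simp: is_iso_def is_inverse_iff)

lemma inv_arr_simps [simp]:
  assumes "is_iso C f"
  shows "inv_arr C f \<in> Arr C" "Dom C (inv_arr C f) = Cod C f" "Cod C (inv_arr C f) = Dom C f"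
    "inv_arr C f \<cdot> f = Id C (Dom C f)" "f \<cdot> inv_arr C f = Id C (Cod C f)"
  using inv_arr_inverse[OF assms] by (auto simp: is_inverse_iff)

lemma inv_arr_cancel [simp]:
  assumes "is_iso C f" "g \<in> Arr C"
  shows "Cod C g = Dom C f \<Longrightarrow> inv_arr C f \<cdot> (f \<cdot> g) = g"
    "Cod C g = Cod C f \<Longrightarrow> f \<cdot> (inv_arr C f \<cdot> g) = g"
  using assms iso_Arr[of f] Comp_reassoc[of "inv_arr C f" f "Id C (Dom C f)" g]
    Comp_reassoc[of f "inv_arr C f" "Id C (Cod C f)" g] by auto

lemma is_isoI:
  "f \<in> Arr C \<Longrightarrow> g \<in> Arr C \<Longrightarrow> Dom C g = Cod C f \<Longrightarrow> Cod C g = Dom C f \<Longrightarrow>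
     g \<cdot> f = Id C (Dom C f) \<Longrightarrow> f \<cdot> g = Id C (Cod C f) \<Longrightarrow> is_iso C f"
  unfolding is_iso_def is_inverse_iff by blast

lemma iso_Id [simp]: "A \<in> Ob C \<Longrightarrow> is_iso C (Id C A)"
  by (rule is_isoI[where g = "Id C A"]) auto

lemma iso_inv [simp]: "is_iso C f \<Longrightarrow> is_iso C (inv_arr C f)"
  by (rule is_isoI[where g = f]) (auto simp: iso_Arr)

lemma inv_arr_inv_arr: "is_iso C f \<Longrightarrow> inv_arr C (inv_arr C f) = f"
  by (rule inv_arr_eq) (auto simp: is_inverse_iff iso_Arr)

lemma iso_Comp:
  assumes "is_iso C f" "is_iso C g" "Dom C g = Cod C f"
  shows "is_iso C (g \<cdot> f)" "inv_arr C (g \<cdot> f) = inv_arr C f \<cdot> inv_arr C g"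
proof -
  have "is_inverse C (g \<cdot> f) (inv_arr C f \<cdot> inv_arr C g)"
    using assms iso_Arr by (simp add: is_inverse_iff)
  then show "is_iso C (g \<cdot> f)" "inv_arr C (g \<cdot> f) = inv_arr C f \<cdot> inv_arr C g"
    using inv_arr_eq by (auto simp: is_iso_def)
qed

lemma iso_left_cancel:
  assumes "is_iso C f" "g \<in> Arr C" "h \<in> Arr C" "Cod C g = Dom C f" "Cod C h = Dom C f" "f \<cdot> g = f \<cdot> h"
  shows "g = h"
proof -
  have "inv_arr C f \<cdot> (f \<cdot> g) = g" "inv_arr C f \<cdot> (f \<cdot> h) = h"
    using assms(1-5) by (simp_all del: Comp_assoc_simp)
  then show ?thesis using assms(6) by (metis (no_types))
qed

lemma iso_right_cancel:
  assumes "is_iso C f" "g \<in> Arr C" "h \<in> Arr C" "Dom C g = Cod C f" "Dom C h = Cod C f" "g \<cdot> f = h \<cdot> f"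
  shows "g = h"
proof -
  note a = assms(1-5) iso_Arr[OF assms(1)]
  have "(g \<cdot> f) \<cdot> inv_arr C f = g" "(h \<cdot> f) \<cdot> inv_arr C f = h" using a by simp_all
  then show ?thesis using assms(6) by (metis (no_types))
qed

lemma iso_of_iso_Comp_left:
  assumes "is_iso C f" "is_iso C (g \<cdot> f)" "g \<in> Arr C" "Dom C g = Cod C f"
  shows "is_iso C g"
proof -
  note a = assms iso_Arr[OF assms(1)]
  have "(g \<cdot> f) \<cdot> inv_arr C f = g" using a by simp
  then show ?thesis using iso_Comp(1)[of "inv_arr C f" "g \<cdot> f"] a by simp
qed

lemma isomorphicI: "is_iso C f \<Longrightarrow> Dom C f = A \<Longrightarrow> Cod C f = B \<Longrightarrow> isomorphic C A B"
  unfolding isomorphic_def using iso_Arr by force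

lemma isomorphicE:
  assumes "isomorphic C A B"
  obtains f where "is_iso C f" "f \<in> Arr C" "Dom C f = A" "Cod C f = B"
  using assms unfolding isomorphic_def by auto

lemma isomorphic_refl: "A \<in> Ob C \<Longrightarrow> isomorphic C A A"
  by (rule isomorphicI[of "Id C A"]) auto

lemma isomorphic_sym: "isomorphic C A B \<Longrightarrow> isomorphic C B A"
  by (metis isomorphicE isomorphicI iso_inv inv_arr_simps(2,3))

lemma isomorphic_trans: "isomorphic C A B \<Longrightarrow> isomorphic C B D \<Longrightarrow> isomorphic C A D"
proof (elim isomorphicE)
  fix f g assume "is_iso C f" "Dom C f = A" "Cod C f = B" "is_iso C g" "Dom C g = B" "Cod C g = D"
  then show ?thesis
    using iso_Comp(1)[of f g] iso_Arr[of f] iso_Arr[of g] by (intro isomorphicI[of "g \<cdot> f"]) auto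
qed

lemma isomorphic_Ob: "isomorphic C A B \<Longrightarrow> A \<in> Ob C \<and> B \<in> Ob C"
  by (elim isomorphicE) auto

lemma zero_arr_Comp_left:
  assumes "zero_arr C f" "f \<in> Arr C" "g \<in> Arr C" "Dom C g = Cod C f"
  shows "zero_arr C (g \<cdot> f)"
proof -
  from assms(1) obtain Z k h where z: "zero_object C Z" "k \<in> Arr C" "Dom C k = Dom C f" "Cod C k = Z"
    "h \<in> Arr C" "Dom C h = Z" "Cod C h = Cod C f" "f = h \<cdot> k"
    unfolding zero_arr_def by auto
  then have "g \<cdot> h \<in> Hom C Z (Cod C (g \<cdot> f))" "k \<in> Hom C (Dom C (g \<cdot> f)) Z" "g \<cdot> f = (g \<cdot> h) \<cdot> k"
    using assms by auto
  with z(1) show ?thesis unfolding zero_arr_def by blast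
qed

lemma zero_arr_Comp_right:
  assumes "zero_arr C f" "f \<in> Arr C" "g \<in> Arr C" "Cod C g = Dom C f"
  shows "zero_arr C (f \<cdot> g)"
proof -
  from assms(1) obtain Z k h where z: "zero_object C Z" "k \<in> Arr C" "Dom C k = Dom C f" "Cod C k = Z"
    "h \<in> Arr C" "Dom C h = Z" "Cod C h = Cod C f" "f = h \<cdot> k"
    unfolding zero_arr_def by auto
  then have "h \<in> Hom C Z (Cod C (f \<cdot> g))" "k \<cdot> g \<in> Hom C (Dom C (f \<cdot> g)) Z" "f \<cdot> g = h \<cdot> (k \<cdot> g)"
    using assms by auto
  with z(1) show ?thesis unfolding zero_arr_def by blast
qed

lemma zero_object_to:
  assumes "zero_object C Z" "f \<in> Arr C" "g \<in> Arr C" "Cod C f = Z" "Cod C g = Z" "Dom C f = Dom C g"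
  shows "f = g"
  using assms unfolding zero_object_def by (metis Hom_iff Dom_in)

lemma zero_object_from:
  assumes "zero_object C Z" "f \<in> Arr C" "g \<in> Arr C" "Dom C f = Z" "Dom C g = Z" "Cod C f = Cod C g"
  shows "f = g"
  using assms unfolding zero_object_def by (metis Hom_iff Cod_in)

lemma zero_objects_isomorphic:
  assumes "zero_object C Z" "zero_object C Z'"
  shows "isomorphic C Z Z'"
proof -
  obtain f g where "f \<in> Arr C" "Dom C f = Z" "Cod C f = Z'" "g \<in> Arr C" "Dom C g = Z'" "Cod C g = Z"
    using assms unfolding zero_object_def by (metis Hom_iff)
  moreover from this have "is_iso C f"
    using zero_object_to[OF assms(1), of "g \<cdot> f" "Id C Z"]
      zero_object_to[OF assms(2), of "f \<cdot> g" "Id C Z'"]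
    by (intro is_isoI[of f g]) auto
  ultimately show ?thesis using isomorphicI by blast
qed

lemma biproductD:
  assumes "biproduct C A B P iA iB pA pB"
  shows "iA \<in> Arr C" "Dom C iA = A" "Cod C iA = P" "iB \<in> Arr C" "Dom C iB = B" "Cod C iB = P"
    "pA \<in> Arr C" "Dom C pA = P" "Cod C pA = A" "pB \<in> Arr C" "Dom C pB = P" "Cod C pB = B"
    "pA \<cdot> iA = Id C A" "pB \<cdot> iB = Id C B" "zero_arr C (pB \<cdot> iA)" "zero_arr C (pA \<cdot> iB)"
  using assms by (auto simp: biproduct_def)

lemma biproduct_pair:
  assumes "biproduct C A B P iA iB pA pB" "f \<in> Arr C" "g \<in> Arr C" "Cod C f = A" "Cod C g = B"
    "Dom C g = Dom C f"
  shows "\<exists>!h. h \<in> Hom C (Dom C f) P \<and> pA \<cdot> h = f \<and> pB \<cdot> h = g"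
  using assms unfolding biproduct_def by auto

lemma biproduct_copair:
  assumes "biproduct C A B P iA iB pA pB" "f \<in> Arr C" "g \<in> Arr C" "Dom C f = A" "Dom C g = B"
    "Cod C g = Cod C f"
  shows "\<exists>!h. h \<in> Hom C P (Cod C f) \<and> h \<cdot> iA = f \<and> h \<cdot> iB = g"
  using assms unfolding biproduct_def by auto

lemma biproduct_pair_eq:
  assumes b: "biproduct C A B P iA iB pA pB" and h: "h \<in> Arr C" "k \<in> Arr C" "Cod C h = P" "Cod C k = P"
    "Dom C k = Dom C h" "pA \<cdot> h = pA \<cdot> k" "pB \<cdot> h = pB \<cdot> k"
  shows "h = k"
  using biproduct_pair[OF b, of "pA \<cdot> h" "pB \<cdot> h"] biproductD[OF b] h by (metis Comp_simps Hom_iff)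

lemma biproducts_isomorphic:
  assumes b: "biproduct C A B P iA iB pA pB" and b': "biproduct C A B P' iA' iB' pA' pB'"
  shows "isomorphic C P P'"
proof -
  note d = biproductD[OF b] biproductD[OF b']
  obtain f where f: "f \<in> Arr C" "Dom C f = P" "Cod C f = P'" "pA' \<cdot> f = pA" "pB' \<cdot> f = pB"
    using biproduct_pair[OF b', of pA pB] d by auto
  obtain g where g: "g \<in> Arr C" "Dom C g = P'" "Cod C g = P" "pA \<cdot> g = pA'" "pB \<cdot> g = pB'"
    using biproduct_pair[OF b, of pA' pB'] d by auto
  have "pA \<cdot> (g \<cdot> f) = pA" "pB \<cdot> (g \<cdot> f) = pB"
    using f g d Comp_reassoc[of pA g pA' f] Comp_reassoc[of pB g pB' f] by auto
  then have "g \<cdot> f = Id C P"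
    using biproduct_pair_eq[OF b, of "g \<cdot> f" "Id C P"] f g d
    by (metis Comp_Id(1) Cod_in Comp_simps Id_simps)
  moreover have "pA' \<cdot> (f \<cdot> g) = pA'" "pB' \<cdot> (f \<cdot> g) = pB'"
    using f g d Comp_reassoc[of pA' f pA g] Comp_reassoc[of pB' f pB g] by auto
  then have "f \<cdot> g = Id C P'"
    using biproduct_pair_eq[OF b', of "f \<cdot> g" "Id C P'"] f g d
    by (metis Comp_Id(1) Cod_in Comp_simps Id_simps)
  ultimately show ?thesis
    using f g by (intro isomorphicI[OF is_isoI[of f g]]) auto
qed

text \<open>Both universal properties are conjugated by \<open>a\<close> and \<open>c\<close>. The
  target application is the localization, which carries no hom groups here, so the matrix
  description of biproducts is not at hand.\<close>

lemma biproduct_transport: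
  assumes b: "biproduct C A B P iA iB pA pB"
    and a: "is_iso C a" "Dom C a = A" "Cod C a = A'"
    and c: "is_iso C c" "Dom C c = B" "Cod C c = B'"
  shows "biproduct C A' B' P (iA \<cdot> inv_arr C a) (iB \<cdot> inv_arr C c) (a \<cdot> pA) (c \<cdot> pB)"
proof -
  note d = biproductD[OF b]
  note ac = iso_Arr[OF a(1)] iso_Arr[OF c(1)]
  show ?thesis unfolding biproduct_def
  proof (intro conjI allI ballI)
    show "iA \<cdot> inv_arr C a \<in> Hom C A' P" "iB \<cdot> inv_arr C c \<in> Hom C B' P" "a \<cdot> pA \<in> Hom C P A'"
      "c \<cdot> pB \<in> Hom C P B'" using d a c ac by auto
    show "(a \<cdot> pA) \<cdot> (iA \<cdot> inv_arr C a) = Id C A'"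
      using d a c ac Comp_reassoc[of pA iA "Id C A" "inv_arr C a"] by simp
    show "(c \<cdot> pB) \<cdot> (iB \<cdot> inv_arr C c) = Id C B'"
      using d a c ac Comp_reassoc[of pB iB "Id C B" "inv_arr C c"] by simp
    have "zero_arr C (c \<cdot> ((pB \<cdot> iA) \<cdot> inv_arr C a))"
      using d a c ac by (intro zero_arr_Comp_left[OF zero_arr_Comp_right]) simp_all
    then show "zero_arr C ((c \<cdot> pB) \<cdot> (iA \<cdot> inv_arr C a))" using d a c ac by simp
    have "zero_arr C (a \<cdot> ((pA \<cdot> iB) \<cdot> inv_arr C c))"
      using d a c ac by (intro zero_arr_Comp_left[OF zero_arr_Comp_right]) simp_all
    then show "zero_arr C ((a \<cdot> pA) \<cdot> (iB \<cdot> inv_arr C c))" using d a c ac by simp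
  next
    fix X f g assume fg: "f \<in> Hom C X A'" "g \<in> Hom C X B'"
    then have "\<exists>!h. h \<in> Hom C X P \<and> pA \<cdot> h = inv_arr C a \<cdot> f \<and> pB \<cdot> h = inv_arr C c \<cdot> g"
      using biproduct_pair[OF b, of "inv_arr C a \<cdot> f" "inv_arr C c \<cdot> g"] d a c ac by auto
    moreover have "pA \<cdot> h = inv_arr C a \<cdot> f \<longleftrightarrow> (a \<cdot> pA) \<cdot> h = f"
        "pB \<cdot> h = inv_arr C c \<cdot> g \<longleftrightarrow> (c \<cdot> pB) \<cdot> h = g" if "h \<in> Hom C X P" for h
      using that d a c ac fg iso_left_cancel[OF a(1), of "pA \<cdot> h" "inv_arr C a \<cdot> f"]
        iso_left_cancel[OF c(1), of "pB \<cdot> h" "inv_arr C c \<cdot> g"] by auto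
    ultimately show "\<exists>!h. h \<in> Hom C X P \<and> (a \<cdot> pA) \<cdot> h = f \<and> (c \<cdot> pB) \<cdot> h = g"
      by (metis (no_types, lifting))
  next
    fix X f g assume fg: "f \<in> Hom C A' X" "g \<in> Hom C B' X"
    then have "\<exists>!h. h \<in> Hom C P X \<and> h \<cdot> iA = f \<cdot> a \<and> h \<cdot> iB = g \<cdot> c"
      using biproduct_copair[OF b, of "f \<cdot> a" "g \<cdot> c"] d a c ac by auto
    moreover have "h \<cdot> iA = f \<cdot> a \<longleftrightarrow> h \<cdot> (iA \<cdot> inv_arr C a) = f"
        "h \<cdot> iB = g \<cdot> c \<longleftrightarrow> h \<cdot> (iB \<cdot> inv_arr C c) = g" if "h \<in> Hom C P X" for h
      using that d a c ac fg iso_right_cancel[OF a(1), of "h \<cdot> (iA \<cdot> inv_arr C a)" f]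
        iso_right_cancel[OF c(1), of "h \<cdot> (iB \<cdot> inv_arr C c)" g]
        Comp_reassoc[of h iA "f \<cdot> a" "inv_arr C a"] Comp_reassoc[of h iB "g \<cdot> c" "inv_arr C c"] by auto
    ultimately show "\<exists>!h. h \<in> Hom C P X \<and> h \<cdot> (iA \<cdot> inv_arr C a) = f \<and> h \<cdot> (iB \<cdot> inv_arr C c) = g"
      by (metis (no_types, lifting))
  qed
qed

end

lemma is_functorD:
  assumes "is_functor C D Fo Fm"
  shows "A \<in> Ob C \<Longrightarrow> Fo A \<in> Ob D"
    "f \<in> Arr C \<Longrightarrow> Fm f \<in> Arr D" "f \<in> Arr C \<Longrightarrow> Dom D (Fm f) = Fo (Dom C f)"
    "f \<in> Arr C \<Longrightarrow> Cod D (Fm f) = Fo (Cod C f)"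
    "A \<in> Ob C \<Longrightarrow> Fm (Id C A) = Id D (Fo A)"
    "f \<in> Arr C \<Longrightarrow> g \<in> Arr C \<Longrightarrow> Dom C g = Cod C f \<Longrightarrow> Fm (g \<cdot>\<^bsub>C\<^esub> f) = Fm g \<cdot>\<^bsub>D\<^esub> Fm f"
  using assms unfolding is_functor_def by auto

section \<open>Localizations\<close>

context category
begin

lemma zigzags_Ob:
  assumes "z \<in> zigzags C W"
  shows "fst z \<in> Ob C \<and> snd (snd z) \<in> Ob C"
proof -
  have "A \<in> Ob C \<and> B \<in> Ob C" if "(A, p, B) \<in> zigzags C W" for A p B
    using that by (induction rule: zigzags.induct) auto
  then show ?thesis using assms by (cases z) auto
qed

lemma zigzags_Nil [simp]: "(A, [], B) \<in> zigzags C W \<longleftrightarrow> A \<in> Ob C \<and> B = A"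
  by (auto intro: zigzags.intros elim: zigzags.cases)

lemma zigzags_Fwd [simp]:
  "(A, Fwd f # p, B) \<in> zigzags C W \<longleftrightarrow> f \<in> Arr C \<and> A = Dom C f \<and> (Cod C f, p, B) \<in> zigzags C W"
  by (auto intro: zigzags.intros elim: zigzags.cases)

lemma zigzags_Bwd [simp]:
  "(A, Bwd w # p, B) \<in> zigzags C W \<longleftrightarrow>
     w \<in> W \<and> w \<in> Arr C \<and> A = Cod C w \<and> (Dom C w, p, B) \<in> zigzags C W"
  by (auto intro: zigzags.intros elim: zigzags.cases)

lemma zigzags_append:
  "(A, p @ q, B) \<in> zigzags C W \<longleftrightarrow> (\<exists>D. (A, p, D) \<in> zigzags C W \<and> (D, q, B) \<in> zigzags C W)"
proof (induction p arbitrary: A)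
  case Nil
  then show ?case using zigzags_Ob by fastforce
next
  case (Cons a p)
  then show ?case by (cases a) auto
qed

lemma zz_step_context:
  assumes "((A, s, B), (A', t, B')) \<in> zz_step C W" "(A0, l, A) \<in> zigzags C W" "(B, r, B0) \<in> zigzags C W"
  shows "((A0, l @ s @ r, B0), (A0, l @ t @ r, B0)) \<in> zz_step C W"
proof -
  from assms(1) obtain l' s' t' r' where e: "s = l' @ s' @ r'" "t = l' @ t' @ r'" "zz_basic C W s' t'"
    "(A, s, B) \<in> zigzags C W" "(A, t, B) \<in> zigzags C W"
    unfolding zz_step_def by auto
  have "(A0, l @ s @ r, B0) \<in> zigzags C W" "(A0, l @ t @ r, B0) \<in> zigzags C W"
    using assms(2,3) e(4,5) zigzags_append by blast+
  then have "((A0, (l @ l') @ s' @ (r' @ r), B0), (A0, (l @ l') @ t' @ (r' @ r), B0)) \<in> zz_step C W"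
    unfolding zz_step_def e(1,2)
    by (intro CollectI exI[of _ A0] exI[of _ "l @ l'"] exI[of _ s'] exI[of _ "r' @ r"] exI[of _ t'] exI[of _ B0])
      (simp add: e(3))
  then show ?thesis by (simp add: e)
qed

lemma zz_step_ends: "((A, s, B), (A', t, B')) \<in> zz_step C W \<Longrightarrow> A' = A \<and> B' = B"
  unfolding zz_step_def by auto

lemma zz_rel_equiv: "equiv (zigzags C W) (zz_rel C W)"
proof (rule equivI)
  show "refl_on (zigzags C W) (zz_rel C W)" by (auto simp: zz_rel_def refl_on_def)
  show "sym (zz_rel C W)"
  proof (rule symI)
    fix x y assume "(x, y) \<in> zz_rel C W"
    then show "(y, x) \<in> zz_rel C W"
      unfolding zz_rel_def
      using symD[OF sym_rtrancl[OF sym_Un_converse[of "zz_step C W"]], of x y] by auto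
  qed
  show "trans (zz_rel C W)" unfolding zz_rel_def by (auto intro!: transI)
  show "zz_rel C W \<subseteq> zigzags C W \<times> zigzags C W" by (auto simp: zz_rel_def)
qed

lemma zz_rel_ends:
  assumes "((A, s, B), (A', t, B')) \<in> zz_rel C W"
  shows "A' = A \<and> B' = B"
proof -
  have "((A, s, B), (A', t, B')) \<in> (zz_step C W \<union> (zz_step C W)\<inverse>)\<^sup>*"
    using assms by (simp add: zz_rel_def)
  then show ?thesis
  proof (induction "(A', t, B')" arbitrary: A' t B' rule: rtrancl_induct)
    case base
    then show ?case by simp
  next
    case (step y)
    then show ?case using zz_step_ends by (metis Un_iff converse_iff prod_cases3)
  qed
qed

text \<open>The generated equivalence is a congruence: a chain of steps can be carried out inside
  any surrounding zigzag, one step at a time by \<open>zz_step_context\<close>.\<close>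

lemma zz_rel_context:
  assumes "((A, s, B), (A, t, B)) \<in> zz_rel C W" "(A0, l, A) \<in> zigzags C W" "(B, r, B0) \<in> zigzags C W"
  shows "((A0, l @ s @ r, B0), (A0, l @ t @ r, B0)) \<in> zz_rel C W"
proof -
  have z: "(A, s, B) \<in> zigzags C W" "(A, t, B) \<in> zigzags C W"
    and "((A, s, B), (A, t, B)) \<in> (zz_step C W \<union> (zz_step C W)\<inverse>)\<^sup>*"
    using assms(1) by (simp_all add: zz_rel_def)
  from this(3) have "((A0, l @ s @ r, B0), (A0, l @ t @ r, B0)) \<in> (zz_step C W \<union> (zz_step C W)\<inverse>)\<^sup>*"
  proof (induction "(A, t, B)" arbitrary: t rule: rtrancl_induct)
    case base
    then show ?case by simp
  next
    case (step y)
    obtain u where y: "y = (A, u, B)"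
      using step(2) zz_step_ends by (metis Un_iff converse_iff prod_cases3)
    have "((A0, l @ u @ r, B0), (A0, l @ t @ r, B0)) \<in> zz_step C W \<union> (zz_step C W)\<inverse>"
      using step(2) zz_step_context[OF _ assms(2,3)] unfolding y by blast
    then show ?case using step(3)[OF y] by (rule rtrancl_into_rtrancl[rotated])
  qed
  moreover have "(A0, l @ s @ r, B0) \<in> zigzags C W" "(A0, l @ t @ r, B0) \<in> zigzags C W"
    using z assms(2,3) zigzags_append by blast+
  ultimately show ?thesis by (simp add: zz_rel_def)
qed

text \<open>The ends are separate arguments because an empty list of letters does not determine its
  object.\<close>

definition zz_class :: "'m set \<Rightarrow> 'o \<Rightarrow> 'm letter list \<Rightarrow> 'o \<Rightarrow> ('o, 'm) zigzag set" where
  "zz_class W A p B = zz_rel C W `` {(A, p, B)}"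

lemma zz_class_eq_iff:
  "(A, p, B) \<in> zigzags C W \<Longrightarrow> (A', q, B') \<in> zigzags C W \<Longrightarrow>
     zz_class W A p B = zz_class W A' q B' \<longleftrightarrow> ((A, p, B), (A', q, B')) \<in> zz_rel C W"
  unfolding zz_class_def by (rule eq_equiv_class_iff[OF zz_rel_equiv])

lemma zz_class_memD:
  "z \<in> zz_class W A p B \<Longrightarrow> fst z = A \<and> snd (snd z) = B \<and> z \<in> zigzags C W \<and>
     ((A, p, B), (A, fst (snd z), B)) \<in> zz_rel C W"
proof (cases z)
  case (fields A' q B')
  assume "z \<in> zz_class W A p B"
  then have r: "((A, p, B), (A', q, B')) \<in> zz_rel C W" by (simp add: zz_class_def fields)
  with zz_rel_ends[OF r] show ?thesis by (simp add: fields zz_rel_def)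
qed

lemma zz_class_step:
  assumes "zz_basic C W s t" "(A, l @ s @ r, B) \<in> zigzags C W" "(A, l @ t @ r, B) \<in> zigzags C W"
  shows "zz_class W A (l @ s @ r) B = zz_class W A (l @ t @ r) B"
proof -
  have "((A, l @ s @ r, B), (A, l @ t @ r, B)) \<in> zz_step C W"
    unfolding zz_step_def using assms by blast
  then show ?thesis using assms(2,3) by (simp add: zz_class_eq_iff zz_rel_def r_into_rtrancl)
qed

lemma localization_simps [simp]:
  "Ob (localization C W) = Ob C"
  "A \<in> Ob C \<Longrightarrow> Id (localization C W) A = zz_class W A [] A"
  by (simp_all add: localization_def zz_class_def)

lemma zz_class_in_loc [simp]:
  assumes "(A, p, B) \<in> zigzags C W"
  shows "zz_class W A p B \<in> Arr (localization C W)"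
    "Dom (localization C W) (zz_class W A p B) = A"
    "Cod (localization C W) (zz_class W A p B) = B"
proof -
  show "zz_class W A p B \<in> Arr (localization C W)"
    using assms by (simp add: localization_def zz_class_def quotientI)
  have "(A, p, B) \<in> zz_class W A p B"
    unfolding zz_class_def by (rule equiv_class_self[OF zz_rel_equiv assms])
  then have "(SOME z. z \<in> zz_class W A p B) \<in> zz_class W A p B" by (rule someI)
  from zz_class_memD[OF this]
  show "Dom (localization C W) (zz_class W A p B) = A"
    "Cod (localization C W) (zz_class W A p B) = B" by (simp_all add: localization_def)
qed

lemma loc_arrE:
  assumes "\<alpha> \<in> Arr (localization C W)"
  obtains A p B where "(A, p, B) \<in> zigzags C W" "\<alpha> = zz_class W A p B"
    "Dom (localization C W) \<alpha> = A" "Cod (localization C W) \<alpha> = B"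
proof -
  obtain z where z: "z \<in> zigzags C W" "\<alpha> = zz_rel C W `` {z}"
    using assms by (auto simp: localization_def elim: quotientE)
  obtain A p B where "z = (A, p, B)" by (cases z)
  with z that show thesis by (metis zz_class_def zz_class_in_loc(2,3))
qed

text \<open>\<open>Comp\<close> collects the concatenations of all representatives; by
  \<open>zz_rel_context\<close>, applied to one factor after the other, they lie in a single
  class.\<close>

lemma zz_class_Comp:
  assumes "(A, p, B) \<in> zigzags C W" "(B, q, D) \<in> zigzags C W"
  shows "zz_class W B q D \<cdot>\<^bsub>localization C W\<^esub> zz_class W A p B = zz_class W A (p @ q) D"
proof -
  have z: "(A, p @ q, D) \<in> zigzags C W" using assms zigzags_append by blast
  let ?X = "{(A', p', B', q', D'). (A', p', B') \<in> zz_class W A p B \<and> (B', q', D') \<in> zz_class W B q D}"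
  have "((A, p @ q, D), (A', p' @ q', D')) \<in> zz_rel C W"
    if "(A', p', B') \<in> zz_class W A p B" "(B', q', D') \<in> zz_class W B q D" for A' p' B' q' D'
  proof -
    have e: "A' = A" "B' = B" "D' = D" and r: "((A, p, B), (A, p', B)) \<in> zz_rel C W"
      "((B, q, D), (B, q', D)) \<in> zz_rel C W" and "(A, p', B) \<in> zigzags C W"
      using that[THEN zz_class_memD] by auto
    have "((A, p @ q, D), (A, p' @ q, D)) \<in> zz_rel C W"
      using zz_rel_context[OF r(1), of A "[]" q D] assms zigzags_Ob by force
    moreover have "((A, p' @ q, D), (A, p' @ q', D)) \<in> zz_rel C W"
      using zz_rel_context[OF r(2), of A p' "[]" D] assms zigzags_Ob \<open>(A, p', B) \<in> zigzags C W\<close> by force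
    ultimately show ?thesis unfolding e using zz_rel_equiv by (meson equivE transD)
  qed
  moreover have "(A, p, B) \<in> zz_class W A p B" "(B, q, D) \<in> zz_class W B q D"
    unfolding zz_class_def using assms equiv_class_self[OF zz_rel_equiv] by blast+
  ultimately have "zz_rel C W `` {(A', p' @ q', D') | A' p' B' q' D'.
      (A', p', B') \<in> zz_class W A p B \<and> (B', q', D') \<in> zz_class W B q D} = zz_class W A (p @ q) D"
    unfolding zz_class_def[of W A "p @ q" D]
    using equiv_class_eq[OF zz_rel_equiv] by (fastforce simp: Image_def)
  then show ?thesis by (simp add: localization_def)
qed

lemma category_localization: "category (localization C W)"
proof
  fix f assume "f \<in> Arr (localization C W)"
  then show "Dom (localization C W) f \<in> Ob (localization C W)" "Cod (localization C W) f \<in> Ob (localization C W)"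
    using zigzags_Ob by (force elim!: loc_arrE)+
next
  fix A assume "A \<in> Ob (localization C W)"
  then show "Id (localization C W) A \<in> Hom (localization C W) A A" by simp
next
  fix f A B g D assume "f \<in> Hom (localization C W) A B" "g \<in> Hom (localization C W) B D"
  then obtain p q where pq: "(A, p, B) \<in> zigzags C W" "f = zz_class W A p B"
    "(B, q, D) \<in> zigzags C W" "g = zz_class W B q D"
    by (metis Hom_iff loc_arrE)
  then have "(A, p @ q, D) \<in> zigzags C W" using zigzags_append by blast
  then show "g \<cdot>\<^bsub>localization C W\<^esub> f \<in> Hom (localization C W) A D"
    using pq by (simp add: zz_class_Comp)
next
  fix f A B assume "f \<in> Hom (localization C W) A B"
  then obtain p where p: "(A, p, B) \<in> zigzags C W" "f = zz_class W A p B" by (auto elim!: loc_arrE)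
  have "A \<in> Ob C" "B \<in> Ob C" using zigzags_Ob[OF p(1)] by auto
  then show "f \<cdot>\<^bsub>localization C W\<^esub> Id (localization C W) A = f" "Id (localization C W) B \<cdot>\<^bsub>localization C W\<^esub> f = f"
    using p by (simp_all add: zz_class_Comp)
next
  fix f g h A B D F
  assume "f \<in> Hom (localization C W) A B" "g \<in> Hom (localization C W) B D" "h \<in> Hom (localization C W) D F"
  then obtain p q r where "(A, p, B) \<in> zigzags C W" "f = zz_class W A p B"
    "(B, q, D) \<in> zigzags C W" "g = zz_class W B q D" "(D, r, F) \<in> zigzags C W" "h = zz_class W D r F"
    by (metis Hom_iff loc_arrE)
  moreover from this have "(A, p @ q, D) \<in> zigzags C W" "(B, q @ r, F) \<in> zigzags C W"
    using zigzags_append by blast+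
  ultimately show "h \<cdot>\<^bsub>localization C W\<^esub> (g \<cdot>\<^bsub>localization C W\<^esub> f) =
      (h \<cdot>\<^bsub>localization C W\<^esub> g) \<cdot>\<^bsub>localization C W\<^esub> f"
    by (simp add: zz_class_Comp)
qed

lemma loc_arr_class: "loc_arr C W f = zz_class W (Dom C f) [Fwd f] (Cod C f)"
  by (simp add: loc_arr_def zz_class_def)

lemma loc_arr_functor: "is_functor C (localization C W) (\<lambda>A. A) (loc_arr C W)"
  unfolding is_functor_def
proof (intro conjI ballI impI)
  fix f assume "f \<in> Arr C"
  then show "loc_arr C W f \<in> Hom (localization C W) (Dom C f) (Cod C f)" by (simp add: loc_arr_class)
next
  fix A assume "A \<in> Ob C"
  then show "loc_arr C W (Id C A) = Id (localization C W) A"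
    using zz_class_step[OF zz_basic.intros(1)[of A], where l = "[]" and r = "[]" and A = A and B = A and W = W] by (simp add: loc_arr_class)
next
  fix f g assume "f \<in> Arr C" "g \<in> Arr C" "Cod C f = Dom C g"
  then show "loc_arr C W (g \<cdot> f) = loc_arr C W g \<cdot>\<^bsub>localization C W\<^esub> loc_arr C W f"
    using zz_class_step[OF zz_basic.intros(2)[of f C "Dom C f" "Cod C f" g "Cod C g"],
        where l = "[]" and r = "[]" and A = "Dom C f" and B = "Cod C g" and W = W]
    by (simp add: loc_arr_class zz_class_Comp)
qed (auto)

lemma loc_arr_inverse:
  assumes "w \<in> W" "w \<in> Arr C"
  shows "is_inverse (localization C W) (loc_arr C W w) (zz_class W (Cod C w) [Bwd w] (Dom C w))"
  using assms
    zz_class_step[OF zz_basic.intros(3)[of w W C], where l = "[]" and r = "[]" and A = "Dom C w" and B = "Dom C w"]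
    zz_class_step[OF zz_basic.intros(4)[of w W C], where l = "[]" and r = "[]" and A = "Cod C w" and B = "Cod C w"]
  by (simp add: category.is_inverse_iff[OF category_localization] loc_arr_class zz_class_Comp)

lemma loc_arr_iso: "w \<in> W \<Longrightarrow> w \<in> Arr C \<Longrightarrow> is_iso (localization C W) (loc_arr C W w)"
  using loc_arr_inverse unfolding is_iso_def by blast

text \<open>An arrow is a finite zigzag, peeled off at the letter traversed first. Formal inverses
  appear as \<open>inv_arr\<close> of images, so that later inductions do not mention
  zigzags.\<close>

lemma localization_induct [consumes 1, case_names Id Fwd Bwd]:
  assumes "\<alpha> \<in> Arr (localization C W)"
    and Id: "\<And>A. A \<in> Ob C \<Longrightarrow> P (Id (localization C W) A)"
    and Fwd: "\<And>f \<beta>. f \<in> Arr C \<Longrightarrow> \<beta> \<in> Arr (localization C W) \<Longrightarrow>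
      Dom (localization C W) \<beta> = Cod C f \<Longrightarrow> P \<beta> \<Longrightarrow> P (\<beta> \<cdot>\<^bsub>localization C W\<^esub> loc_arr C W f)"
    and Bwd: "\<And>w \<beta>. w \<in> W \<Longrightarrow> w \<in> Arr C \<Longrightarrow> \<beta> \<in> Arr (localization C W) \<Longrightarrow>
      Dom (localization C W) \<beta> = Dom C w \<Longrightarrow> P \<beta> \<Longrightarrow>
      P (\<beta> \<cdot>\<^bsub>localization C W\<^esub> inv_arr (localization C W) (loc_arr C W w))"
  shows "P \<alpha>"
proof -
  have "P (zz_class W A p B)" if "(A, p, B) \<in> zigzags C W" for A p B
    using that
  proof (induction p arbitrary: A)
    case Nil
    then show ?case using Id[of A] by simp
  next
    case (Cons a p)
    show ?case
    proof (cases a)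
      case (Fwd f)
      then have f: "f \<in> Arr C" "A = Dom C f" "(Cod C f, p, B) \<in> zigzags C W" using Cons(2) by auto
      then show ?thesis
        using assms(3)[OF f(1) zz_class_in_loc(1)[OF f(3)] _ Cons(1)[OF f(3)]]
          zz_class_Comp[of A "[Fwd f]" "Cod C f" W p B]
        by (simp add: Fwd loc_arr_class)
    next
      case (Bwd w)
      then have f: "w \<in> W" "w \<in> Arr C" "A = Cod C w" "(Dom C w, p, B) \<in> zigzags C W" using Cons(2) by auto
      then show ?thesis
        using assms(4)[OF f(1,2) zz_class_in_loc(1)[OF f(4)] _ Cons(1)[OF f(4)]]
          zz_class_Comp[of A "[Bwd w]" "Dom C w" W p B]
          category.inv_arr_eq[OF category_localization loc_arr_inverse[OF f(1,2)]]
        by (simp add: Bwd)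
    qed
  qed
  then show ?thesis using loc_arrE[OF assms(1)] by metis
qed

end

text \<open>The target \<open>B\<close> matters only for the empty word. Later letters are composed
  on the left, since zigzags are listed in order of traversal.\<close>

fun zz_eval :: "('p, 'n, 'y) cat_scheme \<Rightarrow> ('o \<Rightarrow> 'p) \<Rightarrow> ('m \<Rightarrow> 'n) \<Rightarrow> 'm letter list \<Rightarrow> 'o \<Rightarrow> 'n" where
  "zz_eval D Fo Fm [] B = Id D (Fo B)"
| "zz_eval D Fo Fm (Fwd f # p) B = zz_eval D Fo Fm p B \<cdot>\<^bsub>D\<^esub> Fm f"
| "zz_eval D Fo Fm (Bwd w # p) B = zz_eval D Fo Fm p B \<cdot>\<^bsub>D\<^esub> inv_arr D (Fm w)"

text \<open>Evaluation letter by letter respects the basic relations because \<open>Fm\<close> is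
  functorial and inverts \<open>W\<close>, and it turns concatenation into composition; so it
  descends to classes.\<close>

theorem (in category) localization_universal:
  fixes Fo :: "'o \<Rightarrow> 'p" and Fm :: "'m \<Rightarrow> 'n" and D :: "('p, 'n, 'y) cat_scheme"
  assumes D: "category D" and F: "is_functor C D Fo Fm"
    and W: "\<And>w. w \<in> W \<Longrightarrow> w \<in> Arr C \<Longrightarrow> is_iso D (Fm w)"
  shows "\<exists>G. is_functor (localization C W) D Fo G \<and> (\<forall>f \<in> Arr C. G (loc_arr C W f) = Fm f)"
proof -
  interpret D: category D by (rule D)
  note Fd [simp] = is_functorD[OF F]
  let ?e = "zz_eval D Fo Fm"
  have e_Arr [simp]: "?e p B \<in> Arr D" "Dom D (?e p B) = Fo A" "Cod D (?e p B) = Fo B"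
    if "(A, p, B) \<in> zigzags C W" for A p B
    using that
  proof (induction p arbitrary: A)
    case Nil case 1 then show ?case by simp
  next
    case Nil case 2 then show ?case by simp
  next
    case Nil case 3 then show ?case by simp
  next
    case (Cons a p)
    { case 1 with Cons show ?case using W by (cases a) (auto dest: D.iso_Arr) }
    { case 2 with Cons show ?case using W by (cases a) (auto dest: D.iso_Arr) }
    { case 3 with Cons show ?case using W by (cases a) (auto dest: D.iso_Arr) }
  qed
  have e_append: "?e (p @ q) B = ?e q B \<cdot>\<^bsub>D\<^esub> ?e p E"
    if "(A, p, E) \<in> zigzags C W" "(E, q, B) \<in> zigzags C W" for A p E q B
    using that
  proof (induction p arbitrary: A)
    case Nil
    then show ?case by simp
  next
    case (Cons a p)
    show ?case
    proof (cases a)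
      case (Fwd f)
      then have "(Cod C f, p, E) \<in> zigzags C W" "f \<in> Arr C" using Cons by auto
      then show ?thesis using Cons(1) Cons(3) e_Arr[of "Cod C f" p E] e_Arr[OF Cons(3)] Fwd by simp
    next
      case (Bwd w)
      then have "(Dom C w, p, E) \<in> zigzags C W" "w \<in> Arr C" "w \<in> W" using Cons by auto
      then show ?thesis
        using Cons(1) Cons(3) e_Arr[of "Dom C w" p E] e_Arr[OF Cons(3)] Bwd W[of w] by simp
    qed
  qed
  have basic: "?e s E = ?e t E" if "zz_basic C W s t" "(A, s, E) \<in> zigzags C W" "(A, t, E) \<in> zigzags C W"
    for s t A E
    using that
  proof (induction rule: zz_basic.induct)
    case (3 w)
    then show ?case using W[of w] by simp
  next
    case (4 w)
    then show ?case using W[of w] by simp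
  qed simp_all
  have step: "?e p B = ?e q B" if pq: "((A, p, B), (A', q, B')) \<in> zz_step C W" for A p B A' q B'
  proof -
    from pq obtain l s t r where lr: "p = l @ s @ r" "q = l @ t @ r" "zz_basic C W s t"
      "(A, l @ s @ r, B) \<in> zigzags C W" "(A, l @ t @ r, B) \<in> zigzags C W"
      unfolding zz_step_def by auto
    obtain E E' where E: "(A, l, E) \<in> zigzags C W" "(E, s, E') \<in> zigzags C W" "(E', r, B) \<in> zigzags C W"
      using lr(4) zigzags_append by blast
    obtain E1 E1' where E1: "(A, l, E1) \<in> zigzags C W" "(E1, t, E1') \<in> zigzags C W" "(E1', r, B) \<in> zigzags C W"
      using lr(5) zigzags_append by blast
    \<comment> \<open>The two sides of a step are cut into three pieces independently. Source and
      letters determine where a piece ends, so both sides are cut at the same objects.\<close>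
    have l_det: "E = E1" if "(A, l, E) \<in> zigzags C W" "(A, l, E1) \<in> zigzags C W" for A E E1
      using that
    proof (induction l arbitrary: A)
      case (Cons a l)
      then show ?case by (cases a) auto
    qed simp
    have "E1 = E" using l_det[OF E(1) E1(1)] by simp
    moreover have "E1' = E'"
      using lr(3) E(2) E1(2) unfolding \<open>E1 = E\<close>
      by (induction rule: zz_basic.induct) auto
    ultimately have "?e s E' = ?e t E'" using basic[OF lr(3)] E E1 by simp
    moreover have "(E, s @ r, B) \<in> zigzags C W" "(E, t @ r, B) \<in> zigzags C W"
      using E E1 zigzags_append \<open>E1 = E\<close> \<open>E1' = E'\<close> by blast+
    ultimately show ?thesis
      using E E1 \<open>E1 = E\<close> \<open>E1' = E'\<close> by (simp add: lr(1,2) e_append[of A l E] e_append[of E _ E'])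
  qed
  have rel: "?e p B = ?e q B'" if "((A, p, B), (A', q, B')) \<in> zz_rel C W" for A p B A' q B'
  proof -
    have "((A, p, B), (A', q, B')) \<in> (zz_step C W \<union> (zz_step C W)\<inverse>)\<^sup>*"
      using that by (simp add: zz_rel_def)
    then show ?thesis
    proof (induction "(A', q, B')" arbitrary: A' q B' rule: rtrancl_induct)
      case base
      then show ?case by simp
    next
      case (step y)
      obtain A2 q2 B2 where y: "y = (A2, q2, B2)" by (cases y)
      then show ?case
        using step(2) step(3)[OF y] \<open>\<And>B A q p B' A'. ((A, p, B), (A', q, B')) \<in> zz_step C W \<Longrightarrow> ?e p B = ?e q B\<close>
          zz_step_ends by (metis Un_iff converse_iff)
    qed
  qed
  define G where "G \<alpha> = (let z = SOME z. z \<in> \<alpha> in ?e (fst (snd z)) (snd (snd z)))"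
    for \<alpha> :: "('o, 'm) zigzag set"
  have G: "G (zz_class W A p B) = ?e p B" if "(A, p, B) \<in> zigzags C W" for A p B
  proof -
    have "(A, p, B) \<in> zz_class W A p B"
      unfolding zz_class_def by (rule equiv_class_self[OF zz_rel_equiv that])
    then have "(SOME z. z \<in> zz_class W A p B) \<in> zz_class W A p B" by (rule someI)
    from zz_class_memD[OF this] show ?thesis
      unfolding G_def Let_def using rel by metis
  qed
  have "is_functor (localization C W) D Fo G"
    unfolding is_functor_def
  proof (intro conjI ballI impI)
    fix f assume "f \<in> Arr (localization C W)"
    then show "G f \<in> Hom D (Fo (Dom (localization C W) f)) (Fo (Cod (localization C W) f))"
      by (elim loc_arrE) (simp add: G)
  next
    fix f g assume fg: "f \<in> Arr (localization C W)" "g \<in> Arr (localization C W)"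
      "Cod (localization C W) f = Dom (localization C W) g"
    obtain A p B where f: "(A, p, B) \<in> zigzags C W" "f = zz_class W A p B" using fg(1) by (elim loc_arrE)
    obtain q E where g: "(B, q, E) \<in> zigzags C W" "g = zz_class W B q E"
      using fg(2,3) f by (metis loc_arrE zz_class_in_loc(3))
    have "(A, p @ q, E) \<in> zigzags C W" using f g zigzags_append by blast
    then show "G (g \<cdot>\<^bsub>localization C W\<^esub> f) = G g \<cdot>\<^bsub>D\<^esub> G f"
      using f g by (simp add: zz_class_Comp G e_append)
  qed (simp_all add: G)
  moreover have "\<forall>f \<in> Arr C. G (loc_arr C W f) = Fm f" by (simp add: loc_arr_class G)
  ultimately show ?thesis by blast
qed

section \<open>Additive categories\<close>

context additive_category
begin

text \<open>Source and target are read off the first argument, so sums need no object arguments; the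
  value is meaningful only for parallel arrows.\<close>

definition hadd :: "'m \<Rightarrow> 'm \<Rightarrow> 'm" (infixl "\<boxplus>" 65) where
  "f \<boxplus> g = f \<otimes>\<^bsub>HomGrp C (Dom C f) (Cod C f)\<^esub> g"

definition hneg :: "'m \<Rightarrow> 'm" where
  "hneg f = inv\<^bsub>HomGrp C (Dom C f) (Cod C f)\<^esub> f"

definition hzero :: "'o \<Rightarrow> 'o \<Rightarrow> 'm" where
  "hzero A B = \<one>\<^bsub>HomGrp C A B\<^esub>"

lemma hom_carrier [simp]: "A \<in> Ob C \<Longrightarrow> B \<in> Ob C \<Longrightarrow>
    f \<in> carrier (HomGrp C A B) \<longleftrightarrow> f \<in> Arr C \<and> Dom C f = A \<and> Cod C f = B"
  by (simp add: HomGrp_carrier)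

lemma hom_comm_group: "f \<in> Arr C \<Longrightarrow> comm_group (HomGrp C (Dom C f) (Cod C f))"
  by (simp add: HomGrp_group)

lemma hom_group: "f \<in> Arr C \<Longrightarrow> Group.group (HomGrp C (Dom C f) (Cod C f))"
  using hom_comm_group comm_group_def by blast

lemma hom_monoid: "f \<in> Arr C \<Longrightarrow> Group.monoid (HomGrp C (Dom C f) (Cod C f))"
  using hom_group group.is_monoid by blast

lemma hadd_simps [simp]:
  assumes "f \<in> Arr C" "g \<in> Arr C" "Dom C g = Dom C f" "Cod C g = Cod C f"
  shows "f \<boxplus> g \<in> Arr C" "Dom C (f \<boxplus> g) = Dom C f" "Cod C (f \<boxplus> g) = Cod C f"
  using monoid.m_closed[OF hom_monoid[OF assms(1)], of f g] assms by (auto simp: hadd_def)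

lemma hneg_simps [simp]:
  assumes "f \<in> Arr C"
  shows "hneg f \<in> Arr C" "Dom C (hneg f) = Dom C f" "Cod C (hneg f) = Cod C f"
  using group.inv_closed[OF hom_group[OF assms(1)], of f] assms by (auto simp: hneg_def)

lemma hzero_simps [simp]:
  assumes "A \<in> Ob C" "B \<in> Ob C"
  shows "hzero A B \<in> Arr C" "Dom C (hzero A B) = A" "Cod C (hzero A B) = B"
proof -
  have "Group.monoid (HomGrp C A B)"
    using HomGrp_group[OF assms] by (simp add: comm_group_def comm_monoid_def)
  then show "hzero A B \<in> Arr C" "Dom C (hzero A B) = A" "Cod C (hzero A B) = B"
    using monoid.one_closed[of "HomGrp C A B"] assms by (auto simp: hzero_def)
qed

lemma hadd_comm:
  "f \<in> Arr C \<Longrightarrow> g \<in> Arr C \<Longrightarrow> Dom C g = Dom C f \<Longrightarrow> Cod C g = Cod C f \<Longrightarrow> f \<boxplus> g = g \<boxplus> f"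
  using comm_monoid.m_comm[of "HomGrp C (Dom C f) (Cod C f)" f g] hom_comm_group[of f]
  by (simp add: hadd_def comm_group_def)

lemma hadd_assoc:
  "f \<in> Arr C \<Longrightarrow> g \<in> Arr C \<Longrightarrow> h \<in> Arr C \<Longrightarrow> Dom C g = Dom C f \<Longrightarrow> Cod C g = Cod C f \<Longrightarrow>
     Dom C h = Dom C f \<Longrightarrow> Cod C h = Cod C f \<Longrightarrow> (f \<boxplus> g) \<boxplus> h = f \<boxplus> (g \<boxplus> h)"
  using monoid.m_assoc[OF hom_monoid[of f], of f g h] hadd_simps[of f g]
  by (simp add: hadd_def)

lemma hadd_zero [simp]:
  "f \<in> Arr C \<Longrightarrow> Dom C f = A \<Longrightarrow> Cod C f = B \<Longrightarrow> f \<boxplus> hzero A B = f"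
  "f \<in> Arr C \<Longrightarrow> Dom C f = A \<Longrightarrow> Cod C f = B \<Longrightarrow> hzero A B \<boxplus> f = f"
  using monoid.r_one[OF hom_monoid[of f], of f] monoid.l_one[OF hom_monoid[of f], of f] hzero_simps[of A B]
  by (auto simp: hadd_def hzero_def)

lemma hadd_neg [simp]:
  "f \<in> Arr C \<Longrightarrow> f \<boxplus> hneg f = hzero (Dom C f) (Cod C f)"
  "f \<in> Arr C \<Longrightarrow> hneg f \<boxplus> f = hzero (Dom C f) (Cod C f)"
  using group.r_inv[OF hom_group[of f], of f] group.l_inv[OF hom_group[of f], of f] hneg_simps[of f]
  by (auto simp: hadd_def hzero_def hneg_def)

abbreviation hdiff :: "'m \<Rightarrow> 'm \<Rightarrow> 'm" (infixl "\<boxminus>" 65) where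
  "f \<boxminus> g \<equiv> f \<boxplus> hneg g"

lemma hdiff_cancel [simp]:
  assumes "f \<in> Arr C" "g \<in> Arr C" "Dom C g = Dom C f" "Cod C g = Cod C f"
  shows "(f \<boxminus> g) \<boxplus> g = f" "g \<boxplus> (f \<boxminus> g) = f" "(f \<boxplus> g) \<boxminus> g = f" "f \<boxplus> (hneg f \<boxplus> g) = g"
    "hneg f \<boxplus> (f \<boxplus> g) = g"
proof -
  show 1: "(f \<boxminus> g) \<boxplus> g = f" "(f \<boxplus> g) \<boxminus> g = f" using assms by (simp_all add: hadd_assoc)
  show "g \<boxplus> (f \<boxminus> g) = f" using 1(1) assms hadd_comm[of g "f \<boxminus> g"] by simp
  show "f \<boxplus> (hneg f \<boxplus> g) = g" "hneg f \<boxplus> (f \<boxplus> g) = g"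
    using assms by (simp_all flip: hadd_assoc)
qed

lemma hadd_cancel:
  assumes "f \<boxplus> g = f \<boxplus> h" "f \<in> Arr C" "g \<in> Arr C" "h \<in> Arr C" "Dom C g = Dom C f" "Cod C g = Cod C f"
    "Dom C h = Dom C f" "Cod C h = Cod C f"
  shows "g = h"
  using hdiff_cancel(5)[of f g] hdiff_cancel(5)[of f h] assms by metis

lemma Comp_hadd [simp]:
  assumes "f \<in> Arr C" "g \<in> Arr C" "Dom C g = Dom C f" "Cod C g = Cod C f" "h \<in> Arr C"
  shows "Dom C h = Cod C f \<Longrightarrow> h \<cdot> (f \<boxplus> g) = h \<cdot> f \<boxplus> h \<cdot> g"
    "Cod C h = Dom C f \<Longrightarrow> (f \<boxplus> g) \<cdot> h = f \<cdot> h \<boxplus> g \<cdot> h"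
proof -
  assume "Dom C h = Cod C f"
  then show "h \<cdot> (f \<boxplus> g) = h \<cdot> f \<boxplus> h \<cdot> g"
    using hom_mult[OF Comp_additive_right[of "Dom C f" h "Cod C f" "Cod C h"], of f g] assms
    by (simp add: hadd_def)
next
  assume "Cod C h = Dom C f"
  then show "(f \<boxplus> g) \<cdot> h = f \<cdot> h \<boxplus> g \<cdot> h"
    using hom_mult[OF Comp_additive_left[of "Cod C f" h "Dom C h" "Dom C f"], of f g] assms
    by (simp add: hadd_def)
qed

lemma hadd_idem:
  assumes "f \<boxplus> f = f" "f \<in> Arr C"
  shows "f = hzero (Dom C f) (Cod C f)"
  using hdiff_cancel(3)[of f f] assms by simp

lemma Comp_hzero [simp]:
  assumes "h \<in> Arr C"
  shows "A \<in> Ob C \<Longrightarrow> Dom C h = B \<Longrightarrow> h \<cdot> hzero A B = hzero A (Cod C h)"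
    "A \<in> Ob C \<Longrightarrow> Cod C h = B \<Longrightarrow> hzero B A \<cdot> h = hzero (Dom C h) A"
proof -
  assume a: "A \<in> Ob C" "Dom C h = B"
  have "h \<cdot> (hzero A B \<boxplus> hzero A B) = h \<cdot> hzero A B \<boxplus> h \<cdot> hzero A B"
    using a assms by (intro Comp_hadd) auto
  moreover have "hzero A B \<boxplus> hzero A B = hzero A B" using a assms by (intro hadd_zero) auto
  ultimately show "h \<cdot> hzero A B = hzero A (Cod C h)"
    using hadd_idem[of "h \<cdot> hzero A B"] a assms by auto
next
  assume a: "A \<in> Ob C" "Cod C h = B"
  have "(hzero B A \<boxplus> hzero B A) \<cdot> h = hzero B A \<cdot> h \<boxplus> hzero B A \<cdot> h"
    using a assms by (intro Comp_hadd) auto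
  moreover have "hzero B A \<boxplus> hzero B A = hzero B A" using a assms by (intro hadd_zero) auto
  ultimately show "hzero B A \<cdot> h = hzero (Dom C h) A"
    using hadd_idem[of "hzero B A \<cdot> h"] a assms by auto
qed

lemma hneg_unique:
  assumes "f \<boxplus> g = hzero (Dom C f) (Cod C f)" "f \<in> Arr C" "g \<in> Arr C" "Dom C g = Dom C f" "Cod C g = Cod C f"
  shows "g = hneg f"
  using hadd_cancel[of f g "hneg f"] assms by simp

lemma Comp_hneg [simp]:
  assumes "f \<in> Arr C" "h \<in> Arr C"
  shows "Dom C h = Cod C f \<Longrightarrow> h \<cdot> hneg f = hneg (h \<cdot> f)"
    "Cod C h = Dom C f \<Longrightarrow> hneg f \<cdot> h = hneg (f \<cdot> h)"
proof -
  assume a: "Dom C h = Cod C f"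
  then show "h \<cdot> hneg f = hneg (h \<cdot> f)"
    using Comp_hadd(1)[of f "hneg f" h] assms by (intro hneg_unique) simp_all
next
  assume a: "Cod C h = Dom C f"
  then show "hneg f \<cdot> h = hneg (f \<cdot> h)"
    using Comp_hadd(2)[of f "hneg f" h] assms by (intro hneg_unique) simp_all
qed

lemma hneg_hzero [simp]: "A \<in> Ob C \<Longrightarrow> B \<in> Ob C \<Longrightarrow> hneg (hzero A B) = hzero A B"
  by (rule hneg_unique[symmetric]) simp_all

lemma hzero_to:
  assumes "zero_object C Z" "f \<in> Arr C" "Cod C f = Z"
  shows "f = hzero (Dom C f) Z"
  using zero_object_to[OF assms(1), of f "hzero (Dom C f) Z"] assms by auto

lemma zero_arr_iff:
  assumes "f \<in> Arr C"
  shows "zero_arr C f \<longleftrightarrow> f = hzero (Dom C f) (Cod C f)"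
proof
  assume "zero_arr C f"
  then obtain Z g h where z: "zero_object C Z" "g \<in> Arr C" "Dom C g = Dom C f" "Cod C g = Z"
    "h \<in> Arr C" "Dom C h = Z" "Cod C h = Cod C f" "f = h \<cdot> g"
    unfolding zero_arr_def by auto
  then show "f = hzero (Dom C f) (Cod C f)"
    using hzero_to[of Z g] Comp_hzero(1)[of h "Dom C f" Z] assms by (metis Dom_in)
next
  obtain Z where Z: "zero_object C Z" using zero_object_ex by blast
  then have ZO: "Z \<in> Ob C" by (simp add: zero_object_def)
  assume f: "f = hzero (Dom C f) (Cod C f)"
  have "hzero (Dom C f) Z \<in> Hom C (Dom C f) Z" "hzero Z (Cod C f) \<in> Hom C Z (Cod C f)"
    "f = hzero Z (Cod C f) \<cdot> hzero (Dom C f) Z"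
    using ZO assms f by simp_all
  then show "zero_arr C f" unfolding zero_arr_def using Z by blast
qed

text \<open>For the last equation both sides are compared after the two projections, where the cross
  terms vanish; \<open>biproduct_pair_eq\<close> concludes.\<close>

lemma biproduct_eqs:
  assumes b: "biproduct C A B P iA iB pA pB"
  shows "pB \<cdot> iA = hzero A B" "pA \<cdot> iB = hzero B A" "iA \<cdot> pA \<boxplus> iB \<cdot> pB = Id C P"
proof -
  note d = biproductD[OF b]
  have PO: "P \<in> Ob C" "A \<in> Ob C" "B \<in> Ob C" using d(1-5) Cod_in[of iA] Dom_in[of iA] Dom_in[of iB] by auto
  show z: "pB \<cdot> iA = hzero A B" "pA \<cdot> iB = hzero B A"
    using d zero_arr_iff[of "pB \<cdot> iA"] zero_arr_iff[of "pA \<cdot> iB"] by simp_all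
  show "iA \<cdot> pA \<boxplus> iB \<cdot> pB = Id C P"
  proof (rule biproduct_pair_eq[OF b])
    show "pA \<cdot> (iA \<cdot> pA \<boxplus> iB \<cdot> pB) = pA \<cdot> Id C P"
      using d PO z Comp_reassoc[of pA iA "Id C A" pA] Comp_reassoc[of pA iB "hzero B A" pB] by simp
    show "pB \<cdot> (iA \<cdot> pA \<boxplus> iB \<cdot> pB) = pB \<cdot> Id C P"
      using d PO z Comp_reassoc[of pB iB "Id C B" pB] Comp_reassoc[of pB iA "hzero A B" pA] by simp
  qed (use d PO in simp_all)
qed

text \<open>With hom groups equations suffice: an arrow into or out of \<open>P\<close> is recovered
  from its components by composing with
  \<open>iA \<cdot> pA \<boxplus> iB \<cdot> pB = Id C P\<close>.\<close>

lemma biproductI: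
  assumes t: "iA \<in> Arr C" "Dom C iA = A" "Cod C iA = P" "iB \<in> Arr C" "Dom C iB = B" "Cod C iB = P"
    "pA \<in> Arr C" "Dom C pA = P" "Cod C pA = A" "pB \<in> Arr C" "Dom C pB = P" "Cod C pB = B"
    and e: "pA \<cdot> iA = Id C A" "pB \<cdot> iB = Id C B" "pB \<cdot> iA = hzero A B" "pA \<cdot> iB = hzero B A"
    "iA \<cdot> pA \<boxplus> iB \<cdot> pB = Id C P"
  shows "biproduct C A B P iA iB pA pB"
proof -
  have O: "A \<in> Ob C" "B \<in> Ob C" "P \<in> Ob C" using t Dom_in[of iA] Dom_in[of iB] Dom_in[of pA] by auto
  show ?thesis unfolding biproduct_def
  proof (intro conjI allI ballI)
    show "zero_arr C (pB \<cdot> iA)" "zero_arr C (pA \<cdot> iB)" using e t O by (simp_all add: zero_arr_iff)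
  next
    fix X f g assume fg: "f \<in> Hom C X A" "g \<in> Hom C X B"
    show "\<exists>!h. h \<in> Hom C X P \<and> pA \<cdot> h = f \<and> pB \<cdot> h = g"
    proof (rule ex1I[of _ "iA \<cdot> f \<boxplus> iB \<cdot> g"])
      have "X \<in> Ob C" using fg by auto
      then show "iA \<cdot> f \<boxplus> iB \<cdot> g \<in> Hom C X P \<and> pA \<cdot> (iA \<cdot> f \<boxplus> iB \<cdot> g) = f \<and> pB \<cdot> (iA \<cdot> f \<boxplus> iB \<cdot> g) = g"
        using t e O fg Comp_reassoc[OF e(1), of f] Comp_reassoc[OF e(2), of g]
          Comp_reassoc[OF e(3), of f] Comp_reassoc[OF e(4), of g] by simp
      fix h assume h: "h \<in> Hom C X P \<and> pA \<cdot> h = f \<and> pB \<cdot> h = g"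
      then have "h = (iA \<cdot> pA \<boxplus> iB \<cdot> pB) \<cdot> h" using e(5) by simp
      also have "\<dots> = iA \<cdot> (pA \<cdot> h) \<boxplus> iB \<cdot> (pB \<cdot> h)" using h t by simp
      finally show "h = iA \<cdot> f \<boxplus> iB \<cdot> g" using h by simp
    qed
  next
    fix X f g assume fg: "f \<in> Hom C A X" "g \<in> Hom C B X"
    show "\<exists>!h. h \<in> Hom C P X \<and> h \<cdot> iA = f \<and> h \<cdot> iB = g"
    proof (rule ex1I[of _ "f \<cdot> pA \<boxplus> g \<cdot> pB"])
      have "X \<in> Ob C" using fg by auto
      then show "f \<cdot> pA \<boxplus> g \<cdot> pB \<in> Hom C P X \<and> (f \<cdot> pA \<boxplus> g \<cdot> pB) \<cdot> iA = f \<and> (f \<cdot> pA \<boxplus> g \<cdot> pB) \<cdot> iB = g"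
        using t e O fg by simp
      fix h assume h: "h \<in> Hom C P X \<and> h \<cdot> iA = f \<and> h \<cdot> iB = g"
      then have "h = h \<cdot> (iA \<cdot> pA \<boxplus> iB \<cdot> pB)" using e(5) by simp
      also have "\<dots> = f \<cdot> pA \<boxplus> g \<cdot> pB"
        using h t Comp_reassoc[of h iA f pA] Comp_reassoc[of h iB g pB] by simp
      finally show "h = f \<cdot> pA \<boxplus> g \<cdot> pB" .
    qed
  qed (use t e in simp_all)
qed

lemma biproduct_Ob:
  assumes "biproduct C A B P iA iB pA pB"
  shows "A \<in> Ob C" "B \<in> Ob C" "P \<in> Ob C"
  using biproductD[OF assms] Dom_in[of iA] Dom_in[of iB] Dom_in[of pA] by auto

lemma biproduct_swap:
  assumes "biproduct C A B P iA iB pA pB"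
  shows "biproduct C B A P iB iA pB pA"
proof -
  note d = biproductD[OF assms]
  show ?thesis
    using d biproduct_eqs[OF assms] hadd_comm[of "iA \<cdot> pA" "iB \<cdot> pB"] by (intro biproductI) simp_all
qed

lemma biproduct_iso:
  assumes b: "biproduct C A B P iA iB pA pB" and f: "is_iso C f" "Dom C f = P" "Cod C f = P'"
  shows "biproduct C A B P' (f \<cdot> iA) (f \<cdot> iB) (pA \<cdot> inv_arr C f) (pB \<cdot> inv_arr C f)"
proof -
  note d = biproductD[OF b] and e = biproduct_eqs[OF b]
  note fa = iso_Arr[OF f(1)] f
  have "(f \<cdot> iA) \<cdot> (pA \<cdot> inv_arr C f) \<boxplus> (f \<cdot> iB) \<cdot> (pB \<cdot> inv_arr C f) =
      f \<cdot> ((iA \<cdot> pA \<boxplus> iB \<cdot> pB) \<cdot> inv_arr C f)"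
    using d fa by simp
  also have "\<dots> = Id C P'" unfolding e(3) using d fa by simp
  finally show ?thesis using d e fa by (intro biproductI) simp_all
qed

lemma biproduct_zero_right:
  assumes "zero_object C Z" "A \<in> Ob C"
  shows "biproduct C A Z A (Id C A) (hzero Z A) (Id C A) (hzero A Z)"
proof -
  have Z: "Z \<in> Ob C" using assms(1) by (simp add: zero_object_def)
  have "hzero Z Z = Id C Z" using hzero_to[OF assms(1), of "Id C Z"] Z by simp
  then show ?thesis using assms(2) Z by (intro biproductI) simp_all
qed

end

section \<open>Extensions and triangles\<close>

context ext_biadditive
begin

notation hadd (infixl "\<boxplus>" 65)
notation hdiff (infixl "\<boxminus>" 65)

abbreviation \<E> :: "'o \<Rightarrow> 'o \<Rightarrow> 'e set" where
  "\<E> X A \<equiv> carrier (Ext E X A)"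

lemma push_closed [simp]:
  "X \<in> Ob E \<Longrightarrow> a \<in> Arr E \<Longrightarrow> Cod E a = A' \<Longrightarrow> \<delta> \<in> \<E> X (Dom E a) \<Longrightarrow> push E X a \<delta> \<in> \<E> X A'"
  using hom_in_carrier[OF ExtMap_hom[of "Id E X" X X a "Dom E a" A'], of \<delta>] by (simp add: push_def)

lemma pull_closed [simp]:
  "A \<in> Ob E \<Longrightarrow> c \<in> Arr E \<Longrightarrow> Dom E c = X' \<Longrightarrow> \<delta> \<in> \<E> (Cod E c) A \<Longrightarrow> pull E A c \<delta> \<in> \<E> X' A"
  using hom_in_carrier[OF ExtMap_hom[of c X' "Cod E c" "Id E A" A A], of \<delta>] by (simp add: pull_def)

lemma push_Comp:
  "X \<in> Ob E \<Longrightarrow> a \<in> Arr E \<Longrightarrow> b \<in> Arr E \<Longrightarrow> Dom E b = Cod E a \<Longrightarrow> \<delta> \<in> \<E> X (Dom E a) \<Longrightarrow>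
     push E X (b \<cdot> a) \<delta> = push E X b (push E X a \<delta>)"
  using ExtMap_Comp[of "Id E X" X X "Id E X" X a "Dom E a" "Cod E a" b "Cod E b" \<delta>] by (simp add: push_def)

lemma pull_Comp:
  "A \<in> Ob E \<Longrightarrow> c \<in> Arr E \<Longrightarrow> d \<in> Arr E \<Longrightarrow> Dom E d = Cod E c \<Longrightarrow> \<delta> \<in> \<E> (Cod E d) A \<Longrightarrow>
     pull E A (d \<cdot> c) \<delta> = pull E A c (pull E A d \<delta>)"
  using ExtMap_Comp[of d "Dom E d" "Cod E d" c "Dom E c" "Id E A" A A "Id E A" A \<delta>] by (simp add: pull_def)

lemma ExtMap_push_pull:
  "c \<in> Arr E \<Longrightarrow> a \<in> Arr E \<Longrightarrow> \<delta> \<in> \<E> (Cod E c) (Dom E a) \<Longrightarrow>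
     ExtMap E c a \<delta> = push E (Dom E c) a (pull E (Dom E a) c \<delta>)"
  using ExtMap_Comp[of c "Dom E c" "Cod E c" "Id E (Dom E c)" "Dom E c" "Id E (Dom E a)" "Dom E a" "Dom E a" a "Cod E a" \<delta>]
  by (simp add: push_def pull_def)

lemma ExtMap_pull_push:
  "c \<in> Arr E \<Longrightarrow> a \<in> Arr E \<Longrightarrow> \<delta> \<in> \<E> (Cod E c) (Dom E a) \<Longrightarrow>
     ExtMap E c a \<delta> = pull E (Cod E a) c (push E (Cod E c) a \<delta>)"
  using ExtMap_Comp[of "Id E (Cod E c)" "Cod E c" "Cod E c" c "Dom E c" a "Dom E a" "Cod E a" "Id E (Cod E a)" "Cod E a" \<delta>]
  by (simp add: push_def pull_def)

text \<open>Both sides equal \<open>ExtMap E c a \<delta>\<close>, decomposed in the two possible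
  orders.\<close>

lemma push_pull:
  "c \<in> Arr E \<Longrightarrow> a \<in> Arr E \<Longrightarrow> Dom E c = X' \<Longrightarrow> Dom E a = A \<Longrightarrow> \<delta> \<in> \<E> (Cod E c) A \<Longrightarrow>
     push E X' a (pull E A c \<delta>) = pull E (Cod E a) c (push E (Cod E c) a \<delta>)"
  using ExtMap_pull_push[of c a \<delta>] ExtMap_push_pull[of c a \<delta>] by simp

lemma push_Id [simp]: "X \<in> Ob E \<Longrightarrow> A \<in> Ob E \<Longrightarrow> \<delta> \<in> \<E> X A \<Longrightarrow> push E X (Id E A) \<delta> = \<delta>"
  by (simp add: push_def ExtMap_Id)

lemma pull_Id [simp]: "X \<in> Ob E \<Longrightarrow> A \<in> Ob E \<Longrightarrow> \<delta> \<in> \<E> X A \<Longrightarrow> pull E A (Id E X) \<delta> = \<delta>"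
  by (simp add: pull_def ExtMap_Id)

lemma Ext_Group: "X \<in> Ob E \<Longrightarrow> A \<in> Ob E \<Longrightarrow> Group.group (Ext E X A)"
  using Ext_group comm_group_def by blast

lemma Ext_one [simp]: "X \<in> Ob E \<Longrightarrow> A \<in> Ob E \<Longrightarrow> \<one>\<^bsub>Ext E X A\<^esub> \<in> \<E> X A"
  using Ext_Group group.is_monoid monoid.one_closed by blast

lemma Ext_mult [simp]: "X \<in> Ob E \<Longrightarrow> A \<in> Ob E \<Longrightarrow> \<delta> \<in> \<E> X A \<Longrightarrow> \<epsilon> \<in> \<E> X A \<Longrightarrow> \<delta> \<otimes>\<^bsub>Ext E X A\<^esub> \<epsilon> \<in> \<E> X A"
  using Ext_Group group.is_monoid monoid.m_closed by metis

lemma Ext_inv [simp]: "X \<in> Ob E \<Longrightarrow> A \<in> Ob E \<Longrightarrow> \<delta> \<in> \<E> X A \<Longrightarrow> inv\<^bsub>Ext E X A\<^esub> \<delta> \<in> \<E> X A"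
  using Ext_Group group.inv_closed by metis

lemma Ext_unit [simp]:
  "X \<in> Ob E \<Longrightarrow> A \<in> Ob E \<Longrightarrow> \<delta> \<in> \<E> X A \<Longrightarrow> \<delta> \<otimes>\<^bsub>Ext E X A\<^esub> \<one>\<^bsub>Ext E X A\<^esub> = \<delta>"
  "X \<in> Ob E \<Longrightarrow> A \<in> Ob E \<Longrightarrow> \<delta> \<in> \<E> X A \<Longrightarrow> \<one>\<^bsub>Ext E X A\<^esub> \<otimes>\<^bsub>Ext E X A\<^esub> \<delta> = \<delta>"
  using Ext_Group[of X A] group.is_monoid monoid.r_one monoid.l_one by metis+

lemma push_one [simp]:
  "X \<in> Ob E \<Longrightarrow> a \<in> Arr E \<Longrightarrow> Dom E a = A \<Longrightarrow> push E X a \<one>\<^bsub>Ext E X A\<^esub> = \<one>\<^bsub>Ext E X (Cod E a)\<^esub>"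
  using hom_one[OF ExtMap_hom[of "Id E X" X X a A "Cod E a"]] Ext_Group[of X A] Ext_Group[of X "Cod E a"]
  by (auto simp: push_def)

lemma pull_one [simp]:
  "A \<in> Ob E \<Longrightarrow> c \<in> Arr E \<Longrightarrow> Cod E c = X \<Longrightarrow> pull E A c \<one>\<^bsub>Ext E X A\<^esub> = \<one>\<^bsub>Ext E (Dom E c) A\<^esub>"
  using hom_one[OF ExtMap_hom[of c "Dom E c" X "Id E A" A A]] Ext_Group[of X A] Ext_Group[of "Dom E c" A]
  by (auto simp: pull_def)

lemma push_mult:
  "X \<in> Ob E \<Longrightarrow> a \<in> Arr E \<Longrightarrow> Dom E a = A \<Longrightarrow> \<delta> \<in> \<E> X A \<Longrightarrow> \<epsilon> \<in> \<E> X A \<Longrightarrow>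
     push E X a (\<delta> \<otimes>\<^bsub>Ext E X A\<^esub> \<epsilon>) = push E X a \<delta> \<otimes>\<^bsub>Ext E X (Cod E a)\<^esub> push E X a \<epsilon>"
  using hom_mult[OF ExtMap_hom[of "Id E X" X X a A "Cod E a"], of \<delta> \<epsilon>] by (simp add: push_def)

lemma pull_mult:
  "A \<in> Ob E \<Longrightarrow> c \<in> Arr E \<Longrightarrow> Cod E c = X \<Longrightarrow> \<delta> \<in> \<E> X A \<Longrightarrow> \<epsilon> \<in> \<E> X A \<Longrightarrow>
     pull E A c (\<delta> \<otimes>\<^bsub>Ext E X A\<^esub> \<epsilon>) = pull E A c \<delta> \<otimes>\<^bsub>Ext E (Dom E c) A\<^esub> pull E A c \<epsilon>"
  using hom_mult[OF ExtMap_hom[of c "Dom E c" X "Id E A" A A], of \<delta> \<epsilon>] by (simp add: pull_def)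

lemma push_hadd:
  "X \<in> Ob E \<Longrightarrow> a \<in> Arr E \<Longrightarrow> b \<in> Arr E \<Longrightarrow> Dom E b = Dom E a \<Longrightarrow> Cod E b = Cod E a \<Longrightarrow>
     \<delta> \<in> \<E> X (Dom E a) \<Longrightarrow> push E X (a \<boxplus> b) \<delta> = push E X a \<delta> \<otimes>\<^bsub>Ext E X (Cod E a)\<^esub> push E X b \<delta>"
  by (simp add: hadd_def push_add)

lemma pull_hadd:
  "A \<in> Ob E \<Longrightarrow> c \<in> Arr E \<Longrightarrow> d \<in> Arr E \<Longrightarrow> Dom E d = Dom E c \<Longrightarrow> Cod E d = Cod E c \<Longrightarrow>
     \<delta> \<in> \<E> (Cod E c) A \<Longrightarrow> pull E A (c \<boxplus> d) \<delta> = pull E A c \<delta> \<otimes>\<^bsub>Ext E (Dom E c) A\<^esub> pull E A d \<delta>"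
  by (simp add: hadd_def pull_add)

lemma Ext_idem: "X \<in> Ob E \<Longrightarrow> A \<in> Ob E \<Longrightarrow> \<delta> \<in> \<E> X A \<Longrightarrow> \<delta> \<otimes>\<^bsub>Ext E X A\<^esub> \<delta> = \<delta> \<Longrightarrow> \<delta> = \<one>\<^bsub>Ext E X A\<^esub>"
  using Ext_Group[of X A] group.l_cancel_one by metis

lemma push_hzero [simp]:
  assumes "X \<in> Ob E" "A \<in> Ob E" "B \<in> Ob E" "\<delta> \<in> \<E> X A"
  shows "push E X (hzero A B) \<delta> = \<one>\<^bsub>Ext E X B\<^esub>"
proof -
  have "hzero A B \<boxplus> hzero A B = hzero A B" using assms by (intro hadd_zero) auto
  then show ?thesis
    using push_hadd[of X "hzero A B" "hzero A B" \<delta>] Ext_idem[of X B "push E X (hzero A B) \<delta>"] assms by simp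
qed

lemma pull_hzero [simp]:
  assumes "X \<in> Ob E" "A \<in> Ob E" "Y \<in> Ob E" "\<delta> \<in> \<E> X A"
  shows "pull E A (hzero Y X) \<delta> = \<one>\<^bsub>Ext E Y A\<^esub>"
proof -
  have "hzero Y X \<boxplus> hzero Y X = hzero Y X" using assms by (intro hadd_zero) auto
  then show ?thesis
    using pull_hadd[of A "hzero Y X" "hzero Y X" \<delta>] Ext_idem[of Y A "pull E A (hzero Y X) \<delta>"] assms by simp
qed

lemma Ext_inv_unique:
  "X \<in> Ob E \<Longrightarrow> A \<in> Ob E \<Longrightarrow> \<delta> \<in> \<E> X A \<Longrightarrow> \<epsilon> \<in> \<E> X A \<Longrightarrow> \<delta> \<otimes>\<^bsub>Ext E X A\<^esub> \<epsilon> = \<one>\<^bsub>Ext E X A\<^esub> \<Longrightarrow> \<epsilon> = inv\<^bsub>Ext E X A\<^esub> \<delta>"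
  using Ext_Group[of X A] group.inv_equality group.inv_comm by metis

lemma push_hneg:
  assumes "X \<in> Ob E" "a \<in> Arr E" "\<delta> \<in> \<E> X (Dom E a)"
  shows "push E X (hneg a) \<delta> = inv\<^bsub>Ext E X (Cod E a)\<^esub> push E X a \<delta>"
  using push_hadd[of X a "hneg a" \<delta>] assms by (intro Ext_inv_unique) simp_all

lemma pull_hneg:
  assumes "A \<in> Ob E" "c \<in> Arr E" "\<delta> \<in> \<E> (Cod E c) A"
  shows "pull E A (hneg c) \<delta> = inv\<^bsub>Ext E (Dom E c) A\<^esub> pull E A c \<delta>"
  using pull_hadd[of A c "hneg c" \<delta>] assms by (intro Ext_inv_unique) simp_all

lemma Ext_diff_eq_one:
  assumes "X \<in> Ob E" "A \<in> Ob E" "\<delta> \<in> \<E> X A" "\<epsilon> \<in> \<E> X A"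
  shows "\<delta> \<otimes>\<^bsub>Ext E X A\<^esub> inv\<^bsub>Ext E X A\<^esub> \<epsilon> = \<one>\<^bsub>Ext E X A\<^esub> \<longleftrightarrow> \<delta> = \<epsilon>"
  using Ext_Group[OF assms(1,2)] assms
  by (metis group.inv_solve_right' group.r_inv Ext_unit(2) Ext_one)

lemma Ext_diff_add:
  assumes "X \<in> Ob E" "A \<in> Ob E" "\<delta> \<in> \<E> X A" "\<epsilon> \<in> \<E> X A"
  shows "\<delta> \<otimes>\<^bsub>Ext E X A\<^esub> inv\<^bsub>Ext E X A\<^esub> (\<delta> \<otimes>\<^bsub>Ext E X A\<^esub> inv\<^bsub>Ext E X A\<^esub> \<epsilon>) = \<epsilon>"
proof -
  interpret G: comm_group "Ext E X A" using Ext_group assms by blast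
  have "\<delta> \<otimes>\<^bsub>Ext E X A\<^esub> inv\<^bsub>Ext E X A\<^esub> (\<delta> \<otimes>\<^bsub>Ext E X A\<^esub> inv\<^bsub>Ext E X A\<^esub> \<epsilon>) =
      \<delta> \<otimes>\<^bsub>Ext E X A\<^esub> (inv\<^bsub>Ext E X A\<^esub> \<delta> \<otimes>\<^bsub>Ext E X A\<^esub> \<epsilon>)"
    using assms by (simp add: G.inv_mult)
  then show ?thesis using assms by (simp flip: G.m_assoc)
qed

end

section \<open>Triangles: lifting, extending and splitting\<close>

context extriangulated_category
begin

lemma triangleD:
  assumes "triangle E A x B y X \<delta>"
  shows "A \<in> Ob E" "B \<in> Ob E" "X \<in> Ob E" "\<delta> \<in> \<E> X A" "x \<in> Arr E" "Dom E x = A" "Cod E x = B"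
    "y \<in> Arr E" "Dom E y = B" "Cod E y = X"
  using assms by (auto simp: triangle_def)

lemma realization_E: "realization E"
  using ET2 by (simp add: additive_realization_def)

lemma seq_equiv_iff:
  "((x, y), (x', y')) \<in> seq_equiv E A X \<longleftrightarrow> (x, y) \<in> sequences E A X \<and> (x', y') \<in> sequences E A X \<and>
     (\<exists>b. is_iso E b \<and> Dom E b = Cod E x \<and> Cod E b = Cod E x' \<and> b \<cdot> x = x' \<and> y' \<cdot> b = y)"
  using iso_Arr unfolding seq_equiv_def by (auto simp: Bex_def)

lemma sequences_iff:
  "(x, y) \<in> sequences E A X \<longleftrightarrow> x \<in> Arr E \<and> y \<in> Arr E \<and> Dom E x = A \<and> Cod E y = X \<and> Dom E y = Cod E x"
  by (auto simp: sequences_def)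

lemma seq_equiv_equiv: "equiv (sequences E A X) (seq_equiv E A X)"
proof (rule equivI)
  show "seq_equiv E A X \<subseteq> sequences E A X \<times> sequences E A X" by (auto simp: seq_equiv_def)
  show "refl_on (sequences E A X) (seq_equiv E A X)"
  proof (rule refl_onI)
    fix p assume "p \<in> sequences E A X"
    then show "(p, p) \<in> seq_equiv E A X"
      by (cases p) (auto simp: seq_equiv_iff sequences_iff intro!: exI[of _ "Id E (Cod E (fst p))"])
  qed
  show "sym (seq_equiv E A X)"
  proof (rule symI)
    fix p q assume pq: "(p, q) \<in> seq_equiv E A X"
    obtain x y x' y' where [simp]: "p = (x, y)" "q = (x', y')" by (cases p, cases q)
    obtain b where b: "is_iso E b" "Dom E b = Cod E x" "Cod E b = Cod E x'" "b \<cdot> x = x'" "y' \<cdot> b = y"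
      "(x, y) \<in> sequences E A X" "(x', y') \<in> sequences E A X" using pq by (auto simp: seq_equiv_iff)
    have "b \<in> Arr E" using b(1) by (rule iso_Arr)
    moreover have "x \<in> Arr E" "y' \<in> Arr E" "Dom E y' = Cod E x'" using b(6,7) by (simp_all add: sequences_iff)
    ultimately have "inv_arr E b \<cdot> (b \<cdot> x) = x" "(y' \<cdot> b) \<cdot> inv_arr E b = y'" using b(1-3) by simp_all
    then have "inv_arr E b \<cdot> x' = x" "y \<cdot> inv_arr E b = y'" unfolding b(4,5) .
    then show "(q, p) \<in> seq_equiv E A X"
      using b by (auto simp: seq_equiv_iff intro!: exI[of _ "inv_arr E b"])
  qed
  show "trans (seq_equiv E A X)"
  proof (rule transI)
    fix p q r assume pq: "(p, q) \<in> seq_equiv E A X" "(q, r) \<in> seq_equiv E A X"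
    obtain x y x' y' x'' y'' where e: "p = (x, y)" "q = (x', y')" "r = (x'', y'')" by (cases p, cases q, cases r)
    obtain b where b: "is_iso E b" "Dom E b = Cod E x" "Cod E b = Cod E x'" "b \<cdot> x = x'" "y' \<cdot> b = y"
      "(x, y) \<in> sequences E A X" "(x', y') \<in> sequences E A X" using pq by (auto simp: seq_equiv_iff e)
    obtain c where c: "is_iso E c" "Dom E c = Cod E x'" "Cod E c = Cod E x''" "c \<cdot> x' = x''" "y'' \<cdot> c = y'"
      "(x'', y'') \<in> sequences E A X" using pq by (auto simp: seq_equiv_iff e)
    have "c \<cdot> b \<cdot> x = x''" "y'' \<cdot> c \<cdot> b = y"
      using b(2,3,6,7) c(2,3,6) iso_Arr[OF b(1)] iso_Arr[OF c(1)]
        Comp_reassoc[OF c(5), of b] by (simp_all add: sequences_iff b(4,5) c(4))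
    then show "(p, r) \<in> seq_equiv E A X"
      unfolding e seq_equiv_iff
      using b(2,3,6) c(2,3,6) iso_Comp(1)[OF b(1) c(1)] iso_Arr[OF b(1)] iso_Arr[OF c(1)]
      \<open>c \<cdot> b \<cdot> x = x''\<close> \<open>y'' \<cdot> c \<cdot> b = y\<close>
      by (intro conjI exI[of _ "c \<cdot> b"]) (simp_all add: sequences_iff)
  qed
qed

lemma triangle_exists:
  assumes "X \<in> Ob E" "A \<in> Ob E" "\<delta> \<in> \<E> X A"
  obtains B x y where "triangle E A x B y X \<delta>"
proof -
  have "Real E X A \<delta> \<in> sequences E A X // seq_equiv E A X"
    using realization_E assms unfolding realization_def by blast
  then obtain x y where xy: "(x, y) \<in> sequences E A X" "Real E X A \<delta> = seq_equiv E A X `` {(x, y)}"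
    by (auto elim!: quotientE)
  then have "triangle E A x (Cod E x) y X \<delta>"
    using assms by (auto simp: triangle_def seq_class_def sequences_iff)
  then show thesis by (rule that)
qed

text \<open>\<open>Real\<close> returns a whole equivalence class, so two sequences realizing the
  same extension are related by \<open>seq_equiv\<close>.\<close>

lemma triangle_unique:
  assumes "triangle E A x B y X \<delta>" "triangle E A x' B' y' X \<delta>"
  obtains b where "is_iso E b" "b \<in> Arr E" "Dom E b = B" "Cod E b = B'" "b \<cdot> x = x'" "y' \<cdot> b = y"
proof -
  note d = triangleD[OF assms(1)] triangleD[OF assms(2)]
  have "seq_equiv E A X `` {(x, y)} = seq_equiv E A X `` {(x', y')}"
    using assms by (simp add: triangle_def seq_class_def)
  then have "((x, y), (x', y')) \<in> seq_equiv E A X"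
    using eq_equiv_class_iff[OF seq_equiv_equiv] d by (simp add: sequences_iff)
  then show thesis using that d iso_Arr by (auto simp: seq_equiv_iff)
qed

lemma triangle_iso:
  assumes t: "triangle E A x B y X \<delta>" and b: "is_iso E b" "Dom E b = B" "Cod E b = B'"
  shows "triangle E A (b \<cdot> x) B' (y \<cdot> inv_arr E b) X \<delta>"
proof -
  note d = triangleD[OF t] and ba = iso_Arr[OF b(1)]
  have "((x, y), (b \<cdot> x, y \<cdot> inv_arr E b)) \<in> seq_equiv E A X"
    using d b ba by (auto simp: seq_equiv_iff sequences_iff intro!: exI[of _ b])
  then have "seq_equiv E A X `` {(x, y)} = seq_equiv E A X `` {(b \<cdot> x, y \<cdot> inv_arr E b)}"
    by (rule equiv_class_eq[OF seq_equiv_equiv])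
  then show ?thesis using t d b ba by (auto simp: triangle_def seq_class_def)
qed

lemma triangle_morphism:
  assumes "triangle E A x B y X \<delta>" "triangle E A' x' B' y' X' \<delta>'" "a \<in> Arr E" "Dom E a = A" "Cod E a = A'"
    "c \<in> Arr E" "Dom E c = X" "Cod E c = X'" "push E X a \<delta> = pull E A' c \<delta>'"
  obtains b where "b \<in> Arr E" "Dom E b = B" "Cod E b = B'" "b \<cdot> x = x' \<cdot> a" "y' \<cdot> b = c \<cdot> y"
proof -
  have "ext_morphism E X A \<delta> X' A' \<delta>' a c"
    using assms triangleD[OF assms(1)] triangleD[OF assms(2)] by (simp add: ext_morphism_def)
  then have "\<exists>b \<in> Hom E B B'. b \<cdot> x = x' \<cdot> a \<and> y' \<cdot> b = c \<cdot> y"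
    using realization_E assms(1,2) unfolding realization_def by blast
  then show thesis using that by auto
qed

lemma triangle_biproduct:
  "biproduct E A X P iA iX pA pX \<Longrightarrow> triangle E A iA P pX X \<one>\<^bsub>Ext E X A\<^esub>"
  using ET2 biproduct_Ob[of A X P iA iX pA pX] biproductD[of A X P iA iX pA pX]
  unfolding additive_realization_def triangle_def by (metis Ext_one Hom_iff)

lemma triangle_right_zero:
  assumes "zero_object E Z" "A \<in> Ob E"
  shows "triangle E A (Id E A) A (hzero A Z) Z \<one>\<^bsub>Ext E Z A\<^esub>"
  by (rule triangle_biproduct[OF biproduct_zero_right[OF assms]])

lemma triangle_left_zero:
  assumes "zero_object E Z" "A \<in> Ob E"
  shows "triangle E Z (hzero Z A) A (Id E A) A \<one>\<^bsub>Ext E A Z\<^esub>"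
  by (rule triangle_biproduct[OF biproduct_swap[OF biproduct_zero_right[OF assms]]])

lemma ET3':
  assumes "triangle E A x B y X \<delta>" "triangle E A' x' B' y' X' \<delta>'"
    "a \<in> Arr E" "Dom E a = A" "Cod E a = A'" "b \<in> Arr E" "Dom E b = B" "Cod E b = B'" "b \<cdot> x = x' \<cdot> a"
  obtains c where "c \<in> Arr E" "Dom E c = X" "Cod E c = X'" "y' \<cdot> b = c \<cdot> y" "push E X a \<delta> = pull E A' c \<delta>'"
  using ET3[OF assms(1,2), of a b] assms that by (auto simp: ext_morphism_def)

lemma ET3_op':
  assumes "triangle E A x B y X \<delta>" "triangle E A' x' B' y' X' \<delta>'"
    "b \<in> Arr E" "Dom E b = B" "Cod E b = B'" "c \<in> Arr E" "Dom E c = X" "Cod E c = X'" "y' \<cdot> b = c \<cdot> y"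
  obtains a where "a \<in> Arr E" "Dom E a = A" "Cod E a = A'" "b \<cdot> x = x' \<cdot> a" "push E X a \<delta> = pull E A' c \<delta>'"
  using ET3_op[OF assms(1,2), of b c] assms that by (auto simp: ext_morphism_def)

lemma zero_object_E: obtains Z where "zero_object E Z" "Z \<in> Ob E"
  using zero_object_ex by (auto simp: zero_object_def)

text \<open>(ET3) compares the trivial triangle on \<open>A\<close>, with third term a zero object
  \<open>Z\<close>, to the given one along \<open>Id E A\<close> and \<open>x\<close>; thus
  \<open>y \<cdot> x\<close> factors through \<open>Z\<close>.\<close>

lemma triangle_Comp_zero:
  assumes "triangle E A x B y X \<delta>"
  shows "y \<cdot> x = hzero A X"
proof -
  obtain Z where Z: "zero_object E Z" "Z \<in> Ob E" by (rule zero_object_E)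
  note d = triangleD[OF assms]
  obtain c where c: "c \<in> Arr E" "Dom E c = Z" "Cod E c = X" "y \<cdot> x = c \<cdot> hzero A Z"
    using ET3'[OF triangle_right_zero[OF Z(1)] assms, of A "Id E A" x] d by auto
  then show ?thesis using Z d by simp
qed

lemma triangle_Comp_zero':
  assumes "triangle E A x B y X \<delta>" "f \<in> Arr E" "Cod E f = A"
  shows "y \<cdot> (x \<cdot> f) = hzero (Dom E f) X"
  using Comp_reassoc[OF triangle_Comp_zero[OF assms(1)], of f] triangleD[OF assms(1)] assms by simp

text \<open>The dual of (ET3) compares the trivial triangle Z -> B -> B with the given one along
  \<open>Id E B\<close> and \<open>y\<close>; so the pullback is a pushforward of the zero
  extension.\<close>

lemma pull_deflation:
  assumes "triangle E A x B y X \<delta>"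
  shows "pull E A y \<delta> = \<one>\<^bsub>Ext E B A\<^esub>"
proof -
  obtain Z where Z: "zero_object E Z" "Z \<in> Ob E" by (rule zero_object_E)
  note d = triangleD[OF assms]
  obtain a where "a \<in> Arr E" "Dom E a = Z" "Cod E a = A"
    "push E B a \<one>\<^bsub>Ext E B Z\<^esub> = pull E A y \<delta>"
    using ET3_op'[OF triangle_left_zero[OF Z(1)] assms, of B "Id E B" y] d by auto
  then show ?thesis using d Z by simp
qed

lemma push_inflation:
  assumes "triangle E A x B y X \<delta>"
  shows "push E X x \<delta> = \<one>\<^bsub>Ext E X B\<^esub>"
proof -
  obtain Z where Z: "zero_object E Z" "Z \<in> Ob E" by (rule zero_object_E)
  note d = triangleD[OF assms]
  obtain c where "c \<in> Arr E" "Dom E c = X" "Cod E c = Z"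
    "push E X x \<delta> = pull E B c \<one>\<^bsub>Ext E Z B\<^esub>"
    using ET3'[OF assms triangle_right_zero[OF Z(1)], of B x "Id E B"] d by auto
  then show ?thesis using d Z by simp
qed

text \<open>Vanishing of the pullback makes \<open>Id E A\<close> and \<open>g\<close> a morphism
  from the zero extension. It is realized on a biproduct of \<open>A\<close> with the source of
  \<open>g\<close>, and restricting to the second summand gives the lift.\<close>

lemma lift_along_deflation:
  assumes t: "triangle E A x B y X \<delta>" and g: "g \<in> Arr E" "Cod E g = X"
    and z: "pull E A g \<delta> = \<one>\<^bsub>Ext E (Dom E g) A\<^esub>"
  obtains h where "h \<in> Arr E" "Dom E h = Dom E g" "Cod E h = B" "y \<cdot> h = g"
proof -
  note d = triangleD[OF t]
  obtain P iA iZ pA pZ where b: "biproduct E A (Dom E g) P iA iZ pA pZ"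
    using biproduct_ex[of A "Dom E g"] d g by auto
  note bd = biproductD[OF b]
  have "push E (Dom E g) (Id E A) \<one>\<^bsub>Ext E (Dom E g) A\<^esub> = pull E A g \<delta>"
    using z d g by simp
  then obtain k where "k \<in> Arr E" "Dom E k = P" "Cod E k = B" "y \<cdot> k = g \<cdot> pZ"
    using triangle_morphism[OF triangle_biproduct[OF b] t, of "Id E A" g] d g by auto
  then show thesis using that[of "k \<cdot> iZ"] bd d g Comp_reassoc[of y k "g \<cdot> pZ" iZ] by simp
qed

lemma extend_along_inflation:
  assumes t: "triangle E A x B y X \<delta>" and a: "a \<in> Arr E" "Dom E a = A"
    and z: "push E X a \<delta> = \<one>\<^bsub>Ext E X (Cod E a)\<^esub>"
  obtains h where "h \<in> Arr E" "Dom E h = B" "Cod E h = Cod E a" "h \<cdot> x = a"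
proof -
  note d = triangleD[OF t]
  obtain P iZ iX pZ pX where b: "biproduct E (Cod E a) X P iZ iX pZ pX"
    using biproduct_ex[of "Cod E a" X] d a by auto
  note bd = biproductD[OF b]
  have c: "push E X a \<delta> = pull E (Cod E a) (Id E X) \<one>\<^bsub>Ext E X (Cod E a)\<^esub>" using z d a by simp
  obtain k where k: "k \<in> Arr E" "Dom E k = B" "Cod E k = P" "k \<cdot> x = iZ \<cdot> a"
    using triangle_morphism[OF t triangle_biproduct[OF b] a refl Id_simps[OF d(3)] c] .
  have "pZ \<cdot> (k \<cdot> x) = a" unfolding k(4) using Comp_reassoc[OF bd(13), of a] bd(1-12) a by simp
  then have "(pZ \<cdot> k) \<cdot> x = a" using bd k(1-3) d by simp
  then show thesis by (rule that[rotated -1]) (use bd d k in simp_all)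
qed

text \<open>The dual of (ET3) is applied to the trivial triangle on \<open>Dom E f\<close>.
  Uniqueness cannot be had: an inflation is only a weak kernel.\<close>

lemma factor_through_kernel:
  assumes t: "triangle E A x B y X \<delta>" and f: "f \<in> Arr E" "Cod E f = B" "y \<cdot> f = hzero (Dom E f) X"
  obtains g where "g \<in> Arr E" "Dom E g = Dom E f" "Cod E g = A" "x \<cdot> g = f"
proof -
  obtain Z where Z: "zero_object E Z" "Z \<in> Ob E" by (rule zero_object_E)
  note d = triangleD[OF t]
  have "y \<cdot> f = hzero Z X \<cdot> hzero (Dom E f) Z" "Dom E f \<in> Ob E" using d f Z by simp_all
  with d f Z obtain g where "g \<in> Arr E" "Dom E g = Dom E f" "Cod E g = A" "f \<cdot> Id E (Dom E f) = x \<cdot> g"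
    using ET3_op'[OF triangle_right_zero[OF Z(1)] t, of "Dom E f" f "hzero Z X"] hzero_simps by metis
  then show thesis using that f(1) by (metis Comp_Id(1))
qed

lemma factor_through_cokernel:
  assumes t: "triangle E A x B y X \<delta>" and f: "f \<in> Arr E" "Dom E f = B" "f \<cdot> x = hzero A (Cod E f)"
  obtains g where "g \<in> Arr E" "Dom E g = X" "Cod E g = Cod E f" "g \<cdot> y = f"
proof -
  obtain Z where Z: "zero_object E Z" "Z \<in> Ob E" by (rule zero_object_E)
  note d = triangleD[OF t]
  have "f \<cdot> x = hzero Z (Cod E f) \<cdot> hzero A Z" "Cod E f \<in> Ob E" using d f Z by simp_all
  with d f Z obtain g where "g \<in> Arr E" "Dom E g = X" "Cod E g = Cod E f" "Id E (Cod E f) \<cdot> f = g \<cdot> y"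
    using ET3'[OF t triangle_left_zero[OF Z(1)], of "Cod E f" "hzero A Z" f] hzero_simps by metis
  then show thesis using that f(1) by (metis Comp_Id(2))
qed

text \<open>\<delta> is its own pullback along \<open>y \<cdot> s\<close>, and pulling back along
  \<open>y\<close> already kills it.\<close>

lemma section_imp_split:
  assumes t: "triangle E A x B y X \<delta>" and s: "s \<in> Arr E" "Dom E s = X" "Cod E s = B" "y \<cdot> s = Id E X"
  shows "\<delta> = \<one>\<^bsub>Ext E X A\<^esub>"
proof -
  note d = triangleD[OF t]
  have "pull E A (y \<cdot> s) \<delta> = \<one>\<^bsub>Ext E X A\<^esub>"
    using pull_Comp[of A s y \<delta>] d s pull_deflation[OF t] by simp
  then show ?thesis using s d by simp
qed

lemma retraction_imp_split:
  assumes t: "triangle E A x B y X \<delta>" and s: "r \<in> Arr E" "Dom E r = B" "Cod E r = A" "r \<cdot> x = Id E A"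
  shows "\<delta> = \<one>\<^bsub>Ext E X A\<^esub>"
proof -
  note d = triangleD[OF t]
  have "push E X (r \<cdot> x) \<delta> = \<one>\<^bsub>Ext E X A\<^esub>"
    using push_Comp[of X x r \<delta>] d s push_inflation[OF t] by simp
  then show ?thesis using s d by simp
qed

lemma split_biproduct:
  assumes t: "triangle E A x B y X \<one>\<^bsub>Ext E X A\<^esub>"
  obtains s r where "biproduct E A X B x s r y"
proof -
  note d = triangleD[OF t]
  obtain P iA iX pA pX where b: "biproduct E A X P iA iX pA pX"
    using biproduct_ex[of A X] d by auto
  note bd = biproductD[OF b]
  obtain f where f: "is_iso E f" "f \<in> Arr E" "Dom E f = P" "Cod E f = B" "f \<cdot> iA = x" "y \<cdot> f = pX"
    using triangle_unique[OF triangle_biproduct[OF b] t] .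
  have "pX \<cdot> inv_arr E f = y" using f d by (simp flip: f(6))
  then show thesis using that biproduct_iso[OF b f(1,3,4)] f(5) by simp
qed

section \<open>Exactness of the sequences of extension groups attached to a triangle\<close>

lemma E_exact_1:
  assumes W: "WIC E" and t: "triangle E A x B y X \<delta>" and e: "\<epsilon> \<in> \<E> B V" "V \<in> Ob E" "pull E V x \<epsilon> = \<one>\<^bsub>Ext E A V\<^esub>"
  obtains \<epsilon>' where "\<epsilon>' \<in> \<E> X V" "\<epsilon> = pull E V y \<epsilon>'"
proof -
  note d = triangleD[OF t]
  obtain M i p where m: "triangle E V i M p B \<epsilon>" using triangle_exists e d by blast
  note md = triangleD[OF m]
  obtain G h h' \<delta>'' f e' where g: "triangle E G h' M h X \<delta>''" "h = y \<cdot> p"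
    "f \<in> Hom E V G" "e' \<in> Hom E G A" "h' \<cdot> f = i" "p \<cdot> h' = x \<cdot> e'"
    "triangle E V f G e' A (pull E V x \<epsilon>)" "\<delta> = push E X e' \<delta>''" "push E B f \<epsilon> = pull E G y \<delta>''"
    using ET4_op[OF m t] by blast
  note gd = triangleD[OF g(1)] triangleD[OF g(7)]
  \<comment> \<open>The extension of \<open>A\<close> by \<open>V\<close> in the diagram is the
    vanishing pullback of \<epsilon>, so \<open>f\<close> has a retraction \<open>r\<close>. Pushing
    \<open>push E B f \<epsilon> = pull E G y \<delta>''\<close> along \<open>r\<close> exhibits
    \<epsilon> as a pullback along \<open>y\<close>.\<close>
  obtain s r where b: "biproduct E V A G f s r e'"
    using g(7) unfolding e(3) by (rule split_biproduct)
  note bd = biproductD[OF b]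
  have "\<epsilon> = push E B (r \<cdot> f) \<epsilon>" using bd e d by simp
  also have "\<dots> = push E B r (push E B f \<epsilon>)" using bd e d by (intro push_Comp) simp_all
  also have "\<dots> = pull E V y (push E X r \<delta>'')" unfolding g(9) using bd d gd push_pull[of y r B G \<delta>''] by simp
  finally show thesis using that[of "push E X r \<delta>''"] bd d gd by simp
qed

text \<open>Dual to \<open>E_exact_1\<close>: the extension of \<open>Z\<close> by \<open>X\<close>
  splits, and pulling \<delta>'' back along the section \<open>s\<close> of \<open>e'\<close> gives
  the preimage.\<close>

lemma E_exact_2:
  assumes t: "triangle E A x B y X \<delta>" and e: "\<epsilon> \<in> \<E> Z B" "Z \<in> Ob E" "push E Z y \<epsilon> = \<one>\<^bsub>Ext E Z X\<^esub>"
  obtains \<epsilon>' where "\<epsilon>' \<in> \<E> Z A" "\<epsilon> = push E Z x \<epsilon>'"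
proof -
  note d = triangleD[OF t]
  obtain M i p where m: "triangle E B i M p Z \<epsilon>" using triangle_exists e d by blast
  note md = triangleD[OF m]
  obtain G h h' \<delta>'' f e' where g: "triangle E A h M h' G \<delta>''" "h = i \<cdot> x"
    "f \<in> Hom E X G" "e' \<in> Hom E G Z" "f \<cdot> y = h' \<cdot> i" "e' \<cdot> h' = p"
    "triangle E X f G e' Z (push E Z y \<epsilon>)" "pull E A f \<delta>'' = \<delta>" "push E G x \<delta>'' = pull E B e' \<epsilon>"
    using ET4[OF t m] by blast
  note gd = triangleD[OF g(1)] triangleD[OF g(7)]
  obtain s r where b: "biproduct E X Z G f s r e'"
    using g(7) unfolding e(3) by (rule split_biproduct)
  note bd = biproductD[OF b]
  have "\<epsilon> = pull E B (e' \<cdot> s) \<epsilon>" using bd e d by simp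
  also have "\<dots> = pull E B s (pull E B e' \<epsilon>)" using bd e d by (intro pull_Comp) simp_all
  also have "\<dots> = push E Z x (pull E A s \<delta>'')" unfolding g(9)[symmetric] using bd d gd push_pull[of s x Z A \<delta>''] by simp
  finally show thesis using that[of "pull E A s \<delta>''"] bd d gd by simp
qed

text \<open>Vanishing of the pullback lets \<open>y\<close> lift to the middle term of \<epsilon>;
  over the identity of \<open>X\<close>, the dual of (ET3) then reads off \<open>a\<close> between
  the first terms.\<close>

lemma E_exact_3:
  assumes t: "triangle E A x B y X \<delta>" and e: "\<epsilon> \<in> \<E> X Z" "Z \<in> Ob E" "pull E Z y \<epsilon> = \<one>\<^bsub>Ext E B Z\<^esub>"
  obtains a where "a \<in> Arr E" "Dom E a = A" "Cod E a = Z" "\<epsilon> = push E X a \<delta>"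
proof -
  note d = triangleD[OF t]
  obtain M i p where m: "triangle E Z i M p X \<epsilon>" using triangle_exists e d by blast
  note md = triangleD[OF m]
  obtain b where b: "b \<in> Arr E" "Dom E b = B" "Cod E b = M" "p \<cdot> b = y"
    using lift_along_deflation[OF m, of y] d e by auto
  show thesis
    using ET3_op'[OF t m, of b "Id E X"] b d md that by auto
qed

lemma E_exact_4:
  assumes t: "triangle E A x B y X \<delta>" and e: "\<epsilon> \<in> \<E> Z A" "Z \<in> Ob E" "push E Z x \<epsilon> = \<one>\<^bsub>Ext E Z B\<^esub>"
  obtains c where "c \<in> Arr E" "Dom E c = Z" "Cod E c = X" "\<epsilon> = pull E A c \<delta>"
proof -
  note d = triangleD[OF t]
  obtain M i p where m: "triangle E A i M p Z \<epsilon>" using triangle_exists e d by blast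
  note md = triangleD[OF m]
  obtain b where b: "b \<in> Arr E" "Dom E b = M" "Cod E b = B" "b \<cdot> i = x"
    using extend_along_inflation[OF m, of x] d e by auto
  show thesis
    using ET3'[OF m t, of "Id E A" b] b d md that by auto
qed

lemma push_inv:
  "X \<in> Ob E \<Longrightarrow> A \<in> Ob E \<Longrightarrow> a \<in> Arr E \<Longrightarrow> Dom E a = A \<Longrightarrow> \<delta> \<in> \<E> X A \<Longrightarrow>
     push E X a (inv\<^bsub>Ext E X A\<^esub> \<delta>) = inv\<^bsub>Ext E X (Cod E a)\<^esub> push E X a \<delta>"
  using push_mult[of X a A \<delta> "inv\<^bsub>Ext E X A\<^esub> \<delta>"] group.r_inv[OF Ext_Group, of X A \<delta>]
  by (intro Ext_inv_unique) simp_all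

lemma pull_inv:
  "X \<in> Ob E \<Longrightarrow> A \<in> Ob E \<Longrightarrow> c \<in> Arr E \<Longrightarrow> Cod E c = X \<Longrightarrow> \<delta> \<in> \<E> X A \<Longrightarrow>
     pull E A c (inv\<^bsub>Ext E X A\<^esub> \<delta>) = inv\<^bsub>Ext E (Dom E c) A\<^esub> pull E A c \<delta>"
  using pull_mult[of A c X \<delta> "inv\<^bsub>Ext E X A\<^esub> \<delta>"] group.r_inv[OF Ext_Group, of X A \<delta>]
  by (intro Ext_inv_unique) simp_all

section \<open>Triangles with isomorphic ends\<close>

lemma iso_of_iso_Comps:
  assumes "is_iso E (g \<cdot> f)" "is_iso E (f \<cdot> g)" "f \<in> Arr E" "g \<in> Arr E" "Dom E g = Cod E f" "Cod E g = Dom E f"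
  shows "is_iso E f"
proof -
  let ?l = "inv_arr E (g \<cdot> f) \<cdot> g" and ?r = "g \<cdot> inv_arr E (f \<cdot> g)"
  have l: "?l \<cdot> f = Id E (Dom E f)" using assms inv_arr_simps(4)[OF assms(1)] by simp
  have "f \<cdot> ?r = (f \<cdot> g) \<cdot> inv_arr E (f \<cdot> g)" using assms by (intro Comp_assoc_simp[symmetric]) simp_all
  then have r: "f \<cdot> ?r = Id E (Cod E f)" using assms inv_arr_simps(5)[OF assms(2)] Comp_simps by metis
  have "?l \<in> Arr E" "Dom E ?l = Cod E f" "Cod E ?l = Dom E f" "?r \<in> Arr E" "Dom E ?r = Cod E f" "Cod E ?r = Dom E f"
    using assms by simp_all
  then have "?l = ?r" using assms(3) l r by (metis Comp_Id Comp_assoc_simp)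
  with \<open>?r \<in> Arr E\<close> \<open>Dom E ?r = Cod E f\<close> \<open>Cod E ?r = Dom E f\<close> show ?thesis
    using l r assms(3) by (intro is_isoI[of f ?r]) metis+
qed

text \<open>The difference to the identity squares to zero.\<close>

lemma triangle_endo_iso:
  assumes t: "triangle E A x B y X \<delta>" and f: "f \<in> Arr E" "Dom E f = B" "Cod E f = B" "f \<cdot> x = x" "y \<cdot> f = y"
  shows "is_iso E f"
proof -
  note d = triangleD[OF t]
  define n where "n = Id E B \<boxminus> f"
  have n: "n \<in> Arr E" "Dom E n = B" "Cod E n = B" using d f by (simp_all add: n_def)
  have "n \<cdot> x = hzero A B" "y \<cdot> n = hzero B X" using d f by (simp_all add: n_def)
  obtain m where m: "m \<in> Arr E" "Dom E m = X" "Cod E m = B" "m \<cdot> y = n"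
    using factor_through_cokernel[OF t n(1,2)] n(3) \<open>n \<cdot> x = hzero A B\<close> by auto
  have "n \<cdot> n = m \<cdot> (y \<cdot> n)" using Comp_reassoc[OF m(4), of n] m d n by simp
  also have "\<dots> = hzero B B" unfolding \<open>y \<cdot> n = hzero B X\<close> using m d by simp
  finally have nn: "n \<cdot> n = hzero B B" .
  have "n \<boxplus> f = Id E B" using d f by (simp add: n_def)
  then have fe: "f = Id E B \<boxminus> n" using hdiff_cancel(5)[of n f] n f d hadd_comm[of "hneg n" "Id E B"] by simp
  have "(Id E B \<boxplus> n) \<cdot> (Id E B \<boxminus> n) = Id E B" "(Id E B \<boxminus> n) \<cdot> (Id E B \<boxplus> n) = Id E B"
    using n d nn by (simp_all add: hadd_assoc)
  then show ?thesis unfolding fe using n d by (intro is_isoI[where g = "Id E B \<boxplus> n"]) simp_all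
qed

text \<open>The inverses of \<open>a\<close> and \<open>c\<close> again form a morphism of
  extensions. Realizing both directions, the composites are endomorphisms fixing the ends of a
  triangle, hence isomorphisms by \<open>triangle_endo_iso\<close>.\<close>

lemma triangle_middle_iso:
  assumes t: "triangle E A x B y X \<delta>" and t': "triangle E A' x' B' y' X' \<delta>'"
    and a: "is_iso E a" "Dom E a = A" "Cod E a = A'" and c: "is_iso E c" "Dom E c = X" "Cod E c = X'"
    and e: "push E X a \<delta> = pull E A' c \<delta>'"
  obtains b where "is_iso E b" "b \<in> Arr E" "Dom E b = B" "Cod E b = B'" "b \<cdot> x = x' \<cdot> a" "y' \<cdot> b = c \<cdot> y"
proof -
  note d = triangleD[OF t] triangleD[OF t'] and ac = iso_Arr[OF a(1)] iso_Arr[OF c(1)]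
  let ?a = "inv_arr E a" and ?c = "inv_arr E c"
  obtain b where b: "b \<in> Arr E" "Dom E b = B" "Cod E b = B'" "b \<cdot> x = x' \<cdot> a" "y' \<cdot> b = c \<cdot> y"
    using triangle_morphism[OF t t' ac(1) a(2,3) ac(2) c(2,3) e] .
  have "push E X' ?a \<delta>' = push E X' ?a (pull E A' (c \<cdot> ?c) \<delta>')" using a c d by simp
  also have "\<dots> = push E X' ?a (pull E A' ?c (push E X a \<delta>))"
    unfolding e using a c ac d by (subst pull_Comp) simp_all
  also have "\<dots> = pull E A ?c (push E X ?a (push E X a \<delta>))"
    using a c ac d push_pull[of ?c ?a X' A' "push E X a \<delta>"] by simp
  also have "push E X ?a (push E X a \<delta>) = push E X (?a \<cdot> a) \<delta>"
    using a c ac d by (intro push_Comp[symmetric]) simp_all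
  also have "\<dots> = \<delta>" using a c ac d by simp
  finally have e': "push E X' ?a \<delta>' = pull E A ?c \<delta>" .
  have ac': "?a \<in> Arr E" "Dom E ?a = A'" "Cod E ?a = A" "?c \<in> Arr E" "Dom E ?c = X'" "Cod E ?c = X"
    using a c by simp_all
  obtain b' where b': "b' \<in> Arr E" "Dom E b' = B'" "Cod E b' = B" "b' \<cdot> x' = x \<cdot> ?a" "y \<cdot> b' = ?c \<cdot> y'"
    using triangle_morphism[OF t' t ac' e'] .
  have "(b' \<cdot> b) \<cdot> x = x"
    using b b' d a ac Comp_reassoc[OF b'(4), of a] by simp
  moreover have "y \<cdot> (b' \<cdot> b) = y"
    using b b' d c ac Comp_reassoc[OF b'(5), of b] by simp
  ultimately have 1: "is_iso E (b' \<cdot> b)" using b b' by (intro triangle_endo_iso[OF t]) simp_all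
  have "(b \<cdot> b') \<cdot> x' = x'"
    using b b' d a ac Comp_reassoc[OF b(4), of ?a] by simp
  moreover have "y' \<cdot> (b \<cdot> b') = y'"
    using b b' d c ac Comp_reassoc[OF b(5), of b'] by simp
  ultimately have 2: "is_iso E (b \<cdot> b')" using b b' by (intro triangle_endo_iso[OF t']) simp_all
  have "is_iso E b" using iso_of_iso_Comps[OF 1 2] b b' by simp
  with b that show thesis by blast
qed

text \<open>The transported extension has some realization with an unknown middle term
  \<open>B1\<close>; \<open>triangle_middle_iso\<close> identifies \<open>B1\<close> with
  \<open>B\<close>, and \<open>triangle_iso\<close> moves the sequence over.\<close>

lemma triangle_cokernel_iso:
  assumes t: "triangle E A x B y X \<delta>" and i: "is_iso E i" "Dom E i = X" "Cod E i = X'"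
  shows "triangle E A x B (i \<cdot> y) X' (pull E A (inv_arr E i) \<delta>)"
proof -
  note d = triangleD[OF t] and ia = iso_Arr[OF i(1)]
  let ?\<epsilon> = "pull E A (inv_arr E i) \<delta>"
  have X': "X' \<in> Ob E" using ia i by auto
  have \<epsilon>: "?\<epsilon> \<in> \<E> X' A" using d i by simp
  obtain B1 x1 y1 where t1: "triangle E A x1 B1 y1 X' ?\<epsilon>" using triangle_exists[OF X' d(1) \<epsilon>] .
  note d1 = triangleD[OF t1]
  have "push E X (Id E A) \<delta> = pull E A (inv_arr E i \<cdot> i) \<delta>" using d i by simp
  also have "\<dots> = pull E A i ?\<epsilon>" using d i ia by (intro pull_Comp) simp_all
  finally obtain b where b: "is_iso E b" "b \<in> Arr E" "Dom E b = B1" "Cod E b = B" "b \<cdot> x1 = x" "(i \<cdot> y) \<cdot> b = y1"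
  proof -
    assume e: "push E X (Id E A) \<delta> = pull E A i ?\<epsilon>"
    have I: "is_iso E (Id E A)" "Dom E (Id E A) = A" "Cod E (Id E A) = A" using d by simp_all
    obtain b where b: "is_iso E b" "b \<in> Arr E" "Dom E b = B" "Cod E b = B1" "b \<cdot> x = x1 \<cdot> Id E A" "y1 \<cdot> b = i \<cdot> y"
      using triangle_middle_iso[OF t t1 I i e] .
    have "x1 \<cdot> Id E A = x1" using d1 by simp
    then have "inv_arr E b \<cdot> x1 = inv_arr E b \<cdot> (b \<cdot> x)" using b(5) by simp
    also have "\<dots> = x" by (rule inv_arr_cancel) (use b d in simp_all)
    finally have 1: "inv_arr E b \<cdot> x1 = x" .
    have 2: "(i \<cdot> y) \<cdot> inv_arr E b = y1" unfolding b(6)[symmetric] using b(1-4) d1 by simp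
    show thesis by (rule that[OF _ _ _ _ 1 2]) (use b in simp_all)
  qed
  have "y1 \<cdot> inv_arr E b = i \<cdot> y" unfolding b(6)[symmetric] using b(1-4) d i ia by simp
  then show ?thesis using triangle_iso[OF t1 b(1,3,4)] b(5) by simp
qed

lemma triangle_kernel_iso:
  assumes t: "triangle E A x B y X \<delta>" and i: "is_iso E i" "Dom E i = A" "Cod E i = A'"
  shows "triangle E A' (x \<cdot> inv_arr E i) B y X (push E X i \<delta>)"
proof -
  note d = triangleD[OF t] and ia = iso_Arr[OF i(1)]
  let ?\<epsilon> = "push E X i \<delta>"
  have A': "A' \<in> Ob E" using ia i by auto
  have \<epsilon>: "?\<epsilon> \<in> \<E> X A'" using d i ia by simp
  obtain B1 x1 y1 where t1: "triangle E A' x1 B1 y1 X ?\<epsilon>" using triangle_exists[OF d(3) A' \<epsilon>] .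
  note d1 = triangleD[OF t1]
  have e: "push E X i \<delta> = pull E A' (Id E X) ?\<epsilon>" using d A' \<epsilon> by simp
  have I: "is_iso E (Id E X)" "Dom E (Id E X) = X" "Cod E (Id E X) = X" using d by simp_all
  obtain b where b: "is_iso E b" "b \<in> Arr E" "Dom E b = B" "Cod E b = B1" "b \<cdot> x = x1 \<cdot> i" "y1 \<cdot> b = Id E X \<cdot> y"
    using triangle_middle_iso[OF t t1 i I e] .
  have "inv_arr E b \<cdot> (x1 \<cdot> i) = x" unfolding b(5)[symmetric] using b(1-4) d by simp
  then have "(inv_arr E b \<cdot> x1) \<cdot> i = x" using b(1-4) d1 i ia by simp
  moreover have "((inv_arr E b \<cdot> x1) \<cdot> i) \<cdot> inv_arr E i = inv_arr E b \<cdot> x1" using b(1-4) d1 i ia by simp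
  ultimately have 1: "inv_arr E b \<cdot> x1 = x \<cdot> inv_arr E i" by simp
  have "y1 \<cdot> inv_arr E (inv_arr E b) = y" using b(6) d inv_arr_inv_arr[OF b(1)] by simp
  then show ?thesis
    using triangle_iso[OF t1, of "inv_arr E b" B] b(1,3,4) unfolding 1 by simp
qed

text \<open>The splitting \<open>r\<close> of $G \cong A \oplus A'$ has to be corrected by a multiple of \<open>e\<close> before it pushes $\delta''$ to $\delta$.\<close>

lemma pullback_of_deflations:
  assumes t: "triangle E A x B y X \<delta>" and t': "triangle E A' x' B' y' X \<delta>'"
  obtains M k k' l l' \<epsilon> \<epsilon>' where "triangle E A k M l B' \<epsilon>" "triangle E A' k' M l' B \<epsilon>'"
    "y \<cdot> l' = y' \<cdot> l" "l' \<cdot> k = x" "l \<cdot> k' = x'"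
proof -
  note d = triangleD[OF t] triangleD[OF t']
  obtain M k l where m: "triangle E A k M l B' (pull E A y' \<delta>)"
    by (rule triangle_exists[of B' A "pull E A y' \<delta>"]) (use d in simp_all)
  note md = triangleD[OF m]
  obtain G h h' \<delta>'' f e where g: "triangle E G h' M h X \<delta>''" "h = y' \<cdot> l"
    "f \<in> Hom E A G" "e \<in> Hom E G A'" "h' \<cdot> f = k" "l \<cdot> h' = x' \<cdot> e"
    "triangle E A f G e A' (pull E A x' (pull E A y' \<delta>))" "\<delta>' = push E X e \<delta>''"
    "push E B' f (pull E A y' \<delta>) = pull E G y' \<delta>''"
    using ET4_op[OF m t'] by blast
  note gd = triangleD[OF g(1)] triangleD[OF g(7)]
  have "pull E A x' (pull E A y' \<delta>) = pull E A (y' \<cdot> x') \<delta>" using d by (simp add: pull_Comp)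
  also have "\<dots> = \<one>\<^bsub>Ext E A' A\<^esub>" unfolding triangle_Comp_zero[OF t'] using d by simp
  finally obtain s r where b: "biproduct E A A' G f s r e" using g(7) split_biproduct by metis
  note bd = biproductD[OF b] and be = biproduct_eqs[OF b]
  have "pull E A y' (push E X r \<delta>'') = push E B' r (pull E G y' \<delta>'')"
    using bd d gd by (simp add: push_pull)
  also have "\<dots> = push E B' (r \<cdot> f) (pull E A y' \<delta>)"
    unfolding g(9)[symmetric] using bd(1-12) d gd by (intro push_Comp[symmetric]) simp_all
  also have "\<dots> = pull E A y' \<delta>" using bd d gd by simp
  finally have p: "pull E A y' (push E X r \<delta>'') = pull E A y' \<delta>" .
  define \<eta> where "\<eta> = push E X r \<delta>'' \<otimes>\<^bsub>Ext E X A\<^esub> inv\<^bsub>Ext E X A\<^esub> \<delta>"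
  have \<eta>: "\<eta> \<in> \<E> X A" "pull E A y' \<eta> = \<one>\<^bsub>Ext E B' A\<^esub>"
    using bd(1-12) d gd p by (simp_all add: \<eta>_def pull_mult pull_inv Ext_diff_eq_one)
  obtain a where a: "a \<in> Arr E" "Dom E a = A'" "Cod E a = A" "\<eta> = push E X a \<delta>'"
    by (rule E_exact_3[OF t' \<eta>(1) _ \<eta>(2)]) (use d in simp)
  define r' where "r' = r \<boxminus> a \<cdot> e"
  have r': "r' \<in> Arr E" "Dom E r' = G" "Cod E r' = A" using bd(1-12) gd a by (simp_all add: r'_def)
  have r'f: "r' \<cdot> f = Id E A" using bd(1-14) be gd a d by (simp add: r'_def)
  have "push E X r' \<delta>'' = push E X r \<delta>'' \<otimes>\<^bsub>Ext E X A\<^esub> inv\<^bsub>Ext E X A\<^esub> \<eta>"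
    using bd(1-12) gd a d g(8) by (simp add: r'_def push_hadd push_hneg push_Comp)
  also have "\<dots> = \<delta>"
    using bd(1-12) gd d unfolding \<eta>_def by (simp add: Ext_diff_add)
  finally have pr': "push E X r' \<delta>'' = \<delta>" .
  have "e \<cdot> f = hzero A A'" using be by simp
  \<comment> \<open>As \<open>e \<cdot> s\<close> is the identity, the first arrow is
    \<open>s \<boxplus> f \<cdot> a\<close>. It is the complement on which the corrected
    \<open>r'\<close> vanishes, because \<open>r' \<cdot> s = hneg a\<close> and
    \<open>r' \<cdot> f\<close> is the identity.\<close>
  have f_tri: "triangle E A' (s \<boxplus> f \<cdot> (a \<cdot> (e \<cdot> s))) G r' A \<one>\<^bsub>Ext E A A'\<^esub>"
  proof (rule triangle_biproduct[where pA = e and iX = f])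
    have 1: "(s \<boxplus> f \<cdot> (a \<cdot> (e \<cdot> s))) = s \<boxplus> f \<cdot> a" using bd gd a by simp
    have 2: "r' \<cdot> s = hneg a" using bd(1-14) be gd a d by (simp add: r'_def)
    have "(s \<boxplus> f \<cdot> a) \<cdot> e \<boxplus> f \<cdot> r' = Id E G"
    proof -
      have "(s \<boxplus> f \<cdot> a) \<cdot> e \<boxplus> f \<cdot> r' = (s \<cdot> e \<boxplus> f \<cdot> (a \<cdot> e)) \<boxplus> (hneg (f \<cdot> (a \<cdot> e)) \<boxplus> f \<cdot> r)"
        using bd(1-12) gd a hadd_comm[of "f \<cdot> r" "hneg (f \<cdot> (a \<cdot> e))"] by (simp add: r'_def)
      also have "\<dots> = s \<cdot> e \<boxplus> f \<cdot> r"
        using bd(1-12) gd a by (simp add: hadd_assoc)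
      also have "\<dots> = Id E G" using bd(1-12) be(3) hadd_comm[of "s \<cdot> e" "f \<cdot> r"] by simp
      finally show ?thesis .
    qed
    moreover have "e \<cdot> (s \<boxplus> f \<cdot> a) = Id E A'"
      using bd(1-14) be gd a Comp_reassoc[OF \<open>e \<cdot> f = hzero A A'\<close>, of a] by simp
    moreover have "r' \<cdot> (s \<boxplus> f \<cdot> a) = hzero A' A"
      using bd(1-12) gd a r' r'f 2 Comp_reassoc[OF r'f, of a] by simp
    ultimately show "biproduct E A' A G (s \<boxplus> f \<cdot> (a \<cdot> (e \<cdot> s))) f e r'"
      unfolding 1 using bd(1-12) be gd a d r' r'f \<open>e \<cdot> f = hzero A A'\<close> by (intro biproductI) simp_all
  qed
  \<comment> \<open>(ET4) divides \<open>M\<close> by this copy of \<open>A'\<close>. The quotient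
    \<open>M'\<close> realizes \<open>push E X r' \<delta>''\<close>, that is \<delta>, so it is
    \<open>B\<close> up to isomorphism.\<close>
  obtain M' n n' \<delta>3 d' e' where n: "triangle E A' n M n' M' \<delta>3" "n = h' \<cdot> (s \<boxplus> f \<cdot> (a \<cdot> (e \<cdot> s)))"
    "d' \<in> Hom E A M'" "e' \<in> Hom E M' X" "d' \<cdot> r' = n' \<cdot> h'" "e' \<cdot> n' = h"
    "triangle E A d' M' e' X (push E X r' \<delta>'')"
    using ET4[OF f_tri g(1)] by blast
  note nd = triangleD[OF n(1)] triangleD[OF n(7)]
  obtain i where i: "is_iso E i" "i \<in> Arr E" "Dom E i = M'" "Cod E i = B" "i \<cdot> d' = x" "y \<cdot> i = e'"
    using triangle_unique[OF n(7)[unfolded pr'] t] .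
  have "l \<cdot> n = x'"
    using n(2) g(6) bd gd a md d Comp_reassoc[OF g(6), of "s \<boxplus> f \<cdot> (a \<cdot> (e \<cdot> s))"] be(1)
      Comp_reassoc[OF \<open>e \<cdot> f = hzero A A'\<close>, of a] by simp
  have "(i \<cdot> n') \<cdot> k = x"
  proof -
    have "n' \<cdot> (h' \<cdot> f) = d' \<cdot> (r' \<cdot> f)"
      using Comp_reassoc[OF n(5)[symmetric], of f] nd gd r' by simp
    then have "n' \<cdot> k = d'" using r'f g(5) nd by simp
    then show ?thesis using i nd md by simp
  qed
  have "y \<cdot> (i \<cdot> n') = y' \<cdot> l"
    using Comp_reassoc[OF i(6), of n'] i nd d n(6) g(2) by simp
  have "\<exists>\<epsilon>'. triangle E A' n M (i \<cdot> n') B \<epsilon>'"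
    by (rule exI, rule triangle_cokernel_iso[OF n(1) i(1,3,4)])
  then show thesis using that m \<open>y \<cdot> (i \<cdot> n') = y' \<cdot> l\<close> \<open>(i \<cdot> n') \<cdot> k = x\<close> \<open>l \<cdot> n = x'\<close> by blast
qed

text \<open>Dual to \<open>pullback_of_deflations\<close>: the section \<open>s\<close> is corrected
  by \<open>f \<cdot> c\<close> until it pulls \<delta>'' back to \<delta>'. The dual of (ET4),
  applied to the complementary projection \<open>r'\<close>, then yields a kernel \<open>K\<close>
  that realizes \<delta>' and is therefore \<open>B'\<close> up to isomorphism.\<close>

lemma pushout_of_inflations:
  assumes t: "triangle E A x B y X \<delta>" and t': "triangle E A x' B' y' X' \<delta>'"
  obtains M k k' l l' \<epsilon> \<epsilon>' where "triangle E B k M l X' \<epsilon>" "triangle E B' k' M l' X \<epsilon>'"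
    "k \<cdot> x = k' \<cdot> x'" "l' \<cdot> k = y" "l \<cdot> k' = y'"
proof -
  note d = triangleD[OF t] triangleD[OF t']
  obtain M k l where m: "triangle E B k M l X' (push E X' x \<delta>')"
    by (rule triangle_exists[of X' B "push E X' x \<delta>'"]) (use d in simp_all)
  note md = triangleD[OF m]
  obtain G h h' \<delta>'' f e where g: "triangle E A h M h' G \<delta>''" "h = k \<cdot> x"
    "f \<in> Hom E X G" "e \<in> Hom E G X'" "f \<cdot> y = h' \<cdot> k" "e \<cdot> h' = l"
    "triangle E X f G e X' (push E X' y (push E X' x \<delta>'))" "pull E A f \<delta>'' = \<delta>"
    "push E G x \<delta>'' = pull E B e (push E X' x \<delta>')"
    using ET4[OF t m] by blast
  note gd = triangleD[OF g(1)] triangleD[OF g(7)]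
  have "push E X' y (push E X' x \<delta>') = push E X' (y \<cdot> x) \<delta>'" using d by (simp add: push_Comp)
  also have "\<dots> = \<one>\<^bsub>Ext E X' X\<^esub>" unfolding triangle_Comp_zero[OF t] using d by simp
  finally obtain s r where b: "biproduct E X X' G f s r e" using g(7) split_biproduct by metis
  note bd = biproductD[OF b] and be = biproduct_eqs[OF b]
  have "push E X' x (pull E A s \<delta>'') = pull E B s (push E G x \<delta>'')"
    using bd d gd by (simp add: push_pull)
  also have "\<dots> = pull E B (e \<cdot> s) (push E X' x \<delta>')"
    unfolding g(9) using bd(1-12) d gd by (intro pull_Comp[symmetric]) simp_all
  also have "\<dots> = push E X' x \<delta>'" using bd d gd by simp
  finally have p: "push E X' x (pull E A s \<delta>'') = push E X' x \<delta>'" .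
  define \<eta> where "\<eta> = pull E A s \<delta>'' \<otimes>\<^bsub>Ext E X' A\<^esub> inv\<^bsub>Ext E X' A\<^esub> \<delta>'"
  have \<eta>: "\<eta> \<in> \<E> X' A" "push E X' x \<eta> = \<one>\<^bsub>Ext E X' B\<^esub>"
    using bd(1-12) d gd p by (simp_all add: \<eta>_def push_mult push_inv Ext_diff_eq_one)
  obtain c where c: "c \<in> Arr E" "Dom E c = X'" "Cod E c = X" "\<eta> = pull E A c \<delta>"
    by (rule E_exact_4[OF t \<eta>(1) _ \<eta>(2)]) (use d in simp)
  define s' where "s' = s \<boxminus> f \<cdot> c"
  have s': "s' \<in> Arr E" "Dom E s' = X'" "Cod E s' = G" using bd(1-12) gd c by (simp_all add: s'_def)
  have ef: "e \<cdot> f = hzero X X'" using be by simp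
  have es': "e \<cdot> s' = Id E X'"
    using bd(1-14) gd c d Comp_reassoc[OF ef, of c] by (simp add: s'_def)
  have "pull E A s' \<delta>'' = pull E A s \<delta>'' \<otimes>\<^bsub>Ext E X' A\<^esub> inv\<^bsub>Ext E X' A\<^esub> \<eta>"
    using bd(1-12) gd c d g(8) by (simp add: s'_def pull_hadd pull_hneg pull_Comp)
  also have "\<dots> = \<delta>'"
    using bd(1-12) gd d unfolding \<eta>_def by (simp add: Ext_diff_add)
  finally have ps': "pull E A s' \<delta>'' = \<delta>'" .
  define r' where "r' = r \<boxplus> c \<cdot> e"
  have r': "r' \<in> Arr E" "Dom E r' = G" "Cod E r' = X" using bd(1-12) gd c by (simp_all add: r'_def)
  have r'f: "r' \<cdot> f = Id E X" using bd(1-14) gd c ef d by (simp add: r'_def)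
  have "triangle E X' s' G r' X \<one>\<^bsub>Ext E X X'\<^esub>"
  proof (rule triangle_biproduct[where pA = e and iX = f])
    have "s' \<cdot> e \<boxplus> f \<cdot> r' = Id E G"
    proof -
      have "s' \<cdot> e \<boxplus> f \<cdot> r' = (s \<cdot> e \<boxminus> f \<cdot> (c \<cdot> e)) \<boxplus> (f \<cdot> (c \<cdot> e) \<boxplus> f \<cdot> r)"
        using bd(1-12) gd c hadd_comm[of "f \<cdot> r" "f \<cdot> (c \<cdot> e)"] by (simp add: r'_def s'_def)
      also have "\<dots> = s \<cdot> e \<boxplus> f \<cdot> r"
        using bd(1-12) gd c by (simp add: hadd_assoc)
      also have "\<dots> = Id E G" using bd(1-12) be(3) hadd_comm[of "s \<cdot> e" "f \<cdot> r"] by simp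
      finally show ?thesis .
    qed
    moreover have "r' \<cdot> s' = hzero X' X"
      using bd(1-14) be gd c d Comp_reassoc[OF r'f, of c] r' Comp_reassoc[OF ef, of c] by (simp add: s'_def) (simp add: r'_def)
    ultimately show "biproduct E X' X G s' f e r'"
      using bd(1-12) ef es' gd c d r' s' r'f by (intro biproductI) simp_all
  qed
  then obtain K n n' \<delta>3 d' e' where n: "triangle E K n M n' X \<delta>3" "n' = r' \<cdot> h'"
    "d' \<in> Hom E A K" "e' \<in> Hom E K X'" "n \<cdot> d' = h" "h' \<cdot> n = s' \<cdot> e'"
    "triangle E A d' K e' X' (pull E A s' \<delta>'')"
    using ET4_op[OF g(1)] by blast
  note nd = triangleD[OF n(1)] triangleD[OF n(7)]
  obtain i where i: "is_iso E i" "i \<in> Arr E" "Dom E i = B'" "Cod E i = K" "i \<cdot> x' = d'" "e' \<cdot> i = y'"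
    using triangle_unique[OF t' n(7)[unfolded ps']] .
  have "l \<cdot> n = e'"
    using Comp_reassoc[OF g(6), of n] n(6) gd nd md s' es' Comp_reassoc[OF es', of e'] by simp
  then have 1: "l \<cdot> (n \<cdot> i) = y'"
    using i nd md Comp_reassoc[of l n e' i] by simp
  have 2: "(n \<cdot> i) \<cdot> x' = k \<cdot> x" using i nd d n(5) g(2) by simp
  have 3: "n' \<cdot> k = y"
    using n(2) g(5) r' r'f gd md d Comp_reassoc[OF r'f, of y] by simp
  have 4: "triangle E B' (n \<cdot> i) M n' X (push E X (inv_arr E i) \<delta>3)"
  proof -
    have j: "is_iso E (inv_arr E i)" "Dom E (inv_arr E i) = K" "Cod E (inv_arr E i) = B'" using i by simp_all
    show ?thesis using triangle_kernel_iso[OF n(1) j] i inv_arr_inv_arr[OF i(1)] by simp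
  qed
  show thesis by (rule that[OF m 4 2[symmetric] 3 1])
qed

section \<open>Sums with trivial triangles; homotopy pullbacks and weak pullbacks\<close>

lemma Ext_zero_right:
  assumes "zero_object E Z" "\<eta> \<in> \<E> W Z" "W \<in> Ob E"
  shows "\<eta> = \<one>\<^bsub>Ext E W Z\<^esub>"
proof -
  have Z: "Z \<in> Ob E" using assms(1) by (simp add: zero_object_def)
  have "\<eta> = push E W (Id E Z) \<eta>" using assms Z by simp
  also have "Id E Z = hzero Z Z" using hzero_to[OF assms(1), of "Id E Z"] Z by simp
  also have "push E W (hzero Z Z) \<eta> = \<one>\<^bsub>Ext E W Z\<^esub>" using assms Z by simp
  finally show ?thesis .
qed

lemma Ext_zero_left:
  assumes "zero_object E Z" "\<eta> \<in> \<E> Z W" "W \<in> Ob E"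
  shows "\<eta> = \<one>\<^bsub>Ext E Z W\<^esub>"
proof -
  have Z: "Z \<in> Ob E" using assms(1) by (simp add: zero_object_def)
  have "\<eta> = pull E W (Id E Z) \<eta>" using assms Z by simp
  also have "Id E Z = hzero Z Z" using hzero_to[OF assms(1), of "Id E Z"] Z by simp
  also have "pull E W (hzero Z Z) \<eta> = \<one>\<^bsub>Ext E Z W\<^esub>" using assms Z by simp
  finally show ?thesis .
qed

lemma realization_dsum:
  assumes "triangle E A x B y X \<delta>" "triangle E A' x' B' y' X' \<delta>'"
    "biproduct E A A' AA iA iA' pA pA'" "biproduct E B B' BB iB iB' pB pB'" "biproduct E X X' XX iX iX' pX pX'"
    "\<epsilon> \<in> \<E> XX AA" "ExtMap E iX pA \<epsilon> = \<delta>" "ExtMap E iX pA' \<epsilon> = \<one>\<^bsub>Ext E X A'\<^esub>"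
    "ExtMap E iX' pA \<epsilon> = \<one>\<^bsub>Ext E X' A\<^esub>" "ExtMap E iX' pA' \<epsilon> = \<delta>'"
    "is_dsum_arr E AA pA pA' BB pB pB' x x' xx" "is_dsum_arr E BB pB pB' XX pX pX' y y' yy"
  shows "Real E XX AA \<epsilon> = seq_class E AA XX xx yy"
  by (rule ET2[unfolded additive_realization_def, THEN conjunct2, THEN conjunct2, rule_format], intro conjI, (fact assms)+)

text \<open>Sum with the trivial triangle Z -> Q -> Q. The biproduct of \<open>Z\<close> and
  \<open>A\<close> is taken to be \<open>A\<close> itself, so the first term does not
  change.\<close>

lemma triangle_plus_left:
  assumes t: "triangle E A x B y X \<delta>" and b: "biproduct E Q B P iQ iB pQ pB"
    and b': "biproduct E Q X P' iQ' iX' pQ' pX'"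
  shows "triangle E A (iB \<cdot> x) P (iQ' \<cdot> pQ \<boxplus> iX' \<cdot> (y \<cdot> pB)) P' (pull E A pX' \<delta>)"
proof -
  obtain Z where Z: "zero_object E Z" "Z \<in> Ob E" by (rule zero_object_E)
  note d = triangleD[OF t] and bd = biproductD[OF b] biproductD[OF b'] and bO = biproduct_Ob[OF b] biproduct_Ob[OF b']
  note be = biproduct_eqs[OF b] biproduct_eqs[OF b']
  have bA: "biproduct E Z A A (hzero Z A) (Id E A) (hzero A Z) (Id E A)"
    by (rule biproduct_swap[OF biproduct_zero_right[OF Z(1) d(1)]])
  let ?\<epsilon> = "pull E A pX' \<delta>" and ?y = "iQ' \<cdot> pQ \<boxplus> iX' \<cdot> (y \<cdot> pB)"
  have \<epsilon>: "?\<epsilon> \<in> \<E> P' A" using d bd by simp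
  have e1: "ExtMap E iQ' (hzero A Z) ?\<epsilon> = \<one>\<^bsub>Ext E Q Z\<^esub>"
  proof (rule Ext_zero_right[OF Z(1)])
    show "ExtMap E iQ' (hzero A Z) ?\<epsilon> \<in> \<E> Q Z"
      using bd bO d Z by (simp add: ExtMap_pull_push)
  qed (use bO in simp)
  have e2: "ExtMap E iQ' (Id E A) ?\<epsilon> = \<one>\<^bsub>Ext E Q A\<^esub>"
  proof -
    have "ExtMap E iQ' (Id E A) ?\<epsilon> = pull E A (pX' \<cdot> iQ') \<delta>"
      using bd(1-12) bd(17-28) bO d by (simp add: ExtMap_pull_push pull_Comp)
    then show ?thesis using be bO d by simp
  qed
  have e3: "ExtMap E iX' (hzero A Z) ?\<epsilon> = \<one>\<^bsub>Ext E X Z\<^esub>"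
  proof (rule Ext_zero_right[OF Z(1)])
    show "ExtMap E iX' (hzero A Z) ?\<epsilon> \<in> \<E> X Z"
      using bd bO d Z by (simp add: ExtMap_pull_push)
  qed (use bO in simp)
  have e4: "ExtMap E iX' (Id E A) ?\<epsilon> = \<delta>"
  proof -
    have "ExtMap E iX' (Id E A) ?\<epsilon> = pull E A (pX' \<cdot> iX') \<delta>"
      using bd(17-28) bO d by (simp add: ExtMap_pull_push pull_Comp)
    then show ?thesis using bd bO d by simp
  qed
  have i: "is_dsum_arr E A (hzero A Z) (Id E A) P pQ pB (hzero Z Q) x (iB \<cdot> x)"
    using bd bO d Z be Comp_reassoc[of pB iB "Id E B" x] Comp_reassoc[of pQ iB "hzero B Q" x]
    by (simp add: is_dsum_arr_def)
  have p: "is_dsum_arr E P pQ pB P' pQ' pX' (Id E Q) y ?y"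
    using bd bO d Z be Comp_reassoc[of pQ' iQ' "Id E Q" pQ] Comp_reassoc[of pX' iQ' "hzero Q X" pQ]
      Comp_reassoc[of pQ' iX' "hzero X Q" "y \<cdot> pB"] Comp_reassoc[of pX' iX' "Id E X" "y \<cdot> pB"]
    by (simp add: is_dsum_arr_def)
  have "Real E P' A ?\<epsilon> = seq_class E A P' (iB \<cdot> x) ?y"
    by (rule realization_dsum[OF triangle_left_zero[OF Z(1) bO(1)] t bA b b' \<epsilon> e1 e2 e3 e4 i p])
  then show ?thesis
    using bd bO d \<epsilon> by (simp add: triangle_def)
qed

text \<open>Sum with the trivial triangle Q -> Q -> Z, where now the biproduct of \<open>Z\<close>
  and \<open>X\<close> is \<open>X\<close> itself.\<close>

lemma triangle_plus_middle_left:
  assumes t: "triangle E A x B y X \<delta>" and b: "biproduct E Q A P iQ iA pQ pA"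
    and b': "biproduct E Q B P' iQ' iB' pQ' pB'"
  shows "triangle E P (iQ' \<cdot> pQ \<boxplus> iB' \<cdot> (x \<cdot> pA)) P' (y \<cdot> pB') X (push E X iA \<delta>)"
proof -
  obtain Z where Z: "zero_object E Z" "Z \<in> Ob E" by (rule zero_object_E)
  note d = triangleD[OF t] and bd = biproductD[OF b] biproductD[OF b'] and bO = biproduct_Ob[OF b] biproduct_Ob[OF b']
  note be = biproduct_eqs[OF b] biproduct_eqs[OF b']
  have bX: "biproduct E Z X X (hzero Z X) (Id E X) (hzero X Z) (Id E X)"
    by (rule biproduct_swap[OF biproduct_zero_right[OF Z(1) d(3)]])
  let ?\<epsilon> = "push E X iA \<delta>" and ?x = "iQ' \<cdot> pQ \<boxplus> iB' \<cdot> (x \<cdot> pA)"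
  have \<epsilon>: "?\<epsilon> \<in> \<E> X P" using d bd by simp
  have e1: "ExtMap E (hzero Z X) pQ ?\<epsilon> = \<one>\<^bsub>Ext E Z Q\<^esub>"
  proof (rule Ext_zero_left[OF Z(1)])
    show "ExtMap E (hzero Z X) pQ ?\<epsilon> \<in> \<E> Z Q"
      using bd bO d Z by (simp add: ExtMap_push_pull)
  qed (use bO in simp)
  have e2: "ExtMap E (Id E X) pQ ?\<epsilon> = \<one>\<^bsub>Ext E X Q\<^esub>"
  proof -
    have "ExtMap E (Id E X) pQ ?\<epsilon> = push E X (pQ \<cdot> iA) \<delta>"
      using bd(1-12) bO d by (simp add: push_def[of E X pQ, symmetric] push_Comp)
    then show ?thesis using be bO d by simp
  qed
  have e3: "ExtMap E (hzero Z X) pA ?\<epsilon> = \<one>\<^bsub>Ext E Z A\<^esub>"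
  proof (rule Ext_zero_left[OF Z(1)])
    show "ExtMap E (hzero Z X) pA ?\<epsilon> \<in> \<E> Z A"
      using bd bO d Z by (simp add: ExtMap_push_pull)
  qed (use bO in simp)
  have e4: "ExtMap E (Id E X) pA ?\<epsilon> = \<delta>"
  proof -
    have "ExtMap E (Id E X) pA ?\<epsilon> = push E X (pA \<cdot> iA) \<delta>"
      using bd(1-12) bO d by (simp add: push_def[of E X pA, symmetric] push_Comp)
    then show ?thesis using bd bO d by simp
  qed
  have i: "is_dsum_arr E P pQ pA P' pQ' pB' (Id E Q) x ?x"
    using bd bO d Z be Comp_reassoc[of pQ' iQ' "Id E Q" pQ] Comp_reassoc[of pB' iQ' "hzero Q B" pQ]
      Comp_reassoc[of pQ' iB' "hzero B Q" "x \<cdot> pA"] Comp_reassoc[of pB' iB' "Id E B" "x \<cdot> pA"]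
    by (simp add: is_dsum_arr_def)
  have p: "is_dsum_arr E P' pQ' pB' X (hzero X Z) (Id E X) (hzero Q Z) y (y \<cdot> pB')"
    using bd bO d Z be by (simp add: is_dsum_arr_def)
  have "Real E X P ?\<epsilon> = seq_class E P X ?x (y \<cdot> pB')"
    by (rule realization_dsum[OF triangle_right_zero[OF Z(1) bO(1)] t b b' bX \<epsilon> e1 e3 e2 e4 i p])
  then show ?thesis
    using bd bO d \<epsilon> by (simp add: triangle_def)
qed

text \<open>A shear of the biproduct; it exhibits \<open>e \<cdot> pQ \<boxplus> pD\<close> as a
  split deflation with kernel \<open>Q\<close>.\<close>

lemma biproduct_shear:
  assumes b: "biproduct E Q D P iQ iD pQ pD" and e: "e \<in> Arr E" "Dom E e = Q" "Cod E e = D"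
  shows "biproduct E Q D P (iQ \<boxminus> iD \<cdot> e) iD pQ (e \<cdot> pQ \<boxplus> pD)"
proof -
  note bd = biproductD[OF b] and be = biproduct_eqs[OF b] and bO = biproduct_Ob[OF b]
  have "(iQ \<boxminus> iD \<cdot> e) \<cdot> pQ \<boxplus> iD \<cdot> (e \<cdot> pQ \<boxplus> pD) = iQ \<cdot> pQ \<boxplus> iD \<cdot> pD"
    using bd(1-12) e by (simp add: hadd_assoc)
  also have "\<dots> = Id E P" by (rule be)
  finally have s: "(iQ \<boxminus> iD \<cdot> e) \<cdot> pQ \<boxplus> iD \<cdot> (e \<cdot> pQ \<boxplus> pD) = Id E P" .
  have "pQ \<cdot> (iQ \<boxminus> iD \<cdot> e) = Id E Q" "pD \<cdot> (iQ \<boxminus> iD \<cdot> e) = hneg e"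
    using bd(1-14) be bO e Comp_reassoc[of pQ iD "hzero D Q" e] Comp_reassoc[of pD iD "Id E D" e] by simp_all
  moreover have "(e \<cdot> pQ \<boxplus> pD) \<cdot> h = e \<cdot> (pQ \<cdot> h) \<boxplus> pD \<cdot> h" if "h \<in> Arr E" "Cod E h = P" for h
    using bd(1-12) e that by simp
  from this[of "iQ \<boxminus> iD \<cdot> e"] have "(e \<cdot> pQ \<boxplus> pD) \<cdot> (iQ \<boxminus> iD \<cdot> e) =
      e \<cdot> (pQ \<cdot> (iQ \<boxminus> iD \<cdot> e)) \<boxplus> pD \<cdot> (iQ \<boxminus> iD \<cdot> e)"
    using bd(1-12) e by simp
  ultimately have "(e \<cdot> pQ \<boxplus> pD) \<cdot> (iQ \<boxminus> iD \<cdot> e) = hzero Q D" using e by simp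
  then show ?thesis
    using bd(1-14) be bO e s \<open>pQ \<cdot> (iQ \<boxminus> iD \<cdot> e) = Id E Q\<close> by (intro biproductI) simp_all
qed

text \<open>The arrow with components \<open>e\<close> and \<open>y\<close> is the sum of the
  identity of \<open>Q\<close> with \<open>y\<close>, followed by a sheared projection. Both are
  deflations, and the dual of (ET4) describes the kernel \<open>G\<close> of the composite.\<close>

lemma homotopy_pullback:
  assumes t: "triangle E A x B y D \<delta>" and e: "e \<in> Arr E" "Dom E e = Q" "Cod E e = D"
    and b: "biproduct E Q B P iQ iB pQ pB"
  obtains G a g k \<delta>' \<kappa> where "triangle E A a G g Q \<delta>'" "triangle E G k P (e \<cdot> pQ \<boxplus> y \<cdot> pB) D \<kappa>"
proof -
  note d = triangleD[OF t] and bd = biproductD[OF b] and bO = biproduct_Ob[OF b] and be = biproduct_eqs[OF b]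
  obtain P' iQ' iD' pQ' pD' where b': "biproduct E Q D P' iQ' iD' pQ' pD'"
    using biproduct_ex[OF bO(1) d(3)] by blast
  note bd' = biproductD[OF b'] and bO' = biproduct_Ob[OF b'] and be' = biproduct_eqs[OF b']
  let ?y = "iQ' \<cdot> pQ \<boxplus> iD' \<cdot> (y \<cdot> pB)"
  have t1: "triangle E Q (iQ' \<boxminus> iD' \<cdot> e) P' (e \<cdot> pQ' \<boxplus> pD') D \<one>\<^bsub>Ext E D Q\<^esub>"
    by (rule triangle_biproduct[OF biproduct_shear[OF b' e]])
  obtain G h h' \<delta>'' d' e' where g: "triangle E G h' P h D \<delta>''" "h = (e \<cdot> pQ' \<boxplus> pD') \<cdot> ?y"
    "triangle E A d' G e' Q (pull E A (iQ' \<boxminus> iD' \<cdot> e) (pull E A pD' \<delta>))"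
    using ET4_op[OF triangle_plus_left[OF t b b'] t1] by blast
  have "h = e \<cdot> pQ \<boxplus> y \<cdot> pB"
    unfolding g(2) using d bd(1-12) bd'(1-12) bO bO' e
      Comp_reassoc[OF bd'(13), of pQ] Comp_reassoc[OF be'(1), of pQ]
      Comp_reassoc[OF bd'(14), of "y \<cdot> pB"] Comp_reassoc[OF be'(2), of "y \<cdot> pB"] by simp
  then show thesis using that g(1,3) by blast
qed

text \<open>The extension \<open>\<sigma>\<close> of \<open>j\<close> need not lift along \<open>y\<close>, but it becomes trivial over \<open>S0\<close>.\<close>

lemma deflation_along_inflation:
  assumes t: "triangle E A x B y D \<delta>" and j: "triangle E D j D' p S \<sigma>"
    and q: "triangle E T0 t0 S0 q D' \<theta>" and b: "biproduct E S0 B P iS iB pS pB"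
  obtains K k k' a g Q0 c c' \<delta>' \<phi> \<kappa> \<epsilon> where "triangle E A a K g Q0 \<delta>'" "triangle E Q0 c S0 c' S \<epsilon>"
    "triangle E K k P \<phi> D' \<kappa>" "\<phi> \<cdot> iB = j \<cdot> y"
proof -
  note d = triangleD[OF t] triangleD[OF j] triangleD[OF q] and bd = biproductD[OF b] and bO = biproduct_Ob[OF b]
  \<comment> \<open>\<open>Q0\<close> is the kernel of the composite S0 -> D' -> S. This presents
    \<sigma> as the pushforward along \<open>e0\<close> of an extension whose middle term is
    \<open>S0\<close>.\<close>
  obtain Q0 c c' \<epsilon>0 e0 where g: "triangle E Q0 c S0 c' S \<epsilon>0" "e0 \<in> Hom E Q0 D"  "\<sigma> = push E S e0 \<epsilon>0"
    using ET4_op[OF q j] by blast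
  note gd = triangleD[OF g(1)] and e0 = g(2)[unfolded Hom_iff]
  obtain P1 iQ iB1 pQ pB1 where b1: "biproduct E Q0 B P1 iQ iB1 pQ pB1"
    using biproduct_ex[OF gd(1) d(2)] by blast
  note bd1 = biproductD[OF b1] and bO1 = biproduct_Ob[OF b1] and be1 = biproduct_eqs[OF b1]
  obtain K a g' k \<delta>' \<kappa> where k: "triangle E A a K g' Q0 \<delta>'" "triangle E K k P1 (e0 \<cdot> pQ \<boxplus> y \<cdot> pB1) D \<kappa>"
    using homotopy_pullback[OF t conjunct1[OF e0] conjunct1[OF conjunct2[OF e0]] conjunct2[OF conjunct2[OF e0]] b1] .
  define \<psi> where "\<psi> = e0 \<cdot> pQ \<boxplus> y \<cdot> pB1"
  define i1 where "i1 = iB \<cdot> pB1 \<boxplus> iS \<cdot> (c \<cdot> pQ)"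
  have m: "triangle E P1 i1 P (c' \<cdot> pS) S (push E S iQ \<epsilon>0)"
    unfolding i1_def by (rule triangle_plus_middle_left[OF g(1) biproduct_swap[OF b1] biproduct_swap[OF b]])
  note k = k(1) k(2)[folded \<psi>_def]
  \<comment> \<open>(ET4) for K -> P1 -> D and P1 -> P -> S. The cokernel \<open>G\<close> of K -> P
    realizes the pushforward of \<epsilon>0 along \<open>\<psi> \<cdot> iQ = e0\<close>, which is
    \<sigma>; hence \<open>G\<close> is \<open>D'\<close> up to isomorphism.\<close>
  obtain G h h' \<delta>'' d' e' where n: "triangle E K h P h' G \<delta>''" "d' \<in> Hom E D G" "e' \<in> Hom E G S"
    "d' \<cdot> \<psi> = h' \<cdot> i1" "triangle E D d' G e' S (push E S \<psi> (push E S iQ \<epsilon>0))"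
    using ET4[OF k(2) m] by metis
  note nd = triangleD[OF n(1)] triangleD[OF n(5)] triangleD[OF k(2)] triangleD[OF m]
  have fi: "\<psi> \<cdot> iQ = e0" "\<psi> \<cdot> iB1 = y"
    using bd1(1-14) be1 bO1 d(1-10) e0 by (simp_all add: \<psi>_def)
  have "push E S \<psi> (push E S iQ \<epsilon>0) = push E S (\<psi> \<cdot> iQ) \<epsilon>0"
    using bd1(1-12) nd gd by (intro push_Comp[symmetric]) simp_all
  also have "\<dots> = \<sigma>" using fi g(3) by simp
  finally have s: "push E S \<psi> (push E S iQ \<epsilon>0) = \<sigma>" .
  obtain i where i: "is_iso E i" "i \<in> Arr E" "Dom E i = G" "Cod E i = D'" "i \<cdot> d' = j" "p \<cdot> i = e'"
    using triangle_unique[OF n(5)[unfolded s] j] .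
  have ii: "i1 \<cdot> iB1 = iB" using bd1(1-14) be1 bd(1-12) gd bO1 by (simp add: i1_def)
  have "(h' \<cdot> i1) \<cdot> iB1 = h' \<cdot> iB"
    using Comp_assoc_simp[of iB1 i1 h'] bd1(1-12) nd ii by simp
  moreover have "(d' \<cdot> \<psi>) \<cdot> iB1 = d' \<cdot> y"
    using Comp_assoc_simp[of iB1 \<psi> d'] bd1(1-12) nd fi(2) by simp
  ultimately have hB: "h' \<cdot> iB = d' \<cdot> y" unfolding n(4) by simp
  have "(i \<cdot> h') \<cdot> iB = i \<cdot> (h' \<cdot> iB)" by (rule Comp_assoc_simp) (use i nd bd(1-12) in simp_all)
  also have "\<dots> = j \<cdot> y" unfolding hB by (rule Comp_reassoc[OF i(5)]) (use i nd d in simp_all)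
  finally have "(i \<cdot> h') \<cdot> iB = j \<cdot> y" .
  then show thesis using that[OF k(1) g(1) triangle_cokernel_iso[OF n(1) i(1,3,4)]] by blast
qed

text \<open>The inflation \<open>j\<close> need not be a monomorphism, so a lift of \<open>s\<close> to the kernel \<open>P\<close> gives \<open>f\<close> only
  up to an arrow killed by \<open>j\<close>, which lifts along the deflation $P \to Z$ as well.\<close>

lemma weak_pullback:
  assumes q: "triangle E T0 t0 S0 q T \<theta>" and j: "triangle E Z j T p S \<sigma>"
    and s: "s \<in> Arr E" "Cod E s = S0" and f: "f \<in> Arr E" "Cod E f = Z" "Dom E f = Dom E s" "j \<cdot> f = q \<cdot> s"
  obtains P c c' \<epsilon> e z where "triangle E P c S0 c' S \<epsilon>" "e \<in> Arr E" "Dom E e = P" "Cod E e = Z"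
    "z \<in> Arr E" "Dom E z = Dom E s" "Cod E z = P" "e \<cdot> z = f"
proof -
  note d = triangleD[OF q] triangleD[OF j]
  obtain P c c' \<epsilon> t e where g: "triangle E P c S0 c' S \<epsilon>" "c' = p \<cdot> q" "t \<in> Hom E T0 P" "e \<in> Hom E P Z"
    "c \<cdot> t = t0" "q \<cdot> c = j \<cdot> e" "triangle E T0 t P e Z (pull E T0 j \<theta>)"
    using ET4_op[OF q j] by metis
  note gd = triangleD[OF g(1)] triangleD[OF g(7)]
  let ?X = "Dom E s"
  have X: "?X \<in> Ob E" using s by simp
  have "c' \<cdot> s = p \<cdot> (q \<cdot> s)" using g(2) d s by simp
  also have "\<dots> = hzero ?X S" unfolding f(4)[symmetric] using triangle_Comp_zero'[OF j f(1,2)] f(3) by simp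
  finally have cs: "c' \<cdot> s = hzero ?X S" .
  obtain y where y: "y \<in> Arr E" "Dom E y = ?X" "Cod E y = P" "c \<cdot> y = s"
    using factor_through_kernel[OF g(1) s cs] .
  define h where "h = f \<boxminus> e \<cdot> y"
  have h: "h \<in> Arr E" "Dom E h = ?X" "Cod E h = Z" using f y gd by (simp_all add: h_def)
  have "j \<cdot> (e \<cdot> y) = q \<cdot> s"
    using Comp_reassoc[OF g(6), of y] y gd d by simp
  then have jh: "j \<cdot> h = hzero ?X T"
    using f(1-4) y(1-3) gd d s by (simp add: h_def)
  have "pull E T0 h (pull E T0 j \<theta>) = pull E T0 (j \<cdot> h) \<theta>" using h d by (intro pull_Comp[symmetric]) simp_all
  then have "pull E T0 h (pull E T0 j \<theta>) = \<one>\<^bsub>Ext E (Dom E h) T0\<^esub>" unfolding jh using h d X by simp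
  then obtain z where z: "z \<in> Arr E" "Dom E z = ?X" "Cod E z = P" "e \<cdot> z = h"
    using lift_along_deflation[OF g(7) h(1,3)] h(2) by metis
  have "e \<cdot> (z \<boxplus> y) = h \<boxplus> e \<cdot> y" using z y gd by simp
  also have "\<dots> = f" using f y gd by (simp add: h_def)
  finally have "e \<cdot> (z \<boxplus> y) = f" .
  then show thesis using that[OF g(1), of e "z \<boxplus> y"] z y gd by simp
qed

end

section \<open>Cotorsion pairs\<close>

context extriangulated_category
begin

lemma ET4':
  assumes "triangle E A f B f' D \<delta>" "triangle E B g C g' F \<delta>'"
  obtains G h' \<delta>'' d e where "triangle E A (g \<cdot> f) C h' G \<delta>''" "triangle E D d G e F (push E F f' \<delta>')"
    "d \<cdot> f' = h' \<cdot> g" "e \<cdot> h' = g'" "pull E A d \<delta>'' = \<delta>" "push E G f \<delta>'' = pull E B e \<delta>'"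
  using ET4[OF assms] by metis

lemma ET4_op':
  assumes "triangle E D f' A f B \<delta>" "triangle E F g' B g C \<delta>'"
  obtains G h' \<delta>'' d e where "triangle E G h' A (g \<cdot> f) C \<delta>''" "triangle E D d G e F (pull E D g' \<delta>)"
    "h' \<cdot> d = f'" "f \<cdot> h' = g' \<cdot> e"
  using ET4_op[OF assms] by metis

lemma conflation_iff: "conflation E A x B y X \<longleftrightarrow> (\<exists>\<delta>. triangle E A x B y X \<delta>)"
  by (simp add: conflation_def)

lemma CPD:
  assumes "(\<X>, \<Y>) \<in> CP E"
  shows "additive_subcat E \<X>" "iso_closed E \<X>" "summand_closed E \<X>"
    "additive_subcat E \<Y>" "iso_closed E \<Y>" "summand_closed E \<Y>" "Ext_vanish E \<X> \<Y>"
  using assms by (auto simp: CP_def)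

lemma CP_left_approx:
  assumes "(\<X>, \<Y>) \<in> CP E" "C \<in> Ob E"
  obtains Y X x y \<delta> where "Y \<in> \<Y>" "X \<in> \<X>" "triangle E Y x X y C \<delta>"
  using assms unfolding CP_def conflation_iff by blast

lemma CP_right_approx:
  assumes "(\<X>, \<Y>) \<in> CP E" "C \<in> Ob E"
  obtains Y X x y \<delta> where "Y \<in> \<Y>" "X \<in> \<X>" "triangle E C x Y y X \<delta>"
  using assms unfolding CP_def conflation_iff by blast

lemma CP_Ob:
  assumes "(\<X>, \<Y>) \<in> CP E"
  shows "X \<in> \<X> \<Longrightarrow> X \<in> Ob E" "Y \<in> \<Y> \<Longrightarrow> Y \<in> Ob E"
  using CPD[OF assms] by (auto simp: additive_subcat_def)

lemma CP_vanish:
  assumes "(\<X>, \<Y>) \<in> CP E" "X \<in> \<X>" "Y \<in> \<Y>" "\<delta> \<in> \<E> X Y"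
  shows "\<delta> = \<one>\<^bsub>Ext E X Y\<^esub>"
  using CPD(7)[OF assms(1)] assms(2-) by (auto simp: Ext_vanish_def)

lemma summand_of_split:
  assumes "summand_closed E \<X>" "triangle E A x B y X \<one>\<^bsub>Ext E X A\<^esub>" "B \<in> \<X>"
  shows "A \<in> \<X>" "X \<in> \<X>"
proof -
  obtain s r where "biproduct E A X B x s r y" using split_biproduct[OF assms(2)] .
  then show "A \<in> \<X>" "X \<in> \<X>"
    using assms triangleD[OF assms(2)] unfolding summand_closed_def by blast+
qed

text \<open>Orthogonality splits the approximating conflation, so \<open>X\<close> is a direct
  summand of its middle term.\<close>

lemma CP_leftI:
  assumes cp: "(\<X>, \<Y>) \<in> CP E" and X: "X \<in> Ob E" "\<And>Y \<delta>. Y \<in> \<Y> \<Longrightarrow> \<delta> \<in> \<E> X Y \<Longrightarrow> \<delta> = \<one>\<^bsub>Ext E X Y\<^esub>"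
  shows "X \<in> \<X>"
proof -
  obtain Y X' x y \<delta> where t: "Y \<in> \<Y>" "X' \<in> \<X>" "triangle E Y x X' y X \<delta>" using CP_left_approx[OF cp X(1)] .
  have "\<delta> = \<one>\<^bsub>Ext E X Y\<^esub>" using X(2)[OF t(1)] triangleD[OF t(3)] by blast
  then show ?thesis using summand_of_split(2)[OF CPD(3)[OF cp]] t by blast
qed

lemma CP_rightI:
  assumes cp: "(\<X>, \<Y>) \<in> CP E" and Y: "Y \<in> Ob E" "\<And>X \<delta>. X \<in> \<X> \<Longrightarrow> \<delta> \<in> \<E> X Y \<Longrightarrow> \<delta> = \<one>\<^bsub>Ext E X Y\<^esub>"
  shows "Y \<in> \<Y>"
proof -
  obtain Y' X x y \<delta> where t: "Y' \<in> \<Y>" "X \<in> \<X>" "triangle E Y x Y' y X \<delta>" using CP_right_approx[OF cp Y(1)] .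
  have "\<delta> = \<one>\<^bsub>Ext E X Y\<^esub>" using Y(2)[OF t(2)] triangleD[OF t(3)] by blast
  then show ?thesis using summand_of_split(1)[OF CPD(6)[OF cp]] t by blast
qed

text \<open>Vanishing at the two ends passes to the middle by \<open>E_exact_1\<close>, and
  \<open>CP_leftI\<close> turns orthogonality into membership.\<close>

lemma CP_left_extension:
  assumes W: "WIC E" and cp: "(\<X>, \<Y>) \<in> CP E" and t: "triangle E A x B y X \<delta>" "A \<in> \<X>" "X \<in> \<X>"
  shows "B \<in> \<X>"
proof (rule CP_leftI[OF cp])
  note d = triangleD[OF t(1)]
  show "B \<in> Ob E" by (rule d)
  fix Y \<epsilon> assume Y: "Y \<in> \<Y>" "\<epsilon> \<in> \<E> B Y"
  have YO: "Y \<in> Ob E" using CP_Ob[OF cp] Y by blast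
  have "pull E Y x \<epsilon> \<in> \<E> A Y" using d Y YO by simp
  then have "pull E Y x \<epsilon> = \<one>\<^bsub>Ext E A Y\<^esub>" by (rule CP_vanish[OF cp t(2) Y(1)])
  then obtain \<epsilon>' where e: "\<epsilon>' \<in> \<E> X Y" "\<epsilon> = pull E Y y \<epsilon>'"
    using E_exact_1[OF W t(1) Y(2) YO] by metis
  have "\<epsilon>' = \<one>\<^bsub>Ext E X Y\<^esub>" by (rule CP_vanish[OF cp t(3) Y(1) e(1)])
  then show "\<epsilon> = \<one>\<^bsub>Ext E B Y\<^esub>" using e(2) d YO by simp
qed

lemma CP_right_extension:
  assumes cp: "(\<X>, \<Y>) \<in> CP E" and t: "triangle E A x B y X \<delta>" "A \<in> \<Y>" "X \<in> \<Y>"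
  shows "B \<in> \<Y>"
proof (rule CP_rightI[OF cp])
  note d = triangleD[OF t(1)]
  show "B \<in> Ob E" by (rule d)
  fix Z \<epsilon> assume Z: "Z \<in> \<X>" "\<epsilon> \<in> \<E> Z B"
  have ZO: "Z \<in> Ob E" using CP_Ob[OF cp] Z by blast
  have "push E Z y \<epsilon> \<in> \<E> Z X" using d Z ZO by simp
  then have "push E Z y \<epsilon> = \<one>\<^bsub>Ext E Z X\<^esub>" by (rule CP_vanish[OF cp Z(1) t(3)])
  then obtain \<epsilon>' where e: "\<epsilon>' \<in> \<E> Z A" "\<epsilon> = push E Z x \<epsilon>'"
    using E_exact_2[OF t(1) Z(2) ZO] by metis
  have "\<epsilon>' = \<one>\<^bsub>Ext E Z A\<^esub>" by (rule CP_vanish[OF cp Z(1) t(2) e(1)])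
  then show "\<epsilon> = \<one>\<^bsub>Ext E Z B\<^esub>" using e(2) d ZO by simp
qed

lemma CP_lift:
  assumes cp: "(\<X>, \<Y>) \<in> CP E" and t: "triangle E Y x B y C \<delta>" "Y \<in> \<Y>" and f: "f \<in> Arr E" "Cod E f = C" "Dom E f \<in> \<X>"
  obtains h where "h \<in> Arr E" "Dom E h = Dom E f" "Cod E h = B" "y \<cdot> h = f"
proof -
  note d = triangleD[OF t(1)]
  have "pull E Y f \<delta> \<in> \<E> (Dom E f) Y" using d f by simp
  then have z: "pull E Y f \<delta> = \<one>\<^bsub>Ext E (Dom E f) Y\<^esub>" by (rule CP_vanish[OF cp f(3) t(2)])
  show thesis by (rule lift_along_deflation[OF t(1) f(1,2) z]) (rule that)
qed

lemma CP_extend: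
  assumes cp: "(\<X>, \<Y>) \<in> CP E" and t: "triangle E A x B y X \<delta>" "X \<in> \<X>" and f: "f \<in> Arr E" "Dom E f = A" "Cod E f \<in> \<Y>"
  obtains h where "h \<in> Arr E" "Dom E h = B" "Cod E h = Cod E f" "h \<cdot> x = f"
proof -
  note d = triangleD[OF t(1)]
  have "push E X f \<delta> \<in> \<E> X (Cod E f)" using d f by simp
  then have z: "push E X f \<delta> = \<one>\<^bsub>Ext E X (Cod E f)\<^esub>" by (rule CP_vanish[OF cp t(2) f(3)])
  show thesis by (rule extend_along_inflation[OF t(1) f(1,2) z]) (rule that)
qed

text \<open>Since \<open>r \<cdot> x\<close> is an identity, hence an inflation, Condition (WIC)
  makes \<open>x\<close> an inflation; its conflation splits by \<open>r\<close>, and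
  \<open>K\<close> becomes a direct summand.\<close>

lemma WIC_retract:
  assumes W: "WIC E" and \<X>: "summand_closed E \<X>" and x: "x \<in> Arr E" "Dom E x = K" "Cod E x \<in> \<X>"
    and r: "r \<in> Arr E" "Dom E r = Cod E x" "Cod E r = K" "r \<cdot> x = Id E K"
  shows "K \<in> \<X>"
proof -
  have K: "K \<in> Ob E" using x by auto
  obtain Z where Z: "zero_object E Z" "Z \<in> Ob E" by (rule zero_object_E)
  have "inflation E (Id E K)"
    using triangle_right_zero[OF Z(1) K] unfolding inflation_def conflation_iff by blast
  then have "inflation E x"
    using W x r unfolding WIC_def by (metis Hom_iff)
  then obtain A B y X \<delta> where "triangle E A x B y X \<delta>" unfolding inflation_def conflation_iff by blast
  moreover from triangleD[OF this] have e: "A = K" "B = Cod E x" using x by auto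
  ultimately have t: "triangle E K x (Cod E x) y X \<delta>" by simp
  have "\<delta> = \<one>\<^bsub>Ext E X K\<^esub>" by (rule retraction_imp_split[OF t r])
  then show ?thesis using summand_of_split(1)[OF \<X>] t x(3) by blast
qed

end

section \<open>Hovey twin cotorsion pairs\<close>

locale hovey_pair = extriangulated_category E
  for E :: "('o, 'm, 'e, 'z) extri_scheme" (structure) +
  fixes \<S> \<T> \<U> \<V> :: "'o set"
  assumes WIC_E: "WIC E" and Hovey: "Hovey_twin_cotorsion_pair E \<S> \<T> \<U> \<V>"
begin

lemma ST: "(\<S>, \<T>) \<in> CP E" and UV: "(\<U>, \<V>) \<in> CP E" and SV: "Ext_vanish E \<S> \<V>"
  using Hovey by (auto simp: Hovey_twin_cotorsion_pair_def twin_cotorsion_pair_def)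

text \<open>By the Hovey condition this is also \<open>N_f\<close>, so that either kind of
  conflation may be used to introduce or to eliminate membership. Proofs about \<N> work by
  switching between the two.\<close>

definition \<N> :: "'o set" where "\<N> = N_i E \<S> \<V>"

lemma N_iI: "triangle E V x S y X \<delta> \<Longrightarrow> V \<in> \<V> \<Longrightarrow> S \<in> \<S> \<Longrightarrow> X \<in> \<N>"
  using triangleD(3) unfolding \<N>_def N_i_def conflation_iff by blast

lemma N_fI: "triangle E X x V y S \<delta> \<Longrightarrow> V \<in> \<V> \<Longrightarrow> S \<in> \<S> \<Longrightarrow> X \<in> \<N>"
  using triangleD(1) Hovey unfolding \<N>_def Hovey_twin_cotorsion_pair_def N_f_def conflation_iff by blast

lemma N_iE:
  assumes "X \<in> \<N>"
  obtains V x S y \<delta> where "triangle E V x S y X \<delta>" "V \<in> \<V>" "S \<in> \<S>"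
  using assms unfolding \<N>_def N_i_def conflation_iff by blast

lemma N_fE:
  assumes "X \<in> \<N>"
  obtains V x S y \<delta> where "triangle E X x V y S \<delta>" "V \<in> \<V>" "S \<in> \<S>"
  using assms Hovey unfolding \<N>_def Hovey_twin_cotorsion_pair_def N_f_def conflation_iff by blast

lemma S_sub_U: "\<S> \<subseteq> \<U>"
  using SV CP_Ob[OF ST] by (auto simp: Ext_vanish_def intro!: CP_leftI[OF UV])

lemma V_sub_T: "\<V> \<subseteq> \<T>"
  using SV CP_Ob[OF UV] by (auto simp: Ext_vanish_def intro!: CP_rightI[OF ST])

lemmas in_Ob [simp] = CP_Ob[OF ST] CP_Ob[OF UV]

lemma zero_in: "zero_object E Z \<Longrightarrow> Z \<in> \<S>" "zero_object E Z \<Longrightarrow> Z \<in> \<V>"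
proof -
  have *: "Z \<in> \<X>" if "additive_subcat E \<X>" "iso_closed E \<X>" "zero_object E Z" for \<X> Z
  proof -
    obtain Z' where "Z' \<in> \<X>" "zero_object E Z'" using \<open>additive_subcat E \<X>\<close> unfolding additive_subcat_def by blast
    then have "isomorphic E Z' Z" using zero_objects_isomorphic \<open>zero_object E Z\<close> by blast
    with \<open>Z' \<in> \<X>\<close> show ?thesis
      using \<open>iso_closed E \<X>\<close> isomorphic_Ob unfolding iso_closed_def by blast
  qed
  show "zero_object E Z \<Longrightarrow> Z \<in> \<S>" by (rule *[OF CPD(1,2)[OF ST]])
  show "zero_object E Z \<Longrightarrow> Z \<in> \<V>" by (rule *[OF CPD(4,5)[OF UV]])
qed

text \<open>The conflation X -> V -> S splits because \<E>(\<S>, \<T>) = 0.\<close>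

lemma N_T_in_V: "X \<in> \<N> \<Longrightarrow> X \<in> \<T> \<Longrightarrow> X \<in> \<V>"
proof (elim N_fE)
  fix V x S y \<delta> assume X: "X \<in> \<T>" and t: "triangle E X x V y S \<delta>" "V \<in> \<V>" "S \<in> \<S>"
  have "\<delta> = \<one>\<^bsub>Ext E S X\<^esub>" using CP_vanish[OF ST t(3) X] triangleD[OF t(1)] by blast
  then show "X \<in> \<V>" using summand_of_split(1)[OF CPD(6)[OF UV]] t by blast
qed

lemma S_sub_N: "X \<in> \<S> \<Longrightarrow> X \<in> \<N>"
proof -
  assume X: "X \<in> \<S>"
  obtain Z where Z: "zero_object E Z" by (rule zero_object_E)
  show ?thesis by (rule N_iI[OF triangle_left_zero[OF Z]]) (use X Z zero_in in auto)
qed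

lemma V_sub_N: "X \<in> \<V> \<Longrightarrow> X \<in> \<N>"
proof -
  assume X: "X \<in> \<V>"
  obtain Z where Z: "zero_object E Z" by (rule zero_object_E)
  show ?thesis by (rule N_fI[OF triangle_right_zero[OF Z]]) (use X Z zero_in in auto)
qed

text \<open>Embed the middle term into some \<open>V\<close> with cokernel in \<S>. The composite Q
  -> S -> V then has as cokernel an extension of two objects of \<S>.\<close>

lemma N_kernel_S:
  assumes t: "triangle E Q q S y S' \<delta>" "S \<in> \<S>" "S' \<in> \<S>"
  shows "Q \<in> \<N>"
proof -
  obtain V x S1 z \<epsilon> where v: "triangle E S x V z S1 \<epsilon>" "V \<in> \<V>" "S1 \<in> \<S>"
    using N_fE[OF S_sub_N[OF t(2)]] .
  obtain G h' \<delta>'' d e where g: "triangle E Q (x \<cdot> q) V h' G \<delta>''" "triangle E S' d G e S1 (push E S1 y \<epsilon>)"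
    using ET4'[OF t(1) v(1)] by metis
  have "G \<in> \<S>" by (rule CP_left_extension[OF WIC_E ST g(2) t(3) v(3)])
  then show ?thesis using N_fI[OF g(1) v(2)] by blast
qed

text \<open>Dual to \<open>N_kernel_S\<close>: cover the middle term by an object of \<S> with
  kernel in \<V>; the kernel of the composite is an extension of two objects of \<V>.\<close>

lemma N_cokernel_V:
  assumes t: "triangle E V x V' y G \<delta>" "V \<in> \<V>" "V' \<in> \<V>"
  shows "G \<in> \<N>"
proof -
  obtain V1 z S w \<epsilon> where v: "triangle E V1 z S w V' \<epsilon>" "V1 \<in> \<V>" "S \<in> \<S>"
    using N_iE[OF V_sub_N[OF t(3)]] .
  obtain K h' \<delta>'' d e where g: "triangle E K h' S (y \<cdot> w) G \<delta>''" "triangle E V1 d K e V (pull E V1 x \<epsilon>)"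
    using ET4_op'[OF v(1) t(1)] by metis
  have "K \<in> \<V>" by (rule CP_right_extension[OF UV g(2) v(2) t(2)])
  then show ?thesis using N_iI[OF g(1)] v(3) by blast
qed

text \<open>The ends are exchanged one after the other. A pullback replaces \<open>Z\<close> by
  \<open>S0\<close>, a pushout replaces \<open>X\<close> by \<open>V1\<close>, and an extension of
  \<open>S0\<close> by \<open>V1\<close> splits.\<close>

lemma N_extension:
  assumes t: "triangle E X x Y y Z \<delta>" "X \<in> \<N>" "Z \<in> \<N>"
  shows "Y \<in> \<N>"
proof -
  obtain V0 a S0 b \<epsilon>0 where s: "triangle E V0 a S0 b Z \<epsilon>0" "V0 \<in> \<V>" "S0 \<in> \<S>" using N_iE[OF t(3)] .
  obtain Y' k k' l l' \<delta>1 \<delta>2 where p: "triangle E X k Y' l S0 \<delta>1" "triangle E V0 k' Y' l' Y \<delta>2"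
    using pullback_of_deflations[OF t(1) s(1)] by metis
  obtain V1 c S1 e \<epsilon>1 where v: "triangle E X c V1 e S1 \<epsilon>1" "V1 \<in> \<V>" "S1 \<in> \<S>" using N_fE[OF t(2)] .
  obtain Y'' m m' n n' \<delta>3 \<delta>4 where q: "triangle E Y' m Y'' n S1 \<delta>3" "triangle E V1 m' Y'' n' S0 \<delta>4"
    using pushout_of_inflations[OF p(1) v(1)] by metis
  have "\<delta>4 = \<one>\<^bsub>Ext E S0 V1\<^esub>"
    using SV s(3) v(2) triangleD[OF q(2)] by (auto simp: Ext_vanish_def)
  then obtain s' r' where b: "biproduct E V1 S0 Y'' m' s' r' n'" using q(2) split_biproduct by metis
  \<comment> \<open>Embedding the summand \<open>S0\<close> into an object of \<V> embeds
    \<open>Y''\<close> into \<open>V3\<close>. The cokernel of Y' -> Y'' -> V3 is an extension of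
    objects of \<S>, which puts \<open>Y'\<close> in \<N>.\<close>
  obtain V2 f S2 g \<epsilon>2 where w: "triangle E S0 f V2 g S2 \<epsilon>2" "V2 \<in> \<V>" "S2 \<in> \<S>"
    using N_fE[OF S_sub_N[OF s(3)]] .
  obtain V3 iV iV2 pV pV2 where b2: "V3 \<in> \<V>" "biproduct E V1 V2 V3 iV iV2 pV pV2"
    using CPD(4)[OF UV] v(2) w(2) unfolding additive_subcat_def by blast
  obtain h z \<epsilon>3 where t3: "triangle E Y'' h V3 z S2 \<epsilon>3"
    using triangle_plus_middle_left[OF w(1) b b2(2)] by blast
  obtain G h' \<delta>5 d e' where g: "triangle E Y' (h \<cdot> m) V3 h' G \<delta>5" "triangle E S1 d G e' S2 (push E S2 n \<epsilon>3)"
    using ET4'[OF q(1) t3] by metis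
  have "G \<in> \<S>" by (rule CP_left_extension[OF WIC_E ST g(2) v(3) w(3)])
  then have "Y' \<in> \<N>" using N_fI[OF g(1) b2(1)] by blast
  \<comment> \<open>Here the other description of \<N> is taken: \<open>Y\<close> is the end of a
    deflation from \<open>Y'\<close> with kernel \<open>V0\<close>, so a cover of \<open>Y'\<close>
    by an object of \<S> also covers \<open>Y\<close>.\<close>
  then obtain V4 a4 S4 b4 \<epsilon>4 where x: "triangle E V4 a4 S4 b4 Y' \<epsilon>4" "V4 \<in> \<V>" "S4 \<in> \<S>" by (rule N_iE)
  obtain K h4 \<delta>6 d4 e4 where y: "triangle E K h4 S4 (l' \<cdot> b4) Y \<delta>6" "triangle E V4 d4 K e4 V0 (pull E V4 k' \<epsilon>4)"
    using ET4_op'[OF x(1) p(2)] by metis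
  have "K \<in> \<V>" by (rule CP_right_extension[OF UV y(2) x(2) s(2)])
  then show ?thesis using N_iI[OF y(1) _ x(3)] by blast
qed

section \<open>Weak fibrations, weak cofibrations and factorizations\<close>

lemma wFibI: "triangle E V x A f B \<delta> \<Longrightarrow> V \<in> \<V> \<Longrightarrow> f \<in> wFib E \<V>"
  unfolding wFib_def conflation_iff by blast

lemma wFibE:
  assumes "f \<in> wFib E \<V>"
  obtains V x \<delta> where "V \<in> \<V>" "triangle E V x (Dom E f) f (Cod E f) \<delta>"
proof -
  obtain V x A B \<delta> where "V \<in> \<V>" "triangle E V x A f B \<delta>" using assms unfolding wFib_def conflation_iff by blast
  moreover from triangleD[OF this(2)] have "A = Dom E f" "B = Cod E f" by auto
  ultimately show thesis using that by blast
qed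

lemma wCofI: "triangle E A f B y S \<delta> \<Longrightarrow> S \<in> \<S> \<Longrightarrow> f \<in> wCof E \<S>"
  unfolding wCof_def conflation_iff by blast

lemma wCofE:
  assumes "f \<in> wCof E \<S>"
  obtains S y \<delta> where "S \<in> \<S>" "triangle E (Dom E f) f (Cod E f) y S \<delta>"
proof -
  obtain S y A B \<delta> where "S \<in> \<S>" "triangle E A f B y S \<delta>" using assms unfolding wCof_def conflation_iff by blast
  moreover from triangleD[OF this(2)] have "A = Dom E f" "B = Cod E f" by auto
  ultimately show thesis using that by blast
qed

lemma wFib_Arr [simp]: "f \<in> wFib E \<V> \<Longrightarrow> f \<in> Arr E"
  by (elim wFibE) (auto dest: triangleD)

lemma wCof_Arr [simp]: "f \<in> wCof E \<S> \<Longrightarrow> f \<in> Arr E"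
  by (elim wCofE) (auto dest: triangleD)

lemma Id_wFib: "A \<in> Ob E \<Longrightarrow> Id E A \<in> wFib E \<V>"
  using zero_object_E zero_in(2) triangle_left_zero wFibI by metis

lemma Id_wCof: "A \<in> Ob E \<Longrightarrow> Id E A \<in> wCof E \<S>"
  using zero_object_E zero_in(1) triangle_right_zero wCofI by metis

lemma wCof_Comp:
  assumes "i \<in> wCof E \<S>" "j \<in> wCof E \<S>" "Dom E j = Cod E i"
  shows "j \<cdot> i \<in> wCof E \<S>"
proof -
  obtain S y \<delta> where i: "S \<in> \<S>" "triangle E (Dom E i) i (Cod E i) y S \<delta>" using wCofE[OF assms(1)] .
  obtain S' y' \<delta>' where j: "S' \<in> \<S>" "triangle E (Cod E i) j (Cod E j) y' S' \<delta>'"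
    using wCofE[OF assms(2)] unfolding assms(3) .
  obtain G h' \<delta>'' d e where g: "triangle E (Dom E i) (j \<cdot> i) (Cod E j) h' G \<delta>''" "triangle E S d G e S' (push E S' y \<delta>')"
    using ET4'[OF i(2) j(2)] by metis
  show ?thesis using wCofI[OF g(1)] CP_left_extension[OF WIC_E ST g(2) i(1) j(1)] by blast
qed

lemma wFib_Comp:
  assumes "p \<in> wFib E \<V>" "q \<in> wFib E \<V>" "Dom E q = Cod E p"
  shows "q \<cdot> p \<in> wFib E \<V>"
proof -
  obtain V y \<delta> where p: "V \<in> \<V>" "triangle E V y (Dom E p) p (Cod E p) \<delta>" using wFibE[OF assms(1)] .
  obtain V' y' \<delta>' where q: "V' \<in> \<V>" "triangle E V' y' (Cod E p) q (Cod E q) \<delta>'"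
    using wFibE[OF assms(2)] unfolding assms(3) .
  obtain K h' \<delta>'' d e where g: "triangle E K h' (Dom E p) (q \<cdot> p) (Cod E q) \<delta>''" "triangle E V d K e V' (pull E V y' \<delta>)"
    using ET4_op'[OF p(2) q(2)] by metis
  show ?thesis using wFibI[OF g(1)] CP_right_extension[OF UV g(2) p(1) q(1)] by blast
qed

lemma biproduct_wCof:
  assumes "biproduct E S B P iS iB pS pB" "S \<in> \<S>"
  shows "iB \<in> wCof E \<S>"
  by (rule wCofI[OF triangle_biproduct[OF biproduct_swap[OF assms(1)]] assms(2)])

text \<open>The kernel \<open>K\<close> of the deflation from \<open>deflation_along_inflation\<close> lies in $\mathcal{N}$, so
  embedding it into an object of $\mathcal{T}$ lands in $\mathcal{T} \cap \mathcal{N} = \mathcal{V}$.\<close>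

lemma wCof_wFib_interchange:
  assumes p: "p \<in> wFib E \<V>" and j: "j \<in> wCof E \<S>" and c: "Dom E j = Cod E p"
  obtains i q where "i \<in> wCof E \<S>" "q \<in> wFib E \<V>" "Dom E i = Dom E p" "Dom E q = Cod E i"
    "Cod E q = Cod E j" "q \<cdot> i = j \<cdot> p"
proof -
  obtain V x \<delta> where pt: "V \<in> \<V>" "triangle E V x (Dom E p) p (Cod E p) \<delta>" using wFibE[OF p] .
  obtain S y \<sigma> where jt: "S \<in> \<S>" "triangle E (Cod E p) j (Cod E j) y S \<sigma>" using wCofE[OF j] unfolding c .
  obtain T0 S0 t0 q \<theta> where qt: "T0 \<in> \<T>" "S0 \<in> \<S>" "triangle E T0 t0 S0 q (Cod E j) \<theta>"
    using CP_left_approx[OF ST triangleD(2)[OF jt(2)]] .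
  obtain P iS iB pS pB where b: "biproduct E S0 (Dom E p) P iS iB pS pB"
    using biproduct_ex[OF _ triangleD(2)[OF pt(2)], of S0] qt by auto
  note bd = biproductD[OF b]
  obtain K k k' a g Q0 e e' \<delta>' \<phi> \<kappa> \<epsilon> where f: "triangle E V a K g Q0 \<delta>'" "triangle E Q0 e S0 e' S \<epsilon>"
    "triangle E K k P \<phi> (Cod E j) \<kappa>" "\<phi> \<cdot> iB = j \<cdot> p"
    by (rule deflation_along_inflation[OF pt(2) jt(2) qt(3) b])
  have "K \<in> \<N>" by (rule N_extension[OF f(1) V_sub_N[OF pt(1)] N_kernel_S[OF f(2) qt(2) jt(1)]])
  obtain TK SK l l' \<tau> where tk: "TK \<in> \<T>" "SK \<in> \<S>" "triangle E K l TK l' SK \<tau>"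
    using CP_right_approx[OF ST triangleD(1)[OF f(3)]] .
  have "TK \<in> \<V>"
    using N_T_in_V[OF N_extension[OF tk(3) \<open>K \<in> \<N>\<close> S_sub_N[OF tk(2)]] tk(1)] .
  obtain M m m' n n' \<mu> \<mu>' where po: "triangle E P m M n SK \<mu>" "triangle E TK m' M n' (Cod E j) \<mu>'"
    "n' \<cdot> m = \<phi>" using pushout_of_inflations[OF f(3) tk(3)] by metis
  note pd = triangleD[OF po(1)] triangleD[OF po(2)]
  have mw: "m \<in> wCof E \<S>" by (rule wCofI[OF po(1) tk(2)])
  have nw: "n' \<in> wFib E \<V>" by (rule wFibI[OF po(2) \<open>TK \<in> \<V>\<close>])
  have "m \<cdot> iB \<in> wCof E \<S>" using wCof_Comp[OF biproduct_wCof[OF b qt(2)] mw] bd pd by simp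
  moreover have "n' \<cdot> (m \<cdot> iB) = j \<cdot> p" using Comp_reassoc[OF po(3), of iB] f(4) bd pd by simp
  ultimately show thesis using that[OF _ nw] bd(1-12) pd by simp
qed

text \<open>Adding an object \<open>S0\<close> of \<S> that maps onto the target makes the arrow a
  deflation; a pushout then enlarges its kernel to an object of \<T>. Each change costs only a weak
  cofibration on the source side.\<close>

lemma fibration_factorization:
  assumes "f \<in> Arr E"
  obtains i p T t \<delta> where "i \<in> wCof E \<S>" "Dom E i = Dom E f" "T \<in> \<T>" "triangle E T t (Cod E i) p (Cod E f) \<delta>"
    "p \<cdot> i = f"
proof -
  obtain T0 S0 t0 q \<theta> where qt: "T0 \<in> \<T>" "S0 \<in> \<S>" "triangle E T0 t0 S0 q (Cod E f) \<theta>"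
    using CP_left_approx[OF ST Cod_in[OF assms]] .
  note qd = triangleD[OF qt(3)]
  obtain P iX iS pX pS where b: "biproduct E (Dom E f) S0 P iX iS pX pS"
    using biproduct_ex[OF Dom_in[OF assms], of S0] qt by auto
  note bd = biproductD[OF b] and bO = biproduct_Ob[OF b]
  obtain G a g k \<delta>' \<kappa> where h: "triangle E G k P (f \<cdot> pX \<boxplus> q \<cdot> pS) (Cod E f) \<kappa>"
    using homotopy_pullback[OF qt(3) assms refl refl b] by metis
  obtain TK SK l l' \<tau> where tk: "TK \<in> \<T>" "SK \<in> \<S>" "triangle E G l TK l' SK \<tau>"
    using CP_right_approx[OF ST triangleD(1)[OF h]] .
  obtain M m m' n n' \<mu> \<mu>' where po: "triangle E P m M n SK \<mu>" "triangle E TK m' M n' (Cod E f) \<mu>'"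
    "n' \<cdot> m = f \<cdot> pX \<boxplus> q \<cdot> pS" using pushout_of_inflations[OF h tk(3)] by metis
  note pd = triangleD[OF po(1)] triangleD[OF po(2)]
  have mw: "m \<in> wCof E \<S>" by (rule wCofI[OF po(1) tk(2)])
  have 1: "m \<cdot> iX \<in> wCof E \<S>" using wCof_Comp[OF biproduct_wCof[OF biproduct_swap[OF b] qt(2)] mw] bd pd by simp
  have "n' \<cdot> (m \<cdot> iX) = (f \<cdot> pX \<boxplus> q \<cdot> pS) \<cdot> iX"
    by (rule Comp_reassoc[OF po(3)]) (use bd(1-12) pd in simp_all)
  also have "\<dots> = f" using bd(1-14) qd assms biproduct_eqs[OF b] bO by simp
  finally have 2: "n' \<cdot> (m \<cdot> iX) = f" .
  have 3: "triangle E TK m' (Cod E (m \<cdot> iX)) n' (Cod E f) \<mu>'" using po(2) bd(1-12) pd by simp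
  show thesis by (rule that[OF 1 _ tk(1) 3 2]) (use bd(1-12) pd in simp)
qed

text \<open>Pulling back a cover V -> S -> X gives a middle object \<open>M\<close> that is an
  extension of \<open>S\<close> by \<open>A\<close> and also an extension of \<open>B\<close> by
  \<open>V\<close>.\<close>

lemma inflation_N:
  assumes t: "triangle E A x B y X \<delta>" "X \<in> \<N>"
  obtains i p where "i \<in> wCof E \<S>" "p \<in> wFib E \<V>" "Dom E i = A" "Dom E p = Cod E i" "Cod E p = B" "p \<cdot> i = x"
proof -
  obtain V a S b \<epsilon> where v: "triangle E V a S b X \<epsilon>" "V \<in> \<V>" "S \<in> \<S>" using N_iE[OF t(2)] .
  obtain M k k' l l' \<mu> \<mu>' where m: "triangle E A k M l S \<mu>" "triangle E V k' M l' B \<mu>'" "l' \<cdot> k = x"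
    using pullback_of_deflations[OF t(1) v(1)] by metis
  show thesis
    by (rule that[OF wCofI[OF m(1) v(3)] wFibI[OF m(2) v(2)]])
      (use m(3) triangleD[OF m(1)] triangleD[OF m(2)] in simp_all)
qed

text \<open>Dual to \<open>inflation_N\<close>, pushing out along an embedding of \<open>A\<close>
  into an object of \<V>.\<close>

lemma deflation_N:
  assumes t: "triangle E A x B y X \<delta>" "A \<in> \<N>"
  obtains i p where "i \<in> wCof E \<S>" "p \<in> wFib E \<V>" "Dom E i = B" "Dom E p = Cod E i" "Cod E p = X" "p \<cdot> i = y"
proof -
  obtain V a S b \<epsilon> where v: "triangle E A a V b S \<epsilon>" "V \<in> \<V>" "S \<in> \<S>" using N_fE[OF t(2)] .
  obtain M k k' l l' \<mu> \<mu>' where m: "triangle E B k M l S \<mu>" "triangle E V k' M l' X \<mu>'" "l' \<cdot> k = y"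
    using pushout_of_inflations[OF t(1) v(1)] by metis
  show thesis
    by (rule that[OF wCofI[OF m(1) v(3)] wFibI[OF m(2) v(2)]])
      (use m(3) triangleD[OF m(1)] triangleD[OF m(2)] in simp_all)
qed

section \<open>Arrows factoring through \<S>\<close>

definition null :: "'m \<Rightarrow> bool" where
  "null f \<longleftrightarrow> (\<exists>a b. a \<in> Arr E \<and> b \<in> Arr E \<and> Cod E a \<in> \<S> \<and> Dom E b = Cod E a \<and> f = b \<cdot> a)"

lemma null_Arr: "null f \<Longrightarrow> f \<in> Arr E"
  by (auto simp: null_def)

lemma null_Comp_left:
  assumes "null f" "g \<in> Arr E" "Dom E g = Cod E f"
  shows "null (g \<cdot> f)"
proof -
  obtain a b where "a \<in> Arr E" "b \<in> Arr E" "Cod E a \<in> \<S>" "Dom E b = Cod E a" "f = b \<cdot> a"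
    using assms(1) by (auto simp: null_def)
  then show ?thesis unfolding null_def using assms(2,3) by (intro exI[of _ a] exI[of _ "g \<cdot> b"]) simp
qed

lemma null_Comp_right:
  assumes "null f" "g \<in> Arr E" "Cod E g = Dom E f"
  shows "null (f \<cdot> g)"
proof -
  obtain a b where "a \<in> Arr E" "b \<in> Arr E" "Cod E a \<in> \<S>" "Dom E b = Cod E a" "f = b \<cdot> a"
    using assms(1) by (auto simp: null_def)
  then show ?thesis unfolding null_def using assms(2,3) by (intro exI[of _ "a \<cdot> g"] exI[of _ b]) simp
qed

lemma nullI_dom: "f \<in> Arr E \<Longrightarrow> Dom E f \<in> \<S> \<Longrightarrow> null f"
  unfolding null_def by (intro exI[of _ "Id E (Dom E f)"] exI[of _ f]) simp

lemma nullI_cod: "f \<in> Arr E \<Longrightarrow> Cod E f \<in> \<S> \<Longrightarrow> null f"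
  unfolding null_def by (intro exI[of _ "Id E (Cod E f)"] exI[of _ f]) simp

lemma null_hadd:
  assumes "null f" "null g" "Dom E g = Dom E f" "Cod E g = Cod E f"
  shows "null (f \<boxplus> g)"
proof -
  obtain a b where f: "a \<in> Arr E" "b \<in> Arr E" "Cod E a \<in> \<S>" "Dom E b = Cod E a" "f = b \<cdot> a"
    using assms(1) by (auto simp: null_def)
  obtain a' b' where g: "a' \<in> Arr E" "b' \<in> Arr E" "Cod E a' \<in> \<S>" "Dom E b' = Cod E a'" "g = b' \<cdot> a'"
    using assms(2) by (auto simp: null_def)
  obtain P iA iB pA pB where b: "P \<in> \<S>" "biproduct E (Cod E a) (Cod E a') P iA iB pA pB"
    using CPD(1)[OF ST] f(3) g(3) unfolding additive_subcat_def by blast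
  note bd = biproductD[OF b(2)] and be = biproduct_eqs[OF b(2)] and bO = biproduct_Ob[OF b(2)]
  have "(b \<cdot> pA \<boxplus> b' \<cdot> pB) \<cdot> (iA \<cdot> a \<boxplus> iB \<cdot> a') = f \<boxplus> g"
    using f g bd(1-14) be bO assms(3,4) Comp_reassoc[OF bd(13), of a] Comp_reassoc[OF bd(14), of a']
      Comp_reassoc[OF be(1), of a] Comp_reassoc[OF be(2), of a'] by simp
  moreover have "null ((b \<cdot> pA \<boxplus> b' \<cdot> pB) \<cdot> (iA \<cdot> a \<boxplus> iB \<cdot> a'))"
    using f(1-4) g(1-4) assms(3,4) bd(1-12) b(1) unfolding f(5) g(5)
    by (intro null_Comp_left nullI_cod) simp_all
  ultimately show ?thesis by simp
qed

lemma null_hneg: "null f \<Longrightarrow> null (hneg f)"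
  unfolding null_def by (metis Comp_hneg(1) hneg_simps)

lemma null_hzero: "A \<in> Ob E \<Longrightarrow> B \<in> Ob E \<Longrightarrow> null (hzero A B)"
proof -
  assume AB: "A \<in> Ob E" "B \<in> Ob E"
  obtain Z where Z: "zero_object E Z" "Z \<in> Ob E" by (rule zero_object_E)
  have "null (hzero Z B)" using Z AB zero_in by (intro nullI_dom) auto
  from null_Comp_right[OF this, of "hzero A Z"] Z AB show ?thesis by simp
qed

text \<open>An object of \<N> is covered by an object of \<S> with kernel in \<V>, and arrows from
  \<U> lift along such a cover. So for sources in \<U> factoring through \<N>, in particular through
  \<V>, already means factoring through \<S>.\<close>

lemma null_through_N:
  assumes "a \<in> Arr E" "b \<in> Arr E" "Dom E b = Cod E a" "Dom E a \<in> \<U>" "Cod E a \<in> \<N>"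
  shows "null (b \<cdot> a)"
proof -
  obtain V x S y \<delta> where t: "triangle E V x S y (Cod E a) \<delta>" "V \<in> \<V>" "S \<in> \<S>" using N_iE[OF assms(5)] .
  obtain h where h: "h \<in> Arr E" "Dom E h = Dom E a" "Cod E h = S" "y \<cdot> h = a"
    using CP_lift[OF UV t(1,2) assms(1) refl assms(4)] .
  have "null h" using h t by (intro nullI_cod) auto
  then have "null (b \<cdot> (y \<cdot> h))" using h triangleD[OF t(1)] assms by (intro null_Comp_left) auto
  then show ?thesis using h by simp
qed

end

section \<open>Arrows of the localization\<close>

text \<open>Idempotent relations are the objects, among them the equivalence relations; so the quotient of a
  hom-set is an object without passing to equivalence classes.\<close>

definition karoubi_rel :: "(('a \<times> 'a) set, ('a \<times> 'a) set \<times> ('a \<times> 'a) set \<times> ('a \<times> 'a) set) cat" where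
  "karoubi_rel = \<lparr>Ob = {e. e O e = e}, Arr = {(e, R, e'). e O e = e \<and> e' O e' = e' \<and> e O R = R \<and> R O e' = R},
     Dom = fst, Cod = (\<lambda>r. snd (snd r)), Id = (\<lambda>e. (e, e, e)),
     Comp = (\<lambda>s r. (fst r, fst (snd r) O fst (snd s), snd (snd s)))\<rparr>"

lemma category_karoubi_rel: "category karoubi_rel"
proof
  fix f A B g D h F
  show "g \<cdot>\<^bsub>karoubi_rel\<^esub> f \<in> Hom karoubi_rel A D" if fg: "f \<in> Hom karoubi_rel A B" "g \<in> Hom karoubi_rel B D"
  proof -
    obtain R S where "f = (A, R, B)" "g = (B, S, D)" "A O R = R" "S O D = S" "A O A = A" "D O D = D"
      using fg by (cases f; cases g) (simp add: karoubi_rel_def)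
    moreover from this have "A O (R O S) = R O S" by (simp flip: O_assoc)
    moreover from calculation have "(R O S) O D = R O S" by (simp add: O_assoc)
    ultimately show ?thesis by (simp add: karoubi_rel_def)
  qed
  show "f \<in> Hom karoubi_rel A B \<Longrightarrow> g \<in> Hom karoubi_rel B D \<Longrightarrow> h \<in> Hom karoubi_rel D F \<Longrightarrow>
      h \<cdot>\<^bsub>karoubi_rel\<^esub> (g \<cdot>\<^bsub>karoubi_rel\<^esub> f) = (h \<cdot>\<^bsub>karoubi_rel\<^esub> g) \<cdot>\<^bsub>karoubi_rel\<^esub> f"
    by (simp add: karoubi_rel_def O_assoc)
qed (simp_all add: karoubi_rel_def split_beta)

lemma rel_eqI: "(\<And>x y. (x, y) \<in> R \<longleftrightarrow> (x, y) \<in> S) \<Longrightarrow> R = S"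
  by auto

context hovey_pair
begin

abbreviation "\<H> \<equiv> loc_cat E \<S> \<V>"
abbreviation "\<l> \<equiv> ell E \<S> \<V>"
abbreviation hcomp (infixr "\<bullet>" 75) where "g \<bullet> f \<equiv> g \<cdot>\<^bsub>\<H>\<^esub> f"

lemma WW_Arr: "w \<in> WW E \<S> \<V> \<Longrightarrow> w \<in> Arr E"
  by (auto simp: WW_def)

sublocale H: category "loc_cat E \<S> \<V>"
  unfolding loc_cat_def by (rule category_localization)

lemma Ob_H [simp]: "Ob \<H> = Ob E"
  by (simp add: loc_cat_def)

lemma ell_functor: "is_functor E \<H> (\<lambda>A. A) \<l>"
  using loc_arr_functor unfolding loc_cat_def ell_def .

lemmas ell_simps [simp] = is_functorD(2-4)[OF ell_functor]
lemmas ell_Id = is_functorD(5)[OF ell_functor]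
lemmas ell_Comp = is_functorD(6)[OF ell_functor]

lemma ell_square:
  assumes "b \<cdot> f = g \<cdot> a" "f \<in> Arr E" "b \<in> Arr E" "Dom E b = Cod E f" "a \<in> Arr E" "g \<in> Arr E" "Dom E g = Cod E a"
  shows "\<l> b \<bullet> \<l> f = \<l> g \<bullet> \<l> a"
  using assms ell_Comp[of f b] ell_Comp[of a g] by simp

lemma wFib_WW: "p \<in> wFib E \<V> \<Longrightarrow> p \<in> WW E \<S> \<V>"
  unfolding WW_def using Id_wCof[of "Dom E p"] Comp_Id(1)[of p "Dom E p"]
  by (intro CollectI exI[of _ p] exI[of _ "Id E (Dom E p)"]) simp

lemma wCof_WW: "i \<in> wCof E \<S> \<Longrightarrow> i \<in> WW E \<S> \<V>"
  unfolding WW_def using Id_wFib[of "Cod E i"] Comp_Id(2)[of i "Cod E i"]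
  by (intro CollectI exI[of _ "Id E (Cod E i)"] exI[of _ i]) simp

lemma ell_iso:
  "w \<in> WW E \<S> \<V> \<Longrightarrow> is_iso \<H> (\<l> w)"
  "p \<in> wFib E \<V> \<Longrightarrow> is_iso \<H> (\<l> p)"
  "i \<in> wCof E \<S> \<Longrightarrow> is_iso \<H> (\<l> i)"
  using loc_arr_iso WW_Arr wFib_WW wCof_WW unfolding loc_cat_def ell_def by blast+

text \<open>Two sections of the weak equivalence $X \oplus S \to X$ become equal in the localization.\<close>

lemma null_diff_ell_eq:
  assumes "null (f \<boxminus> g)" "f \<in> Arr E" "g \<in> Arr E" "Dom E g = Dom E f" "Cod E g = Cod E f"
  shows "\<l> f = \<l> g"
proof -
  obtain a b where ab: "a \<in> Arr E" "b \<in> Arr E" "Cod E a \<in> \<S>" "Dom E b = Cod E a" "f \<boxminus> g = b \<cdot> a"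
    using assms(1) by (auto simp: null_def)
  have da: "Dom E a = Dom E f" "Cod E b = Cod E f"
    using Comp_simps(2,3)[OF ab(1,2,4)] ab(5) hadd_simps[of f "hneg g"] assms by simp_all
  let ?X = "Dom E f" and ?S = "Cod E a"
  have O: "?X \<in> Ob E" "?S \<in> Ob E" using ab assms by simp_all
  obtain P iX iS pX pS where b: "biproduct E ?X ?S P iX iS pX pS" using biproduct_ex[OF O] by blast
  note bd = biproductD[OF b] and be = biproduct_eqs[OF b]
  have i: "is_iso \<H> (\<l> iX)" by (rule ell_iso(3)[OF biproduct_wCof[OF biproduct_swap[OF b] ab(3)]])
  define s where "s = iX \<boxplus> iS \<cdot> a"
  have s: "s \<in> Arr E" "Dom E s = ?X" "Cod E s = P" using bd(1-12) ab da by (simp_all add: s_def)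
  have ps: "pX \<cdot> s = Id E ?X" using bd(1-14) be ab da O Comp_reassoc[OF be(2), of a] by (simp add: s_def)
  have 1: "\<l> pX \<bullet> \<l> iX = Id \<H> ?X" using ell_Comp[of iX pX] bd O by (simp add: ell_Id)
  have 2: "\<l> pX \<bullet> \<l> s = Id \<H> ?X" using ell_Comp[of s pX] ps s bd(1-12) O by (simp add: ell_Id)
  have "is_iso \<H> (\<l> pX)"
    by (rule H.iso_of_iso_Comp_left[OF i]) (use 1 bd(1-12) O in simp_all)
  then have e: "\<l> s = \<l> iX"
    by (rule H.iso_left_cancel) (use 1 2 s bd(1-12) in simp_all)
  \<comment> \<open>\<open>m\<close> has components \<open>g\<close> and \<open>b\<close>: it
    restricts to \<open>g\<close> along \<open>iX\<close>, and to
    \<open>g \<boxplus> b \<cdot> a = f\<close> along \<open>s\<close>.\<close>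
  define m where "m = g \<cdot> pX \<boxplus> b \<cdot> pS"
  have m: "m \<in> Arr E" "Dom E m = P" "Cod E m = Cod E f" using bd(1-12) ab da assms by (simp_all add: m_def)
  have mi: "m \<cdot> iX = g" using bd(1-14) be ab da O assms by (simp add: m_def)
  have "m \<cdot> s = g \<cdot> (pX \<cdot> s) \<boxplus> b \<cdot> (pS \<cdot> s)" using bd(1-12) s ab da assms(2-) by (simp add: m_def)
  also have "pS \<cdot> s = a" using bd(1-14) be ab da O Comp_reassoc[OF bd(14), of a] by (simp add: s_def)
  also have "g \<cdot> (pX \<cdot> s) \<boxplus> b \<cdot> a = f" unfolding ps ab(5)[symmetric] using assms by simp
  finally have ms: "m \<cdot> s = f" .
  show ?thesis using ell_Comp[OF s(1) m(1)] ell_Comp[of iX m] ms mi m s bd(1-12) e by simp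
qed

section \<open>Replacement by objects of \<T>, functorial modulo null arrows\<close>

lemma wCof_extend:
  assumes "i \<in> wCof E \<S>" "g \<in> Arr E" "Dom E g = Dom E i" "Cod E g \<in> \<T>"
  obtains h where "h \<in> Arr E" "Dom E h = Cod E i" "Cod E h = Cod E g" "h \<cdot> i = g"
proof -
  obtain S y \<delta> where "S \<in> \<S>" "triangle E (Dom E i) i (Cod E i) y S \<delta>" using wCofE[OF assms(1)] .
  then show thesis using CP_extend[OF ST _ _ assms(2-4)] that by metis
qed

text \<open>The difference vanishes on \<open>i\<close>, so it factors through the cokernel, an
  object of \<S>.\<close>

lemma wCof_extend_unique:
  assumes i: "i \<in> wCof E \<S>" and h: "h \<in> Arr E" "h' \<in> Arr E" "Dom E h = Cod E i" "Dom E h' = Cod E i" "Cod E h' = Cod E h"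
    "h \<cdot> i = h' \<cdot> i"
  shows "null (h \<boxminus> h')"
proof -
  obtain S y \<delta> where t: "S \<in> \<S>" "triangle E (Dom E i) i (Cod E i) y S \<delta>" using wCofE[OF i] .
  note d = triangleD[OF t(2)]
  have h': "h \<boxminus> h' \<in> Arr E" "Dom E (h \<boxminus> h') = Cod E i" "Cod E (h \<boxminus> h') = Cod E h" using h by simp_all
  have "(h \<boxminus> h') \<cdot> i = hzero (Dom E i) (Cod E (h \<boxminus> h'))" using h i by simp
  then obtain g where g: "g \<in> Arr E" "Dom E g = S" "Cod E g = Cod E (h \<boxminus> h')" "g \<cdot> y = h \<boxminus> h'"
    using factor_through_cokernel[OF t(2) h'(1,2)] by metis
  have "null (g \<cdot> y)" using g d t(1) by (intro null_Comp_right nullI_dom) simp_all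
  then show ?thesis using g(4) by simp
qed

definition jT :: "'o \<Rightarrow> 'm" where
  "jT Z = (SOME j. j \<in> wCof E \<S> \<and> Dom E j = Z \<and> Cod E j \<in> \<T>)"

definition TR :: "'o \<Rightarrow> 'o" where
  "TR Z = Cod E (jT Z)"

lemma jT [simp]:
  assumes "Z \<in> Ob E"
  shows "jT Z \<in> wCof E \<S>" "Dom E (jT Z) = Z" "Cod E (jT Z) = TR Z" "TR Z \<in> \<T>"
proof -
  obtain Y X x y \<delta> where "Y \<in> \<T>" "X \<in> \<S>" "triangle E Z x Y y X \<delta>" using CP_right_approx[OF ST assms] .
  then have "x \<in> wCof E \<S> \<and> Dom E x = Z \<and> Cod E x \<in> \<T>"
    using wCofI triangleD(6,7)[of Z x Y y X \<delta>] by auto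
  then have "jT Z \<in> wCof E \<S> \<and> Dom E (jT Z) = Z \<and> Cod E (jT Z) \<in> \<T>" unfolding jT_def by (rule someI)
  then show "jT Z \<in> wCof E \<S>" "Dom E (jT Z) = Z" "Cod E (jT Z) = TR Z" "TR Z \<in> \<T>" by (auto simp: TR_def)
qed

text \<open>A relation rather than a function, because an extension to the replacements is
  determined only modulo null arrows.\<close>

definition extends :: "'m \<Rightarrow> 'm \<Rightarrow> bool" where
  "extends f h \<longleftrightarrow> h \<in> Arr E \<and> Dom E h = TR (Dom E f) \<and> Cod E h = TR (Cod E f) \<and> h \<cdot> jT (Dom E f) = jT (Cod E f) \<cdot> f"

lemma extends_ex:
  assumes "f \<in> Arr E"
  obtains h where "extends f h"
  by (rule wCof_extend[of "jT (Dom E f)" "jT (Cod E f) \<cdot> f"]) (use assms in \<open>auto simp: extends_def\<close>)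

lemma extends_unique:
  assumes "f \<in> Arr E" "extends f h" "extends f h'"
  shows "null (h \<boxminus> h')"
  by (rule wCof_extend_unique[of "jT (Dom E f)"]) (use assms in \<open>auto simp: extends_def\<close>)

text \<open>Composition with \<open>h\<close> is a bijection modulo null on arrows from each object
  of \<U>. Injectivity is stated as triviality of the kernel. Sources are restricted to \<U> because
  only from there do arrows lift along weak fibrations.\<close>

definition U_bijective :: "'m \<Rightarrow> bool" where
  "U_bijective h \<longleftrightarrow> h \<in> Arr E \<and>
     (\<forall>g \<in> Arr E. Dom E g \<in> \<U> \<longrightarrow> Cod E g = Dom E h \<longrightarrow> null (h \<cdot> g) \<longrightarrow> null g) \<and>
     (\<forall>k \<in> Arr E. Dom E k \<in> \<U> \<longrightarrow> Cod E k = Cod E h \<longrightarrow>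
        (\<exists>g \<in> Arr E. Dom E g = Dom E k \<and> Cod E g = Dom E h \<and> null (k \<boxminus> h \<cdot> g)))"

lemma null_hdiff_swap:
  assumes "null (f \<boxminus> g)" "f \<in> Arr E" "g \<in> Arr E" "Dom E g = Dom E f" "Cod E g = Cod E f"
  shows "null (g \<boxminus> f)"
proof -
  have "hneg (f \<boxminus> g) = g \<boxminus> f"
    by (rule hneg_unique[symmetric]) (use assms in \<open>simp_all add: hadd_assoc\<close>)
  then show ?thesis using null_hneg[OF assms(1)] by simp
qed

lemma null_hdiff_trans:
  assumes "null (f \<boxminus> g)" "null (g \<boxminus> h)" "f \<in> Arr E" "g \<in> Arr E" "h \<in> Arr E" "Dom E g = Dom E f" "Cod E g = Cod E f"
    "Dom E h = Dom E f" "Cod E h = Cod E f"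
  shows "null (f \<boxminus> h)"
proof -
  have "(f \<boxminus> g) \<boxplus> (g \<boxminus> h) = f \<boxminus> h" using assms(3-) by (simp add: hadd_assoc)
  moreover have "null ((f \<boxminus> g) \<boxplus> (g \<boxminus> h))" by (rule null_hadd[OF assms(1,2)]) (use assms in simp_all)
  ultimately show ?thesis by simp
qed

lemma null_of_hdiff:
  assumes "null (f \<boxminus> g)" "null g" "f \<in> Arr E" "Dom E g = Dom E f" "Cod E g = Cod E f"
  shows "null f"
proof -
  have "null ((f \<boxminus> g) \<boxplus> g)"
    by (rule null_hadd[OF assms(1,2)]) (use assms null_Arr[OF assms(2)] in simp_all)
  then show ?thesis using assms null_Arr[OF assms(2)] by simp
qed

lemma null_hdiff_Comp_right:
  assumes "null (f \<boxminus> g)" "f \<in> Arr E" "g \<in> Arr E" "Dom E g = Dom E f" "Cod E g = Cod E f" "h \<in> Arr E" "Cod E h = Dom E f"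
  shows "null (f \<cdot> h \<boxminus> g \<cdot> h)"
  using null_Comp_right[OF assms(1,6)] assms by simp

lemma null_hdiff_Comp_left:
  assumes "null (f \<boxminus> g)" "f \<in> Arr E" "g \<in> Arr E" "Dom E g = Dom E f" "Cod E g = Cod E f" "h \<in> Arr E" "Dom E h = Cod E f"
  shows "null (h \<cdot> f \<boxminus> h \<cdot> g)"
  using null_Comp_left[OF assms(1,6)] assms by simp

lemma U_bijective_cong:
  assumes h: "U_bijective h" and k: "null (h \<boxminus> k)" "k \<in> Arr E" "Dom E k = Dom E h" "Cod E k = Cod E h"
  shows "U_bijective k"
  unfolding U_bijective_def
proof (intro conjI ballI impI)
  have hA: "h \<in> Arr E" using h by (simp add: U_bijective_def)
  show "k \<in> Arr E" by fact
  fix g assume g: "g \<in> Arr E" "Dom E g \<in> \<U>"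
  { assume c: "Cod E g = Dom E k" and "null (k \<cdot> g)"
    moreover have "null (h \<cdot> g \<boxminus> k \<cdot> g)" using null_hdiff_Comp_right[OF k(1) hA k(2-4) g(1)] c k by simp
    ultimately have "null (h \<cdot> g)" using null_of_hdiff g k hA by simp
    then show "null g" using h g c k unfolding U_bijective_def by auto }
  { assume c: "Cod E g = Cod E k"
    then obtain f where f: "f \<in> Arr E" "Dom E f = Dom E g" "Cod E f = Dom E h" "null (g \<boxminus> h \<cdot> f)"
      using h g k unfolding U_bijective_def by auto
    have "null (h \<cdot> f \<boxminus> k \<cdot> f)" using null_hdiff_Comp_right[OF k(1) hA k(2-4) f(1)] f by simp
    then have "null (g \<boxminus> k \<cdot> f)" using null_hdiff_trans[OF f(4)] f g c k hA by simp
    then show "\<exists>f \<in> Arr E. Dom E f = Dom E g \<and> Cod E f = Dom E k \<and> null (g \<boxminus> k \<cdot> f)" using f k by auto }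
qed

lemma U_bijective_Comp:
  assumes h: "U_bijective h" and k: "U_bijective k" and c: "Dom E k = Cod E h"
  shows "U_bijective (k \<cdot> h)"
  unfolding U_bijective_def
proof (intro conjI ballI impI)
  have A: "h \<in> Arr E" "k \<in> Arr E" using h k by (simp_all add: U_bijective_def)
  then show "k \<cdot> h \<in> Arr E" using c by simp
  fix g assume g: "g \<in> Arr E" "Dom E g \<in> \<U>"
  { assume d: "Cod E g = Dom E (k \<cdot> h)" and n: "null ((k \<cdot> h) \<cdot> g)"
    then have "null (k \<cdot> (h \<cdot> g))" "Cod E g = Dom E h" using A c g by simp_all
    then have "null (h \<cdot> g)" using k A c g unfolding U_bijective_def by auto
    then show "null g" using h \<open>Cod E g = Dom E h\<close> g unfolding U_bijective_def by auto }
  { assume d: "Cod E g = Cod E (k \<cdot> h)"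
    then have "Cod E g = Cod E k" using A c by simp
    then obtain f where f: "f \<in> Arr E" "Dom E f = Dom E g" "Cod E f = Dom E k" "null (g \<boxminus> k \<cdot> f)"
      using k g unfolding U_bijective_def by auto
    then obtain e where e: "e \<in> Arr E" "Dom E e = Dom E f" "Cod E e = Dom E h" "null (f \<boxminus> h \<cdot> e)"
      using h g c unfolding U_bijective_def by auto
    have "null (k \<cdot> f \<boxminus> k \<cdot> (h \<cdot> e))"
      using null_hdiff_Comp_left[OF e(4), of k] e f c A by simp
    then have "null (g \<boxminus> (k \<cdot> h) \<cdot> e)"
      using null_hdiff_trans[OF f(4), of "k \<cdot> (h \<cdot> e)"] e f c A g \<open>Cod E g = Cod E k\<close> by simp
    then show "\<exists>f \<in> Arr E. Dom E f = Dom E g \<and> Cod E f = Dom E (k \<cdot> h) \<and> null (g \<boxminus> (k \<cdot> h) \<cdot> f)"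
      using e f c A by auto }
qed

lemma U_bijective_null_inverse:
  assumes h: "h \<in> Arr E" "r \<in> Arr E" "Dom E r = Cod E h" "Cod E r = Dom E h"
    and n: "null (Id E (Dom E h) \<boxminus> r \<cdot> h)" "null (Id E (Cod E h) \<boxminus> h \<cdot> r)"
  shows "U_bijective h"
  unfolding U_bijective_def
proof (intro conjI ballI impI)
  show "h \<in> Arr E" by fact
  fix g assume g: "g \<in> Arr E" "Dom E g \<in> \<U>"
  { assume d: "Cod E g = Dom E h" and n0: "null (h \<cdot> g)"
    from n0 have 1: "null (r \<cdot> (h \<cdot> g))" by (rule null_Comp_left) (use h g d in simp_all)
    have 2: "null (g \<boxminus> r \<cdot> (h \<cdot> g))" using null_Comp_right[OF n(1) g(1)] h d g by simp
    show "null g" by (rule null_of_hdiff[OF 2 1]) (use h g d in simp_all) }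
  { assume d: "Cod E g = Cod E h"
    have "null (g \<boxminus> h \<cdot> (r \<cdot> g))" using null_Comp_right[OF n(2) g(1)] h d g by simp
    then show "\<exists>f \<in> Arr E. Dom E f = Dom E g \<and> Cod E f = Dom E h \<and> null (g \<boxminus> h \<cdot> f)"
      using h d g by (intro bexI[of _ "r \<cdot> g"]) simp_all }
qed

text \<open>Two weak cofibrations from one object into \<T> extend along each other. The composites
  agree with the identities on the given arrows, hence modulo null by
  \<open>wCof_extend_unique\<close>.\<close>

lemma U_bijective_wCof_comparison:
  assumes a: "a \<in> wCof E \<S>" "Cod E a \<in> \<T>" and b: "b \<in> wCof E \<S>" "Cod E b \<in> \<T>" "Dom E b = Dom E a"
    and h: "h \<in> Arr E" "Dom E h = Cod E a" "Cod E h = Cod E b" "h \<cdot> a = b"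
  shows "U_bijective h"
proof -
  have A: "a \<in> Arr E" "b \<in> Arr E" using a b by simp_all
  obtain r where r: "r \<in> Arr E" "Dom E r = Cod E b" "Cod E r = Cod E a" "r \<cdot> b = a"
    using wCof_extend[OF b(1) A(1) b(3)[symmetric] a(2)] .
  show ?thesis
  proof (rule U_bijective_null_inverse[OF h(1) r(1)])
    show "null (Id E (Dom E h) \<boxminus> r \<cdot> h)" by (rule wCof_extend_unique[OF a(1)]) (use r h A in simp_all)
    show "null (Id E (Cod E h) \<boxminus> h \<cdot> r)" by (rule wCof_extend_unique[OF b(1)]) (use r h A in simp_all)
  qed (use r h in simp_all)
qed

text \<open>For injectivity the second factor of a null \<open>q \<cdot> g\<close> is lifted along
  \<open>q\<close>; after subtraction \<open>g\<close> maps into the kernel, and arrows from \<U>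
  through \<V> are null. Surjectivity is lifting itself.\<close>

lemma U_bijective_wFib:
  assumes q: "q \<in> wFib E \<V>"
  shows "U_bijective q"
  unfolding U_bijective_def
proof (intro conjI ballI impI)
  obtain V x \<delta> where t: "V \<in> \<V>" "triangle E V x (Dom E q) q (Cod E q) \<delta>" using wFibE[OF q] .
  note d = triangleD[OF t(2)]
  show "q \<in> Arr E" using q by simp
  fix g assume g: "g \<in> Arr E" "Dom E g \<in> \<U>"
  { assume c: "Cod E g = Dom E q" and n: "null (q \<cdot> g)"
    from n obtain a b where ab: "a \<in> Arr E" "b \<in> Arr E" "Cod E a \<in> \<S>" "Dom E b = Cod E a" "q \<cdot> g = b \<cdot> a"
      by (auto simp: null_def)
    have dc: "Dom E a = Dom E g" "Cod E b = Cod E q"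
      using Comp_simps(2,3)[OF ab(1,2,4)] ab(5) Comp_simps(2,3)[OF g(1) d(8)] c by simp_all
    obtain b' where b': "b' \<in> Arr E" "Dom E b' = Dom E b" "Cod E b' = Dom E q" "q \<cdot> b' = b"
      using CP_lift[OF UV t(2,1) ab(2) dc(2)] ab(3,4) S_sub_U by auto
    define k where "k = g \<boxminus> b' \<cdot> a"
    have k: "k \<in> Arr E" "Dom E k = Dom E g" "Cod E k = Dom E q" using g c ab b' dc by (simp_all add: k_def)
    have "q \<cdot> k = hzero (Dom E k) (Cod E q)"
      using g c ab b' dc d(8) Comp_reassoc[OF b'(4), of a] k by (simp add: k_def)
    then obtain l where l: "l \<in> Arr E" "Dom E l = Dom E k" "Cod E l = V" "x \<cdot> l = k"
      using factor_through_kernel[OF t(2) k(1,3)] by metis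
    have "null (x \<cdot> l)" using l d k g t(1) V_sub_N by (intro null_through_N) simp_all
    moreover have "null (b' \<cdot> a)" using ab b' by (intro null_Comp_left nullI_cod) simp_all
    ultimately show "null g" using null_of_hdiff[of g "b' \<cdot> a"] l(4) g c ab b' dc by (simp add: k_def) }
  { assume c: "Cod E g = Cod E q"
    obtain f where f: "f \<in> Arr E" "Dom E f = Dom E g" "Cod E f = Dom E q" "q \<cdot> f = g"
      using CP_lift[OF UV t(2,1) g(1) c g(2)] .
    then show "\<exists>f \<in> Arr E. Dom E f = Dom E g \<and> Cod E f = Dom E q \<and> null (g \<boxminus> q \<cdot> f)"
      using g c \<open>q \<in> Arr E\<close> by (intro bexI[of _ f]) (simp_all add: null_hzero) }
qed

text \<open>The replacement of the target, precomposed with \<open>i\<close>, is a second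
  replacement of the source.\<close>

lemma U_bijective_extends_wCof:
  assumes i: "i \<in> wCof E \<S>" and h: "extends i h"
  shows "U_bijective h"
proof (rule U_bijective_wCof_comparison[of "jT (Dom E i)" "jT (Cod E i) \<cdot> i" h])
  show "jT (Cod E i) \<cdot> i \<in> wCof E \<S>" using i by (intro wCof_Comp) simp_all
qed (use i h in \<open>simp_all add: extends_def\<close>)

text \<open>\<open>wCof_wFib_interchange\<close> rewrites \<open>jT (Cod E p) \<cdot> p\<close> as a
  weak cofibration \<open>i\<close> followed by a weak fibration \<open>q\<close>. Their common
  object lies in \<T>, so \<open>i\<close> is another replacement of \<open>Dom E p\<close>; modulo
  null, \<open>h\<close> is a comparison of replacements followed by \<open>q\<close>.\<close>

lemma U_bijective_extends_wFib:
  assumes p: "p \<in> wFib E \<V>" and h: "extends p h"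
  shows "U_bijective h"
proof -
  have pA: "p \<in> Arr E" using p by simp
  obtain i q where iq: "i \<in> wCof E \<S>" "q \<in> wFib E \<V>" "Dom E i = Dom E p" "Dom E q = Cod E i"
    "Cod E q = TR (Cod E p)" "q \<cdot> i = jT (Cod E p) \<cdot> p"
    using wCof_wFib_interchange[OF p jT(1)[OF Cod_in[OF pA]] jT(2)[OF Cod_in[OF pA]]]
    unfolding jT(3)[OF Cod_in[OF pA]] .
  have iA: "i \<in> Arr E" "q \<in> Arr E" using iq by simp_all
  obtain V x \<delta> where "V \<in> \<V>" "triangle E V x (Cod E i) q (TR (Cod E p)) \<delta>"
    using wFibE[OF iq(2)] unfolding iq(4,5) .
  then have M: "Cod E i \<in> \<T>" using CP_right_extension[OF ST] V_sub_T jT(4)[OF Cod_in[OF pA]] by blast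
  obtain a where a: "a \<in> Arr E" "Dom E a = TR (Dom E p)" "Cod E a = Cod E i" "a \<cdot> jT (Dom E p) = i"
    using wCof_extend[of "jT (Dom E p)" i] iA M iq(3) pA by auto
  have "U_bijective a"
    by (rule U_bijective_wCof_comparison[of "jT (Dom E p)" i]) (use a M iq pA in simp_all)
  then have b: "U_bijective (q \<cdot> a)"
    using U_bijective_Comp[OF _ U_bijective_wFib[OF iq(2)]] a iq by simp
  show ?thesis
  proof (rule U_bijective_cong[OF b])
    show "null (q \<cdot> a \<boxminus> h)"
      by (rule wCof_extend_unique[of "jT (Dom E p)"]) (use a h iq iA pA in \<open>simp_all add: extends_def\<close>)
  qed (use a h iq iA in \<open>simp_all add: extends_def\<close>)
qed

lemma extends_Comp:
  assumes "extends f h" "extends g k" "f \<in> Arr E" "g \<in> Arr E" "Dom E g = Cod E f"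
  shows "extends (g \<cdot> f) (k \<cdot> h)"
proof -
  note h = assms(1)[unfolded extends_def] and k = assms(2)[unfolded extends_def]
  have "(k \<cdot> h) \<cdot> jT (Dom E f) = k \<cdot> (h \<cdot> jT (Dom E f))" by (rule Comp_assoc_simp) (use h k assms in simp_all)
  also have "h \<cdot> jT (Dom E f) = jT (Dom E g) \<cdot> f" using h assms(5) by simp
  also have "k \<cdot> (jT (Dom E g) \<cdot> f) = (jT (Cod E g) \<cdot> g) \<cdot> f"
    by (rule Comp_reassoc) (use k assms in simp_all)
  also have "\<dots> = jT (Cod E g) \<cdot> (g \<cdot> f)" by (rule Comp_assoc_simp) (use assms in simp_all)
  finally show ?thesis using h k assms unfolding extends_def by (simp del: Comp_assoc_simp)
qed

lemma U_bijective_extends_WW: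
  assumes w: "w \<in> WW E \<S> \<V>" and h: "extends w h"
  shows "U_bijective h"
proof -
  obtain i p where ip: "w = p \<cdot> i" "i \<in> wCof E \<S>" "p \<in> wFib E \<V>" "Dom E p = Cod E i"
    using w by (auto simp: WW_def)
  have A: "i \<in> Arr E" "p \<in> Arr E" "w \<in> Arr E" using ip WW_Arr[OF w] by simp_all
  obtain hi where hi: "extends i hi" using extends_ex[OF A(1)] .
  obtain hp where hp: "extends p hp" using extends_ex[OF A(2)] .
  have e: "extends w (hp \<cdot> hi)" unfolding ip(1) using extends_Comp[OF hi hp] A ip by simp
  have "U_bijective (hp \<cdot> hi)"
    by (rule U_bijective_Comp[OF U_bijective_extends_wCof[OF ip(2) hi] U_bijective_extends_wFib[OF ip(3) hp]])
      (use hi hp ip in \<open>simp add: extends_def\<close>)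
  then show ?thesis
    by (rule U_bijective_cong) (use extends_unique[OF A(3) e h] e h in \<open>simp_all add: extends_def\<close>)
qed

section \<open>The invariant: arrows from a fixed object to replacements, modulo null\<close>

definition hom_rel :: "'o \<Rightarrow> 'o \<Rightarrow> ('m \<times> 'm) set" where
  "hom_rel X Z = {(g, g'). g \<in> Hom E X Z \<and> g' \<in> Hom E X Z \<and> null (g \<boxminus> g')}"

text \<open>The graph of composition with an extension of \<open>f\<close>, saturated modulo null.
  By \<open>act_rel_iff\<close> every single extension describes it.\<close>

definition act_rel :: "'o \<Rightarrow> 'm \<Rightarrow> ('m \<times> 'm) set" where
  "act_rel X f = {(g, k). g \<in> Hom E X (TR (Dom E f)) \<and> k \<in> Hom E X (TR (Cod E f)) \<and>
     (\<exists>h. extends f h \<and> null (k \<boxminus> h \<cdot> g))}"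

lemma null_hdiff_self: "f \<in> Arr E \<Longrightarrow> null (f \<boxminus> f)"
  by (simp add: null_hzero)

lemma hom_rel_sym: "(g, k) \<in> hom_rel X Z \<Longrightarrow> (k, g) \<in> hom_rel X Z"
  unfolding hom_rel_def by (auto intro: null_hdiff_swap)

lemma hom_rel_trans: "(g, k) \<in> hom_rel X Z \<Longrightarrow> (k, l) \<in> hom_rel X Z \<Longrightarrow> (g, l) \<in> hom_rel X Z"
  unfolding hom_rel_def by (auto intro: null_hdiff_trans)

lemma hom_rel_idem: "hom_rel X Z O hom_rel X Z = hom_rel X Z"
proof
  show "hom_rel X Z \<subseteq> hom_rel X Z O hom_rel X Z"
  proof (rule subrelI)
    fix g k assume gk: "(g, k) \<in> hom_rel X Z"
    then have "(k, k) \<in> hom_rel X Z" using hom_rel_sym hom_rel_trans by blast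
    with gk show "(g, k) \<in> hom_rel X Z O hom_rel X Z" by (rule relcompI)
  qed
qed (use hom_rel_trans in blast)

lemma act_rel_iff:
  assumes "f \<in> Arr E" "extends f h"
  shows "(g, k) \<in> act_rel X f \<longleftrightarrow> g \<in> Hom E X (TR (Dom E f)) \<and> (k, h \<cdot> g) \<in> hom_rel X (TR (Cod E f))"
proof
  assume "(g, k) \<in> act_rel X f"
  then obtain h' where g: "g \<in> Hom E X (TR (Dom E f))" "k \<in> Hom E X (TR (Cod E f))" "extends f h'" "null (k \<boxminus> h' \<cdot> g)"
    by (auto simp: act_rel_def)
  have "null (h' \<cdot> g \<boxminus> h \<cdot> g)"
    using null_hdiff_Comp_right[OF extends_unique[OF assms(1) g(3) assms(2)], of g] g assms
    by (simp add: extends_def)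
  then have "null (k \<boxminus> h \<cdot> g)" using null_hdiff_trans[OF g(4)] g assms by (simp add: extends_def)
  then show "g \<in> Hom E X (TR (Dom E f)) \<and> (k, h \<cdot> g) \<in> hom_rel X (TR (Cod E f))"
    using g assms by (simp add: hom_rel_def extends_def)
qed (use assms in \<open>auto simp: act_rel_def hom_rel_def\<close>)

definition act :: "'o \<Rightarrow> 'm \<Rightarrow> ('m \<times> 'm) set \<times> ('m \<times> 'm) set \<times> ('m \<times> 'm) set" where
  "act X f = (hom_rel X (TR (Dom E f)), act_rel X f, hom_rel X (TR (Cod E f)))"

lemma hom_rel_D: "(g, k) \<in> hom_rel X Z \<Longrightarrow> g \<in> Hom E X Z \<and> k \<in> Hom E X Z \<and> null (g \<boxminus> k)"
  by (simp add: hom_rel_def)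

lemma hom_rel_refl: "g \<in> Hom E X Z \<Longrightarrow> (g, g) \<in> hom_rel X Z"
  using null_hdiff_self[of g] by (simp add: hom_rel_def del: hadd_neg)

lemma hom_rel_Comp:
  assumes "(g, k) \<in> hom_rel X Z" "h \<in> Arr E" "Dom E h = Z" "Cod E h = Z'"
  shows "(h \<cdot> g, h \<cdot> k) \<in> hom_rel X Z'"
  using assms null_hdiff_Comp_left[of g k h] by (simp add: hom_rel_def)

lemma act_functor:
  "is_functor E karoubi_rel (\<lambda>Z. hom_rel X (TR Z)) (act X)"
  unfolding is_functor_def
proof (intro conjI ballI impI)
  fix A show "hom_rel X (TR A) \<in> Ob karoubi_rel" by (simp add: karoubi_rel_def hom_rel_idem)
next
  fix f assume f: "f \<in> Arr E"
  obtain h where h: "extends f h" using extends_ex[OF f] .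
  note hd = h[unfolded extends_def]
  have "hom_rel X (TR (Dom E f)) O act_rel X f = act_rel X f" (is "?L = ?R")
  proof
    show "?L \<subseteq> ?R"
    proof (rule subrelI)
      fix g k assume "(g, k) \<in> ?L"
      then obtain g' where g': "(g, g') \<in> hom_rel X (TR (Dom E f))" "(g', k) \<in> act_rel X f" by blast
      then have "(k, h \<cdot> g') \<in> hom_rel X (TR (Cod E f))" by (simp add: act_rel_iff[OF f h])
      moreover have "(h \<cdot> g', h \<cdot> g) \<in> hom_rel X (TR (Cod E f))"
        using hom_rel_Comp[OF hom_rel_sym[OF g'(1)]] hd by blast
      ultimately show "(g, k) \<in> ?R"
        using hom_rel_trans hom_rel_D[OF g'(1)] unfolding act_rel_iff[OF f h] by blast
    qed
    show "?R \<subseteq> ?L"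
    proof (rule subrelI)
      fix g k assume gk: "(g, k) \<in> ?R"
      then have "(g, g) \<in> hom_rel X (TR (Dom E f))"
        unfolding act_rel_iff[OF f h] by (blast intro: hom_rel_refl)
      then show "(g, k) \<in> ?L" using gk by (rule relcompI)
    qed
  qed
  moreover have "act_rel X f O hom_rel X (TR (Cod E f)) = act_rel X f" (is "?L = ?R")
  proof
    show "?L \<subseteq> ?R"
    proof (rule subrelI)
      fix g k assume "(g, k) \<in> ?L"
      then obtain l where l: "(g, l) \<in> act_rel X f" "(l, k) \<in> hom_rel X (TR (Cod E f))" by blast
      then show "(g, k) \<in> ?R"
        unfolding act_rel_iff[OF f h] using hom_rel_trans[OF hom_rel_sym[OF l(2)]] by blast
    qed
    show "?R \<subseteq> ?L"
    proof (rule subrelI)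
      fix g k assume gk: "(g, k) \<in> ?R"
      then have "(k, k) \<in> hom_rel X (TR (Cod E f))"
        using hom_rel_refl hom_rel_D unfolding act_rel_iff[OF f h] by blast
      with gk show "(g, k) \<in> ?L" by (rule relcompI)
    qed
  qed
  ultimately show "act X f \<in> Hom karoubi_rel (hom_rel X (TR (Dom E f))) (hom_rel X (TR (Cod E f)))"
    by (simp add: act_def karoubi_rel_def hom_rel_idem)
next
  fix A assume A: "A \<in> Ob E"
  have e: "extends (Id E A) (Id E (TR A))" using A by (auto simp: extends_def)
  have "act_rel X (Id E A) = hom_rel X (TR A)"
  proof (rule rel_eqI)
    fix g k
    show "(g, k) \<in> act_rel X (Id E A) \<longleftrightarrow> (g, k) \<in> hom_rel X (TR A)"
      unfolding act_rel_iff[OF Id_simps(1)[OF A] e]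
      using A hom_rel_sym[of g k X "TR A"] hom_rel_sym[of k g X "TR A"] hom_rel_D[of g k X "TR A"] by auto
  qed
  then show "act X (Id E A) = Id karoubi_rel (hom_rel X (TR A))"
    using A by (simp add: act_def karoubi_rel_def)
next
  fix f g assume fg: "f \<in> Arr E" "g \<in> Arr E" "Cod E f = Dom E g"
  obtain h where h: "extends f h" using extends_ex[OF fg(1)] .
  obtain k where k: "extends g k" using extends_ex[OF fg(2)] .
  note hd = h[unfolded extends_def] and kd = k[unfolded extends_def]
  have e: "extends (g \<cdot> f) (k \<cdot> h)" using extends_Comp[OF h k] fg by simp
  have gf: "g \<cdot> f \<in> Arr E" using fg by simp
  have "act_rel X (g \<cdot> f) = act_rel X f O act_rel X g"
  proof (rule rel_eqI)
    fix a b
    have "(a, b) \<in> act_rel X f O act_rel X g" if ab: "(a, b) \<in> act_rel X (g \<cdot> f)"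
    proof (rule relcompI)
      have a: "a \<in> Hom E X (TR (Dom E f))" "(b, (k \<cdot> h) \<cdot> a) \<in> hom_rel X (TR (Cod E g))"
        using ab fg unfolding act_rel_iff[OF gf e] by simp_all
      have "h \<cdot> a \<in> Hom E X (TR (Cod E f))" using a(1) hd by simp
      then show "(a, h \<cdot> a) \<in> act_rel X f" using a(1) hom_rel_refl unfolding act_rel_iff[OF fg(1) h] by blast
      show "(h \<cdot> a, b) \<in> act_rel X g"
        using a hd kd fg unfolding act_rel_iff[OF fg(2) k] by simp
    qed
    moreover have "(a, b) \<in> act_rel X (g \<cdot> f)" if "(a, b) \<in> act_rel X f O act_rel X g"
    proof -
      from that obtain c where c: "(a, c) \<in> act_rel X f" "(c, b) \<in> act_rel X g" by blast
      then have a: "a \<in> Hom E X (TR (Dom E f))" "(c, h \<cdot> a) \<in> hom_rel X (TR (Cod E f))"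
        "(b, k \<cdot> c) \<in> hom_rel X (TR (Cod E g))"
        unfolding act_rel_iff[OF fg(1) h] act_rel_iff[OF fg(2) k] by simp_all
      have "(k \<cdot> c, k \<cdot> (h \<cdot> a)) \<in> hom_rel X (TR (Cod E g))"
        by (rule hom_rel_Comp[OF a(2)]) (use kd fg in auto)
      then have "(b, k \<cdot> (h \<cdot> a)) \<in> hom_rel X (TR (Cod E g))" by (rule hom_rel_trans[OF a(3)])
      then show ?thesis unfolding act_rel_iff[OF gf e] using a(1) hd kd fg by simp
    qed
    ultimately show "(a, b) \<in> act_rel X (g \<cdot> f) \<longleftrightarrow> (a, b) \<in> act_rel X f O act_rel X g" by blast
  qed
  then show "act X (g \<cdot> f) = act X g \<cdot>\<^bsub>karoubi_rel\<^esub> act X f"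
    using fg by (simp add: act_def karoubi_rel_def)
qed

text \<open>Injectivity and surjectivity of composition with \<open>h\<close> say that the graph and
  its converse compose to the two relations that serve as objects; so the converse relation is the
  inverse.\<close>

lemma act_iso:
  assumes X: "X \<in> \<U>" and w: "w \<in> WW E \<S> \<V>"
  shows "is_iso karoubi_rel (act X w)"
proof -
  have wA: "w \<in> Arr E" using WW_Arr[OF w] .
  obtain h where h: "extends w h" using extends_ex[OF wA] .
  note hd = h[unfolded extends_def]
  have bij: "U_bijective h" by (rule U_bijective_extends_WW[OF w h])
  let ?e = "hom_rel X (TR (Dom E w))" and ?e' = "hom_rel X (TR (Cod E w))" and ?R = "act_rel X w"
  interpret K: category karoubi_rel by (rule category_karoubi_rel)
  note F = is_functorD[OF act_functor[of X]]
  have "?e O ?R = ?R" "?R O ?e' = ?R"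
    using F(2)[OF wA] by (simp_all add: act_def karoubi_rel_def)
  then have c: "?e' O ?R\<inverse> = ?R\<inverse>" "?R\<inverse> O ?e = ?R\<inverse>"
  proof -
    assume a: "?e O ?R = ?R" "?R O ?e' = ?R"
    have s: "?e\<inverse> = ?e" "?e'\<inverse> = ?e'" using hom_rel_sym by auto
    show "?e' O ?R\<inverse> = ?R\<inverse>" "?R\<inverse> O ?e = ?R\<inverse>"
      using arg_cong[OF a(2), of converse] arg_cong[OF a(1), of converse] by (simp_all add: converse_relcomp s)
  qed
  have 1: "?R O ?R\<inverse> = ?e"
  proof (rule rel_eqI)
    fix g g'
    show "(g, g') \<in> ?R O ?R\<inverse> \<longleftrightarrow> (g, g') \<in> ?e"
    proof
      assume "(g, g') \<in> ?R O ?R\<inverse>"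
      then obtain k where k: "(g, k) \<in> ?R" "(g', k) \<in> ?R" by blast
      then have g: "g \<in> Hom E X (TR (Dom E w))" "g' \<in> Hom E X (TR (Dom E w))" "(h \<cdot> g, h \<cdot> g') \<in> ?e'"
        using hom_rel_sym hom_rel_trans unfolding act_rel_iff[OF wA h] by blast+
      have "null (h \<cdot> (g \<boxminus> g'))" using hom_rel_D[OF g(3)] g(1,2) hd by simp
      then have "null (g \<boxminus> g')"
        using bij g(1,2) hd X unfolding U_bijective_def by auto
      then show "(g, g') \<in> ?e" using g by (simp add: hom_rel_def)
    next
      assume g: "(g, g') \<in> ?e"
      have "(h \<cdot> g, h \<cdot> g') \<in> ?e'" by (rule hom_rel_Comp[OF g]) (use hd in auto)
      moreover have "(h \<cdot> g, h \<cdot> g) \<in> ?e'" by (rule hom_rel_refl) (use hom_rel_D[OF g] hd in simp)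
      ultimately have "(g, h \<cdot> g) \<in> ?R" "(g', h \<cdot> g) \<in> ?R"
        using hom_rel_D[OF g] unfolding act_rel_iff[OF wA h] by blast+
      then show "(g, g') \<in> ?R O ?R\<inverse>" by blast
    qed
  qed
  have 2: "?R\<inverse> O ?R = ?e'"
  proof (rule rel_eqI)
    fix k k'
    show "(k, k') \<in> ?R\<inverse> O ?R \<longleftrightarrow> (k, k') \<in> ?e'"
    proof
      assume "(k, k') \<in> ?R\<inverse> O ?R"
      then obtain g where "(g, k) \<in> ?R" "(g, k') \<in> ?R" by blast
      then show "(k, k') \<in> ?e'" using hom_rel_sym hom_rel_trans unfolding act_rel_iff[OF wA h] by blast
    next
      assume k: "(k, k') \<in> ?e'"
      note kD = hom_rel_D[OF k]
      obtain g where g: "g \<in> Arr E" "Dom E g = X" "Cod E g = Dom E h" "null (k \<boxminus> h \<cdot> g)"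
        using bij kD hd X unfolding U_bijective_def by auto
      then have "(k, h \<cdot> g) \<in> ?e'" using kD hd by (simp add: hom_rel_def)
      moreover from this have "(k', h \<cdot> g) \<in> ?e'" using hom_rel_sym[OF k] hom_rel_trans by blast
      ultimately have "(g, k) \<in> ?R" "(g, k') \<in> ?R"
        using g hd unfolding act_rel_iff[OF wA h] by simp_all
      then show "(k, k') \<in> ?R\<inverse> O ?R" by blast
    qed
  qed
  have "(?e', ?R\<inverse>, ?e) \<in> Arr karoubi_rel" using c by (simp add: karoubi_rel_def hom_rel_idem)
  then show ?thesis
    using F(2)[OF wA] 1 2
    by (intro K.is_isoI[where g = "(?e', ?R\<inverse>, ?e)"]) (simp_all add: act_def karoubi_rel_def)
qed

section \<open>Fullness and faithfulness of localization on arrows from \<U> to \<T>\<close>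

lemma TR_retraction:
  assumes "Y \<in> \<T>"
  obtains r where "r \<in> Arr E" "Dom E r = TR Y" "Cod E r = Y" "r \<cdot> jT Y = Id E Y"
proof -
  have Y: "Y \<in> Ob E" using assms by simp
  show thesis
    using wCof_extend[OF jT(1)[OF Y], of "Id E Y"] Y assms that by auto
qed

text \<open>The extension of \<open>act X\<close> to the localization cannot separate
  \<open>f\<close> from \<open>g\<close>. Evaluating both at \<open>jT X\<close>, as in the Yoneda
  lemma, compares the two arrows after replacement of the target, and a target in \<T> is a retract
  of its replacement.\<close>

theorem ell_eq_imp_null:
  assumes X: "X \<in> \<U>" and f: "f \<in> Arr E" "g \<in> Arr E" "Dom E f = X" "Dom E g = X" "Cod E g = Cod E f"
    and Y: "Cod E f \<in> \<T>" and e: "\<l> f = \<l> g"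
  shows "null (f \<boxminus> g)"
proof -
  let ?Y = "Cod E f"
  obtain G where G: "\<forall>f \<in> Arr E. G (\<l> f) = act X f"
    using localization_universal[OF category_karoubi_rel act_functor[of X] act_iso[OF X]]
    unfolding ell_def by blast
  then have "act X f = act X g" using f e by metis
  then have r: "act_rel X f = act_rel X g" by (simp add: act_def)
  obtain h where h: "extends f h" using extends_ex[OF f(1)] .
  obtain k where k: "extends g k" using extends_ex[OF f(2)] .
  have XO: "X \<in> Ob E" using X by simp
  have "jT ?Y \<cdot> f \<in> Hom E X (TR ?Y)" using f by simp
  then have "(jT X, jT ?Y \<cdot> f) \<in> act_rel X f"
    unfolding act_rel_iff[OF f(1) h] using h f XO hom_rel_refl[of "jT ?Y \<cdot> f" X "TR ?Y"] by (simp add: extends_def)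
  then have "(jT ?Y \<cdot> f, jT ?Y \<cdot> g) \<in> hom_rel X (TR ?Y)"
    unfolding r act_rel_iff[OF f(2) k] using k f by (simp add: extends_def)
  then have n: "null (jT ?Y \<cdot> f \<boxminus> jT ?Y \<cdot> g)" by (simp add: hom_rel_def)
  obtain r where r: "r \<in> Arr E" "Dom E r = TR ?Y" "Cod E r = ?Y" "r \<cdot> jT ?Y = Id E ?Y" using TR_retraction[OF Y] .
  have "null (r \<cdot> (jT ?Y \<cdot> f) \<boxminus> r \<cdot> (jT ?Y \<cdot> g))"
    by (rule null_hdiff_Comp_left[OF n]) (use f r in simp_all)
  then show ?thesis
    using Comp_reassoc[OF r(4), of f] Comp_reassoc[OF r(4), of g] f r by simp
qed

lemmas H_induct [consumes 1, case_names Id Fwd Bwd] =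
  localization_induct[where W = "WW E \<S> \<V>", folded loc_cat_def, folded ell_def]

text \<open>Along the zigzag an arrow of the original category into a replacement is carried from
  letter to letter. A forward letter composes it with an extension \<open>h\<close>; at a formal
  inverse it must be divided by \<open>h\<close> modulo null, which \<open>U_bijective\<close>
  permits.\<close>

theorem ell_full_TR:
  assumes "\<alpha> \<in> Arr \<H>" "Dom \<H> \<alpha> \<in> \<U>"
  obtains k where "k \<in> Arr E" "Dom E k = Dom \<H> \<alpha>" "Cod E k = TR (Cod \<H> \<alpha>)" "\<l> (jT (Cod \<H> \<alpha>)) \<bullet> \<alpha> = \<l> k"
proof -
  \<comment> \<open>The claim is generalized to a prefix \<gamma> that \<open>g\<close> already
    represents after replacement, because the induction peels off the letter traversed
    first.\<close>
  have *: "\<exists>k \<in> Arr E. Dom E k = Dom \<H> \<gamma> \<and> Cod E k = TR (Cod \<H> \<alpha>) \<and>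
      \<l> (jT (Cod \<H> \<alpha>)) \<bullet> (\<alpha> \<bullet> \<gamma>) = \<l> k"
    if "\<alpha> \<in> Arr \<H>" "\<gamma> \<in> Arr \<H>" "Cod \<H> \<gamma> = Dom \<H> \<alpha>" "Dom \<H> \<gamma> \<in> \<U>" "g \<in> Arr E"
      "Dom E g = Dom \<H> \<gamma>" "Cod E g = TR (Dom \<H> \<alpha>)" "\<l> (jT (Dom \<H> \<alpha>)) \<bullet> \<gamma> = \<l> g" for \<alpha> \<gamma> g
    using that
  proof (induction \<alpha> arbitrary: \<gamma> g rule: H_induct)
    case (Id A)
    then show ?case by auto
  next
    case (Fwd f \<beta>)
    obtain h where h: "extends f h" using extends_ex[OF Fwd(1)] .
    note hd = h[unfolded extends_def]
    have d: "Cod \<H> \<gamma> = Dom E f" using Fwd by simp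
    have s: "\<l> h \<bullet> \<l> (jT (Dom E f)) = \<l> (jT (Cod E f)) \<bullet> \<l> f"
      by (rule ell_square) (use hd Fwd(1) in auto)
    have "\<l> (jT (Cod E f)) \<bullet> (\<l> f \<bullet> \<gamma>) = (\<l> (jT (Cod E f)) \<bullet> \<l> f) \<bullet> \<gamma>"
      using Fwd d by simp
    also have "\<dots> = \<l> h \<bullet> (\<l> (jT (Dom E f)) \<bullet> \<gamma>)" unfolding s[symmetric] using Fwd d hd by simp
    also have "\<dots> = \<l> (h \<cdot> g)" using Fwd d hd ell_Comp[of g h] by simp
    finally have e: "\<l> (jT (Cod E f)) \<bullet> (\<l> f \<bullet> \<gamma>) = \<l> (h \<cdot> g)" .
    have "\<exists>k \<in> Arr E. Dom E k = Dom \<H> (\<l> f \<bullet> \<gamma>) \<and> Cod E k = TR (Cod \<H> \<beta>) \<and>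
      \<l> (jT (Cod \<H> \<beta>)) \<bullet> (\<beta> \<bullet> (\<l> f \<bullet> \<gamma>)) = \<l> k"
      by (rule Fwd.IH[of "\<l> f \<bullet> \<gamma>" "h \<cdot> g"]) (use Fwd d e hd in simp_all)
    then show ?case using Fwd d by simp
  next
    case (Bwd w \<beta>)
    obtain h where h: "extends w h" using extends_ex[OF Bwd(2)] .
    note hd = h[unfolded extends_def] and i = ell_iso(1)[OF Bwd(1)]
    have d: "Cod \<H> \<gamma> = Cod E w" "Cod E g = TR (Cod E w)" using Bwd i by simp_all
    have "U_bijective h" by (rule U_bijective_extends_WW[OF Bwd(1) h])
    \<comment> \<open>Division by \<open>h\<close> succeeds only modulo null; by
      \<open>null_diff_ell_eq\<close> the error disappears in the localization.\<close>
    then obtain g' where g': "g' \<in> Arr E" "Dom E g' = Dom E g" "Cod E g' = Dom E h" "null (g \<boxminus> h \<cdot> g')"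
      using Bwd hd d unfolding U_bijective_def by auto
    have s: "\<l> h \<bullet> \<l> (jT (Dom E w)) = \<l> (jT (Cod E w)) \<bullet> \<l> w"
      by (rule ell_square) (use hd Bwd(2) in auto)
    have ih: "is_iso \<H> (\<l> h)"
    proof (rule H.iso_of_iso_Comp_left)
      show "is_iso \<H> (\<l> (jT (Dom E w)))" using Bwd(2) by (simp add: ell_iso)
      show "is_iso \<H> (\<l> h \<bullet> \<l> (jT (Dom E w)))"
        unfolding s using Bwd(2) i by (intro H.iso_Comp) (simp_all add: ell_iso)
    qed (use hd Bwd(2) in simp_all)
    let ?\<gamma> = "inv_arr \<H> (\<l> w) \<bullet> \<gamma>"
    have \<gamma>: "?\<gamma> \<in> Arr \<H>" "Dom \<H> ?\<gamma> = Dom \<H> \<gamma>" "Cod \<H> ?\<gamma> = Dom E w" using Bwd d i by simp_all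
    have e: "\<l> (jT (Dom E w)) \<bullet> ?\<gamma> = \<l> g'"
    proof (rule H.iso_left_cancel[OF ih])
      have "\<l> h \<bullet> (\<l> (jT (Dom E w)) \<bullet> ?\<gamma>) = (\<l> h \<bullet> \<l> (jT (Dom E w))) \<bullet> ?\<gamma>"
        using \<gamma> hd Bwd(2) by (intro H.Comp_assoc_simp[symmetric]) simp_all
      also have "\<dots> = \<l> (jT (Cod E w)) \<bullet> \<gamma>" unfolding s using Bwd d i by simp
      also have "\<dots> = \<l> g" using Bwd i by simp
      also have "\<dots> = \<l> (h \<cdot> g')"
        by (rule null_diff_ell_eq[OF g'(4)]) (use g' hd Bwd d in simp_all)
      also have "\<dots> = \<l> h \<bullet> \<l> g'" using g' hd by (intro ell_Comp) simp_all
      finally show "\<l> h \<bullet> (\<l> (jT (Dom E w)) \<bullet> ?\<gamma>) = \<l> h \<bullet> \<l> g'" .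
    qed (use \<gamma> g' hd Bwd(2) in simp_all)
    have "\<exists>k \<in> Arr E. Dom E k = Dom \<H> ?\<gamma> \<and> Cod E k = TR (Cod \<H> \<beta>) \<and>
      \<l> (jT (Cod \<H> \<beta>)) \<bullet> (\<beta> \<bullet> ?\<gamma>) = \<l> k"
      by (rule Bwd.IH[of ?\<gamma> g']) (use Bwd \<gamma> e g' hd in simp_all)
    then show ?case using Bwd \<gamma> d i by simp
  qed
  have O: "Dom \<H> \<alpha> \<in> Ob E" using assms(2) by simp
  have "\<exists>k \<in> Arr E. Dom E k = Dom \<H> (Id \<H> (Dom \<H> \<alpha>)) \<and> Cod E k = TR (Cod \<H> \<alpha>) \<and>
      \<l> (jT (Cod \<H> \<alpha>)) \<bullet> (\<alpha> \<bullet> Id \<H> (Dom \<H> \<alpha>)) = \<l> k"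
    by (rule *[of \<alpha> _ "jT (Dom \<H> \<alpha>)"]) (use assms O in simp_all)
  then show thesis using that assms O by auto
qed

theorem ell_full:
  assumes "\<alpha> \<in> Arr \<H>" "Dom \<H> \<alpha> \<in> \<U>" "Cod \<H> \<alpha> \<in> \<T>"
  obtains k where "k \<in> Arr E" "Dom E k = Dom \<H> \<alpha>" "Cod E k = Cod \<H> \<alpha>" "\<alpha> = \<l> k"
proof -
  let ?Y = "Cod \<H> \<alpha>"
  have Y: "?Y \<in> Ob E" using assms(3) by simp
  obtain k where k: "k \<in> Arr E" "Dom E k = Dom \<H> \<alpha>" "Cod E k = TR ?Y" "\<l> (jT ?Y) \<bullet> \<alpha> = \<l> k"
    using ell_full_TR[OF assms(1,2)] .
  obtain r where r: "r \<in> Arr E" "Dom E r = TR ?Y" "Cod E r = ?Y" "r \<cdot> jT ?Y = Id E ?Y" using TR_retraction[OF assms(3)] .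
  have 1: "\<l> r \<bullet> \<l> (jT ?Y) = Id \<H> ?Y" using ell_Comp[of "jT ?Y" r] r Y by (simp add: ell_Id)
  have "\<alpha> = (\<l> r \<bullet> \<l> (jT ?Y)) \<bullet> \<alpha>" unfolding 1 using assms by simp
  also have "\<dots> = \<l> r \<bullet> (\<l> (jT ?Y) \<bullet> \<alpha>)" using r Y assms by (intro H.Comp_assoc_simp) simp_all
  also have "\<dots> = \<l> (r \<cdot> k)" unfolding k(4) using r k by (simp add: ell_Comp)
  finally have e: "\<alpha> = \<l> (r \<cdot> k)" .
  show thesis by (rule that[OF _ _ _ e]) (use k r in simp_all)
qed

text \<open>The target is arbitrary, so at first only \<open>f\<close> followed by its replacement
  arrow is null. That factorization lifts to \<open>S0\<close>, and \<open>f\<close> then passes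
  through a weak pullback \<open>P\<close> of \<open>S0\<close> and the target. \<open>P\<close> is
  the kernel of a deflation between objects of \<S>, hence in \<N>.\<close>

theorem ell_zero_imp_null:
  assumes f: "f \<in> Arr E" "Dom E f \<in> \<U>" "\<l> f = \<l> (hzero (Dom E f) (Cod E f))"
  shows "null f"
proof -
  let ?X = "Dom E f" and ?Z = "Cod E f"
  have "\<l> (jT ?Z \<cdot> f) = \<l> (jT ?Z) \<bullet> \<l> (hzero ?X ?Z)" using f(1) by (simp add: ell_Comp f(3)[symmetric])
  also have "\<dots> = \<l> (hzero ?X (TR ?Z))" using f(1) ell_Comp[of "hzero ?X ?Z" "jT ?Z"] by simp
  finally have "null (jT ?Z \<cdot> f \<boxminus> hzero ?X (TR ?Z))"
    using f(1,2) by (intro ell_eq_imp_null[of ?X]) simp_all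
  then have "null (jT ?Z \<cdot> f)" using f(1) by simp
  then obtain a b where ab: "a \<in> Arr E" "b \<in> Arr E" "Cod E a \<in> \<S>" "Dom E b = Cod E a" "jT ?Z \<cdot> f = b \<cdot> a"
    by (auto simp: null_def)
  have dc: "Dom E a = ?X" "Cod E b = TR ?Z"
    using Comp_simps(2,3)[OF ab(1,2,4)] ab(5) Comp_simps(2,3)[of f "jT ?Z"] f(1) by simp_all
  obtain T0 S0 t0 q \<theta> where q: "T0 \<in> \<T>" "S0 \<in> \<S>" "triangle E T0 t0 S0 q (TR ?Z) \<theta>"
    using CP_left_approx[OF ST in_Ob(2)[OF jT(4)[OF Cod_in[OF f(1)]]]] .
  note qd = triangleD[OF q(3)]
  obtain b' where b': "b' \<in> Arr E" "Dom E b' = Dom E b" "Cod E b' = S0" "q \<cdot> b' = b"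
    using CP_lift[OF ST q(3,1) ab(2) dc(2)] ab(3,4) by auto
  have O: "?Z \<in> Ob E" using f(1) by simp
  obtain S y \<sigma> where j: "S \<in> \<S>" "triangle E ?Z (jT ?Z) (TR ?Z) y S \<sigma>"
    using wCofE[OF jT(1)[OF O]] unfolding jT(2,3)[OF O] .
  have s: "b' \<cdot> a \<in> Arr E" "Cod E (b' \<cdot> a) = S0" "Dom E f = Dom E (b' \<cdot> a)" using b' ab dc by simp_all
  have sq: "jT ?Z \<cdot> f = q \<cdot> (b' \<cdot> a)"
    using Comp_reassoc[OF b'(4), of a] b' ab qd by simp
  obtain P c c' \<epsilon> e z where P: "triangle E P c S0 c' S \<epsilon>" "e \<in> Arr E" "Dom E e = P" "Cod E e = ?Z"
    "z \<in> Arr E" "Dom E z = Dom E (b' \<cdot> a)" "Cod E z = P" "e \<cdot> z = f"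
    using weak_pullback[OF q(3) j(2) s(1,2) f(1) refl s(3) sq] .
  have "P \<in> \<N>" by (rule N_kernel_S[OF P(1) q(2) j(1)])
  then have "null (e \<cdot> z)" using P s f(2) by (intro null_through_N) simp_all
  then show ?thesis using P(8) by simp
qed

end

section \<open>Zero objects and biproducts in the localization\<close>

context hovey_pair
begin

text \<open>By induction along zigzags the image of a zero arrow into or out of \<open>Z\<close>
  absorbs every arrow; since \<open>hzero Z Z\<close> is the identity, an arrow to or from
  \<open>Z\<close> must be that image.\<close>

lemma H_zero_object:
  assumes Z: "zero_object E Z"
  shows "zero_object \<H> Z"
proof -
  have ZO: "Z \<in> Ob E" using Z by (simp add: zero_object_def)
  have to: "\<l> (hzero (Cod \<H> \<alpha>) Z) \<bullet> \<alpha> = \<l> (hzero (Dom \<H> \<alpha>) Z)" if "\<alpha> \<in> Arr \<H>" for \<alpha>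
    using that
  proof (induction \<alpha> rule: H_induct)
    case (Id A)
    then show ?case using ZO by simp
  next
    case (Fwd f \<beta>)
    have "\<l> (hzero (Cod \<H> \<beta>) Z) \<bullet> (\<beta> \<bullet> \<l> f) = (\<l> (hzero (Cod \<H> \<beta>) Z) \<bullet> \<beta>) \<bullet> \<l> f"
      using Fwd(1-3) ZO H.Cod_in[OF Fwd(2)] by simp
    also have "\<dots> = \<l> (hzero (Dom E f) Z)" unfolding Fwd.IH using Fwd ZO ell_Comp[of f "hzero (Cod E f) Z"] by simp
    finally show ?case using Fwd by simp
  next
    case (Bwd w \<beta>)
    note i = ell_iso(1)[OF Bwd(1)]
    have "\<l> (hzero (Cod \<H> \<beta>) Z) \<bullet> (\<beta> \<bullet> inv_arr \<H> (\<l> w)) = (\<l> (hzero (Cod \<H> \<beta>) Z) \<bullet> \<beta>) \<bullet> inv_arr \<H> (\<l> w)"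
      using Bwd(1-4) ZO H.Cod_in[OF Bwd(3)] i by simp
    also have "\<l> (hzero (Cod \<H> \<beta>) Z) \<bullet> \<beta> = \<l> (hzero (Cod E w) Z) \<bullet> \<l> w"
      unfolding Bwd.IH using Bwd ZO ell_Comp[of w "hzero (Cod E w) Z"] by simp
    also have "(\<l> (hzero (Cod E w) Z) \<bullet> \<l> w) \<bullet> inv_arr \<H> (\<l> w) = \<l> (hzero (Cod E w) Z)"
      using Bwd ZO i by simp
    finally show ?case using Bwd i by simp
  qed
  have from_Z: "\<alpha> \<bullet> \<l> (hzero Z (Dom \<H> \<alpha>)) = \<l> (hzero Z (Cod \<H> \<alpha>))" if "\<alpha> \<in> Arr \<H>" for \<alpha>
    using that
  proof (induction \<alpha> rule: H_induct)
    case (Id A)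
    then show ?case using ZO by simp
  next
    case (Fwd f \<beta>)
    have "(\<beta> \<bullet> \<l> f) \<bullet> \<l> (hzero Z (Dom E f)) = \<beta> \<bullet> (\<l> f \<bullet> \<l> (hzero Z (Dom E f)))"
      using Fwd ZO by simp
    also have "\<l> f \<bullet> \<l> (hzero Z (Dom E f)) = \<l> (hzero Z (Cod E f))"
      using Fwd ZO ell_Comp[of "hzero Z (Dom E f)" f] by simp
    finally show ?case using Fwd by simp
  next
    case (Bwd w \<beta>)
    note i = ell_iso(1)[OF Bwd(1)]
    have "\<l> (hzero Z (Cod E w)) = \<l> w \<bullet> \<l> (hzero Z (Dom E w))"
      using Bwd ZO ell_Comp[of "hzero Z (Dom E w)" w] by simp
    then have "inv_arr \<H> (\<l> w) \<bullet> \<l> (hzero Z (Cod E w)) = \<l> (hzero Z (Dom E w))"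
      using Bwd ZO i by simp
    then show ?case using Bwd ZO i by simp
  qed
  show ?thesis
    unfolding zero_object_def
  proof (intro conjI ballI)
    show "Z \<in> Ob \<H>" using ZO by simp
    fix A assume A: "A \<in> Ob \<H>"
    show "\<exists>!f. f \<in> Hom \<H> A Z"
    proof (rule ex1I[of _ "\<l> (hzero A Z)"])
      fix \<alpha> assume a: "\<alpha> \<in> Hom \<H> A Z"
      have "hzero Z Z = Id E Z" using hzero_to[OF Z, of "Id E Z"] ZO by simp
      then show "\<alpha> = \<l> (hzero A Z)" using to[of \<alpha>] a ZO ell_Id[OF ZO] by simp
    qed (use A ZO in simp)
    show "\<exists>!f. f \<in> Hom \<H> Z A"
    proof (rule ex1I[of _ "\<l> (hzero Z A)"])
      fix \<alpha> assume a: "\<alpha> \<in> Hom \<H> Z A"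
      have "hzero Z Z = Id E Z" using hzero_to[OF Z, of "Id E Z"] ZO by simp
      then show "\<alpha> = \<l> (hzero Z A)" using from_Z[of \<alpha>] a ZO ell_Id[OF ZO] by simp
    qed (use A ZO in simp)
  qed
qed

lemma H_zero_arr_iff:
  assumes "\<alpha> \<in> Arr \<H>"
  shows "zero_arr \<H> \<alpha> \<longleftrightarrow> \<alpha> = \<l> (hzero (Dom \<H> \<alpha>) (Cod \<H> \<alpha>))"
proof -
  obtain Z where Z: "zero_object E Z" "Z \<in> Ob E" by (rule zero_object_E)
  note ZH = H_zero_object[OF Z(1)]
  have O: "Dom \<H> \<alpha> \<in> Ob E" "Cod \<H> \<alpha> \<in> Ob E" using H.Dom_in[OF assms] H.Cod_in[OF assms] by simp_all
  have z: "\<l> (hzero A B) = \<l> (hzero Z B) \<bullet> \<l> (hzero A Z)" if "A \<in> Ob E" "B \<in> Ob E" for A B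
    using that Z ell_Comp[of "hzero A Z" "hzero Z B"] by simp
  show ?thesis
  proof
    assume "zero_arr \<H> \<alpha>"
    then obtain Z' g h where z': "zero_object \<H> Z'" "g \<in> Arr \<H>" "Dom \<H> g = Dom \<H> \<alpha>" "Cod \<H> g = Z'"
      "h \<in> Arr \<H>" "Dom \<H> h = Z'" "Cod \<H> h = Cod \<H> \<alpha>" "\<alpha> = h \<bullet> g"
      unfolding zero_arr_def by auto
    have Z'O: "Z' \<in> Ob E" using z'(1) by (simp add: zero_object_def)
    have "g = \<l> (hzero Z Z') \<bullet> \<l> (hzero (Dom \<H> \<alpha>) Z)"
      by (rule H.zero_object_to[OF z'(1)]) (use z' O Z Z'O in simp_all)
    then have "\<alpha> = (h \<bullet> \<l> (hzero Z Z')) \<bullet> \<l> (hzero (Dom \<H> \<alpha>) Z)"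
      using z'(2-) O Z Z'O by (metis H.Comp_assoc_simp ell_simps hzero_simps)
    also have "h \<bullet> \<l> (hzero Z Z') = \<l> (hzero Z (Cod \<H> \<alpha>))"
      by (rule H.zero_object_from[OF ZH]) (use z'(2-7) O Z Z'O in simp_all)
    finally show "\<alpha> = \<l> (hzero (Dom \<H> \<alpha>) (Cod \<H> \<alpha>))" unfolding z[OF O] .
  next
    assume a: "\<alpha> = \<l> (hzero (Dom \<H> \<alpha>) (Cod \<H> \<alpha>))"
    have "\<l> (hzero (Dom \<H> \<alpha>) Z) \<in> Hom \<H> (Dom \<H> \<alpha>) Z" "\<l> (hzero Z (Cod \<H> \<alpha>)) \<in> Hom \<H> Z (Cod \<H> \<alpha>)"
      using O Z by simp_all
    moreover have "\<alpha> = \<l> (hzero Z (Cod \<H> \<alpha>)) \<bullet> \<l> (hzero (Dom \<H> \<alpha>) Z)" using a z[OF O] by simp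
    ultimately show "zero_arr \<H> \<alpha>" unfolding zero_arr_def using ZH by blast
  qed
qed

lemma U_replacement:
  assumes "Z \<in> Ob E"
  obtains q where "q \<in> wFib E \<V>" "q \<in> Arr E" "Dom E q \<in> \<U>" "Cod E q = Z"
proof -
  obtain Y X x y \<delta> where t: "Y \<in> \<V>" "X \<in> \<U>" "triangle E Y x X y Z \<delta>" using CP_left_approx[OF UV assms] .
  show thesis by (rule that[OF wFibI[OF t(3,1)]]) (use triangleD[OF t(3)] t in simp_all)
qed

lemma dsum_wCof:
  assumes i: "i \<in> wCof E \<S>" "Dom E i = A" "Cod E i = A'" and b: "biproduct E A B P iA iB pA pB"
    and b': "biproduct E A' B P' iA' iB' pA' pB'"
  shows "iB' \<cdot> pB \<boxplus> iA' \<cdot> (i \<cdot> pA) \<in> wCof E \<S>"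
proof -
  obtain S y \<delta> where t: "S \<in> \<S>" "triangle E A i A' y S \<delta>" using wCofE[OF i(1)] unfolding i(2,3) .
  show ?thesis
    by (rule wCofI[OF triangle_plus_middle_left[OF t(2) biproduct_swap[OF b] biproduct_swap[OF b']] t(1)])
qed

lemma dsum_wFib:
  assumes i: "p \<in> wFib E \<V>" "Dom E p = A" "Cod E p = A'" and b: "biproduct E A B P iA iB pA pB"
    and b': "biproduct E A' B P' iA' iB' pA' pB'"
  shows "iB' \<cdot> pB \<boxplus> iA' \<cdot> (p \<cdot> pA) \<in> wFib E \<V>"
proof -
  obtain V x \<delta> where t: "V \<in> \<V>" "triangle E V x A p A' \<delta>" using wFibE[OF i(1)] unfolding i(2,3) .
  show ?thesis
    by (rule wFibI[OF triangle_plus_left[OF t(2) biproduct_swap[OF b] biproduct_swap[OF b']] t(1)])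
qed

lemma ell_full_Hom:
  assumes "\<alpha> \<in> Hom \<H> X Y" "X \<in> \<U>" "Y \<in> \<T>"
  obtains k where "k \<in> Arr E" "Dom E k = X" "Cod E k = Y" "\<alpha> = \<l> k"
  using ell_full[of \<alpha>] assms unfolding Hom_iff by metis

text \<open>All arrows involved are images of arrows of the original category, so the matrix arrow
  solves the problem. A difference with null components is null by the decomposition of the identity
  of \<open>P\<close>, which gives uniqueness.\<close>

lemma H_product_TR:
  assumes b: "biproduct E A B P iA iB pA pB" and AB: "A \<in> \<T>" "B \<in> \<T>" and X: "X \<in> \<U>"
    and \<alpha>: "\<alpha> \<in> Hom \<H> X A" and \<beta>: "\<beta> \<in> Hom \<H> X B"
  shows "\<exists>!h. h \<in> Hom \<H> X P \<and> \<l> pA \<bullet> h = \<alpha> \<and> \<l> pB \<bullet> h = \<beta>"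
proof -
  note bd = biproductD[OF b] and be = biproduct_eqs[OF b] and bO = biproduct_Ob[OF b]
  have XO: "X \<in> Ob E" using X by simp
  have P: "P \<in> \<T>" by (rule CP_right_extension[OF ST triangle_biproduct[OF b] AB])
  obtain f where f: "f \<in> Arr E" "Dom E f = X" "Cod E f = A" "\<alpha> = \<l> f"
    using ell_full_Hom[OF \<alpha> X AB(1)] .
  obtain g where g: "g \<in> Arr E" "Dom E g = X" "Cod E g = B" "\<beta> = \<l> g"
    using ell_full_Hom[OF \<beta> X AB(2)] .
  let ?h = "iA \<cdot> f \<boxplus> iB \<cdot> g"
  have h: "?h \<in> Arr E" "Dom E ?h = X" "Cod E ?h = P" using bd(1-12) f g by simp_all
  have ph: "pA \<cdot> ?h = f" "pB \<cdot> ?h = g"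
    using bd(1-12) f g bO be XO Comp_reassoc[OF bd(13), of f] Comp_reassoc[OF be(2), of g]
      Comp_reassoc[OF bd(14), of g] Comp_reassoc[OF be(1), of f] by simp_all
  show ?thesis
  proof (rule ex1I[of _ "\<l> ?h"])
    show "\<l> ?h \<in> Hom \<H> X P \<and> \<l> pA \<bullet> \<l> ?h = \<alpha> \<and> \<l> pB \<bullet> \<l> ?h = \<beta>"
      using h ph ell_Comp[of ?h pA] ell_Comp[of ?h pB] bd(7-12) f(4) g(4) by simp
    fix \<gamma> assume \<gamma>: "\<gamma> \<in> Hom \<H> X P \<and> \<l> pA \<bullet> \<gamma> = \<alpha> \<and> \<l> pB \<bullet> \<gamma> = \<beta>"
    obtain k where k: "k \<in> Arr E" "Dom E k = X" "Cod E k = P" "\<gamma> = \<l> k"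
      using ell_full_Hom[OF conjunct1[OF \<gamma>] X P] .
    have "\<l> (pA \<cdot> k) = \<l> f" "\<l> (pB \<cdot> k) = \<l> g" using \<gamma> k bd(7-12) f(4) g(4) by (simp_all add: ell_Comp)
    then have nn: "null (pA \<cdot> k \<boxminus> f)" "null (pB \<cdot> k \<boxminus> g)"
      using bd(7-12) k f g AB X by (intro ell_eq_imp_null[of X]; simp)+
    have n: "null (iA \<cdot> (pA \<cdot> k \<boxminus> f) \<boxplus> iB \<cdot> (pB \<cdot> k \<boxminus> g))"
      by (rule null_hadd[OF null_Comp_left[OF nn(1)] null_Comp_left[OF nn(2)]])
        (use bd(1-12) k f g in \<open>simp_all del: Comp_hadd\<close>)
    have kk: "k = iA \<cdot> (pA \<cdot> k) \<boxplus> iB \<cdot> (pB \<cdot> k)"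
    proof -
      have "k = (iA \<cdot> pA \<boxplus> iB \<cdot> pB) \<cdot> k" unfolding be(3) using k by simp
      then show ?thesis using bd(1-12) k(1-3) by simp
    qed
    have "(k \<boxminus> ?h) = iA \<cdot> (pA \<cdot> k \<boxminus> f) \<boxplus> iB \<cdot> (pB \<cdot> k \<boxminus> g)"
    proof -
      have 1: "pA \<cdot> (k \<boxminus> ?h) = pA \<cdot> k \<boxminus> f" "pB \<cdot> (k \<boxminus> ?h) = pB \<cdot> k \<boxminus> g"
        using Comp_hadd(1)[of k "hneg ?h" pA] Comp_hadd(1)[of k "hneg ?h" pB] ph h k bd(7-12)
        by (simp_all del: Comp_hadd)
      have "(k \<boxminus> ?h) = (iA \<cdot> pA \<boxplus> iB \<cdot> pB) \<cdot> (k \<boxminus> ?h)" unfolding be(3) using k h by simp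
      also have "\<dots> = iA \<cdot> (pA \<cdot> (k \<boxminus> ?h)) \<boxplus> iB \<cdot> (pB \<cdot> (k \<boxminus> ?h))"
        using bd(1-12) k h Comp_hadd(2)[of "iA \<cdot> pA" "iB \<cdot> pB" "k \<boxminus> ?h"] by (simp del: Comp_hadd)
      finally show ?thesis unfolding 1 .
    qed
    then show "\<gamma> = \<l> ?h" using n k h null_diff_ell_eq[of k ?h] by simp
  qed
qed

lemma H_coproduct_U:
  assumes b: "biproduct E A B P iA iB pA pB" and AB: "A \<in> \<U>" "B \<in> \<U>" and X: "X \<in> \<T>"
    and \<alpha>: "\<alpha> \<in> Hom \<H> A X" and \<beta>: "\<beta> \<in> Hom \<H> B X"
  shows "\<exists>!h. h \<in> Hom \<H> P X \<and> h \<bullet> \<l> iA = \<alpha> \<and> h \<bullet> \<l> iB = \<beta>"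
proof -
  note bd = biproductD[OF b] and be = biproduct_eqs[OF b] and bO = biproduct_Ob[OF b]
  have XO: "X \<in> Ob E" using X by simp
  have P: "P \<in> \<U>" by (rule CP_left_extension[OF WIC_E UV triangle_biproduct[OF b] AB])
  obtain f where f: "f \<in> Arr E" "Dom E f = A" "Cod E f = X" "\<alpha> = \<l> f"
    using ell_full_Hom[OF \<alpha> AB(1) X] .
  obtain g where g: "g \<in> Arr E" "Dom E g = B" "Cod E g = X" "\<beta> = \<l> g"
    using ell_full_Hom[OF \<beta> AB(2) X] .
  let ?h = "f \<cdot> pA \<boxplus> g \<cdot> pB"
  have h: "?h \<in> Arr E" "Dom E ?h = P" "Cod E ?h = X" using bd(1-12) f g by simp_all
  have ph: "?h \<cdot> iA = f" "?h \<cdot> iB = g" using bd(1-14) f g bO be XO by simp_all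
  show ?thesis
  proof (rule ex1I[of _ "\<l> ?h"])
    show "\<l> ?h \<in> Hom \<H> P X \<and> \<l> ?h \<bullet> \<l> iA = \<alpha> \<and> \<l> ?h \<bullet> \<l> iB = \<beta>"
      using h ph ell_Comp[of iA ?h] ell_Comp[of iB ?h] bd(1-6) f(4) g(4) by simp
    fix \<gamma> assume \<gamma>: "\<gamma> \<in> Hom \<H> P X \<and> \<gamma> \<bullet> \<l> iA = \<alpha> \<and> \<gamma> \<bullet> \<l> iB = \<beta>"
    obtain k where k: "k \<in> Arr E" "Dom E k = P" "Cod E k = X" "\<gamma> = \<l> k"
      using ell_full_Hom[OF conjunct1[OF \<gamma>] P X] .
    have "\<l> (k \<cdot> iA) = \<l> f" "\<l> (k \<cdot> iB) = \<l> g" using \<gamma> k bd(1-6) f(4) g(4) by (simp_all add: ell_Comp)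
    then have nn: "null (k \<cdot> iA \<boxminus> f)" "null (k \<cdot> iB \<boxminus> g)"
      using ell_eq_imp_null[OF AB(1), of "k \<cdot> iA" f] ell_eq_imp_null[OF AB(2), of "k \<cdot> iB" g] bd(1-6) k f g X by simp_all
    have n: "null ((k \<cdot> iA \<boxminus> f) \<cdot> pA \<boxplus> (k \<cdot> iB \<boxminus> g) \<cdot> pB)"
      by (rule null_hadd[OF null_Comp_right[OF nn(1)] null_Comp_right[OF nn(2)]])
        (use bd(1-12) k f g in \<open>simp_all del: Comp_hadd\<close>)
    have "(k \<boxminus> ?h) = (k \<cdot> iA \<boxminus> f) \<cdot> pA \<boxplus> (k \<cdot> iB \<boxminus> g) \<cdot> pB"
    proof -
      have 1: "(k \<boxminus> ?h) \<cdot> iA = k \<cdot> iA \<boxminus> f" "(k \<boxminus> ?h) \<cdot> iB = k \<cdot> iB \<boxminus> g"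
        using Comp_hadd(2)[of k "hneg ?h" iA] Comp_hadd(2)[of k "hneg ?h" iB] ph h k bd(1-6)
        by (simp_all del: Comp_hadd)
      have "(k \<boxminus> ?h) = (k \<boxminus> ?h) \<cdot> (iA \<cdot> pA \<boxplus> iB \<cdot> pB)" unfolding be(3) using k h by simp
      also have "\<dots> = ((k \<boxminus> ?h) \<cdot> iA) \<cdot> pA \<boxplus> ((k \<boxminus> ?h) \<cdot> iB) \<cdot> pB"
        using bd(1-12) k h Comp_hadd(1)[of "iA \<cdot> pA" "iB \<cdot> pB" "k \<boxminus> ?h"] by (simp del: Comp_hadd)
      finally show ?thesis unfolding 1 .
    qed
    then show "\<gamma> = \<l> ?h" using n k h null_diff_ell_eq[of k ?h] by simp
  qed
qed

text \<open>The universal property of \<open>P\<close> in the localization is checked after replacing the source by an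
  object of $\mathcal{U}$ and the target by a sum of objects of $\mathcal{T}$, or vice versa.\<close>

lemma H_product:
  assumes b: "biproduct E A B P iA iB pA pB"
    and \<alpha>: "\<alpha> \<in> Hom \<H> X A" and \<beta>: "\<beta> \<in> Hom \<H> X B"
  shows "\<exists>!h. h \<in> Hom \<H> X P \<and> \<l> pA \<bullet> h = \<alpha> \<and> \<l> pB \<bullet> h = \<beta>"
proof -
  note bd = biproductD[OF b] and bO = biproduct_Ob[OF b]
  have XO: "X \<in> Ob E" using \<alpha> H.Dom_in[of \<alpha>] by auto
  obtain q where q: "q \<in> wFib E \<V>" "q \<in> Arr E" "Dom E q \<in> \<U>" "Cod E q = X" using U_replacement[OF XO] .
  obtain P1 i1 i1' p1 p1' where b1: "biproduct E (TR A) B P1 i1 i1' p1 p1'"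
    using biproduct_ex[of "TR A" B] bO by auto
  obtain P2 i2 i2' p2 p2' where b2: "biproduct E (TR A) (TR B) P2 i2 i2' p2 p2'"
    using biproduct_ex[of "TR A" "TR B"] bO by auto
  note d1 = biproductD[OF b1] biproduct_eqs[OF b1] biproduct_Ob[OF b1]
    and d2 = biproductD[OF b2] biproduct_eqs[OF b2] biproduct_Ob[OF b2]
  \<comment> \<open>\<open>j1\<close> replaces the first summand and \<open>j2\<close> the second;
    their composite \<open>w\<close> goes from \<open>P\<close> to the sum of the
    replacements.\<close>
  define j1 where "j1 = i1' \<cdot> pB \<boxplus> i1 \<cdot> (jT A \<cdot> pA)"
  define j2 where "j2 = i2 \<cdot> p1 \<boxplus> i2' \<cdot> (jT B \<cdot> p1')"
  have j: "j1 \<in> wCof E \<S>" "j2 \<in> wCof E \<S>"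
    unfolding j1_def j2_def
    using dsum_wCof[OF jT(1-3)[OF bO(1)] b b1]
      dsum_wCof[OF jT(1-3)[OF bO(2)] biproduct_swap[OF b1] biproduct_swap[OF b2]] by simp_all
  have jd: "j1 \<in> Arr E" "Dom E j1 = P" "Cod E j1 = P1" "j2 \<in> Arr E" "Dom E j2 = P1" "Cod E j2 = P2"
    using bd(1-12) d1(1-12) d2(1-12) bO by (simp_all add: j1_def j2_def)
  define w where "w = j2 \<cdot> j1"
  have w: "w \<in> Arr E" "Dom E w = P" "Cod E w = P2" using jd by (simp_all add: w_def)
  have wi: "is_iso \<H> (\<l> w)" using ell_iso(3)[OF wCof_Comp[OF j]] jd by (simp add: w_def)
  have p1j: "p1 \<cdot> j1 = jT A \<cdot> pA" "p1' \<cdot> j1 = pB"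
    using bd(1-12) d1 bO Comp_reassoc[OF d1(13), of "jT A \<cdot> pA"] Comp_reassoc[OF d1(14), of pB]
      Comp_reassoc[OF d1(17), of "jT A \<cdot> pA"] Comp_reassoc[OF d1(18), of pB] by (simp_all add: j1_def)
  have p2j: "p2 \<cdot> j2 = p1" "p2' \<cdot> j2 = jT B \<cdot> p1'"
    using d1(1-12) d2 bO Comp_reassoc[OF d2(13), of p1] Comp_reassoc[OF d2(14), of "jT B \<cdot> p1'"]
      Comp_reassoc[OF d2(17), of p1] Comp_reassoc[OF d2(18), of "jT B \<cdot> p1'"] by (simp_all add: j2_def)
  have pw: "p2 \<cdot> w = jT A \<cdot> pA" "p2' \<cdot> w = jT B \<cdot> pB"
    using Comp_reassoc[OF p2j(1), of j1] Comp_reassoc[OF p2j(2), of j1] p1j d1(1-12) d2(1-12) jd bO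
    by (simp_all add: w_def)
  have lw: "\<l> p2 \<bullet> \<l> w = \<l> (jT A) \<bullet> \<l> pA" "\<l> p2' \<bullet> \<l> w = \<l> (jT B) \<bullet> \<l> pB"
    using ell_square[OF pw(1)] ell_square[OF pw(2)] w d2(1-12) bd(1-12) bO by simp_all
  note ji = ell_iso(3)[OF jT(1)[OF bO(1)]] ell_iso(3)[OF jT(1)[OF bO(2)]] and qi = ell_iso(2)[OF q(1)]
  have ex: "\<exists>!h. h \<in> Hom \<H> (Dom E q) P2 \<and> \<l> p2 \<bullet> h = \<l> (jT A) \<bullet> (\<alpha> \<bullet> \<l> q) \<and> \<l> p2' \<bullet> h = \<l> (jT B) \<bullet> (\<beta> \<bullet> \<l> q)"
    by (rule H_product_TR[OF b2 _ _ q(3)]) (use \<alpha> \<beta> q bO in simp_all)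
  \<comment> \<open>Composing with the invertible \<open>\<l> w\<close> and \<open>\<l> q\<close>
    turns the conditions on \<open>h\<close> into those of the replaced problem, where
    \<open>ex\<close> applies.\<close>
  have iff: "(\<l> p2 \<bullet> (\<l> w \<bullet> (h \<bullet> \<l> q)) = \<l> (jT A) \<bullet> (\<alpha> \<bullet> \<l> q)) = (\<l> pA \<bullet> h = \<alpha>)"
    "(\<l> p2' \<bullet> (\<l> w \<bullet> (h \<bullet> \<l> q)) = \<l> (jT B) \<bullet> (\<beta> \<bullet> \<l> q)) = (\<l> pB \<bullet> h = \<beta>)"
    if h: "h \<in> Hom \<H> X P" for h
  proof -
    have "\<l> p2 \<bullet> (\<l> w \<bullet> (h \<bullet> \<l> q)) = (\<l> (jT A) \<bullet> \<l> pA) \<bullet> (h \<bullet> \<l> q)"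
      by (rule H.Comp_reassoc[OF lw(1)]) (use h w d2(1-12) q in simp_all)
    also have "\<dots> = \<l> (jT A) \<bullet> ((\<l> pA \<bullet> h) \<bullet> \<l> q)" using h q bd(1-12) bO by simp
    finally have e1: "\<l> p2 \<bullet> (\<l> w \<bullet> (h \<bullet> \<l> q)) = \<l> (jT A) \<bullet> ((\<l> pA \<bullet> h) \<bullet> \<l> q)" .
    have "\<l> p2' \<bullet> (\<l> w \<bullet> (h \<bullet> \<l> q)) = (\<l> (jT B) \<bullet> \<l> pB) \<bullet> (h \<bullet> \<l> q)"
      by (rule H.Comp_reassoc[OF lw(2)]) (use h w d2(1-12) q in simp_all)
    also have "\<dots> = \<l> (jT B) \<bullet> ((\<l> pB \<bullet> h) \<bullet> \<l> q)" using h q bd(1-12) bO by simp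
    finally have e2: "\<l> p2' \<bullet> (\<l> w \<bullet> (h \<bullet> \<l> q)) = \<l> (jT B) \<bullet> ((\<l> pB \<bullet> h) \<bullet> \<l> q)" .
    have t: "\<l> pA \<bullet> h \<in> Hom \<H> X A" "\<l> pB \<bullet> h \<in> Hom \<H> X B" using h bd(1-12) by simp_all
    have c: "u = v" if "\<l> (jT Y) \<bullet> (u \<bullet> \<l> q) = \<l> (jT Y) \<bullet> (v \<bullet> \<l> q)" "u \<in> Hom \<H> X Y" "v \<in> Hom \<H> X Y" "Y \<in> Ob E" for u v Y
    proof -
      have "u \<bullet> \<l> q = v \<bullet> \<l> q"
        by (rule H.iso_left_cancel[OF ell_iso(3)[OF jT(1)[OF that(4)]] _ _ _ _ that(1)]) (use that q in simp_all)
      then show ?thesis by (rule H.iso_right_cancel[OF qi, rotated -1]) (use that q in simp_all)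
    qed
    show "(\<l> p2 \<bullet> (\<l> w \<bullet> (h \<bullet> \<l> q)) = \<l> (jT A) \<bullet> (\<alpha> \<bullet> \<l> q)) = (\<l> pA \<bullet> h = \<alpha>)"
      unfolding e1 using c[OF _ t(1) \<alpha> bO(1)] by metis
    show "(\<l> p2' \<bullet> (\<l> w \<bullet> (h \<bullet> \<l> q)) = \<l> (jT B) \<bullet> (\<beta> \<bullet> \<l> q)) = (\<l> pB \<bullet> h = \<beta>)"
      unfolding e2 using c[OF _ t(2) \<beta> bO(2)] by metis
  qed
  obtain h0 where h0: "h0 \<in> Hom \<H> (Dom E q) P2" "\<l> p2 \<bullet> h0 = \<l> (jT A) \<bullet> (\<alpha> \<bullet> \<l> q)" "\<l> p2' \<bullet> h0 = \<l> (jT B) \<bullet> (\<beta> \<bullet> \<l> q)"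
    using ex by blast
  define h where "h = inv_arr \<H> (\<l> w) \<bullet> (h0 \<bullet> inv_arr \<H> (\<l> q))"
  have h: "h \<in> Hom \<H> X P" using h0(1) wi qi w q by (simp add: h_def)
  have hh: "\<l> w \<bullet> (h \<bullet> \<l> q) = h0" using h0(1) wi qi w q by (simp add: h_def)
  show ?thesis
  proof (rule ex1I[of _ h])
    show "h \<in> Hom \<H> X P \<and> \<l> pA \<bullet> h = \<alpha> \<and> \<l> pB \<bullet> h = \<beta>"
      using h iff[OF h] h0 unfolding hh by simp
    fix k assume k: "k \<in> Hom \<H> X P \<and> \<l> pA \<bullet> k = \<alpha> \<and> \<l> pB \<bullet> k = \<beta>"
    then have kH: "k \<in> Hom \<H> X P" by simp
    have "\<l> w \<bullet> (k \<bullet> \<l> q) \<in> Hom \<H> (Dom E q) P2" using kH w q by simp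
    then have "\<l> w \<bullet> (k \<bullet> \<l> q) = h0" using iff[OF kH] k h0 ex by blast
    then have "\<l> w \<bullet> (k \<bullet> \<l> q) = \<l> w \<bullet> (h \<bullet> \<l> q)" unfolding hh .
    then have "k \<bullet> \<l> q = h \<bullet> \<l> q" by (rule H.iso_left_cancel[OF wi, rotated -1]) (use kH h w q in simp_all)
    then show "k = h" by (rule H.iso_right_cancel[OF qi, rotated -1]) (use kH h q in simp_all)
  qed
qed

lemma H_coproduct:
  assumes b: "biproduct E A B P iA iB pA pB"
    and \<alpha>: "\<alpha> \<in> Hom \<H> A X" and \<beta>: "\<beta> \<in> Hom \<H> B X"
  shows "\<exists>!h. h \<in> Hom \<H> P X \<and> h \<bullet> \<l> iA = \<alpha> \<and> h \<bullet> \<l> iB = \<beta>"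
proof -
  note bd = biproductD[OF b] and bO = biproduct_Ob[OF b]
  have XO: "X \<in> Ob E" using \<alpha> H.Cod_in[of \<alpha>] by auto
  obtain qA where qA: "qA \<in> wFib E \<V>" "qA \<in> Arr E" "Dom E qA \<in> \<U>" "Cod E qA = A" using U_replacement[OF bO(1)] .
  obtain qB where qB: "qB \<in> wFib E \<V>" "qB \<in> Arr E" "Dom E qB \<in> \<U>" "Cod E qB = B" using U_replacement[OF bO(2)] .
  obtain P1 i1 i1' p1 p1' where b1: "biproduct E (Dom E qA) B P1 i1 i1' p1 p1'"
    using biproduct_ex[of "Dom E qA" B] bO qA by auto
  obtain P2 i2 i2' p2 p2' where b2: "biproduct E (Dom E qA) (Dom E qB) P2 i2 i2' p2 p2'"
    using biproduct_ex[of "Dom E qA" "Dom E qB"] bO qA qB by auto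
  note d1 = biproductD[OF b1] biproduct_eqs[OF b1] biproduct_Ob[OF b1]
    and d2 = biproductD[OF b2] biproduct_eqs[OF b2] biproduct_Ob[OF b2]
  \<comment> \<open>Here the two summands are replaced by objects of \<U>, one at a time; the target
    is replaced through \<open>jT X\<close>.\<close>
  define q1 where "q1 = iB \<cdot> p1' \<boxplus> iA \<cdot> (qA \<cdot> p1)"
  define q2 where "q2 = i1 \<cdot> p2 \<boxplus> i1' \<cdot> (qB \<cdot> p2')"
  have j: "q1 \<in> wFib E \<V>" "q2 \<in> wFib E \<V>"
    unfolding q1_def q2_def
    using dsum_wFib[OF qA(1) refl qA(4) b1 b]
      dsum_wFib[OF qB(1) refl qB(4) biproduct_swap[OF b2] biproduct_swap[OF b1]] by simp_all
  have jd: "q1 \<in> Arr E" "Dom E q1 = P1" "Cod E q1 = P" "q2 \<in> Arr E" "Dom E q2 = P2" "Cod E q2 = P1"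
    using bd(1-12) d1(1-12) d2(1-12) bO qA qB by (simp_all add: q1_def q2_def)
  define w where "w = q1 \<cdot> q2"
  have w: "w \<in> Arr E" "Dom E w = P2" "Cod E w = P" using jd by (simp_all add: w_def)
  have wi: "is_iso \<H> (\<l> w)" using ell_iso(2)[OF wFib_Comp[OF j(2,1)]] jd by (simp add: w_def)
  have q1i: "q1 \<cdot> i1 = iA \<cdot> qA" "q1 \<cdot> i1' = iB"
    using bd(1-12) d1 bO qA by (simp_all add: q1_def)
  have q2i: "q2 \<cdot> i2 = i1" "q2 \<cdot> i2' = i1' \<cdot> qB"
    using d1(1-12,20-) d2 bO qA qB by (simp_all add: q2_def)
  have pw: "w \<cdot> i2 = iA \<cdot> qA" "w \<cdot> i2' = iB \<cdot> qB"
    using q1i q2i Comp_reassoc[OF q1i(2), of qB] d1(1-12) d2(1-12) jd bO qB by (simp_all add: w_def)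
  have lw: "\<l> w \<bullet> \<l> i2 = \<l> iA \<bullet> \<l> qA" "\<l> w \<bullet> \<l> i2' = \<l> iB \<bullet> \<l> qB"
    using ell_square[OF pw(1)] ell_square[OF pw(2)] w d2(1-12) bd(1-12) bO qA qB by simp_all
  note qi = ell_iso(2)[OF qA(1)] ell_iso(2)[OF qB(1)] and ji = ell_iso(3)[OF jT(1)[OF XO]]
  let ?j = "\<l> (jT X)"
  have ex: "\<exists>!h. h \<in> Hom \<H> P2 (TR X) \<and> h \<bullet> \<l> i2 = ?j \<bullet> (\<alpha> \<bullet> \<l> qA) \<and> h \<bullet> \<l> i2' = ?j \<bullet> (\<beta> \<bullet> \<l> qB)"
    by (rule H_coproduct_U[OF b2 qA(3) qB(3)]) (use \<alpha> \<beta> qA qB XO in simp_all)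
  have iff: "((?j \<bullet> (h \<bullet> \<l> w)) \<bullet> \<l> i2 = ?j \<bullet> (\<alpha> \<bullet> \<l> qA)) = (h \<bullet> \<l> iA = \<alpha>)"
    "((?j \<bullet> (h \<bullet> \<l> w)) \<bullet> \<l> i2' = ?j \<bullet> (\<beta> \<bullet> \<l> qB)) = (h \<bullet> \<l> iB = \<beta>)"
    if h: "h \<in> Hom \<H> P X" for h
  proof -
    have "(?j \<bullet> (h \<bullet> \<l> w)) \<bullet> \<l> i2 = ?j \<bullet> (h \<bullet> (\<l> w \<bullet> \<l> i2))" using h w d2(1-12) XO by simp
    also have "\<dots> = ?j \<bullet> ((h \<bullet> \<l> iA) \<bullet> \<l> qA)" unfolding lw using h bd(1-12) qA by simp
    finally have e1: "(?j \<bullet> (h \<bullet> \<l> w)) \<bullet> \<l> i2 = ?j \<bullet> ((h \<bullet> \<l> iA) \<bullet> \<l> qA)" .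
    have "(?j \<bullet> (h \<bullet> \<l> w)) \<bullet> \<l> i2' = ?j \<bullet> (h \<bullet> (\<l> w \<bullet> \<l> i2'))" using h w d2(1-12) XO by simp
    also have "\<dots> = ?j \<bullet> ((h \<bullet> \<l> iB) \<bullet> \<l> qB)" unfolding lw using h bd(1-12) qB by simp
    finally have e2: "(?j \<bullet> (h \<bullet> \<l> w)) \<bullet> \<l> i2' = ?j \<bullet> ((h \<bullet> \<l> iB) \<bullet> \<l> qB)" .
    have t: "h \<bullet> \<l> iA \<in> Hom \<H> A X" "h \<bullet> \<l> iB \<in> Hom \<H> B X" using h bd(1-12) by simp_all
    have c: "u = v" if "?j \<bullet> (u \<bullet> \<l> q) = ?j \<bullet> (v \<bullet> \<l> q)" "u \<in> Hom \<H> Y X" "v \<in> Hom \<H> Y X"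
      "q \<in> wFib E \<V>" "Cod E q = Y" for u v Y q
    proof -
      have "u \<bullet> \<l> q = v \<bullet> \<l> q"
        by (rule H.iso_left_cancel[OF ji _ _ _ _ that(1)]) (use that XO in simp_all)
      then show ?thesis by (rule H.iso_right_cancel[OF ell_iso(2)[OF that(4)], rotated -1]) (use that in simp_all)
    qed
    show "((?j \<bullet> (h \<bullet> \<l> w)) \<bullet> \<l> i2 = ?j \<bullet> (\<alpha> \<bullet> \<l> qA)) = (h \<bullet> \<l> iA = \<alpha>)"
      unfolding e1 using c[OF _ t(1) \<alpha> qA(1,4)] by metis
    show "((?j \<bullet> (h \<bullet> \<l> w)) \<bullet> \<l> i2' = ?j \<bullet> (\<beta> \<bullet> \<l> qB)) = (h \<bullet> \<l> iB = \<beta>)"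
      unfolding e2 using c[OF _ t(2) \<beta> qB(1,4)] by metis
  qed
  obtain h0 where h0: "h0 \<in> Hom \<H> P2 (TR X)" "h0 \<bullet> \<l> i2 = ?j \<bullet> (\<alpha> \<bullet> \<l> qA)" "h0 \<bullet> \<l> i2' = ?j \<bullet> (\<beta> \<bullet> \<l> qB)"
    using ex by blast
  define h where "h = inv_arr \<H> ?j \<bullet> (h0 \<bullet> inv_arr \<H> (\<l> w))"
  have h: "h \<in> Hom \<H> P X" using h0(1) wi ji w XO by (simp add: h_def)
  have hh: "?j \<bullet> (h \<bullet> \<l> w) = h0" using h0(1) wi ji w XO by (simp add: h_def)
  show ?thesis
  proof (rule ex1I[of _ h])
    show "h \<in> Hom \<H> P X \<and> h \<bullet> \<l> iA = \<alpha> \<and> h \<bullet> \<l> iB = \<beta>"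
      using h iff[OF h] h0 unfolding hh by simp
    fix k assume k: "k \<in> Hom \<H> P X \<and> k \<bullet> \<l> iA = \<alpha> \<and> k \<bullet> \<l> iB = \<beta>"
    then have kH: "k \<in> Hom \<H> P X" by simp
    have "?j \<bullet> (k \<bullet> \<l> w) \<in> Hom \<H> P2 (TR X)" using kH w XO by simp
    then have "?j \<bullet> (k \<bullet> \<l> w) = h0" using iff[OF kH] k h0 ex by blast
    then have "?j \<bullet> (k \<bullet> \<l> w) = ?j \<bullet> (h \<bullet> \<l> w)" unfolding hh .
    then have "k \<bullet> \<l> w = h \<bullet> \<l> w" by (rule H.iso_left_cancel[OF ji, rotated -1]) (use kH h w XO in simp_all)
    then show "k = h" by (rule H.iso_right_cancel[OF wi, rotated -1]) (use kH h w in simp_all)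
  qed
qed

theorem H_biproduct:
  assumes b: "biproduct E A B P iA iB pA pB"
  shows "biproduct \<H> A B P (\<l> iA) (\<l> iB) (\<l> pA) (\<l> pB)"
proof -
  note bd = biproductD[OF b] and be = biproduct_eqs[OF b] and bO = biproduct_Ob[OF b]
  show ?thesis
    unfolding biproduct_def
  proof (intro conjI allI ballI)
    show "\<l> pA \<bullet> \<l> iA = Id \<H> A" "\<l> pB \<bullet> \<l> iB = Id \<H> B"
      using bd bO ell_Comp[of iA pA] ell_Comp[of iB pB] by (simp_all add: ell_Id)
    have "\<l> pB \<bullet> \<l> iA = \<l> (hzero A B)" "\<l> pA \<bullet> \<l> iB = \<l> (hzero B A)"
      using bd(1-12) be ell_Comp[of iA pB] ell_Comp[of iB pA] by simp_all
    then show "zero_arr \<H> (\<l> pB \<bullet> \<l> iA)" "zero_arr \<H> (\<l> pA \<bullet> \<l> iB)"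
      using bO by (simp_all add: H_zero_arr_iff)
    show "\<l> iA \<in> Hom \<H> A P" "\<l> iB \<in> Hom \<H> B P" "\<l> pA \<in> Hom \<H> P A" "\<l> pB \<in> Hom \<H> P B"
      using bd(1-12) by simp_all
  next
    fix X f g assume "f \<in> Hom \<H> X A" "g \<in> Hom \<H> X B"
    then show "\<exists>!h. h \<in> Hom \<H> X P \<and> \<l> pA \<bullet> h = f \<and> \<l> pB \<bullet> h = g" by (rule H_product[OF b])
  next
    fix X f g assume "f \<in> Hom \<H> A X" "g \<in> Hom \<H> B X"
    then show "\<exists>!h. h \<in> Hom \<H> P X \<and> h \<bullet> \<l> iA = f \<and> h \<bullet> \<l> iB = g" by (rule H_coproduct[OF b])
  qed
qed

end

section \<open>The shift functor and the connecting arrows\<close>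

context hovey_pair
begin

lemma wFib_isomorphic: "p \<in> wFib E \<V> \<Longrightarrow> isomorphic \<H> (Dom E p) (Cod E p)"
  using H.isomorphicI[OF ell_iso(2)[of p]] wFib_Arr[of p] by simp

lemma wCof_isomorphic: "i \<in> wCof E \<S> \<Longrightarrow> isomorphic \<H> (Dom E i) (Cod E i)"
  using H.isomorphicI[OF ell_iso(3)[of i]] wCof_Arr[of i] by simp

lemma inflation_N_isomorphic:
  assumes "triangle E A x B y X \<delta>" "X \<in> \<N>"
  shows "isomorphic \<H> A B"
proof -
  obtain i p where "i \<in> wCof E \<S>" "p \<in> wFib E \<V>" "Dom E i = A" "Dom E p = Cod E i" "Cod E p = B"
    using inflation_N[OF assms] by metis
  then show ?thesis using wCof_isomorphic[of i] wFib_isomorphic[of p] H.isomorphic_trans by metis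
qed

lemma deflation_N_iso:
  assumes "triangle E A x B y X \<delta>" "A \<in> \<N>"
  shows "is_iso \<H> (\<l> y)"
proof -
  obtain i p where ip: "i \<in> wCof E \<S>" "p \<in> wFib E \<V>" "Dom E i = B" "Dom E p = Cod E i" "p \<cdot> i = y"
    using deflation_N[OF assms] by metis
  have "\<l> y = \<l> p \<bullet> \<l> i" unfolding ip(5)[symmetric] using ip by (intro ell_Comp) simp_all
  then show ?thesis using H.iso_Comp(1)[OF ell_iso(3)[OF ip(1)] ell_iso(2)[OF ip(2)]] ip by simp
qed

lemma coextension_morphism:
  assumes t: "triangle E A v V u U \<delta>" "U \<in> \<U>" and t': "triangle E A' v' V' u' U' \<delta>'" "V' \<in> \<V>"
    and f: "f \<in> Arr E" "Dom E f = A" "Cod E f = A'"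
  obtains c where "c \<in> Arr E" "Dom E c = U" "Cod E c = U'" "push E U f \<delta> = pull E A' c \<delta>'"
proof -
  note d = triangleD[OF t(1)] triangleD[OF t'(1)]
  have vf: "v' \<cdot> f \<in> Arr E" "Dom E (v' \<cdot> f) = A" "Cod E (v' \<cdot> f) = V'" using d f by simp_all
  obtain b where b: "b \<in> Arr E" "Dom E b = V" "Cod E b = V'" "b \<cdot> v = v' \<cdot> f"
    using CP_extend[OF UV t vf(1,2)] vf(3) t'(2) by metis
  show thesis using ET3'[OF t(1) t'(1) f b] that by metis
qed

text \<open>Equality of the pullbacks lets the difference lift to \<open>V'\<close>; an arrow from
  \<U> through \<V> is null.\<close>

lemma coextension_unique:
  assumes t': "triangle E A' v' V' u' U' \<delta>'" "V' \<in> \<V>"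
    and c: "c \<in> Arr E" "c' \<in> Arr E" "Dom E c \<in> \<U>" "Dom E c' = Dom E c" "Cod E c = U'" "Cod E c' = U'"
    "pull E A' c \<delta>' = pull E A' c' \<delta>'"
  shows "\<l> c = \<l> c'"
proof (rule null_diff_ell_eq)
  note d = triangleD[OF t'(1)]
  have h: "c \<boxminus> c' \<in> Arr E" "Cod E (c \<boxminus> c') = U'" "Dom E (c \<boxminus> c') = Dom E c" using c by simp_all
  have "pull E A' (c \<boxminus> c') \<delta>' = \<one>\<^bsub>Ext E (Dom E (c \<boxminus> c')) A'\<^esub>"
    using c d by (simp add: pull_hadd pull_hneg Ext_diff_eq_one)
  then obtain g where g: "g \<in> Arr E" "Dom E g = Dom E (c \<boxminus> c')" "Cod E g = V'" "u' \<cdot> g = c \<boxminus> c'"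
    using lift_along_deflation[OF t'(1) h(1,2)] by metis
  have "null (u' \<cdot> g)" using g h d c(3) t'(2) V_sub_N by (intro null_through_N) simp_all
  then show "null (c \<boxminus> c')" using g(4) by simp
qed (use c in simp_all)

text \<open>Comparison arrows over the identity of \<open>A\<close> exist in both directions, and
  \<open>coextension_unique\<close> makes their composites identities. So the shift of
  \<open>A\<close> may be computed from any such triangle.\<close>

lemma coextension_iso:
  assumes t: "triangle E A v V u U \<delta>" "V \<in> \<V>" "U \<in> \<U>" and t': "triangle E A v' V' u' U' \<delta>'" "V' \<in> \<V>" "U' \<in> \<U>"
  obtains c where "c \<in> Arr E" "Dom E c = U" "Cod E c = U'" "\<delta> = pull E A c \<delta>'" "is_iso \<H> (\<l> c)"
proof -
  note d = triangleD[OF t(1)] triangleD[OF t'(1)]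
  have A: "Id E A \<in> Arr E" "Dom E (Id E A) = A" "Cod E (Id E A) = A" using d by simp_all
  obtain c where c: "c \<in> Arr E" "Dom E c = U" "Cod E c = U'" "push E U (Id E A) \<delta> = pull E A c \<delta>'"
    using coextension_morphism[OF t(1,3) t'(1,2) A] .
  obtain c' where c': "c' \<in> Arr E" "Dom E c' = U'" "Cod E c' = U" "push E U' (Id E A) \<delta>' = pull E A c' \<delta>"
    using coextension_morphism[OF t'(1,3) t(1,2) A] .
  have e: "pull E A c \<delta>' = \<delta>" "pull E A c' \<delta> = \<delta>'" using c(4) c'(4) d by simp_all
  have "\<l> (c' \<cdot> c) = \<l> (Id E U)"
    by (rule coextension_unique[OF t(1,2)]) (use c c' d e t(3) in \<open>simp_all add: pull_Comp\<close>)
  then have 1: "\<l> c' \<bullet> \<l> c = Id \<H> U" using c c' d by (simp add: ell_Comp ell_Id)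
  have "\<l> (c \<cdot> c') = \<l> (Id E U')"
    by (rule coextension_unique[OF t'(1,2)]) (use c c' d e t'(3) in \<open>simp_all add: pull_Comp\<close>)
  then have 2: "\<l> c \<bullet> \<l> c' = Id \<H> U'" using c c' d by (simp add: ell_Comp ell_Id)
  have "is_iso \<H> (\<l> c)" by (rule H.is_isoI[of "\<l> c" "\<l> c'"]) (use c c' 1 2 in simp_all)
  with c e that show thesis by metis
qed

end

locale hovey_shift = hovey_pair E \<S> \<T> \<U> \<V>
  for E :: "('o, 'm, 'e, 'z) extri_scheme" (structure) and \<S> \<T> \<U> \<V> :: "'o set" +
  fixes v u :: "'o \<Rightarrow> 'm" and VA UA :: "'o \<Rightarrow> 'o" and \<rho> :: "'o \<Rightarrow> 'e"
  assumes shift: "shift_choice E \<U> \<V> v VA u UA \<rho>"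
begin

lemma shift_triangle:
  assumes "A \<in> Ob E"
  shows "triangle E A (v A) (VA A) (u A) (UA A) (\<rho> A)" "VA A \<in> \<V>" "UA A \<in> \<U>"
  using shift assms by (auto simp: shift_choice_def)

text \<open>A relation, since an arrow between the chosen shifts is determined only after
  localization.\<close>

definition is_shift :: "'m \<Rightarrow> 'm \<Rightarrow> bool" where
  "is_shift f c \<longleftrightarrow> c \<in> Arr E \<and> Dom E c = UA (Dom E f) \<and> Cod E c = UA (Cod E f) \<and>
     push E (UA (Dom E f)) f (\<rho> (Dom E f)) = pull E (Cod E f) c (\<rho> (Cod E f))"

lemma is_shift_ex:
  assumes "f \<in> Arr E"
  obtains c where "is_shift f c"
  by (rule coextension_morphism[OF shift_triangle(1,3)[OF Dom_in[OF assms]] shift_triangle(1,2)[OF Cod_in[OF assms]]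
      assms refl refl]) (rule that, simp add: is_shift_def)

lemma is_shift_unique:
  assumes "f \<in> Arr E" "is_shift f c" "is_shift f c'"
  shows "\<l> c = \<l> c'"
  by (rule coextension_unique[OF shift_triangle(1,2)[OF Cod_in[OF assms(1)]]])
    (use assms shift_triangle(3)[of "Dom E f"] in \<open>simp_all add: is_shift_def\<close>)

definition shift_map :: "'m \<Rightarrow> ('o, 'm) zigzag set" where
  "shift_map f = \<l> (SOME c. is_shift f c)"

lemma shift_map_eq: "f \<in> Arr E \<Longrightarrow> is_shift f c \<Longrightarrow> shift_map f = \<l> c"
  unfolding shift_map_def using is_shift_unique someI[of "is_shift f" c] by blast

lemma UA_Ob [simp]: "A \<in> Ob E \<Longrightarrow> UA A \<in> Ob E"
  using shift_triangle(3) by simp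

lemma \<rho>_in [simp]: "A \<in> Ob E \<Longrightarrow> \<rho> A \<in> \<E> (UA A) A"
  using triangleD(4)[OF shift_triangle(1)] .

lemma shift_map_functor: "is_functor E \<H> UA shift_map"
  unfolding is_functor_def
proof (intro conjI ballI impI)
  fix f assume f: "f \<in> Arr E"
  obtain c where c: "is_shift f c" using is_shift_ex[OF f] .
  show "shift_map f \<in> Hom \<H> (UA (Dom E f)) (UA (Cod E f))"
    unfolding shift_map_eq[OF f c] using c by (simp add: is_shift_def)
next
  fix A assume A: "A \<in> Ob E"
  then have "is_shift (Id E A) (Id E (UA A))" by (simp add: is_shift_def)
  then show "shift_map (Id E A) = Id \<H> (UA A)"
    using shift_map_eq[of "Id E A"] A by (simp add: ell_Id)
next
  fix f g assume fg: "f \<in> Arr E" "g \<in> Arr E" "Cod E f = Dom E g"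
  obtain c where c: "is_shift f c" using is_shift_ex[OF fg(1)] .
  obtain c' where c': "is_shift g c'" using is_shift_ex[OF fg(2)] .
  note cd = c[unfolded is_shift_def] c'[unfolded is_shift_def]
  let ?A = "Dom E f" and ?B = "Dom E g" and ?C = "Cod E g"
  have "push E (UA ?A) (g \<cdot> f) (\<rho> ?A) = push E (UA ?A) g (push E (UA ?A) f (\<rho> ?A))"
    using fg by (intro push_Comp) simp_all
  also have "\<dots> = push E (UA ?A) g (pull E ?B c (\<rho> ?B))" using cd fg by simp
  also have "\<dots> = pull E ?C c (push E (UA ?B) g (\<rho> ?B))"
    using push_pull[of c g "UA ?A" ?B "\<rho> ?B"] cd fg by simp
  also have "\<dots> = pull E ?C (c' \<cdot> c) (\<rho> ?C)"
    using cd fg pull_Comp[of ?C c c' "\<rho> ?C"] by simp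
  finally have "is_shift (g \<cdot> f) (c' \<cdot> c)" using cd fg by (simp add: is_shift_def)
  then show "shift_map (g \<cdot> f) = shift_map g \<bullet> shift_map f"
    using shift_map_eq[OF fg(1) c] shift_map_eq[OF fg(2) c'] shift_map_eq[of "g \<cdot> f"] fg cd
    by (simp add: ell_Comp)
qed auto

text \<open>The cokernel \<open>G\<close> of A -> B -> VA B is an extension of \<open>UA B\<close>
  by an object of \<S>, hence in \<U> and a second candidate for the shift of A. The arrow from
  \<open>G\<close> to \<open>UA B\<close> has its kernel in \<S> and becomes invertible.\<close>

lemma shift_map_wCof:
  assumes i: "i \<in> wCof E \<S>"
  shows "is_iso \<H> (shift_map i)"
proof -
  let ?A = "Dom E i" and ?B = "Cod E i"
  have iA: "i \<in> Arr E" using i by simp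
  obtain S y \<sigma> where t: "S \<in> \<S>" "triangle E ?A i ?B y S \<sigma>" using wCofE[OF i] .
  note tA = shift_triangle[OF Dom_in[OF iA]] and tB = shift_triangle[OF Cod_in[OF iA]]
  obtain G h' \<delta>'' d e where g: "triangle E ?A (v ?B \<cdot> i) (VA ?B) h' G \<delta>''" "triangle E S d G e (UA ?B) (push E (UA ?B) y (\<rho> ?B))"
    "push E G i \<delta>'' = pull E ?B e (\<rho> ?B)"
    using ET4'[OF t(2) tB(1)] by metis
  note gd = triangleD[OF g(1)] triangleD[OF g(2)]
  have G: "G \<in> \<U>" using CP_left_extension[OF WIC_E UV g(2) _ tB(3)] t(1) S_sub_U by blast
  obtain k where k: "k \<in> Arr E" "Dom E k = UA ?A" "Cod E k = G" "\<rho> ?A = pull E ?A k \<delta>''" "is_iso \<H> (\<l> k)"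
    using coextension_iso[OF tA g(1) tB(2) G] .
  have "push E (UA ?A) i (pull E ?A k \<delta>'') = pull E ?B k (push E G i \<delta>'')"
    using push_pull[of k i "UA ?A" ?A \<delta>''] k gd iA by simp
  also have "\<dots> = pull E ?B (e \<cdot> k) (\<rho> ?B)"
    unfolding g(3) using k gd iA by (intro pull_Comp[symmetric]) simp_all
  finally have "is_shift i (e \<cdot> k)" unfolding k(4)[symmetric] using k gd by (simp add: is_shift_def)
  then have "shift_map i = \<l> e \<bullet> \<l> k" using shift_map_eq[OF iA] k gd by (simp add: ell_Comp)
  moreover have "is_iso \<H> (\<l> e)" by (rule deflation_N_iso[OF g(2) S_sub_N[OF t(1)]])
  ultimately show ?thesis using H.iso_Comp(1)[OF k(5)] k gd by simp
qed

text \<open>The cone of $B \to G$ is $U_A$, but \<open>G\<close> is only known to lie in $\mathcal{N}$; it is replaced by an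
  object of $\mathcal{V}$ at the cost of enlarging $U_A$ by an object of $\mathcal{S}$.\<close>

lemma shift_map_wFib:
  assumes p: "p \<in> wFib E \<V>"
  shows "is_iso \<H> (shift_map p)"
proof -
  let ?A = "Dom E p" and ?B = "Cod E p"
  have pA: "p \<in> Arr E" using p by simp
  obtain V x \<tau> where t: "V \<in> \<V>" "triangle E V x ?A p ?B \<tau>" using wFibE[OF p] .
  note tA = shift_triangle[OF Dom_in[OF pA]] and tB = shift_triangle[OF Cod_in[OF pA]]
  obtain G h' \<delta>'' d e where g: "triangle E V (v ?A \<cdot> x) (VA ?A) h' G \<delta>''"
    "triangle E ?B d G e (UA ?A) (push E (UA ?A) p (\<rho> ?A))"
    using ET4'[OF t(2) tA(1)] by metis
  obtain V0 a S0 b \<epsilon> where n: "triangle E G a V0 b S0 \<epsilon>" "V0 \<in> \<V>" "S0 \<in> \<S>"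
    using N_fE[OF N_cokernel_V[OF g(1) t(1) tA(2)]] .
  obtain U h2 \<delta>2 d2 e2 where w: "triangle E ?B (a \<cdot> d) V0 h2 U \<delta>2" "triangle E (UA ?A) d2 U e2 S0 (push E S0 e \<epsilon>)"
    "pull E ?B d2 \<delta>2 = push E (UA ?A) p (\<rho> ?A)"
    using ET4'[OF g(2) n(1)] by metis
  note wd = triangleD[OF w(1)] triangleD[OF w(2)]
  have U: "U \<in> \<U>" using CP_left_extension[OF WIC_E UV w(2) tA(3)] n(3) S_sub_U by blast
  obtain k where k: "k \<in> Arr E" "Dom E k = U" "Cod E k = UA ?B" "\<delta>2 = pull E ?B k (\<rho> ?B)" "is_iso \<H> (\<l> k)"
    using coextension_iso[OF w(1) n(2) U tB] .
  have "pull E ?B (k \<cdot> d2) (\<rho> ?B) = push E (UA ?A) p (\<rho> ?A)"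
    unfolding w(3)[symmetric] k(4) using k wd pA by (intro pull_Comp) simp_all
  then have "is_shift p (k \<cdot> d2)" using k wd by (simp add: is_shift_def)
  then have "shift_map p = \<l> k \<bullet> \<l> d2" using shift_map_eq[OF pA] k wd by (simp add: ell_Comp)
  then show ?thesis using H.iso_Comp(1)[OF ell_iso(3)[OF wCofI[OF w(2) n(3)]] k(5)] k wd by simp
qed

abbreviation "Sh \<equiv> shift_arr E \<S> \<V> UA \<rho>"

text \<open>\<open>shift_map\<close> inverts weak equivalences and so extends to the localization;
  hence the condition in the choice of \<open>shift_arr\<close> is satisfiable and the chosen value
  is a functor.\<close>

lemma shift_arr_functor: "is_functor \<H> \<H> UA Sh"
proof -
  have "is_iso \<H> (shift_map w)" if w: "w \<in> WW E \<S> \<V>" for w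
  proof -
    obtain i p where ip: "w = p \<cdot> i" "i \<in> wCof E \<S>" "p \<in> wFib E \<V>" "Dom E p = Cod E i"
      using w by (auto simp: WW_def)
    note F = is_functorD[OF shift_map_functor]
    have "shift_map w = shift_map p \<bullet> shift_map i" unfolding ip(1) using ip by (intro F(6)) simp_all
    then show ?thesis
      using H.iso_Comp(1)[OF shift_map_wCof[OF ip(2)] shift_map_wFib[OF ip(3)]] ip F(3,4) by simp
  qed
  then obtain F where F: "is_functor \<H> \<H> UA F" "\<forall>f \<in> Arr E. F (\<l> f) = shift_map f"
    using localization_universal[OF H.category_axioms shift_map_functor, of "WW E \<S> \<V>"]
    unfolding ell_def loc_cat_def by blast
  have "F (\<l> f) = \<l> c" if "ext_morphism E (UA A) A (\<rho> A) (UA B) B (\<rho> B) f c" for A B f c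
  proof -
    have "f \<in> Arr E" "is_shift f c" using that by (auto simp: ext_morphism_def is_shift_def)
    then show ?thesis using F(2) shift_map_eq by simp
  qed
  with F(1) have "\<exists>F. is_functor \<H> \<H> UA F \<and> (\<forall>A \<in> Ob E. \<forall>B \<in> Ob E. \<forall>f uf.
           ext_morphism E (UA A) A (\<rho> A) (UA B) B (\<rho> B) f uf \<longrightarrow> F (\<l> f) = \<l> uf)" by blast
  from someI_ex[OF this] show ?thesis unfolding shift_arr_def by blast
qed

lemmas Sh_simps [simp] = is_functorD(2-4)[OF shift_arr_functor]
lemmas Sh_Id = is_functorD(5)[OF shift_arr_functor]
lemmas Sh_Comp = is_functorD(6)[OF shift_arr_functor]

abbreviation "conn \<equiv> ell_ext E \<S> \<V> UA \<rho>"

text \<open>Over a \<U>-replacement \<open>q\<close> of \<open>X\<close> the pushforward of \<delta>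
  to \<open>VA A\<close> vanishes, and exactness produces \<open>d\<close>. This witness makes the
  choice in \<open>ell_ext\<close> come from an actual span.\<close>

lemma ell_ext_span:
  assumes "\<delta> \<in> \<E> X A" "X \<in> Ob E" "A \<in> Ob E"
  obtains D w d where "w \<in> wFib E \<V>" "Dom E w = D" "Cod E w = X" "d \<in> Arr E" "Dom E d = D" "Cod E d = UA A"
    "pull E A w \<delta> = pull E A d (\<rho> A)" "conn X A \<delta> = \<l> d \<bullet> inv_arr \<H> (\<l> w)"
proof -
  obtain q where q: "q \<in> wFib E \<V>" "q \<in> Arr E" "Dom E q \<in> \<U>" "Cod E q = X" using U_replacement[OF assms(2)] .
  note t = shift_triangle[OF assms(3)] and td = triangleD[OF shift_triangle(1)[OF assms(3)]]
  have e: "pull E A q \<delta> \<in> \<E> (Dom E q) A" "Dom E q \<in> Ob E" using q assms by simp_all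
  have "push E (Dom E q) (v A) (pull E A q \<delta>) = \<one>\<^bsub>Ext E (Dom E q) (VA A)\<^esub>"
    by (rule CP_vanish[OF UV q(3) t(2)]) (use e td in simp)
  then obtain d where "d \<in> Arr E" "Dom E d = Dom E q" "Cod E d = UA A" "pull E A q \<delta> = pull E A d (\<rho> A)"
    using E_exact_4[OF t(1) e] by metis
  then have "\<exists>g. \<exists>D. \<exists>w \<in> Hom E D X. \<exists>d \<in> Hom E D (UA A).
        w \<in> wFib E \<V> \<and> pull E A w \<delta> = pull E A d (\<rho> A) \<and> g = \<l> d \<bullet> inv_arr \<H> (\<l> w)"
    using q by (intro exI[of _ "\<l> d \<bullet> inv_arr \<H> (\<l> q)"] exI[of _ "Dom E q"] bexI[of _ q] bexI[of _ d]) simp_all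
  from someI_ex[OF this] have "\<exists>D. \<exists>w \<in> Hom E D X. \<exists>d \<in> Hom E D (UA A).
        w \<in> wFib E \<V> \<and> pull E A w \<delta> = pull E A d (\<rho> A) \<and> conn X A \<delta> = \<l> d \<bullet> inv_arr \<H> (\<l> w)"
    unfolding ell_ext_def .
  then show thesis using that by auto
qed

lemma ell_ext_Hom:
  assumes "\<delta> \<in> \<E> X A" "X \<in> Ob E" "A \<in> Ob E"
  shows "conn X A \<delta> \<in> Hom \<H> X (UA A)"
proof -
  obtain D w d where s: "w \<in> wFib E \<V>" "Dom E w = D" "Cod E w = X" "d \<in> Arr E" "Dom E d = D" "Cod E d = UA A"
    "conn X A \<delta> = \<l> d \<bullet> inv_arr \<H> (\<l> w)"
    using ell_ext_span[OF assms] by metis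
  show ?thesis unfolding s(7) using s(1-6) ell_iso(2)[OF s(1)] by simp
qed

text \<open>The weak fibration \<open>w\<close> of the span has a section \<open>r\<close> because
  its target is in \<U>. The connecting arrow is thus the image of \<open>d \<cdot> r\<close>, along
  which \<open>\<rho> A\<close> pulls back to \<delta>. If it is null it passes through \<S>, where
  \<open>\<rho> A\<close> pulls back to zero.\<close>

theorem ell_ext_zero_imp_trivial:
  assumes \<delta>: "\<delta> \<in> \<E> X A" and X: "X \<in> \<U>" and A: "A \<in> \<T>" and z: "zero_arr \<H> (conn X A \<delta>)"
  shows "\<delta> = \<one>\<^bsub>Ext E X A\<^esub>"
proof -
  have O: "X \<in> Ob E" "A \<in> Ob E" using X A by simp_all
  obtain D w d where s: "w \<in> wFib E \<V>" "Dom E w = D" "Cod E w = X" "d \<in> Arr E" "Dom E d = D" "Cod E d = UA A"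
    "pull E A w \<delta> = pull E A d (\<rho> A)" "conn X A \<delta> = \<l> d \<bullet> inv_arr \<H> (\<l> w)"
    using ell_ext_span[OF \<delta> O] .
  have wA: "w \<in> Arr E" using s(1) by simp
  note wi = ell_iso(2)[OF s(1)]
  obtain V x \<tau> where t: "V \<in> \<V>" "triangle E V x D w X \<tau>" using wFibE[OF s(1)] unfolding s(2,3) .
  obtain r where r: "r \<in> Arr E" "Dom E r = X" "Cod E r = D" "w \<cdot> r = Id E X"
    using CP_lift[OF UV t(2,1), of "Id E X"] X O by auto
  have "\<l> w \<bullet> \<l> r = Id \<H> X" using r s(2) wA O ell_Comp[of r w] by (simp add: ell_Id)
  then have "\<l> r = inv_arr \<H> (\<l> w)"
    using H.iso_left_cancel[OF wi, of "\<l> r" "inv_arr \<H> (\<l> w)"] r s wA wi by simp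
  then have c: "conn X A \<delta> = \<l> (d \<cdot> r)" using s(4,5,8) r by (simp add: ell_Comp)
  have dr: "d \<cdot> r \<in> Arr E" "Dom E (d \<cdot> r) = X" "Cod E (d \<cdot> r) = UA A" using s r by simp_all
  have "null (d \<cdot> r)"
    by (rule ell_zero_imp_null[OF dr(1)]) (use z[unfolded c] dr X H_zero_arr_iff[of "\<l> (d \<cdot> r)"] in simp_all)
  then obtain a b where ab: "a \<in> Arr E" "b \<in> Arr E" "Cod E a \<in> \<S>" "Dom E b = Cod E a" "d \<cdot> r = b \<cdot> a"
    by (auto simp: null_def)
  have ad: "Dom E a = X" "Cod E b = UA A" using ab(1,2,4,5) dr by (metis Comp_simps(2), metis Comp_simps(3))
  have "pull E A b (\<rho> A) = \<one>\<^bsub>Ext E (Cod E a) A\<^esub>"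
    by (rule CP_vanish[OF ST ab(3) A]) (use ab ad O in simp)
  then have 1: "pull E A (d \<cdot> r) (\<rho> A) = \<one>\<^bsub>Ext E X A\<^esub>"
    unfolding ab(5) using ab(1-4) ad O by (simp add: pull_Comp)
  have "\<delta> = pull E A (w \<cdot> r) \<delta>" using r(4) \<delta> O by simp
  also have "\<dots> = pull E A r (pull E A w \<delta>)" using r s wA O \<delta> by (intro pull_Comp) simp_all
  also have "\<dots> = pull E A (d \<cdot> r) (\<rho> A)" unfolding s(7) using r s O by (intro pull_Comp[symmetric]) simp_all
  finally show ?thesis using 1 by simp
qed

end

section \<open>Transport of conflations along isomorphisms of the localization\<close>

context hovey_pair
begin

text \<open>Factor \<open>f\<close> into a weak cofibration and a deflation \<open>p\<close> with
  kernel \<open>K\<close> in \<T>. Invertibility of \<open>\<l> p\<close> splits \<open>p\<close>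
  and makes the identity of \<open>K\<close> factor through \<S>; so \<open>K\<close> lies in \<S>
  and in \<T>, hence in \<V>.\<close>

lemma ell_iso_imp_weak_equivalence:
  assumes f: "f \<in> Arr E" "Dom E f \<in> \<U>" "Cod E f \<in> \<U>" "Cod E f \<in> \<T>" and iso: "is_iso \<H> (\<l> f)"
  obtains i p where "i \<in> wCof E \<S>" "p \<in> wFib E \<V>" "Dom E i = Dom E f" "Dom E p = Cod E i" "Cod E p = Cod E f"
proof -
  let ?X = "Dom E f" and ?Y = "Cod E f"
  obtain i p K t \<delta> where ip: "i \<in> wCof E \<S>" "Dom E i = ?X" "K \<in> \<T>" "triangle E K t (Cod E i) p ?Y \<delta>" "p \<cdot> i = f"
    using fibration_factorization[OF f(1)] .
  let ?M = "Cod E i"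
  note d = triangleD[OF ip(4)]
  obtain S y \<sigma> where s: "S \<in> \<S>" "triangle E ?X i ?M y S \<sigma>" using wCofE[OF ip(1)] unfolding ip(2) .
  have MU: "?M \<in> \<U>" using CP_left_extension[OF WIC_E UV s(2) f(2)] s(1) S_sub_U by blast
  have MT: "?M \<in> \<T>" by (rule CP_right_extension[OF ST ip(4,3) f(4)])
  have iA: "i \<in> Arr E" using ip by simp
  have lp: "\<l> p \<bullet> \<l> i = \<l> f" unfolding ip(5)[symmetric] using iA d by (intro ell_Comp[symmetric]) simp_all
  have pi: "is_iso \<H> (\<l> p)"
    by (rule H.iso_of_iso_Comp_left[OF ell_iso(3)[OF ip(1)]]) (use iso lp iA d in simp_all)
  have "inv_arr \<H> (\<l> p) \<in> Hom \<H> ?Y ?M" using pi d by simp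
  then obtain g where g: "g \<in> Arr E" "Dom E g = ?Y" "Cod E g = ?M" "inv_arr \<H> (\<l> p) = \<l> g"
    using ell_full_Hom[OF _ f(3) MT] by metis
  have YO: "?Y \<in> Ob E" using f by simp
  have "\<l> (p \<cdot> g) = \<l> p \<bullet> \<l> g" using g(1-3) d by (intro ell_Comp) simp_all
  also have "\<dots> = \<l> (Id E ?Y)" unfolding g(4)[symmetric] using pi d YO by (simp add: ell_Id)
  finally have "null (Id E ?Y \<boxminus> p \<cdot> g)"
    using g d f by (intro ell_eq_imp_null[OF f(3)]) simp_all
  then obtain a b where ab: "a \<in> Arr E" "b \<in> Arr E" "Cod E a \<in> \<S>" "Dom E b = Cod E a" "Id E ?Y \<boxminus> p \<cdot> g = b \<cdot> a"
    by (auto simp: null_def)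
  have tq: "Id E ?Y \<boxminus> p \<cdot> g \<in> Arr E" "Dom E (Id E ?Y \<boxminus> p \<cdot> g) = ?Y" "Cod E (Id E ?Y \<boxminus> p \<cdot> g) = ?Y" using g d by simp_all
  have ad: "Dom E a = ?Y" "Cod E b = ?Y" using ab(1,2,4) tq unfolding ab(5) by simp_all
  obtain b' where b': "b' \<in> Arr E" "Dom E b' = Dom E b" "Cod E b' = ?M" "p \<cdot> b' = b"
    using CP_lift[OF ST ip(4,3) ab(2) ad(2)] ab(3,4) by auto
  \<comment> \<open>\<open>p \<cdot> g\<close> is the identity only modulo null. The defect
    \<open>b \<cdot> a\<close> lifts through \<open>p\<close>, since \<E>(\<S>, \<T>) = 0, and
    adding the lift gives a true section.\<close>
  define g' where "g' = g \<boxplus> b' \<cdot> a"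
  have g': "g' \<in> Arr E" "Dom E g' = ?Y" "Cod E g' = ?M" using g b' ab ad by (simp_all add: g'_def)
  have "p \<cdot> g' = p \<cdot> g \<boxplus> (Id E ?Y \<boxminus> p \<cdot> g)"
    unfolding ab(5) using g b' ab(1-4) ad d Comp_reassoc[OF b'(4), of a] by (simp add: g'_def)
  also have "\<dots> = Id E ?Y" using g d YO by simp
  finally have pg': "p \<cdot> g' = Id E ?Y" .
  have "\<delta> = \<one>\<^bsub>Ext E ?Y K\<^esub>" by (rule section_imp_split[OF ip(4) g' pg'])
  then obtain s0 r0 where b0: "biproduct E K ?Y ?M t s0 r0 p" using ip(4) split_biproduct by metis
  note bd0 = biproductD[OF b0]
  have "\<l> p \<bullet> \<l> g' = Id \<H> ?Y" using ell_Comp[of g' p] pg' g' d YO by (simp add: ell_Id)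
  then have lg': "\<l> g' = inv_arr \<H> (\<l> p)"
    using H.iso_left_cancel[OF pi, of "\<l> g'" "inv_arr \<H> (\<l> p)"] g' d pi by simp
  have "\<l> (g' \<cdot> p) = Id \<H> ?M" using ell_Comp[of p g'] g' d pi by (simp add: lg')
  then have "\<l> (Id E ?M) = \<l> (g' \<cdot> p)" using d by (simp add: ell_Id)
  then have "null (Id E ?M \<boxminus> g' \<cdot> p)"
    using g' d MT by (intro ell_eq_imp_null[OF MU]) simp_all
  then obtain a2 b2 where c: "a2 \<in> Arr E" "b2 \<in> Arr E" "Cod E a2 \<in> \<S>" "Dom E b2 = Cod E a2" "Id E ?M \<boxminus> g' \<cdot> p = b2 \<cdot> a2"
    by (auto simp: null_def)
  have tq2: "Id E ?M \<boxminus> g' \<cdot> p \<in> Arr E" "Dom E (Id E ?M \<boxminus> g' \<cdot> p) = ?M" "Cod E (Id E ?M \<boxminus> g' \<cdot> p) = ?M" using g' d by simp_all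
  have cd: "Dom E a2 = ?M" "Cod E b2 = ?M" using c(1,2,4) tq2 unfolding c(5) by simp_all
  \<comment> \<open>On the kernel \<open>g' \<cdot> p\<close> vanishes, so the null arrow restricts
    to \<open>t\<close>. Followed by the retraction \<open>r0\<close>, it exhibits \<open>K\<close>
    as a retract of \<open>Cod E a2\<close>.\<close>
  have "(b2 \<cdot> a2) \<cdot> t = t"
    unfolding c(5)[symmetric] using g' d triangle_Comp_zero[OF ip(4)] by simp
  then have "r0 \<cdot> ((b2 \<cdot> a2) \<cdot> t) = Id E K" using bd0(13) by simp
  then have "(r0 \<cdot> b2) \<cdot> (a2 \<cdot> t) = Id E K" using c(1-4) cd bd0(1-12) by simp
  then have "K \<in> \<S>"
    by (intro WIC_retract[OF WIC_E CPD(3)[OF ST], of "a2 \<cdot> t" K "r0 \<cdot> b2"]) (use c(1-4) cd bd0(1-12) in simp_all)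
  then have "K \<in> \<V>" using S_sub_N N_T_in_V ip(3) by blast
  then have "p \<in> wFib E \<V>" using wFibI[OF ip(4)] by blast
  then show thesis using that[OF ip(1)] ip(2) d by simp
qed

definition presented :: "'o set \<Rightarrow> 'o set \<Rightarrow> 'o \<Rightarrow> bool" where
  "presented \<R> \<L> D \<longleftrightarrow> (\<exists>A x B y \<delta>. triangle E A x B y D \<delta> \<and> A \<in> \<R> \<and> B \<in> \<L>)"

context
  fixes \<R> \<L> :: "'o set"
  assumes R_iso: "\<And>A B. A \<in> \<R> \<Longrightarrow> isomorphic \<H> A B \<Longrightarrow> B \<in> \<R>"
    and L_iso: "\<And>A B. A \<in> \<L> \<Longrightarrow> isomorphic \<H> A B \<Longrightarrow> B \<in> \<L>"
begin

text \<open>Composing with \<open>p\<close> enlarges the kernel by an object of \<V>, which does not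
  change it in the localization.\<close>

lemma presented_wFib_forward:
  assumes "presented \<R> \<L> (Dom E p)" and p: "p \<in> wFib E \<V>"
  shows "presented \<R> \<L> (Cod E p)"
proof -
  obtain A x B y \<delta> where t: "triangle E A x B y (Dom E p) \<delta>" "A \<in> \<R>" "B \<in> \<L>" using assms(1) by (auto simp: presented_def)
  obtain V z \<tau> where w: "V \<in> \<V>" "triangle E V z (Dom E p) p (Cod E p) \<tau>" using wFibE[OF p] .
  obtain K h' \<delta>'' d e where g: "triangle E K h' B (p \<cdot> y) (Cod E p) \<delta>''" "triangle E A d K e V (pull E A z \<delta>)"
    using ET4_op'[OF t(1) w(2)] by metis
  have "K \<in> \<R>" using R_iso[OF t(2) inflation_N_isomorphic[OF g(2) V_sub_N[OF w(1)]]] .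
  then show ?thesis using g(1) t(3) unfolding presented_def by blast
qed

text \<open>The conflation is pulled back along \<open>p\<close>; the kernel stays, and the new
  middle term maps to \<open>B\<close> by a weak fibration.\<close>

lemma presented_wFib_backward:
  assumes "presented \<R> \<L> (Cod E p)" and p: "p \<in> wFib E \<V>"
  shows "presented \<R> \<L> (Dom E p)"
proof -
  obtain A x B y \<delta> where t: "triangle E A x B y (Cod E p) \<delta>" "A \<in> \<R>" "B \<in> \<L>" using assms(1) by (auto simp: presented_def)
  obtain V z \<tau> where w: "V \<in> \<V>" "triangle E V z (Dom E p) p (Cod E p) \<tau>" using wFibE[OF p] .
  obtain M k k' l l' \<epsilon> \<epsilon>' where m: "triangle E A k M l (Dom E p) \<epsilon>" "triangle E V k' M l' B \<epsilon>'"
    using pullback_of_deflations[OF t(1) w(2)] by metis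
  have "isomorphic \<H> B M"
    using H.isomorphic_sym[OF wFib_isomorphic[OF wFibI[OF m(2) w(1)]]] triangleD[OF m(2)] by simp
  then show ?thesis using m(1) t(2) L_iso[OF t(3)] unfolding presented_def by blast
qed

text \<open>\<open>j \<cdot> y\<close> need not be a deflation. After adding an object of \<S> to
  \<open>B\<close> it extends to one, whose kernel differs from \<open>A\<close> by an object of
  \<N>.\<close>

lemma presented_wCof_forward:
  assumes "presented \<R> \<L> (Dom E j)" and j: "j \<in> wCof E \<S>"
  shows "presented \<R> \<L> (Cod E j)"
proof -
  obtain A x B y \<delta> where t: "triangle E A x B y (Dom E j) \<delta>" "A \<in> \<R>" "B \<in> \<L>" using assms(1) by (auto simp: presented_def)
  obtain S z \<sigma> where w: "S \<in> \<S>" "triangle E (Dom E j) j (Cod E j) z S \<sigma>" using wCofE[OF j] .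
  obtain T0 S0 t0 q \<theta> where q: "T0 \<in> \<T>" "S0 \<in> \<S>" "triangle E T0 t0 S0 q (Cod E j) \<theta>"
    using CP_left_approx[OF ST triangleD(2)[OF w(2)]] .
  obtain P iS iB pS pB where b: "biproduct E S0 B P iS iB pS pB"
    using biproduct_ex[OF _ triangleD(2)[OF t(1)], of S0] q by auto
  obtain K k k' a g Q0 c c' \<delta>' \<phi> \<kappa> \<epsilon> where f: "triangle E A a K g Q0 \<delta>'" "triangle E Q0 c S0 c' S \<epsilon>"
    "triangle E K k P \<phi> (Cod E j) \<kappa>" "\<phi> \<cdot> iB = j \<cdot> y"
    by (rule deflation_along_inflation[OF t(1) w(2) q(3) b])
  have "K \<in> \<R>" using R_iso[OF t(2) inflation_N_isomorphic[OF f(1) N_kernel_S[OF f(2) q(2) w(1)]]] .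
  moreover have "P \<in> \<L>"
    using L_iso[OF t(3)] wCof_isomorphic[OF biproduct_wCof[OF b q(2)]] biproductD[OF b] by simp
  ultimately show ?thesis using f(3) unfolding presented_def by blast
qed

text \<open>The kernel \<open>G\<close> of B -> Cod j -> S maps onto \<open>Dom E j\<close> with
  kernel \<open>A\<close>, and its inclusion into \<open>B\<close> is a weak cofibration.\<close>

lemma presented_wCof_backward:
  assumes "presented \<R> \<L> (Cod E j)" and j: "j \<in> wCof E \<S>"
  shows "presented \<R> \<L> (Dom E j)"
proof -
  obtain A x B y \<delta> where t: "triangle E A x B y (Cod E j) \<delta>" "A \<in> \<R>" "B \<in> \<L>" using assms(1) by (auto simp: presented_def)
  obtain S z \<sigma> where w: "S \<in> \<S>" "triangle E (Dom E j) j (Cod E j) z S \<sigma>" using wCofE[OF j] .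
  obtain G h' \<delta>'' d e where g: "triangle E G h' B (z \<cdot> y) S \<delta>''" "triangle E A d G e (Dom E j) (pull E A j \<delta>)"
    using ET4_op'[OF t(1) w(2)] by metis
  have "isomorphic \<H> B G"
    using H.isomorphic_sym[OF wCof_isomorphic[OF wCofI[OF g(1) w(1)]]] triangleD[OF g(1)] by simp
  then show ?thesis using g(2) t(2) L_iso[OF t(3)] unfolding presented_def by blast
qed

text \<open>Both objects are replaced by objects of \<U> \<inter> \<T>, joined to them by weak
  equivalences. There the isomorphism is the image of an arrow, and
  \<open>ell_iso_imp_weak_equivalence\<close> connects its ends by a weak cofibration and a weak
  fibration; the four transport lemmas follow this chain.\<close>

lemma presented_isomorphic:
  assumes D: "presented \<R> \<L> D" and iso: "isomorphic \<H> D X"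
  shows "presented \<R> \<L> X"
proof -
  have O: "D \<in> Ob E" "X \<in> Ob E" using H.isomorphic_Ob[OF iso] by simp_all
  obtain q where q: "q \<in> wFib E \<V>" "q \<in> Arr E" "Dom E q \<in> \<U>" "Cod E q = D" using U_replacement[OF O(1)] .
  obtain r where r: "r \<in> wFib E \<V>" "r \<in> Arr E" "Dom E r \<in> \<U>" "Cod E r = X" using U_replacement[OF O(2)] .
  have TR_U: "TR Z \<in> \<U>" if Z: "Z \<in> \<U>" for Z
  proof -
    have ZO: "Z \<in> Ob E" using Z by simp
    obtain S y \<sigma> where "S \<in> \<S>" "triangle E Z (jT Z) (TR Z) y S \<sigma>"
      using wCofE[OF jT(1)[OF ZO]] unfolding jT(2,3)[OF ZO] .
    then show ?thesis using CP_left_extension[OF WIC_E UV _ Z] S_sub_U by blast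
  qed
  let ?D = "TR (Dom E q)" and ?X = "TR (Dom E r)"
  note jq = jT[OF in_Ob(3)[OF q(3)]] and jr = jT[OF in_Ob(3)[OF r(3)]]
  have "isomorphic \<H> ?D D"
    using H.isomorphic_trans[OF H.isomorphic_sym[OF wCof_isomorphic[OF jq(1)]]] wFib_isomorphic[OF q(1)] jq(2,3) q(4) by simp
  moreover have "isomorphic \<H> X ?X"
    using H.isomorphic_trans[OF H.isomorphic_sym[OF wFib_isomorphic[OF r(1)]]] wCof_isomorphic[OF jr(1)] jr(2,3) r(4) by simp
  ultimately have "isomorphic \<H> ?D ?X" using iso H.isomorphic_trans by blast
  then obtain \<alpha> where \<alpha>: "is_iso \<H> \<alpha>" "\<alpha> \<in> Hom \<H> ?D ?X" by (auto elim: H.isomorphicE)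
  obtain f where f: "f \<in> Arr E" "Dom E f = ?D" "Cod E f = ?X" "\<alpha> = \<l> f"
    using ell_full_Hom[OF \<alpha>(2) TR_U[OF q(3)] jr(4)] .
  have fu: "Dom E f \<in> \<U>" "Cod E f \<in> \<U>" "Cod E f \<in> \<T>" "is_iso \<H> (\<l> f)"
    using f \<alpha>(1) TR_U[OF q(3)] TR_U[OF r(3)] jr(4) by simp_all
  obtain i p where ip: "i \<in> wCof E \<S>" "p \<in> wFib E \<V>" "Dom E i = ?D" "Dom E p = Cod E i" "Cod E p = ?X"
    using ell_iso_imp_weak_equivalence[OF f(1) fu] f by metis
  have "presented \<R> \<L> (Dom E q)" using presented_wFib_backward[OF _ q(1)] D q(4) by simp
  then have "presented \<R> \<L> ?D" using presented_wCof_forward[OF _ jq(1)] jq(2,3) by simp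
  then have "presented \<R> \<L> (Cod E i)" using presented_wCof_forward[OF _ ip(1)] ip(3) by simp
  then have "presented \<R> \<L> ?X" using presented_wFib_forward[OF _ ip(2)] ip(4,5) by simp
  then have "presented \<R> \<L> (Dom E r)" using presented_wCof_backward[OF _ jr(1)] jr(2,3) by simp
  then show ?thesis using presented_wFib_forward[OF _ r(1)] r(4) by simp
qed

text \<open>A pushout along the replacement of \<open>A\<close> moves the kernel into \<T>; a
  \<U>-replacement of the new middle term enlarges the kernel only by an object of \<V>, so it stays
  in \<T>.\<close>

lemma presented_in_U_T:
  assumes "presented \<R> \<L> X"
  obtains K k M l \<kappa> where "triangle E K k M l X \<kappa>" "K \<in> \<T> \<inter> \<R>" "M \<in> \<U> \<inter> \<L>"
proof -
  obtain A x B y \<delta> where t: "triangle E A x B y X \<delta>" "A \<in> \<R>" "B \<in> \<L>" using assms(1) by (auto simp: presented_def)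
  note j = jT[OF triangleD(1)[OF t(1)]]
  obtain S z \<sigma> where w: "S \<in> \<S>" "triangle E A (jT A) (TR A) z S \<sigma>" using wCofE[OF j(1)] unfolding j(2,3) .
  obtain M k k' l l' \<epsilon> \<epsilon>' where m: "triangle E B k M l S \<epsilon>" "triangle E (TR A) k' M l' X \<epsilon>'"
    using pushout_of_inflations[OF t(1) w(2)] by metis
  note md = triangleD[OF m(1)]
  have M_L: "M \<in> \<L>" using L_iso[OF t(3)] wCof_isomorphic[OF wCofI[OF m(1) w(1)]] md by simp
  have TR: "TR A \<in> \<R>" using R_iso[OF t(2)] wCof_isomorphic[OF j(1)] j(2,3) by simp
  obtain q where q: "q \<in> wFib E \<V>" "q \<in> Arr E" "Dom E q \<in> \<U>" "Cod E q = M" using U_replacement[OF md(2)] .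
  obtain V a \<tau> where v: "V \<in> \<V>" "triangle E V a (Dom E q) q M \<tau>" using wFibE[OF q(1)] unfolding q(4) .
  obtain K h' \<delta>'' d e where g: "triangle E K h' (Dom E q) (l' \<cdot> q) X \<delta>''" "triangle E V d K e (TR A) (pull E V k' \<tau>)"
    using ET4_op'[OF v(2) m(2)] by metis
  note gd = triangleD[OF g(2)]
  have "K \<in> \<T>" using CP_right_extension[OF ST g(2) _ j(4)] v(1) V_sub_T by blast
  moreover have "K \<in> \<R>" using R_iso[OF TR] H.isomorphic_sym[OF wFib_isomorphic[OF wFibI[OF g(2) v(1)]]] gd by simp
  moreover have "Dom E q \<in> \<L>" using L_iso[OF M_L] H.isomorphic_sym[OF wFib_isomorphic[OF q(1)]] q(4) by simp
  ultimately show thesis using that[OF g(1)] q(3) by simp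
qed

end

end

section \<open>The correspondence\<close>

context hovey_shift
begin

abbreviation "\<D> \<equiv> loc_tri E \<S> \<V> UA \<rho>"

lemma loc_tri_simps [simp]:
  "Ob \<D> = Ob E" "Arr \<D> = Arr \<H>" "Dom \<D> = Dom \<H>" "Cod \<D> = Cod \<H>" "Id \<D> = Id \<H>" "Comp \<D> = Comp \<H>"
  "ShOb \<D> = UA" "ShArr \<D> = Sh" "Dist \<D> = loc_dist E \<S> \<V> UA \<rho>"
  using Ob_H by (simp_all add: loc_tri_def cat.defs tri_cat.defs)

text \<open>\<open>loc_tri\<close> extends the record \<open>loc_cat\<close> without changing its
  fields; these equations transfer facts about the localization to the triangulated
  structure.\<close>

lemma loc_tri_cat_notions [simp]:
  "Hom \<D> = Hom \<H>" "is_iso \<D> = is_iso \<H>" "isomorphic \<D> = isomorphic \<H>" "zero_object \<D> = zero_object \<H>"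
  "zero_arr \<D> = zero_arr \<H>" "biproduct \<D> = biproduct \<H>" "additive_subcat \<D> = additive_subcat \<H>"
  "iso_closed \<D> = iso_closed \<H>" "summand_closed \<D> = summand_closed \<H>" "ess_image \<D> = ess_image \<H>"
proof -
  show 1: "Hom \<D> = Hom \<H>" by (intro ext) (simp add: Hom_def)
  show 2: "is_iso \<D> = is_iso \<H>" by (intro ext) (simp add: is_iso_def is_inverse_def 1)
  show 3: "isomorphic \<D> = isomorphic \<H>" by (intro ext) (simp only: isomorphic_def 1 2)
  show 4: "zero_object \<D> = zero_object \<H>" by (intro ext) (simp only: zero_object_def 1 loc_tri_simps Ob_H)
  show 5: "zero_arr \<D> = zero_arr \<H>" by (intro ext) (simp only: zero_arr_def 1 4 loc_tri_simps)
  show 6: "biproduct \<D> = biproduct \<H>" by (intro ext) (simp only: biproduct_def 1 5 loc_tri_simps)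
  show "additive_subcat \<D> = additive_subcat \<H>" by (intro ext) (simp only: additive_subcat_def 4 6 loc_tri_simps Ob_H)
  show "iso_closed \<D> = iso_closed \<H>" by (intro ext) (simp only: iso_closed_def 3 loc_tri_simps Ob_H)
  show "summand_closed \<D> = summand_closed \<H>" by (intro ext) (simp only: summand_closed_def 6 loc_tri_simps Ob_H)
  show "ess_image \<D> = ess_image \<H>" by (intro ext) (simp only: ess_image_def 3 loc_tri_simps Ob_H)
qed

lemma tri_Ext_vanish_iff:
  "tri_Ext_vanish \<D> \<L> \<R> \<longleftrightarrow> (\<forall>X \<in> \<L>. \<forall>Y \<in> \<R>. \<forall>f \<in> Hom \<H> X (UA Y). zero_arr \<H> f)"
  by (simp only: tri_Ext_vanish_def loc_tri_cat_notions loc_tri_simps)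

lemma distinguished_of_triangle:
  assumes t: "triangle E A x B y X \<delta>"
  shows "is_distinguished \<D> A (\<l> x) B (\<l> y) X (conn X A \<delta>)"
proof -
  note d = triangleD[OF t]
  have h: "conn X A \<delta> \<in> Hom \<H> X (UA A)" by (rule ell_ext_Hom[OF d(4,3,1)])
  have "(\<l> x, \<l> y, conn X A \<delta>) \<in> loc_dist E \<S> \<V> UA \<rho>"
    unfolding loc_dist_def
    by (rule CollectI, rule exI[of _ "\<l> x"], rule exI[of _ "\<l> y"], rule exI[of _ "conn X A \<delta>"], rule conjI[OF refl],
      rule exI[of _ A], rule exI[of _ B], rule exI[of _ X], rule exI[of _ A], rule exI[of _ x], rule exI[of _ B],
      rule exI[of _ y], rule exI[of _ X], rule exI[of _ \<delta>], rule exI[of _ "Id \<H> A"], rule exI[of _ "Id \<H> B"],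
      rule exI[of _ "Id \<H> X"]) (use d h t in \<open>simp add: Sh_Id\<close>)
  then show ?thesis using d h by (simp add: is_distinguished_def)
qed

text \<open>Only the isomorphism classes of the three objects are kept, which is what
  \<open>presented\<close> asks for.\<close>

lemma triangle_of_distinguished:
  assumes "is_distinguished \<D> X f Y g Z h"
  obtains A x B y D \<delta> where "triangle E A x B y D \<delta>" "isomorphic \<H> X A" "isomorphic \<H> Y B" "isomorphic \<H> Z D"
proof -
  have fg: "f \<in> Hom \<H> X Y" "g \<in> Hom \<H> Y Z" and "(f, g, h) \<in> loc_dist E \<S> \<V> UA \<rho>"
    using assms by (simp_all add: is_distinguished_def)
  then obtain X' Y' Z' A x B y D \<delta> a b c where
    "f \<in> Hom \<H> X' Y'" "g \<in> Hom \<H> Y' Z'" "triangle E A x B y D \<delta>"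
    "a \<in> Hom \<H> X' A" "is_iso \<H> a" "b \<in> Hom \<H> Y' B" "is_iso \<H> b" "c \<in> Hom \<H> Z' D" "is_iso \<H> c"
    unfolding loc_dist_def by blast
  then show thesis using that fg by (metis H.isomorphicI Hom_iff)
qed

lemma tri_CP_iff:
  "(\<L>, \<R>) \<in> tri_CP \<D> \<longleftrightarrow>
     additive_subcat \<H> \<L> \<and> iso_closed \<H> \<L> \<and> summand_closed \<H> \<L> \<and>
     additive_subcat \<H> \<R> \<and> iso_closed \<H> \<R> \<and> summand_closed \<H> \<R> \<and>
     tri_Ext_vanish \<D> \<L> \<R> \<and>
     (\<forall>X \<in> Ob E. \<exists>R \<in> \<R>. \<exists>L \<in> \<L>. \<exists>f g h. is_distinguished \<D> R f L g X h) \<and>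
     (\<forall>X \<in> Ob E. \<exists>R \<in> \<R>. \<exists>L \<in> \<L>. \<exists>f g h. is_distinguished \<D> X f R g L h)"
  by (simp only: tri_CP_def mem_Collect_eq prod.case loc_tri_cat_notions loc_tri_simps)

lemma in_ess_imageI: "isomorphic \<H> A B \<Longrightarrow> A \<in> \<X> \<Longrightarrow> B \<in> ess_image \<H> \<X>"
  unfolding ess_image_def using H.isomorphic_Ob by simp blast

lemma ess_image_self: "\<X> \<subseteq> Ob E \<Longrightarrow> A \<in> \<X> \<Longrightarrow> A \<in> ess_image \<H> \<X>"
  using in_ess_imageI H.isomorphic_refl by force

lemma ess_image_iso_closed: "iso_closed \<H> (ess_image \<H> \<X>)"
  unfolding iso_closed_def ess_image_def using H.isomorphic_trans by blast

lemma ess_image_additive: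
  assumes X: "additive_subcat E \<X>"
  shows "additive_subcat \<H> (ess_image \<H> \<X>)"
  unfolding additive_subcat_def
proof (intro conjI ballI)
  have sub: "\<X> \<subseteq> Ob E" using X by (simp add: additive_subcat_def)
  show "ess_image \<H> \<X> \<subseteq> Ob \<H>" by (auto simp: ess_image_def)
  show "\<exists>Z \<in> ess_image \<H> \<X>. zero_object \<H> Z"
    using X ess_image_self[OF sub] H_zero_object unfolding additive_subcat_def by blast
  fix A B assume AB: "A \<in> ess_image \<H> \<X>" "B \<in> ess_image \<H> \<X>"
  obtain A' where A': "A' \<in> \<X>" "isomorphic \<H> A' A" using AB(1) by (auto simp: ess_image_def)
  obtain B' where B': "B' \<in> \<X>" "isomorphic \<H> B' B" using AB(2) by (auto simp: ess_image_def)
  obtain P iA iB pA pB where P: "P \<in> \<X>" "biproduct E A' B' P iA iB pA pB"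
    using X A'(1) B'(1) unfolding additive_subcat_def by blast
  obtain a where a: "is_iso \<H> a" "Dom \<H> a = A'" "Cod \<H> a = A" using A'(2) by (elim H.isomorphicE)
  obtain b where b: "is_iso \<H> b" "Dom \<H> b = B'" "Cod \<H> b = B" using B'(2) by (elim H.isomorphicE)
  show "\<exists>P \<in> ess_image \<H> \<X>. \<exists>iA iB pA pB. biproduct \<H> A B P iA iB pA pB"
    using H.biproduct_transport[OF H_biproduct[OF P(2)] a b] ess_image_self[OF sub P(1)] by blast
qed

lemma biproduct_zero_of_zero:
  assumes "biproduct \<H> X Y P iX iY pX pY" "zero_arr \<H> (f \<bullet> pX)" "f \<in> Arr \<H>" "Dom \<H> f = X"
  shows "zero_arr \<H> f"
proof -
  note d = H.biproductD[OF assms(1)]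
  have "zero_arr \<H> ((f \<bullet> pX) \<bullet> iX)" by (rule H.zero_arr_Comp_right[OF assms(2)]) (use d assms in simp_all)
  moreover have "(f \<bullet> pX) \<bullet> iX = f" using d assms by simp
  ultimately show ?thesis by simp
qed

lemma biproduct_swap_H: "biproduct \<H> X Y P iX iY pX pY \<Longrightarrow> biproduct \<H> Y X P iY iX pY pX"
  unfolding biproduct_def by (simp add: conj_commute conj_left_commute ball_conj_distrib)

section \<open>From a mutable cotorsion pair to the localization\<close>

context
  fixes \<A> \<B> :: "'o set"
  assumes AB: "(\<A>, \<B>) \<in> CP E" and AU: "\<A> \<subseteq> \<U>" and BT: "\<B> \<subseteq> \<T>"
begin

text \<open>The approximating conflation B -> A -> X has zero connecting arrow, so it splits by
  \<open>ell_ext_zero_imp_trivial\<close>, and \<open>X\<close> is a summand of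
  \<open>A\<close>.\<close>

lemma left_perp_in_CP:
  assumes X: "X \<in> \<U>" and z: "\<And>B f. B \<in> \<B> \<Longrightarrow> f \<in> Hom \<H> X (UA B) \<Longrightarrow> zero_arr \<H> f"
  shows "X \<in> \<A>"
proof -
  have XO: "X \<in> Ob E" using X by simp
  obtain B A x y \<delta> where t: "B \<in> \<B>" "A \<in> \<A>" "triangle E B x A y X \<delta>" using CP_left_approx[OF AB XO] .
  note d = triangleD[OF t(3)]
  have "\<delta> = \<one>\<^bsub>Ext E X B\<^esub>"
    using ell_ext_zero_imp_trivial[OF d(4) X] t(1) BT z[OF t(1) ell_ext_Hom[OF d(4,3,1)]] by blast
  then show ?thesis using summand_of_split(2)[OF CPD(3)[OF AB]] t by blast
qed

lemma right_perp_in_CP: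
  assumes Y: "Y \<in> \<T>" and z: "\<And>A f. A \<in> \<A> \<Longrightarrow> f \<in> Hom \<H> A (UA Y) \<Longrightarrow> zero_arr \<H> f"
  shows "Y \<in> \<B>"
proof -
  have YO: "Y \<in> Ob E" using Y by simp
  obtain B A x y \<delta> where t: "B \<in> \<B>" "A \<in> \<A>" "triangle E Y x B y A \<delta>" using CP_right_approx[OF AB YO] .
  note d = triangleD[OF t(3)]
  have "\<delta> = \<one>\<^bsub>Ext E A Y\<^esub>"
    using ell_ext_zero_imp_trivial[OF d(4) _ Y] t(2) AU z[OF t(2) ell_ext_Hom[OF d(4,3,1)]] by blast
  then show ?thesis using summand_of_split(1)[OF CPD(6)[OF AB]] t by blast
qed

lemma left_perp_in_ess_image:
  assumes X: "X \<in> Ob E" and z: "\<And>B f. B \<in> \<B> \<Longrightarrow> f \<in> Hom \<H> X (UA B) \<Longrightarrow> zero_arr \<H> f"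
  shows "X \<in> ess_image \<H> \<A>"
proof -
  obtain q where q: "q \<in> wFib E \<V>" "q \<in> Arr E" "Dom E q \<in> \<U>" "Cod E q = X" using U_replacement[OF X] .
  note qi = ell_iso(2)[OF q(1)]
  have "Dom E q \<in> \<A>"
  proof (rule left_perp_in_CP[OF q(3)])
    fix B f assume B: "B \<in> \<B>" "f \<in> Hom \<H> (Dom E q) (UA B)"
    then have "zero_arr \<H> (f \<bullet> inv_arr \<H> (\<l> q))" using q qi by (intro z) simp_all
    then have "zero_arr \<H> ((f \<bullet> inv_arr \<H> (\<l> q)) \<bullet> \<l> q)"
      by (rule H.zero_arr_Comp_right) (use B q qi in simp_all)
    then show "zero_arr \<H> f" using B q qi by simp
  qed
  then show ?thesis using in_ess_imageI[OF wFib_isomorphic[OF q(1)]] q(4) by simp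
qed

text \<open>The test arrows end in shifts, so orthogonality is carried from \<open>Y\<close> to its
  replacement by the functor \<open>Sh\<close>.\<close>

lemma right_perp_in_ess_image:
  assumes Y: "Y \<in> Ob E" and z: "\<And>A f. A \<in> \<A> \<Longrightarrow> f \<in> Hom \<H> A (UA Y) \<Longrightarrow> zero_arr \<H> f"
  shows "Y \<in> ess_image \<H> \<B>"
proof -
  note j = jT[OF Y]
  have jA: "jT Y \<in> Arr E" using j by simp
  note ji = ell_iso(3)[OF j(1)]
  let ?s = "Sh (\<l> (jT Y))" and ?t = "Sh (inv_arr \<H> (\<l> (jT Y)))"
  have st: "?s \<bullet> ?t = Id \<H> (UA (TR Y))"
    using Sh_Comp[of "inv_arr \<H> (\<l> (jT Y))" "\<l> (jT Y)"] ji j jA Y by (simp add: Sh_Id)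
  have "TR Y \<in> \<B>"
  proof (rule right_perp_in_CP[OF j(4)])
    fix A f assume A: "A \<in> \<A>" "f \<in> Hom \<H> A (UA (TR Y))"
    then have "zero_arr \<H> (?t \<bullet> f)" using j ji jA by (intro z[OF A(1)]) simp
    then have "zero_arr \<H> (?s \<bullet> (?t \<bullet> f))"
      by (rule H.zero_arr_Comp_left) (use A j ji jA in simp_all)
    moreover have "?s \<bullet> (?t \<bullet> f) = f"
      using H.Comp_reassoc[OF st, of f] A j ji jA by simp
    ultimately show "zero_arr \<H> f" by simp
  qed
  then show ?thesis using in_ess_imageI[OF H.isomorphic_sym[OF wCof_isomorphic[OF j(1)]]] j(2,3) by simp
qed

lemma ess_image_in_tri_CP:
  assumes van: "tri_Ext_vanish \<D> (ess_image \<H> \<A>) (ess_image \<H> \<B>)"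
  shows "(ess_image \<H> \<A>, ess_image \<H> \<B>) \<in> tri_CP \<D>"
  unfolding tri_CP_iff
proof (intro conjI ballI)
  have sub: "\<A> \<subseteq> Ob E" "\<B> \<subseteq> Ob E" using CP_Ob[OF AB] by auto
  note v = van[unfolded tri_Ext_vanish_iff, rule_format]
  show "additive_subcat \<H> (ess_image \<H> \<A>)" "additive_subcat \<H> (ess_image \<H> \<B>)"
    using CPD(1,4)[OF AB] by (simp_all add: ess_image_additive)
  show "iso_closed \<H> (ess_image \<H> \<A>)" "iso_closed \<H> (ess_image \<H> \<B>)" by (rule ess_image_iso_closed)+
  show "tri_Ext_vanish \<D> (ess_image \<H> \<A>) (ess_image \<H> \<B>)" by fact
  have left: "X \<in> ess_image \<H> \<A>" if b: "biproduct \<H> X Y P iX iY pX pY" "P \<in> ess_image \<H> \<A>" for X Y P iX iY pX pY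
  proof (rule left_perp_in_ess_image)
    note d = H.biproductD[OF b(1)]
    show "X \<in> Ob E" using d(1,2) H.Dom_in[of iX] by simp
    fix B f assume B: "B \<in> \<B>" "f \<in> Hom \<H> X (UA B)"
    have "zero_arr \<H> (f \<bullet> pX)"
      by (rule v[OF b(2) ess_image_self[OF sub(2) B(1)]]) (use B d in simp)
    then show "zero_arr \<H> f" by (rule biproduct_zero_of_zero[OF b(1)]) (use B in simp_all)
  qed
  \<comment> \<open>A test arrow into the shift of the summand becomes zero in the shift of
    \<open>P\<close>; functoriality of \<open>Sh\<close> makes the inclusion split, so the arrow
    itself is zero.\<close>
  have right: "X \<in> ess_image \<H> \<B>" if b: "biproduct \<H> X Y P iX iY pX pY" "P \<in> ess_image \<H> \<B>" for X Y P iX iY pX pY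
  proof (rule right_perp_in_ess_image)
    note d = H.biproductD[OF b(1)]
    show XO: "X \<in> Ob E" using d(1,2) H.Dom_in[of iX] by simp
    fix A f assume A: "A \<in> \<A>" "f \<in> Hom \<H> A (UA X)"
    have "zero_arr \<H> (Sh iX \<bullet> f)"
      by (rule v[OF ess_image_self[OF sub(1) A(1)] b(2)]) (use A d in simp)
    then have "zero_arr \<H> (Sh pX \<bullet> (Sh iX \<bullet> f))" by (rule H.zero_arr_Comp_left) (use A d in simp_all)
    moreover have "Sh pX \<bullet> Sh iX = Id \<H> (UA X)" using Sh_Comp[of iX pX] d XO by (simp add: Sh_Id)
    then have "Sh pX \<bullet> (Sh iX \<bullet> f) = f" using H.Comp_reassoc[of "Sh pX" "Sh iX" "Id \<H> (UA X)" f] A d by simp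
    ultimately show "zero_arr \<H> f" by simp
  qed
  show "summand_closed \<H> (ess_image \<H> \<A>)"
    unfolding summand_closed_def using left biproduct_swap_H by blast
  show "summand_closed \<H> (ess_image \<H> \<B>)"
    unfolding summand_closed_def using right biproduct_swap_H by blast
  fix X assume X: "X \<in> Ob E"
  show "\<exists>R \<in> ess_image \<H> \<B>. \<exists>L \<in> ess_image \<H> \<A>. \<exists>f g h. is_distinguished \<D> R f L g X h"
  proof -
    obtain B A x y \<delta> where "B \<in> \<B>" "A \<in> \<A>" "triangle E B x A y X \<delta>" using CP_left_approx[OF AB X] .
    then show ?thesis using distinguished_of_triangle ess_image_self sub by blast
  qed
  show "\<exists>R \<in> ess_image \<H> \<B>. \<exists>L \<in> ess_image \<H> \<A>. \<exists>f g h. is_distinguished \<D> X f R g L h"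
  proof -
    obtain B A x y \<delta> where "B \<in> \<B>" "A \<in> \<A>" "triangle E X x B y A \<delta>" using CP_right_approx[OF AB X] .
    then show ?thesis using distinguished_of_triangle ess_image_self sub by blast
  qed
qed

lemma ess_image_inter:
  assumes van: "tri_Ext_vanish \<D> (ess_image \<H> \<A>) (ess_image \<H> \<B>)"
  shows "\<U> \<inter> ess_image \<H> \<A> = \<A>" "\<T> \<inter> ess_image \<H> \<B> = \<B>"
proof -
  have sub: "\<A> \<subseteq> Ob E" "\<B> \<subseteq> Ob E" using CP_Ob[OF AB] by auto
  note v = van[unfolded tri_Ext_vanish_iff, rule_format]
  show "\<U> \<inter> ess_image \<H> \<A> = \<A>"
    using left_perp_in_CP v ess_image_self[OF sub(2)] ess_image_self[OF sub(1)] AU by blast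
  show "\<T> \<inter> ess_image \<H> \<B> = \<B>"
    using right_perp_in_CP v ess_image_self[OF sub(2)] ess_image_self[OF sub(1)] BT by blast
qed

end

section \<open>From a cotorsion pair on the localization back to the original category\<close>

context
  fixes \<L> \<R> :: "'o set"
  assumes LR: "(\<L>, \<R>) \<in> tri_CP \<D>"
begin

lemmas LR_D = LR[unfolded tri_CP_iff]

lemma LR_iso:
  "A \<in> \<L> \<Longrightarrow> isomorphic \<H> A B \<Longrightarrow> B \<in> \<L>" "A \<in> \<R> \<Longrightarrow> isomorphic \<H> A B \<Longrightarrow> B \<in> \<R>"
  using LR_D H.isomorphic_Ob unfolding iso_closed_def by blast+

text \<open>By \<open>H_biproduct\<close> and \<open>H_zero_object\<close> sums and zero objects of
  the original category remain such in the localization, where they are unique up to isomorphism;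
  hence they lie in \<Y> as well.\<close>

lemma inter_subcat:
  assumes X: "additive_subcat E \<X>" "iso_closed E \<X>" "summand_closed E \<X>"
    and Y: "additive_subcat \<H> \<Y>" "iso_closed \<H> \<Y>" "summand_closed \<H> \<Y>"
  shows "additive_subcat E (\<X> \<inter> \<Y>)" "iso_closed E (\<X> \<inter> \<Y>)" "summand_closed E (\<X> \<inter> \<Y>)"
proof -
  have Yi: "B \<in> \<Y>" if "A \<in> \<Y>" "isomorphic \<H> A B" for A B
    using that Y(2) H.isomorphic_Ob unfolding iso_closed_def by blast
  show "additive_subcat E (\<X> \<inter> \<Y>)"
    unfolding additive_subcat_def
  proof (intro conjI ballI)
    show "\<X> \<inter> \<Y> \<subseteq> Ob E" using X(1) by (auto simp: additive_subcat_def)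
    obtain Z where Z: "Z \<in> \<X>" "zero_object E Z" using X(1) by (auto simp: additive_subcat_def)
    obtain Z' where Z': "Z' \<in> \<Y>" "zero_object \<H> Z'" using Y(1) by (auto simp: additive_subcat_def)
    have "Z \<in> \<Y>" using Yi[OF Z'(1) H.zero_objects_isomorphic[OF Z'(2) H_zero_object[OF Z(2)]]] .
    with Z show "\<exists>Z \<in> \<X> \<inter> \<Y>. zero_object E Z" by blast
    fix A B assume AB: "A \<in> \<X> \<inter> \<Y>" "B \<in> \<X> \<inter> \<Y>"
    obtain P iA iB pA pB where P: "P \<in> \<X>" "biproduct E A B P iA iB pA pB"
      using X(1) AB unfolding additive_subcat_def by blast
    obtain P' iA' iB' pA' pB' where P': "P' \<in> \<Y>" "biproduct \<H> A B P' iA' iB' pA' pB'"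
      using Y(1) AB unfolding additive_subcat_def by blast
    have "P \<in> \<Y>" using Yi[OF P'(1) H.biproducts_isomorphic[OF P'(2) H_biproduct[OF P(2)]]] .
    with P show "\<exists>P \<in> \<X> \<inter> \<Y>. \<exists>iA iB pA pB. biproduct E A B P iA iB pA pB" by blast
  qed
  have "isomorphic \<H> A B" if iso: "isomorphic E A B" for A B
  proof -
    obtain f where f: "is_iso E f" "f \<in> Arr E" "Dom E f = A" "Cod E f = B" using iso by (rule isomorphicE)
    have "is_iso \<H> (\<l> f)"
      using f ell_Comp[of f "inv_arr E f"] ell_Comp[of "inv_arr E f" f]
      by (intro H.is_isoI[of "\<l> f" "\<l> (inv_arr E f)"]) (auto simp: ell_Id)
    then show ?thesis using f H.isomorphicI by simp
  qed
  then show "iso_closed E (\<X> \<inter> \<Y>)" using X(2) Yi unfolding iso_closed_def by blast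
  show "summand_closed E (\<X> \<inter> \<Y>)"
    unfolding summand_closed_def
  proof (intro ballI allI impI)
    fix A B P iA iB pA pB
    assume AB: "A \<in> Ob E" "B \<in> Ob E" and b: "biproduct E A B P iA iB pA pB \<and> P \<in> \<X> \<inter> \<Y>"
    have "A \<in> \<X> \<and> B \<in> \<X>" using X(3) AB b unfolding summand_closed_def by blast
    moreover have "biproduct \<H> A B P (\<l> iA) (\<l> iB) (\<l> pA) (\<l> pB)" using H_biproduct b by blast
    then have "A \<in> \<Y> \<and> B \<in> \<Y>" using Y(3) AB b unfolding summand_closed_def Ob_H by blast
    ultimately show "A \<in> \<X> \<inter> \<Y> \<and> B \<in> \<X> \<inter> \<Y>" by blast
  qed
qed

lemma preimage_left_approx:
  assumes X: "X \<in> Ob E"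
  obtains K k M l \<kappa> where "triangle E K k M l X \<kappa>" "K \<in> \<T> \<inter> \<R>" "M \<in> \<U> \<inter> \<L>"
proof -
  obtain R L f g h where dist: "R \<in> \<R>" "L \<in> \<L>" "is_distinguished \<D> R f L g X h"
    using LR_D X by blast
  obtain A x B y D \<delta> where t: "triangle E A x B y D \<delta>" "isomorphic \<H> R A" "isomorphic \<H> L B" "isomorphic \<H> X D"
    using triangle_of_distinguished[OF dist(3)] .
  have D: "presented \<R> \<L> D"
    unfolding presented_def using t(1) LR_iso(2)[OF dist(1) t(2)] LR_iso(1)[OF dist(2) t(3)] by blast
  have X': "presented \<R> \<L> X"
    by (rule presented_isomorphic[OF _ _ D H.isomorphic_sym[OF t(4)]]) (erule (1) LR_iso)+
  show thesis by (rule presented_in_U_T[OF _ _ X']) (erule (1) LR_iso | erule (2) that)+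
qed

text \<open>Approximate the shift of \<open>X\<close> from the left and pull back along VA X -> UA
  X. The new object is an extension of \<open>VA X\<close> by \<open>K\<close>, hence in \<T>, and
  isomorphic to \<open>K\<close> in the localization.\<close>

lemma preimage_right_approx:
  assumes X: "X \<in> Ob E"
  obtains K k M l \<kappa> where "triangle E X k K l M \<kappa>" "K \<in> \<T> \<inter> \<R>" "M \<in> \<U> \<inter> \<L>"
proof -
  note s = shift_triangle[OF X]
  obtain K k M l \<kappa> where t: "triangle E K k M l (UA X) \<kappa>" "K \<in> \<T> \<inter> \<R>" "M \<in> \<U> \<inter> \<L>"
    using preimage_left_approx[OF UA_Ob[OF X]] .
  obtain N a a' b b' \<epsilon> \<epsilon>' where n: "triangle E X a N b M \<epsilon>" "triangle E K a' N b' (VA X) \<epsilon>'"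
    using pullback_of_deflations[OF s(1) t(1)] by metis
  have "N \<in> \<T>" using CP_right_extension[OF ST n(2)] t(2) s(2) V_sub_T by blast
  moreover have "N \<in> \<R>" using LR_iso(2) t(2) inflation_N_isomorphic[OF n(2) V_sub_N[OF s(2)]] by blast
  ultimately show thesis using that[OF n(1) _ t(3)] by blast
qed

lemma preimage_in_CP: "(\<U> \<inter> \<L>, \<T> \<inter> \<R>) \<in> CP E"
proof -
  have "Ext_vanish E (\<U> \<inter> \<L>) (\<T> \<inter> \<R>)"
    unfolding Ext_vanish_def
  proof (intro ballI)
    fix X A assume XA: "X \<in> \<U> \<inter> \<L>" "A \<in> \<T> \<inter> \<R>"
    then have O: "X \<in> Ob E" "A \<in> Ob E" by simp_all
    have "\<delta> = \<one>\<^bsub>Ext E X A\<^esub>" if \<delta>: "\<delta> \<in> \<E> X A" for \<delta>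
    proof (rule ell_ext_zero_imp_trivial[OF \<delta>])
      show "zero_arr \<H> (conn X A \<delta>)"
        using LR_D ell_ext_Hom[OF \<delta> O] XA unfolding tri_Ext_vanish_iff by blast
    qed (use XA in blast)+
    then show "\<E> X A = {\<one>\<^bsub>Ext E X A\<^esub>}" using Ext_one[OF O] by blast
  qed
  moreover have "\<exists>V \<in> \<T> \<inter> \<R>. \<exists>U \<in> \<U> \<inter> \<L>. \<exists>x y. conflation E V x U y X" if X: "X \<in> Ob E" for X
    using preimage_left_approx[OF X] unfolding conflation_iff by metis
  moreover have "\<exists>V \<in> \<T> \<inter> \<R>. \<exists>U \<in> \<U> \<inter> \<L>. \<exists>x y. conflation E X x V y U" if X: "X \<in> Ob E" for X
    using preimage_right_approx[OF X] unfolding conflation_iff by metis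
  moreover note inter_subcat[OF CPD(1-3)[OF UV], of \<L>] inter_subcat[OF CPD(4-6)[OF ST], of \<R>]
  ultimately show ?thesis using LR_D unfolding CP_def by simp
qed

text \<open>The arrow from a zero object to \<open>S\<close> is a weak cofibration and the arrow
  from \<open>V\<close> to a zero object a weak fibration, so \<open>S\<close> and \<open>V\<close>
  become zero.\<close>

lemma weakly_trivial_in:
  "S \<in> \<S> \<Longrightarrow> S \<in> \<L>" "V \<in> \<V> \<Longrightarrow> V \<in> \<R>"
proof -
  obtain Z where Z: "zero_object E Z" "Z \<in> Ob E" by (rule zero_object_E)
  note ZH = H_zero_object[OF Z(1)]
  have ZL: "Z \<in> \<L>" "Z \<in> \<R>"
    using LR_D LR_iso H.zero_objects_isomorphic[OF _ ZH] unfolding additive_subcat_def by metis+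
  show "S \<in> \<S> \<Longrightarrow> S \<in> \<L>"
    using LR_iso(1)[OF ZL(1)] wCof_isomorphic[OF wCofI[OF triangle_left_zero[OF Z(1)]], of S] Z by simp
  show "V \<in> \<V> \<Longrightarrow> V \<in> \<R>"
    using LR_iso(2)[OF ZL(2)] H.isomorphic_sym[OF wFib_isomorphic[OF wFibI[OF triangle_right_zero[OF Z(1)]]], of V] Z by simp
qed

text \<open>Every object is isomorphic in the localization to a \<U>-replacement and to a
  \<T>-replacement, and the two classes are closed under these isomorphisms.\<close>

lemma ess_image_preimage: "ess_image \<H> (\<U> \<inter> \<L>) = \<L>" "ess_image \<H> (\<T> \<inter> \<R>) = \<R>"
proof -
  have sub: "\<L> \<subseteq> Ob E" "\<R> \<subseteq> Ob E" using LR_D by (auto simp: additive_subcat_def)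
  show "ess_image \<H> (\<U> \<inter> \<L>) = \<L>"
  proof
    show "ess_image \<H> (\<U> \<inter> \<L>) \<subseteq> \<L>" using LR_iso(1) by (auto simp: ess_image_def)
    show "\<L> \<subseteq> ess_image \<H> (\<U> \<inter> \<L>)"
    proof
      fix X assume X: "X \<in> \<L>"
      then obtain q where q: "q \<in> wFib E \<V>" "q \<in> Arr E" "Dom E q \<in> \<U>" "Cod E q = X"
        using U_replacement sub by blast
      have i: "isomorphic \<H> (Dom E q) X" using wFib_isomorphic[OF q(1)] q(4) by simp
      then show "X \<in> ess_image \<H> (\<U> \<inter> \<L>)" using in_ess_imageI[OF i] q(3) LR_iso(1)[OF X H.isomorphic_sym[OF i]] by blast
    qed
  qed
  show "ess_image \<H> (\<T> \<inter> \<R>) = \<R>"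
  proof
    show "ess_image \<H> (\<T> \<inter> \<R>) \<subseteq> \<R>" using LR_iso(2) by (auto simp: ess_image_def)
    show "\<R> \<subseteq> ess_image \<H> (\<T> \<inter> \<R>)"
    proof
      fix X assume X: "X \<in> \<R>"
      then have XO: "X \<in> Ob E" using sub by blast
      have i: "isomorphic \<H> X (TR X)" using wCof_isomorphic[OF jT(1)[OF XO]] jT(2,3)[OF XO] by simp
      then show "X \<in> ess_image \<H> (\<T> \<inter> \<R>)"
        using in_ess_imageI[OF H.isomorphic_sym[OF i]] jT(4)[OF XO] LR_iso(2)[OF X i] by blast
    qed
  qed
qed

lemma preimage_in_mutable: "(\<U> \<inter> \<L>, \<T> \<inter> \<R>) \<in> mutable_CP E \<S> \<T> \<U> \<V> UA \<rho>"
proof -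
  have "\<S> \<subseteq> \<U> \<inter> \<L>" "\<V> \<subseteq> \<T> \<inter> \<R>" using weakly_trivial_in S_sub_U V_sub_T by blast+
  moreover have "tri_Ext_vanish \<D> (ess_image \<D> (\<U> \<inter> \<L>)) (ess_image \<D> (\<T> \<inter> \<R>))"
    using LR_D by (simp only: loc_tri_cat_notions ess_image_preimage)
  ultimately show ?thesis using preimage_in_CP unfolding mutable_CP_def by blast
qed

end

lemma ell_preimage_inter: "\<U> \<inter> ell_preimage E \<L> = \<U> \<inter> \<L>" "\<T> \<inter> ell_preimage E \<R> = \<T> \<inter> \<R>"
  by (auto simp: ell_preimage_def)

lemma RR_in:
  assumes "P \<in> mutable_CP E \<S> \<T> \<U> \<V> UA \<rho>"
  shows "RR E \<S> \<V> UA \<rho> P \<in> tri_CP \<D>" "II E \<T> \<U> (RR E \<S> \<V> UA \<rho> P) = P"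
proof -
  obtain \<A> \<B> where P: "P = (\<A>, \<B>)" by (cases P)
  have m: "(\<A>, \<B>) \<in> CP E" "\<A> \<subseteq> \<U>" "\<B> \<subseteq> \<T>" "tri_Ext_vanish \<D> (ess_image \<H> \<A>) (ess_image \<H> \<B>)"
    using assms unfolding P mutable_CP_def loc_tri_cat_notions by simp_all
  show "RR E \<S> \<V> UA \<rho> P \<in> tri_CP \<D>"
    unfolding P RR_def prod.case loc_tri_cat_notions by (rule ess_image_in_tri_CP[OF m])
  show "II E \<T> \<U> (RR E \<S> \<V> UA \<rho> P) = P"
    unfolding P RR_def II_def prod.case loc_tri_cat_notions ell_preimage_inter
    by (simp only: ess_image_inter[OF m])
qed

lemma II_in:
  assumes "Q \<in> tri_CP \<D>"
  shows "II E \<T> \<U> Q \<in> mutable_CP E \<S> \<T> \<U> \<V> UA \<rho>" "RR E \<S> \<V> UA \<rho> (II E \<T> \<U> Q) = Q"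
proof -
  obtain \<L> \<R> where Q: "Q = (\<L>, \<R>)" by (cases Q)
  note LR = assms[unfolded Q]
  show "II E \<T> \<U> Q \<in> mutable_CP E \<S> \<T> \<U> \<V> UA \<rho>"
    unfolding Q II_def prod.case ell_preimage_inter by (rule preimage_in_mutable[OF LR])
  show "RR E \<S> \<V> UA \<rho> (II E \<T> \<U> Q) = Q"
    unfolding Q RR_def II_def prod.case loc_tri_cat_notions ell_preimage_inter
    by (simp only: ess_image_preimage[OF LR])
qed

end

theorem theorem7p10:
  fixes E :: "('o, 'm, 'e) extri"
    and \<S> \<T> \<U> \<V> :: "'o set"
    and v u :: "'o \<Rightarrow> 'm" and VA UA :: "'o \<Rightarrow> 'o" and \<rho> :: "'o \<Rightarrow> 'e"
  assumes "extriangulated_category E"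
    and "WIC E"
    and "Hovey_twin_cotorsion_pair E \<S> \<T> \<U> \<V>"
    and "shift_choice E \<U> \<V> v VA u UA \<rho>"
  shows "bij_betw (RR E \<S> \<V> UA \<rho>) (mutable_CP E \<S> \<T> \<U> \<V> UA \<rho>) (tri_CP (loc_tri E \<S> \<V> UA \<rho>)) \<and>
    bij_betw (II E \<T> \<U>) (tri_CP (loc_tri E \<S> \<V> UA \<rho>)) (mutable_CP E \<S> \<T> \<U> \<V> UA \<rho>) \<and>
    (\<forall>P \<in> mutable_CP E \<S> \<T> \<U> \<V> UA \<rho>. II E \<T> \<U> (RR E \<S> \<V> UA \<rho> P) = P) \<and>
    (\<forall>Q \<in> tri_CP (loc_tri E \<S> \<V> UA \<rho>). RR E \<S> \<V> UA \<rho> (II E \<T> \<U> Q) = Q)"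
proof -
  interpret extriangulated_category E by fact
  interpret hovey_shift E \<S> \<T> \<U> \<V> v u VA UA \<rho>
    by unfold_locales (fact assms)+
  show ?thesis
  proof (intro conjI ballI)
    show "bij_betw (RR E \<S> \<V> UA \<rho>) (mutable_CP E \<S> \<T> \<U> \<V> UA \<rho>) (tri_CP (loc_tri E \<S> \<V> UA \<rho>))"
      by (rule bij_betw_byWitness[where f' = "II E \<T> \<U>"]) (use RR_in II_in in auto)
    show "bij_betw (II E \<T> \<U>) (tri_CP (loc_tri E \<S> \<V> UA \<rho>)) (mutable_CP E \<S> \<T> \<U> \<V> UA \<rho>)"
      by (rule bij_betw_byWitness[where f' = "RR E \<S> \<V> UA \<rho>"]) (use RR_in II_in in auto)
  qed (use RR_in II_in in auto)
qed

end
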